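(* For every $m\ge0$ and all sufficiently large $n$, the map $\pi_n$ is injective on $\Lambda^{\circ,\le m}$ and $T_n(\pi_n(\Lambda^{\circ,\le m}))\subseteq\pi_n(\Lambda^{\circ,\le m})$; for every $f\in\Lambda^{\circ,\le m}$ the elements $g_n\in\Lambda^{\circ,\le m}$ with $\pi_n(g_n)=n^2(T_n-\mathbf 1)\pi_n(f)$ converge in $\Lambda^{\circ,\le m}$ to an element $Af$, defining a linear operator $A:\Lambda^\circ\to\Lambda^\circ$. The operator $A$ (with domain $\Lambda^\circ\subset C(\Omega)$) is closable in $C(\Omega)$, its closure generates a conservative Markov semigroup $\{T(t)\}_{t\ge0}$ in $C(\Omega)$, and for every $f\in C(\Omega)$ and $t\ge0$, $$\lim_{n\to\infty}\big\|T_n^{[n^2t]}\pi_n(f)-\pi_n(T(t)f)\big\|_n=0,$$ uniformly in $t$ on bounded intervals.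
   Context: $\mathbb Y_n$ is the set of Young diagrams with $n$ boxes; $\mu\nearrow\lambda$ (equivalently $\lambda\searrow\mu$) means $\mu\subset\lambda$, $|\lambda|=|\mu|+1$; $(z)_\theta=\prod_{(i,j)\in\theta}(z+j-i)$ for a skew diagram $\theta$ ($(i,j)$ = row $i$, column $j$); $\dim\lambda$ is the number of standard Young tableaux of shape $\lambda$. Modified Frobenius coordinates: $\lambda=(a_1,\dots,a_d\mid b_1,\dots,b_d)$, $d$ the number of diagonal boxes, $a_i=\lambda_i-i+\frac12$, $b_i=\lambda'_i-i+\frac12$. $(z,z')$ is fixed in the principal series ($z\notin\mathbb R$, $z'=\bar z$) or complementary series ($z,z'\in(N,N+1)$, $N\in\mathbb Z$). $p^\downarrow(\nu,\lambda)=\dim\lambda/\dim\nu$ if $\lambda\nearrow\nu$, else 0; for $\lambda\in\mathbb Y_n$, $p^\uparrow(\lambda,\nu)=\frac{(z)_{\nu/\lambda}(z')_{\nu/\lambda}}{zz'+n}\frac{\dim\nu}{(n+1)\dim\lambda}$ if $\nu\searrow\lambda$, else 0. $C(\mathbb Y_n)$: real functions on $\mathbb Y_n$ with norm $\|g\|_n=\max|g|$; $(T_ng)(\lambda)=\sum_{\nu\in\mathbb Y_{n+1}}p^\uparrow(\lambda,\nu)\sum_{\tilde\lambda\in\mathbb Y_n}p^\downarrow(\nu,\tilde\lambda)g(\tilde\lambda)$ (up–down Markov chain whose invariant law is the z-measure $M_n(\lambda)=\frac{(z)_\lambda(z')_\lambda}{(zz')_n}\frac{(\dim\lambda)^2}{n!}$);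 $\mathbf 1$ = identity. Thoma simplex $\Omega$: pairs $(\alpha,\beta)$ of nonincreasing sequences of nonnegative reals with $\sum_i(\alpha_i+\beta_i)\le1$, topology induced from $[0,1]^\infty\times[0,1]^\infty$ (compact); $C(\Omega)$ real continuous functions with sup norm. $\iota_n:\mathbb Y_n\to\Omega$, $\alpha_i=a_i/n$, $\beta_i=b_i/n$ ($i\le d$), 0 otherwise; $\pi_n:C(\Omega)\to C(\mathbb Y_n)$, $\pi_nf=f\circ\iota_n$. $\Lambda=\mathbb R[p_1,p_2,\dots]$ symmetric functions, $\Lambda^\circ=\Lambda/(p_1-1)$ with filtration $\Lambda^{\circ,\le m}$ = image of elements of degree $\le m$, realized as a dense subalgebra of $C(\Omega)$ via $p_1^\circ=1$, $p_k^\circ(\alpha,\beta)=\sum_i\alpha_i^k+(-1)^{k-1}\sum_i\beta_i^k$ ($k\ge2$). A conservative Markov semigroup is a strongly continuous semigroup of contractions preserving nonnegative functions and the constant $1$. *)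

theory Defs
  imports "HOL-Analysis.Analysis"
begin

text \<open>A Young diagram is a partition: a nonincreasing list of positive naturals.
  Boxes are pairs (i,j) = (row, column), both indexed from 1.\<close>

definition is_partition :: "nat list \<Rightarrow> bool" where
  "is_partition lam \<longleftrightarrow> sorted_wrt (\<ge>) lam \<and> (\<forall>x\<in>set lam. 0 < x)"

definition YD :: "nat \<Rightarrow> nat list set" where
  "YD n = {lam. is_partition lam \<and> sum_list lam = n}"

definition yrow :: "nat list \<Rightarrow> nat \<Rightarrow> nat" where
  "yrow lam i = (if 1 \<le> i \<and> i \<le> length lam then lam ! (i - 1) else 0)"

definition boxes :: "nat list \<Rightarrow> (nat \<times> nat) set" where
  "boxes lam = {(i, j). 1 \<le> i \<and> 1 \<le> j \<and> j \<le> yrow lam i}"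

definition ycol :: "nat list \<Rightarrow> nat \<Rightarrow> nat" where
  "ycol lam j = card {i. (i, j) \<in> boxes lam}"

definition yedge :: "nat list \<Rightarrow> nat list \<Rightarrow> bool" where
  "yedge mu lam \<longleftrightarrow> boxes mu \<subseteq> boxes lam \<and> sum_list lam = sum_list mu + 1"

definition zpoch :: "complex \<Rightarrow> nat list \<Rightarrow> nat list \<Rightarrow> complex" where
  "zpoch z lam mu = (\<Prod>(i, j)\<in>boxes lam - boxes mu. z + of_int (int j - int i))"

definition ydim :: "nat list \<Rightarrow> nat" where
  "ydim lam = card {f \<in> boxes lam \<rightarrow>\<^sub>E {1..sum_list lam}.
      bij_betw f (boxes lam) {1..sum_list lam} \<and>
      (\<forall>i j. (i, j) \<in> boxes lam \<and> (i, Suc j) \<in> boxes lam \<longrightarrow> f (i, j) < f (i, Suc j)) \<and>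
      (\<forall>i j. (i, j) \<in> boxes lam \<and> (Suc i, j) \<in> boxes lam \<longrightarrow> f (i, j) < f (Suc i, j))}"

definition p_down :: "nat list \<Rightarrow> nat list \<Rightarrow> real" where
  "p_down nu lam = (if yedge lam nu then real (ydim lam) / real (ydim nu) else 0)"

definition p_up :: "complex \<Rightarrow> complex \<Rightarrow> nat list \<Rightarrow> nat list \<Rightarrow> real" where
  "p_up z z' lam nu = (if yedge lam nu then
      Re (zpoch z nu lam * zpoch z' nu lam / (z * z' + of_nat (sum_list lam)))
      * real (ydim nu) / (real (sum_list lam + 1) * real (ydim lam))
    else 0)"

definition Tn :: "complex \<Rightarrow> complex \<Rightarrow> nat \<Rightarrow> (nat list \<Rightarrow> real) \<Rightarrow> nat list \<Rightarrow> real" where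
  "Tn z z' n g lam = (\<Sum>nu\<in>YD (Suc n). p_up z z' lam nu * (\<Sum>lt\<in>YD n. p_down nu lt * g lt))"

definition normY :: "nat \<Rightarrow> (nat list \<Rightarrow> real) \<Rightarrow> real" where
  "normY n g = Max ((\<lambda>lam. \<bar>g lam\<bar>) ` YD n)"

text \<open>Points are pairs (alpha, beta) of sequences; alpha 0 is alpha_1 etc.
  The topology is the product topology (coordinatewise convergence).\<close>

type_synonym tpt = "(nat \<Rightarrow> real) \<times> (nat \<Rightarrow> real)"

definition Thoma :: "tpt set" where
  "Thoma = {(al, be). (\<forall>i. 0 \<le> al i \<and> 0 \<le> be i \<and> al (Suc i) \<le> al i \<and> be (Suc i) \<le> be i)
                     \<and> (\<forall>N. (\<Sum>i<N. al i + be i) \<le> 1)}"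

text \<open>C(Omega): continuous functions on Omega, normalised to vanish outside Omega
  (so that elements of C(Omega) are represented uniquely).\<close>
definition CO :: "(tpt \<Rightarrow> real) set" where
  "CO = {f. continuous_on Thoma f \<and> (\<forall>x. x \<notin> Thoma \<longrightarrow> f x = 0)}"

definition restrO :: "(tpt \<Rightarrow> real) \<Rightarrow> tpt \<Rightarrow> real" where
  "restrO f = (\<lambda>x. if x \<in> Thoma then f x else 0)"

definition supO :: "(tpt \<Rightarrow> real) \<Rightarrow> real" where
  "supO f = (SUP x\<in>Thoma. \<bar>f x\<bar>)"

definition oneO :: "tpt \<Rightarrow> real" where
  "oneO = restrO (\<lambda>_. 1)"

definition frob_d :: "nat list \<Rightarrow> nat" where
  "frob_d lam = card {i. 1 \<le> i \<and> i \<le> yrow lam i}"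

definition frob_a :: "nat list \<Rightarrow> nat \<Rightarrow> real" where
  "frob_a lam i = real (yrow lam i) - real i + 1/2"

definition frob_b :: "nat list \<Rightarrow> nat \<Rightarrow> real" where
  "frob_b lam i = real (ycol lam i) - real i + 1/2"

definition iota :: "nat \<Rightarrow> nat list \<Rightarrow> tpt" where
  "iota n lam = ((\<lambda>i. if Suc i \<le> frob_d lam then frob_a lam (Suc i) / real n else 0),
                 (\<lambda>i. if Suc i \<le> frob_d lam then frob_b lam (Suc i) / real n else 0))"

definition pi_n :: "nat \<Rightarrow> (tpt \<Rightarrow> real) \<Rightarrow> nat list \<Rightarrow> real" where
  "pi_n n f = f \<circ> iota n"

definition pcirc :: "nat \<Rightarrow> tpt \<Rightarrow> real" where
  "pcirc k x = (if k = 1 then 1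
     else (\<Sum>i. fst x i ^ k) + (-1) ^ (k - 1) * (\<Sum>i. snd x i ^ k))"

text \<open>Lambda-circ of filtration degree at most m: the images of linear combinations
  of the power sums p_mu = p_(mu_1) ... p_(mu_l) with |mu| \<le> m, under p_1 \<mapsto> 1.\<close>
definition LamC :: "nat \<Rightarrow> (tpt \<Rightarrow> real) set" where
  "LamC m = {restrO (\<lambda>x. \<Sum>mu\<in>{mu. is_partition mu \<and> sum_list mu \<le> m}.
                          c mu * (\<Prod>k\<leftarrow>mu. pcirc k x)) | c. True}"

definition LamCall :: "(tpt \<Rightarrow> real) set" where
  "LamCall = (\<Union>m. LamC m)"

definition graph_closure :: "(tpt \<Rightarrow> real) set \<Rightarrow> ((tpt \<Rightarrow> real) \<Rightarrow> (tpt \<Rightarrow> real))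
    \<Rightarrow> ((tpt \<Rightarrow> real) \<times> (tpt \<Rightarrow> real)) set" where
  "graph_closure D A = {(f, g). f \<in> CO \<and> g \<in> CO \<and>
     (\<exists>h. (\<forall>k. h k \<in> D) \<and> (\<lambda>k. supO (\<lambda>x. h k x - f x)) \<longlonglongrightarrow> 0
             \<and> (\<lambda>k. supO (\<lambda>x. A (h k) x - g x)) \<longlonglongrightarrow> 0)}"

definition closable :: "(tpt \<Rightarrow> real) set \<Rightarrow> ((tpt \<Rightarrow> real) \<Rightarrow> (tpt \<Rightarrow> real)) \<Rightarrow> bool" where
  "closable D A \<longleftrightarrow> (\<forall>f g1 g2. (f, g1) \<in> graph_closure D A \<and> (f, g2) \<in> graph_closure D A \<longrightarrow> g1 = g2)"

definition conservative_markov_semigroup :: "(real \<Rightarrow> (tpt \<Rightarrow> real) \<Rightarrow> (tpt \<Rightarrow> real)) \<Rightarrow> bool" where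
  "conservative_markov_semigroup T \<longleftrightarrow>
     (\<forall>t\<ge>0. \<forall>f\<in>CO. T t f \<in> CO) \<and>
     (\<forall>t\<ge>0. \<forall>f\<in>CO. \<forall>g\<in>CO. \<forall>a b. T t (\<lambda>x. a * f x + b * g x) = (\<lambda>x. a * T t f x + b * T t g x)) \<and>
     (\<forall>f\<in>CO. T 0 f = f) \<and>
     (\<forall>s\<ge>0. \<forall>t\<ge>0. \<forall>f\<in>CO. T (s + t) f = T s (T t f)) \<and>
     (\<forall>f\<in>CO. ((\<lambda>t. supO (\<lambda>x. T t f x - f x)) \<longlongrightarrow> 0) (at_right 0)) \<and>
     (\<forall>t\<ge>0. \<forall>f\<in>CO. supO (T t f) \<le> supO f) \<and>
     (\<forall>t\<ge>0. \<forall>f\<in>CO. (\<forall>x\<in>Thoma. 0 \<le> f x) \<longrightarrow> (\<forall>x\<in>Thoma. 0 \<le> T t f x)) \<and>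
     (\<forall>t\<ge>0. T t oneO = oneO)"

definition generator_graph :: "(real \<Rightarrow> (tpt \<Rightarrow> real) \<Rightarrow> (tpt \<Rightarrow> real))
    \<Rightarrow> ((tpt \<Rightarrow> real) \<times> (tpt \<Rightarrow> real)) set" where
  "generator_graph T = {(f, g). f \<in> CO \<and> g \<in> CO \<and>
     ((\<lambda>t. supO (\<lambda>x. (T t f x - f x) / t - g x)) \<longlongrightarrow> 0) (at_right 0)}"

end

theory Submission
  imports Defs "HOL-Computational_Algebra.Computational_Algebra"
begin

text \<open>
  Let \<open>D\<close> be the down operator and \<open>U\<close> the weighted up operator on the Young graph. The relation
  \<open>[D, U] = z z' + 2 n\<close> on level \<open>n\<close> gives
  \<open>(z z' + n) (n + 1) (T\<^sub>n - 1) D = D (z z' + n - 1) n (T\<^sub>n\<^sub>-\<^sub>1 - 1)\<close>, so the action of \<open>T\<^sub>n\<close> on functions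
  lifted from a fixed level \<open>m\<close> is, up to an explicit scalar, that of \<open>T\<^sub>m\<close>.

  The power sums of the Frobenius coordinates are sums over boxes of polynomials in the content. With
  the product formula for the co-transition probabilities, \<open>n (D - 1)\<close> acts on polynomials in these
  power sums as minus the weighted degree, up to terms of lower degree. Its eigenfunctions of
  eigenvalue \<open>- k\<close> are exactly lifted from level \<open>k\<close>, and every function on level \<open>m\<close> is a polynomial
  function; eigencomponents of degree above \<open>m\<close> die when lifted to high levels. Hence \<open>T\<^sub>n\<close> preserves
  the polynomial functions of degree at most \<open>m\<close>, and \<open>n\<^sup>2 (T\<^sub>n - 1)\<close> converges there.

  On each of these finite-dimensional spaces the limit \<open>A\<close> has an exponential, which is compared with
  \<open>T\<^sub>n\<close> by a telescoping estimate. Contractivity, positivity and conservativity pass to the limit because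
  the embedded Young diagrams fill the Thoma simplex, and everything extends to continuous functions by
  Stone-Weierstrass. The generator is the closure of \<open>A\<close> since \<open>1 - A\<close>, being injective, is onto on each
  finite-dimensional piece.
\<close>

section \<open>Diagrams\<close>


text \<open>No formula for the generator in terms of power sums is derived. What replaces it is the
  normalisation \<open>(z z' + n) (n + 1)\<close>: with it the operators on neighbouring levels are
  intertwined exactly, without error terms, so a degree-k eigenfunction is governed by one finite
  level, the level k. The values there may be interpolated by a polynomial function of uncontrolled
  degree, since falling factorials vanish below their order and remove the surplus when lifting. The
  normalising factor is asymptotic to n^2, which is the origin of the time scale; after division by
  n^m only the eigencomponent of top degree m keeps a nonzero limit. Since A stays inexplicit,
  dissipativity, injectivity of 1 - A and the Markov properties are all drawn from the chains.
  Positivity of the chains rests on (z + c) (z' + c) > 0 for integers c, the common feature of the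
  two series. The main combinatorial input is the co-transition law; it is needed in a form rational
  in the row coordinates, so that the moments of the content of the removed box obey a Newton
  recursion.\<close>

definition diagram :: "(nat \<times> nat) set \<Rightarrow> bool" where
  "diagram S \<longleftrightarrow> finite S \<and> (\<forall>i j. (i, j) \<in> S \<longrightarrow> 1 \<le> i \<and> 1 \<le> j) \<and>
     (\<forall>i j. (Suc i, j) \<in> S \<longrightarrow> 1 \<le> i \<longrightarrow> (i, j) \<in> S) \<and>
     (\<forall>i j. (i, Suc j) \<in> S \<longrightarrow> 1 \<le> j \<longrightarrow> (i, j) \<in> S)"

definition rowlen :: "(nat \<times> nat) set \<Rightarrow> nat \<Rightarrow> nat" where
  "rowlen S i = card {j. (i, j) \<in> S}"

definition boxcont :: "nat \<times> nat \<Rightarrow> int" where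
  "boxcont b = int (snd b) - int (fst b)"

definition Rem :: "(nat \<times> nat) set \<Rightarrow> (nat \<times> nat) set" where
  "Rem S = {(i, j). (i, j) \<in> S \<and> (Suc i, j) \<notin> S \<and> (i, Suc j) \<notin> S}"

definition Add :: "(nat \<times> nat) set \<Rightarrow> (nat \<times> nat) set" where
  "Add S = {(i, j). 1 \<le> i \<and> 1 \<le> j \<and> (i, j) \<notin> S \<and> (i = 1 \<or> (i - 1, j) \<in> S) \<and> (j = 1 \<or> (i, j - 1) \<in> S)}"

text \<open>Diagrams are handled as sets of boxes, where adding and removing a box are
  \<open>insert\<close> and set difference; \<open>lst\<close> carries the results back to the
  partitions of the statement.\<close>

definition lst :: "(nat \<times> nat) set \<Rightarrow> nat list" where
  "lst S = (THE lam. is_partition lam \<and> boxes lam = S)"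

lemma diagram_finite: "diagram S \<Longrightarrow> finite S"
  unfolding diagram_def by blast

lemma diagram_pos: "diagram S \<Longrightarrow> (i, j) \<in> S \<Longrightarrow> 1 \<le> i \<and> 1 \<le> j"
  unfolding diagram_def by blast

lemma diagram_down1: "diagram S \<Longrightarrow> (Suc i, j) \<in> S \<Longrightarrow> 1 \<le> i \<Longrightarrow> (i, j) \<in> S"
  unfolding diagram_def by blast

lemma diagram_down2: "diagram S \<Longrightarrow> (i, Suc j) \<in> S \<Longrightarrow> 1 \<le> j \<Longrightarrow> (i, j) \<in> S"
  unfolding diagram_def by blast

text \<open>Rows, columns, the main diagonal and the diagonals of fixed content are all recovered
  from their cardinalities through this fact.\<close>

lemma initial_segment_eq:
  fixes J :: "nat set"
  assumes "finite J" "\<And>j. j \<in> J \<Longrightarrow> 1 \<le> j" "\<And>j. Suc j \<in> J \<Longrightarrow> 1 \<le> j \<Longrightarrow> j \<in> J"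
  shows "J = {1..card J}"
proof (cases "J = {}")
  case False
  define M where "M = Max J"
  have M: "M \<in> J" using False assms(1) by (simp add: M_def)
  have "{1..M} \<subseteq> J"
  proof
    fix k assume "k \<in> {1..M}"
    then have "k \<le> M" "1 \<le> k" by auto
    then show "k \<in> J"
    proof (induction rule: inc_induct)
      case base show ?case by (rule M)
    next
      case (step n) then show ?case using assms(3)[of n] by auto
    qed
  qed
  moreover have "J \<subseteq> {1..M}" using assms M_def by auto
  ultimately have "J = {1..M}" by auto
  then show ?thesis by (metis card_atLeastAtMost diff_Suc_1 add_0 Suc_eq_plus1 diff_Suc_Suc One_nat_def diff_zero)
qed simp

lemma diagram_fibre_finite: "diagram S \<Longrightarrow> finite {j. (i, j) \<in> S}"
  by (rule finite_subset[of _ "snd ` S"]) (force dest: diagram_finite)+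

lemma diagram_fibre_finite': "diagram S \<Longrightarrow> finite {i. (i, j) \<in> S}"
  by (rule finite_subset[of _ "fst ` S"]) (force dest: diagram_finite)+

lemma diagram_row: assumes "diagram S"
  shows "(i, j) \<in> S \<longleftrightarrow> 1 \<le> i \<and> 1 \<le> j \<and> j \<le> rowlen S i"
proof -
  have "{j. (i, j) \<in> S} = {1..rowlen S i}"
    unfolding rowlen_def
    by (rule initial_segment_eq)
       (use assms diagram_fibre_finite diagram_pos diagram_down2 in blast)+
  then have "(i, j) \<in> S \<longleftrightarrow> 1 \<le> j \<and> j \<le> rowlen S i" by (metis atLeastAtMost_iff mem_Collect_eq)
  then show ?thesis using diagram_pos[OF assms] by blast
qed

lemma diagram_col: assumes "diagram S"
  shows "(i, j) \<in> S \<longleftrightarrow> 1 \<le> i \<and> 1 \<le> j \<and> i \<le> card {i. (i, j) \<in> S}"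
proof -
  have "{i. (i, j) \<in> S} = {1..card {i. (i, j) \<in> S}}"
    by (rule initial_segment_eq)
       (use assms diagram_fibre_finite' diagram_pos diagram_down1 in blast)+
  then have "(i, j) \<in> S \<longleftrightarrow> 1 \<le> i \<and> i \<le> card {i. (i, j) \<in> S}" by (metis (lifting) atLeastAtMost_iff mem_Collect_eq)
  then show ?thesis using diagram_pos[OF assms] by blast
qed

lemma row_anti: "diagram S \<Longrightarrow> 1 \<le> i \<Longrightarrow> rowlen S (Suc i) \<le> rowlen S i"
  unfolding rowlen_def by (rule card_mono) (auto simp: diagram_fibre_finite diagram_down1)

lemma row_anti': assumes "diagram S" "1 \<le> i" "i \<le> k" shows "rowlen S k \<le> rowlen S i"
  using assms(3,2)
proof (induction rule: dec_induct)
  case (step n) then show ?case using row_anti[OF assms(1), of n] by auto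
qed simp

lemma diagram_down: "diagram S \<Longrightarrow> (i, j) \<in> S \<Longrightarrow> 1 \<le> i' \<Longrightarrow> i' \<le> i \<Longrightarrow> 1 \<le> j' \<Longrightarrow> j' \<le> j \<Longrightarrow> (i', j') \<in> S"
  using row_anti'[of S i' i] by (auto simp: diagram_row)

lemma diagram_Un: "diagram S \<Longrightarrow> diagram T \<Longrightarrow> diagram (S \<union> T)"
  unfolding diagram_def by blast

lemma diagram_Int: "diagram S \<Longrightarrow> diagram T \<Longrightarrow> diagram (S \<inter> T)"
  unfolding diagram_def by blast

text \<open>Turns the local corner condition into a statement about diagrams, so that arguments on
  pairs of corners can use closure of diagrams under union and intersection.\<close>

lemma Rem_iff: assumes "diagram S" shows "b \<in> Rem S \<longleftrightarrow> b \<in> S \<and> diagram (S - {b})"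
proof -
  obtain i j where b: "b = (i, j)" by (cases b)
  show ?thesis
  proof
    assume *: "b \<in> Rem S"
    then have m: "b \<in> S" "(Suc i, j) \<notin> S" "(i, Suc j) \<notin> S" unfolding b Rem_def by auto
    have "diagram (S - {b})" unfolding diagram_def
    proof (intro conjI allI impI)
      show "finite (S - {b})" using assms diagram_finite by auto
    next
      fix k l assume "(k, l) \<in> S - {b}" then show "1 \<le> k" "1 \<le> l" using diagram_pos[OF assms, of k l] by auto
    next
      fix k l assume *: "(Suc k, l) \<in> S - {b}" "1 \<le> k"
      then show "(k, l) \<in> S - {b}" using diagram_down1[OF assms, of k l] m b by auto
    next
      fix k l assume *: "(k, Suc l) \<in> S - {b}" "1 \<le> l"
      then show "(k, l) \<in> S - {b}" using diagram_down2[OF assms, of k l] m b by auto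
    qed
    then show "b \<in> S \<and> diagram (S - {b})" using m by auto
  next
    assume *: "b \<in> S \<and> diagram (S - {b})"
    then have p: "1 \<le> i" "1 \<le> j" using diagram_pos[OF assms] b by auto
    have "(Suc i, j) \<notin> S" using diagram_down1[of "S - {b}" i j] * p b by auto
    moreover have "(i, Suc j) \<notin> S" using diagram_down2[of "S - {b}" i j] * p b by auto
    ultimately show "b \<in> Rem S" using * b unfolding Rem_def by auto
  qed
qed

lemma Add_iff: assumes "diagram S" shows "b \<in> Add S \<longleftrightarrow> b \<notin> S \<and> diagram (insert b S)"
proof -
  obtain i j where b: "b = (i, j)" by (cases b)
  show ?thesis
  proof
    assume "b \<in> Add S"
    then have m: "1 \<le> i" "1 \<le> j" "b \<notin> S" "i = 1 \<or> (i - 1, j) \<in> S" "j = 1 \<or> (i, j - 1) \<in> S"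
      unfolding b Add_def by auto
    have "diagram (insert b S)" unfolding diagram_def
    proof (intro conjI allI impI)
      show "finite (insert b S)" using assms diagram_finite by auto
    next
      fix k l assume "(k, l) \<in> insert b S" then show "1 \<le> k" "1 \<le> l" using diagram_pos[OF assms, of k l] m b by auto
    next
      fix k l assume *: "(Suc k, l) \<in> insert b S" "1 \<le> k"
      then show "(k, l) \<in> insert b S" using diagram_down1[OF assms, of k l] m b by auto
    next
      fix k l assume *: "(k, Suc l) \<in> insert b S" "1 \<le> l"
      then show "(k, l) \<in> insert b S" using diagram_down2[OF assms, of k l] m b by auto
    qed
    then show "b \<notin> S \<and> diagram (insert b S)" using m by auto
  next
    assume *: "b \<notin> S \<and> diagram (insert b S)"
    have p: "1 \<le> i" "1 \<le> j" using * diagram_pos[of "insert b S" i j] b by auto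
    have "i = 1 \<or> (i - 1, j) \<in> S"
      using diagram_down1[of "insert b S" "i - 1" j] * p b by (cases "i = 1"; cases i) auto
    moreover have "j = 1 \<or> (i, j - 1) \<in> S"
      using diagram_down2[of "insert b S" i "j - 1"] * p b by (cases "j = 1"; cases j) auto
    ultimately show "b \<in> Add S" using * p unfolding b Add_def by auto
  qed
qed

lemma Rem_diagram: "diagram S \<Longrightarrow> b \<in> Rem S \<Longrightarrow> diagram (S - {b})"
  by (simp add: Rem_iff)

lemma Add_diagram: "diagram S \<Longrightarrow> b \<in> Add S \<Longrightarrow> diagram (insert b S)"
  by (simp add: Add_iff)

lemma Rem_subset: "Rem S \<subseteq> S" by (auto simp: Rem_def)

lemma finite_Rem: "diagram S \<Longrightarrow> finite (Rem S)"
  using finite_subset[OF Rem_subset] diagram_finite by blast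

lemma Rem_rows: assumes "diagram S"
  shows "Rem S = (\<lambda>i. (i, rowlen S i)) ` {i. 1 \<le> i \<and> rowlen S (Suc i) < rowlen S i}" (is "?L = ?R")
proof
  show "?L \<subseteq> ?R" by (auto simp: Rem_def diagram_row[OF assms] image_iff)
  show "?R \<subseteq> ?L" by (auto simp: Rem_def diagram_row[OF assms])
qed

lemma Add_rows: assumes "diagram S"
  shows "Add S = (\<lambda>i. (i, Suc (rowlen S i))) ` {i. 1 \<le> i \<and> (i = 1 \<or> rowlen S i < rowlen S (i - 1))}" (is "?L = ?R")
proof
  show "?L \<subseteq> ?R" by (auto simp: Add_def diagram_row[OF assms] image_iff)
  show "?R \<subseteq> ?L" by (auto simp: Add_def diagram_row[OF assms])
qed

text \<open>An upper bound on the number of rows rather than the exact number: the same N then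
  serves for S and for S with boxes removed, and products indexed by rows stay comparable.\<close>

definition height_le :: "(nat \<times> nat) set \<Rightarrow> nat \<Rightarrow> bool" where
  "height_le S N \<longleftrightarrow> (\<forall>i>N. rowlen S i = 0)"

lemma height_le_ex: assumes "diagram S" shows "\<exists>N. height_le S N"
proof -
  have f: "finite (fst ` S)" using diagram_finite[OF assms] by simp
  then obtain N where N: "\<forall>i\<in>fst ` S. i \<le> N" using finite_nat_set_iff_bounded_le by blast
  have "rowlen S i = 0" if "i > N" for i
  proof -
    have "{j. (i, j) \<in> S} = {}" using N that by force
    then show ?thesis by (simp add: rowlen_def)
  qed
  then show ?thesis by (auto simp: height_le_def)
qed

lemma height_le_card: assumes "diagram S" shows "height_le S (card S)"
  unfolding height_le_def
proof (intro allI impI, rule ccontr)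
  fix i assume i: "i > card S" and r: "rowlen S i \<noteq> 0"
  then have "(i, 1) \<in> S" using assms by (auto simp: diagram_row)
  then have "(\<lambda>k. (k, 1)) ` {1..i} \<subseteq> S" using diagram_down[OF assms] by auto
  then have "card ((\<lambda>k. (k, 1::nat)) ` {1..i}) \<le> card S"
    using assms diagram_finite card_mono by blast
  moreover have "card ((\<lambda>k. (k, 1::nat)) ` {1..i}) = i" by (subst card_image) (auto simp: inj_on_def)
  ultimately show False using i by auto
qed

section \<open>Sums over boxes and over corners\<close>

lemma diagram_Sigma: assumes "diagram S" "height_le S N"
  shows "S = Sigma {1..N} (\<lambda>i. {1..rowlen S i})"
proof (rule set_eqI)
  fix b :: "nat \<times> nat"
  obtain i j where b: "b = (i, j)" by (cases b)
  have "1 \<le> j \<and> j \<le> rowlen S i \<Longrightarrow> i \<le> N" using assms(2) unfolding height_le_def by (metis not_less_eq_eq not_le le_zero_eq not_one_le_zero le_trans)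
  then show "b \<in> S \<longleftrightarrow> b \<in> Sigma {1..N} (\<lambda>i. {1..rowlen S i})"
    unfolding b using diagram_row[OF assms(1)] by auto
qed

lemma sum_diagram: fixes f :: "nat \<times> nat \<Rightarrow> 'a::comm_monoid_add"
  assumes "diagram S" "height_le S N"
  shows "sum f S = (\<Sum>i=1..N. \<Sum>j=1..rowlen S i. f (i, j))"
  by (subst diagram_Sigma[OF assms]) (simp add: sum.Sigma)

text \<open>Summing over all rows instead of corner rows adds terms that cancel: a row to which no
  box can be added is as long as the row above, which then has no removable box, and the two
  contents agree. The term at -N comes from the empty row N + 1.\<close>

lemma add_minus_rem:
  fixes f :: "int \<Rightarrow> 'a::ab_group_add"
  assumes d: "diagram S" and N: "height_le S N"
  shows "(\<Sum>b\<in>Add S. f (boxcont b)) - (\<Sum>b\<in>Rem S. f (boxcont b))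
    = f (- int N) + (\<Sum>i=1..N. f (int (rowlen S i) - int i + 1) - f (int (rowlen S i) - int i))"
proof -
  let ?r = "rowlen S"
  have rem: "(\<Sum>b\<in>Rem S. f (boxcont b)) = (\<Sum>i\<in>{i\<in>{1..N}. ?r (Suc i) < ?r i}. f (int (?r i) - int i))"
  proof -
    have "{i. 1 \<le> i \<and> ?r (Suc i) < ?r i} = {i\<in>{1..N}. ?r (Suc i) < ?r i}"
      using N unfolding height_le_def by (auto, metis not_le less_nat_zero_code)
    then show ?thesis unfolding Rem_rows[OF d]
      by (subst sum.reindex) (auto simp: inj_on_def boxcont_def)
  qed
  have add: "(\<Sum>b\<in>Add S. f (boxcont b)) = (\<Sum>i\<in>{i\<in>{1..Suc N}. i = 1 \<or> ?r i < ?r (i - 1)}. f (int (?r i) - int i + 1))"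
  proof -
    have "{i. 1 \<le> i \<and> (i = 1 \<or> ?r i < ?r (i - 1))} = {i\<in>{1..Suc N}. i = 1 \<or> ?r i < ?r (i - 1)}"
    proof -
      have "i \<le> Suc N" if "?r i < ?r (i - 1)" for i
      proof (rule ccontr)
        assume "\<not> i \<le> Suc N"
        then have "i - 1 > N" by auto
        then show False using N that unfolding height_le_def by auto
      qed
      then show ?thesis by auto
    qed
    then show ?thesis unfolding Add_rows[OF d]
      by (subst sum.reindex) (auto simp: inj_on_def boxcont_def algebra_simps)
  qed
  have s1: "(\<Sum>i=1..Suc N. f (int (?r i) - int i + 1)) =
     (\<Sum>i\<in>{i\<in>{1..Suc N}. i = 1 \<or> ?r i < ?r (i - 1)}. f (int (?r i) - int i + 1))
     + (\<Sum>i\<in>{i\<in>{1..Suc N}. \<not> (i = 1 \<or> ?r i < ?r (i - 1))}. f (int (?r i) - int i + 1))"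
    by (subst sum.union_disjoint[symmetric], simp, simp, blast, rule sum.cong, auto)
  have s2: "(\<Sum>i=1..N. f (int (?r i) - int i)) =
     (\<Sum>i\<in>{i\<in>{1..N}. ?r (Suc i) < ?r i}. f (int (?r i) - int i))
     + (\<Sum>i\<in>{i\<in>{1..N}. \<not> (?r (Suc i) < ?r i)}. f (int (?r i) - int i))"
    by (subst sum.union_disjoint[symmetric], simp, simp, blast, rule sum.cong, auto)
  have s3: "(\<Sum>i\<in>{i\<in>{1..Suc N}. \<not> (i = 1 \<or> ?r i < ?r (i - 1))}. f (int (?r i) - int i + 1))
    = (\<Sum>i\<in>{i\<in>{1..N}. \<not> (?r (Suc i) < ?r i)}. f (int (?r i) - int i))"
  proof (rule sum.reindex_bij_witness[of _ Suc "\<lambda>i. i - 1"], goal_cases)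
    case (5 a)
    then have a: "1 \<le> a - 1" "Suc (a - 1) = a" "\<not> ?r a < ?r (a - 1)" by auto
    then have "?r a = ?r (a - 1)" using row_anti[OF d a(1)] by auto
    moreover have "int (a - 1) = int a - 1" using a by auto
    ultimately show ?case by (simp add: algebra_simps)
  qed auto
  have s4: "(\<Sum>i=1..Suc N. f (int (?r i) - int i + 1)) = f (- int N) + (\<Sum>i=1..N. f (int (?r i) - int i + 1))"
    using N by (simp add: height_le_def add.commute)
  show ?thesis unfolding rem add sum_subtractf using s1 s2 s3 s4 by (simp add: algebra_simps)
qed

text \<open>The row expression telescopes twice: the second difference in the content collapses
  along each row, and the boundary terms at the left edge collapse down the first column to f 0 - f
  (-N). The bound N thereby disappears.\<close>

lemma add_minus_rem_boxes:
  fixes f :: "int \<Rightarrow> real"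
  assumes d: "diagram S"
  shows "(\<Sum>b\<in>Add S. f (boxcont b)) - (\<Sum>b\<in>Rem S. f (boxcont b))
    = f 0 + (\<Sum>b\<in>S. f (boxcont b + 1) + f (boxcont b - 1) - 2 * f (boxcont b))"
proof -
  obtain N where N: "height_le S N" using height_le_ex[OF d] by blast
  have inner: "(\<Sum>j=1..r. f (int j - int i + 1) + f (int j - int i - 1) - 2 * f (int j - int i))
     = f (int r - int i + 1) - f (int r - int i) - (f (1 - int i) - f (- int i))" for r i :: nat
    by (induction r) (auto simp: algebra_simps)
  have tel: "(\<Sum>i=1..N. f (1 - int i) - f (- int i)) = f 0 - f (- int N)" for N
    by (induction N) (auto simp: algebra_simps)
  have "(\<Sum>b\<in>S. f (boxcont b + 1) + f (boxcont b - 1) - 2 * f (boxcont b))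
    = (\<Sum>i=1..N. \<Sum>j=1..rowlen S i. f (int j - int i + 1) + f (int j - int i - 1) - 2 * f (int j - int i))"
    unfolding sum_diagram[OF d N] boxcont_def by simp
  also have "\<dots> = (\<Sum>i=1..N. f (int (rowlen S i) - int i + 1) - f (int (rowlen S i) - int i) - (f (1 - int i) - f (- int i)))"
    by (simp only: inner)
  also have "\<dots> = (\<Sum>i=1..N. f (int (rowlen S i) - int i + 1) - f (int (rowlen S i) - int i)) - (f 0 - f (- int N))"
    by (simp only: sum_subtractf tel[symmetric])
  finally show ?thesis unfolding add_minus_rem[OF d N] by simp
qed

section \<open>Partitions and standard tableaux\<close>


lemma rowlen_boxes: "1 \<le> i \<Longrightarrow> rowlen (boxes lam) i = yrow lam i"
proof -
  assume "1 \<le> i"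
  then have "{j. (i, j) \<in> boxes lam} = {1..yrow lam i}" by (auto simp: boxes_def)
  then show ?thesis by (simp add: rowlen_def)
qed

lemma yrow_anti: assumes "is_partition lam" "1 \<le> i" shows "yrow lam (Suc i) \<le> yrow lam i"
  using assms unfolding is_partition_def yrow_def
  by (auto simp: sorted_wrt_iff_nth_less)

lemma finite_boxes: "finite (boxes lam)"
proof -
  have "boxes lam \<subseteq> Sigma {1..length lam} (\<lambda>i. {1..yrow lam i})"
    by (auto simp: boxes_def yrow_def split: if_splits)
  then show ?thesis using finite_subset by blast
qed

lemma diagram_boxes: assumes "is_partition lam" shows "diagram (boxes lam)"
proof -
  have "(i, j) \<in> boxes lam" if "(Suc i, j) \<in> boxes lam" "1 \<le> i" for i j
    using that yrow_anti[OF assms that(2)] unfolding boxes_def by auto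
  then show ?thesis unfolding diagram_def using finite_boxes by (auto simp: boxes_def)
qed

lemma card_boxes: "card (boxes lam) = sum_list lam"
proof -
  have "boxes lam = Sigma {1..length lam} (\<lambda>i. {1..yrow lam i})"
    by (auto simp: boxes_def yrow_def split: if_splits)
  then have "card (boxes lam) = (\<Sum>i=1..length lam. yrow lam i)" by (simp add: card_SigmaI)
  also have "\<dots> = (\<Sum>i<length lam. lam ! i)"
    by (rule sum.reindex_bij_witness[of _ Suc "\<lambda>i. i - 1"]) (auto simp: yrow_def)
  also have "\<dots> = sum_list lam" by (simp add: sum_list_sum_nth atLeast0LessThan)
  finally show ?thesis .
qed

lemma yrow_pos: "is_partition lam \<Longrightarrow> 1 \<le> i \<Longrightarrow> 0 < yrow lam i \<longleftrightarrow> i \<le> length lam"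
  by (auto simp: yrow_def is_partition_def split: if_splits)

lemma boxes_inj: assumes "is_partition lam" "is_partition mu" "boxes lam = boxes mu" shows "lam = mu"
proof -
  have r: "yrow lam i = yrow mu i" if "1 \<le> i" for i using assms(3) rowlen_boxes[OF that] by metis
  have len: "length lam = length mu"
  proof (rule ccontr)
    assume "length lam \<noteq> length mu"
    then consider "length lam < length mu" | "length mu < length lam" by linarith
    then show False
      using yrow_pos[OF assms(1), of "length mu"] yrow_pos[OF assms(2), of "length mu"]
        yrow_pos[OF assms(1), of "length lam"] yrow_pos[OF assms(2), of "length lam"] r[of "length mu"] r[of "length lam"]
      by cases auto
  qed
  show ?thesis
  proof (rule nth_equalityI[OF len])
    fix i assume "i < length lam"
    then show "lam ! i = mu ! i" using r[of "Suc i"] len by (auto simp: yrow_def)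
  qed
qed

lemma diagram_list: assumes "diagram S" shows "\<exists>lam. is_partition lam \<and> boxes lam = S"
proof -
  define L where "L = card {i. (i, 1) \<in> S}"
  define lam where "lam = map (\<lambda>i. rowlen S (Suc i)) [0..<L]"
  have len: "length lam = L" by (simp add: lam_def)
  have pos: "rowlen S i > 0 \<longleftrightarrow> i \<le> L" if "1 \<le> i" for i
  proof -
    have "(i, 1) \<in> S \<longleftrightarrow> i \<le> L" using diagram_col[OF assms, of i 1] that L_def by auto
    then show ?thesis using diagram_row[OF assms, of i 1] that by auto
  qed
  have yr: "yrow lam i = rowlen S i" if "1 \<le> i" for i
    using pos[OF that] that len unfolding yrow_def by (auto simp: lam_def)
  have "is_partition lam" unfolding is_partition_def
  proof
    show "sorted_wrt (\<ge>) lam"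
      unfolding sorted_wrt_iff_nth_less using row_anti'[OF assms] by (auto simp: lam_def)
    show "\<forall>x\<in>set lam. 0 < x" using pos by (auto simp: lam_def)
  qed
  moreover have "boxes lam = S"
    using yr diagram_row[OF assms] unfolding boxes_def by auto
  ultimately show ?thesis by blast
qed

lemma lst_props: assumes "diagram S" shows "is_partition (lst S)" "boxes (lst S) = S"
proof -
  have "\<exists>!lam. is_partition lam \<and> boxes lam = S" using diagram_list[OF assms] boxes_inj by blast
  from theI'[OF this] show "is_partition (lst S)" "boxes (lst S) = S" unfolding lst_def by auto
qed

lemma lst_boxes: "is_partition lam \<Longrightarrow> lst (boxes lam) = lam"
  by (rule boxes_inj) (simp_all add: lst_props diagram_boxes)

lemma YD_D: "lam \<in> YD n \<Longrightarrow> is_partition lam \<and> diagram (boxes lam) \<and> card (boxes lam) = n \<and> sum_list lam = n"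
  using diagram_boxes card_boxes by (auto simp: YD_def)

lemma lst_YD: "diagram S \<Longrightarrow> card S = n \<Longrightarrow> lst S \<in> YD n"
  using lst_props[of S] card_boxes[of "lst S"] by (auto simp: YD_def)

lemma sum_YD: "(\<Sum>lam\<in>YD n. F lam) = (\<Sum>S\<in>{S. diagram S \<and> card S = n}. F (lst S))"
  by (rule sum.reindex_bij_witness[of _ lst boxes])
     (auto dest: YD_D simp: lst_YD lst_boxes lst_props)

lemma finite_diagrams: "finite {S. diagram S \<and> card S = n}"
proof -
  have "S \<subseteq> {1..n} \<times> {1..n}" if d: "diagram S" "card S = n" for S
  proof
    fix b assume b: "b \<in> S"
    obtain i j where ij: "b = (i, j)" by (cases b)
    have "i \<le> n" using height_le_card[OF d(1)] b ij d diagram_row[OF d(1), of i j] unfolding height_le_def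
      by (metis le_zero_eq not_le not_one_le_zero le_trans)
    moreover have "j \<le> n"
    proof -
      have "(\<lambda>k. (i, k)) ` {1..j} \<subseteq> S" using diagram_row[OF d(1)] b ij by auto
      then have "card ((\<lambda>k. (i, k)) ` {1..j}) \<le> n" using d diagram_finite card_mono by metis
      moreover have "card ((\<lambda>k. (i, k)) ` {1..j}) = j" by (subst card_image) (auto simp: inj_on_def)
      ultimately show ?thesis by simp
    qed
    ultimately show "b \<in> {1..n} \<times> {1..n}" using diagram_pos[OF d(1), of i j] b ij by auto
  qed
  then have "{S. diagram S \<and> card S = n} \<subseteq> Pow ({1..n} \<times> {1..n})" by auto
  then show ?thesis by (rule finite_subset) auto
qed

lemma finite_YD: "finite (YD n)"
proof -
  have "YD n \<subseteq> lst ` {S. diagram S \<and> card S = n}"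
  proof
    fix lam assume "lam \<in> YD n"
    then show "lam \<in> lst ` {S. diagram S \<and> card S = n}"
      using YD_D[of lam n] lst_boxes[of lam] by (metis (mono_tags, lifting) image_eqI mem_Collect_eq)
  qed
  then show ?thesis using finite_diagrams finite_surj by blast
qed

lemma YD_nonempty: "YD n \<noteq> {}"
proof -
  have "replicate n 1 \<in> YD n" by (auto simp: YD_def is_partition_def sum_list_replicate sorted_wrt_iff_nth_less)
  then show ?thesis by blast
qed

section \<open>Standard tableaux and the recursion for the dimension\<close>

definition SYT :: "(nat \<times> nat) set \<Rightarrow> (nat \<times> nat \<Rightarrow> nat) set" where
  "SYT S = {f \<in> S \<rightarrow>\<^sub>E {1..card S}.
      bij_betw f S {1..card S} \<and>
      (\<forall>i j. (i, j) \<in> S \<and> (i, Suc j) \<in> S \<longrightarrow> f (i, j) < f (i, Suc j)) \<and>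
      (\<forall>i j. (i, j) \<in> S \<and> (Suc i, j) \<in> S \<longrightarrow> f (i, j) < f (Suc i, j))}"

definition sdim :: "(nat \<times> nat) set \<Rightarrow> nat" where "sdim S = card (SYT S)"

lemma ydim_sdim: "ydim lam = sdim (boxes lam)"
  unfolding ydim_def sdim_def SYT_def card_boxes ..

lemma finite_SYT: "finite S \<Longrightarrow> finite (SYT S)"
  unfolding SYT_def using finite_PiE[of S "\<lambda>_. {1..card S}"] by simp

lemma sdim_empty: "sdim {} = 1"
proof -
  have "SYT {} = {\<lambda>x. undefined}" by (auto simp: SYT_def bij_betw_def)
  then show ?thesis by (simp add: sdim_def)
qed

lemma SYT_top_Rem:
  assumes "diagram S" "f \<in> SYT S" "b \<in> S" "f b = card S"
  shows "b \<in> Rem S"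
proof -
  obtain i j where b: "b = (i, j)" by (cases b)
  have le: "f x \<le> card S" if "x \<in> S" for x using assms(2) that unfolding SYT_def bij_betw_def by force
  have "(Suc i, j) \<notin> S"
  proof
    assume "(Suc i, j) \<in> S"
    then have "f (i, j) < f (Suc i, j)" using assms(2,3) b by (auto simp: SYT_def)
    then show False using le[OF \<open>(Suc i, j) \<in> S\<close>] assms(4) b by simp
  qed
  moreover have "(i, Suc j) \<notin> S"
  proof
    assume "(i, Suc j) \<in> S"
    then have "f (i, j) < f (i, Suc j)" using assms(2,3) b by (auto simp: SYT_def)
    then show False using le[OF \<open>(i, Suc j) \<in> S\<close>] assms(4) b by simp
  qed
  ultimately show ?thesis using assms(3) b by (auto simp: Rem_def)
qed

text \<open>Deleting the largest entry at the corner b and writing it back are mutually inverse;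
  writing it back respects the order since a corner has no neighbour to the right or below.\<close>

lemma card_SYT_top:
  assumes d: "diagram S" and b: "b \<in> Rem S"
  shows "card {f \<in> SYT S. f b = card S} = sdim (S - {b})"
proof -
  let ?n = "card S"
  have fin: "finite S" using d diagram_finite by auto
  have bS: "b \<in> S" using b Rem_subset by auto
  have n: "?n \<ge> 1" using fin bS by (metis One_nat_def Suc_leI card_gt_0_iff empty_iff)
  have c: "card (S - {b}) = ?n - 1" using fin bS by simp
  have set: "{1..?n} - {?n} = {1..?n - 1}" using n by auto
  have "bij_betw (\<lambda>f. restrict f (S - {b})) {f \<in> SYT S. f b = ?n} (SYT (S - {b}))"
  proof (rule bij_betw_byWitness[where f' = "\<lambda>g. g(b := ?n)"])
    show "\<forall>f\<in>{f \<in> SYT S. f b = ?n}. (restrict f (S - {b}))(b := ?n) = f"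
    proof
      fix f assume f: "f \<in> {f \<in> SYT S. f b = ?n}"
      then have "f \<in> extensional S" by (auto simp: SYT_def PiE_def)
      then show "(restrict f (S - {b}))(b := ?n) = f"
        using f by (auto simp: fun_eq_iff extensional_def restrict_def)
    qed
    show "\<forall>g\<in>SYT (S - {b}). restrict (g(b := ?n)) (S - {b}) = g"
    proof
      fix g assume "g \<in> SYT (S - {b})"
      then have "g \<in> extensional (S - {b})" by (auto simp: SYT_def PiE_def)
      then show "restrict (g(b := ?n)) (S - {b}) = g"
        by (auto simp: fun_eq_iff extensional_def restrict_def)
    qed
    show "(\<lambda>f. restrict f (S - {b})) ` {f \<in> SYT S. f b = ?n} \<subseteq> SYT (S - {b})"
    proof clarify
      fix f assume f: "f \<in> SYT S" "f b = ?n"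
      have bij: "bij_betw f S {1..?n}" using f by (auto simp: SYT_def)
      then have bij': "bij_betw f (S - {b}) ({1..?n} - {f b})"
        using bS inj_on_image_set_diff[of f S S "{b}"] unfolding bij_betw_def by (auto simp: inj_on_diff)
      then have bij2: "bij_betw (restrict f (S - {b})) (S - {b}) {1..?n - 1}"
        using set f by (simp add: bij_betw_restrict_eq)
      then have "restrict f (S - {b}) \<in> (S - {b}) \<rightarrow>\<^sub>E {1..?n - 1}"
        by (auto simp: bij_betw_def)
      then show "restrict f (S - {b}) \<in> SYT (S - {b})"
        using bij2 f unfolding SYT_def c by auto
    qed
    show "(\<lambda>g. g(b := ?n)) ` SYT (S - {b}) \<subseteq> {f \<in> SYT S. f b = ?n}"
    proof clarify
      fix g assume g: "g \<in> SYT (S - {b})"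
      have bij: "bij_betw g (S - {b}) {1..?n - 1}" using g c by (auto simp: SYT_def)
      have rng: "g x \<le> ?n - 1" "1 \<le> g x" if "x \<in> S" "x \<noteq> b" for x using bij that by (auto simp: bij_betw_def)
      have bij2: "bij_betw (g(b := ?n)) S {1..?n}"
      proof -
        have "bij_betw (g(b := ?n)) (S - {b}) {1..?n - 1}"
          by (rule iffD1[OF bij_betw_cong bij]) auto
        moreover have "bij_betw (g(b := ?n)) {b} {?n}" by (simp add: bij_betw_def)
        ultimately have "bij_betw (g(b := ?n)) ((S - {b}) \<union> {b}) ({1..?n - 1} \<union> {?n})"
          by (rule bij_betw_combine) (use n in auto)
        moreover have "(S - {b}) \<union> {b} = S" "{1..?n - 1} \<union> {?n} = {1..?n}" using bS n by auto
        ultimately show ?thesis by simp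
      qed
      have ext: "g(b := ?n) \<in> S \<rightarrow>\<^sub>E {1..?n}"
      proof -
        have "g \<in> extensional (S - {b})" using g by (auto simp: SYT_def PiE_def)
        then have "g(b := ?n) \<in> extensional S" using bS by (auto simp: extensional_def)
        moreover have "g(b := ?n) \<in> S \<rightarrow> {1..?n}" using bij2 unfolding bij_betw_def by (metis Pi_I image_eqI)
        ultimately show ?thesis by (simp add: PiE_def)
      qed
      obtain i j where bij3: "b = (i, j)" by (cases b)
      have nb: "(Suc i, j) \<notin> S" "(i, Suc j) \<notin> S" using b bij3 by (auto simp: Rem_def)
      have up: "(g(b := ?n)) x < (g(b := ?n)) y" if "x \<in> S" "y \<in> S" "x \<noteq> b" "y \<noteq> b \<Longrightarrow> g x < g y" for x y
        using that rng[of x] n by (auto simp: fun_upd_def)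
      have "g(b := ?n) \<in> SYT S" unfolding SYT_def
      proof (intro CollectI conjI ext bij2 allI impI)
        fix k l assume *: "(k, l) \<in> S \<and> (k, Suc l) \<in> S"
        show "(g(b := ?n)) (k, l) < (g(b := ?n)) (k, Suc l)"
          by (rule up) (use * nb bij3 g in \<open>auto simp: SYT_def\<close>)
      next
        fix k l assume *: "(k, l) \<in> S \<and> (Suc k, l) \<in> S"
        show "(g(b := ?n)) (k, l) < (g(b := ?n)) (Suc k, l)"
          by (rule up) (use * nb bij3 g in \<open>auto simp: SYT_def\<close>)
      qed
      then show "g(b := ?n) \<in> SYT S \<and> (g(b := ?n)) b = ?n" by simp
    qed
  qed
  then show ?thesis unfolding sdim_def by (rule bij_betw_same_card)
qed

text \<open>Tableaux are classified by the corner that holds the largest entry.\<close>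

lemma sdim_rec: assumes d: "diagram S" and ne: "S \<noteq> {}"
  shows "sdim S = (\<Sum>b\<in>Rem S. sdim (S - {b}))"
proof -
  have fin: "finite S" using d diagram_finite by auto
  have n: "card S \<ge> 1" using fin ne by (simp add: Suc_leI card_gt_0_iff)
  have "SYT S = (\<Union>b\<in>Rem S. {f \<in> SYT S. f b = card S})"
  proof
    show "SYT S \<subseteq> (\<Union>b\<in>Rem S. {f \<in> SYT S. f b = card S})"
    proof
      fix f assume f: "f \<in> SYT S"
      then have "f ` S = {1..card S}" by (auto simp: SYT_def bij_betw_def)
      then obtain b where "b \<in> S" "f b = card S" using n by (metis atLeastAtMost_iff imageE order_refl)
      then show "f \<in> (\<Union>b\<in>Rem S. {f \<in> SYT S. f b = card S})" using SYT_top_Rem[OF d f, of b] f by auto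
    qed
  qed auto
  moreover have "card (\<Union>b\<in>Rem S. {f \<in> SYT S. f b = card S}) = (\<Sum>b\<in>Rem S. card {f \<in> SYT S. f b = card S})"
  proof (rule card_UN_disjoint)
    show "finite (Rem S)" using finite_Rem d by auto
    show "\<forall>b\<in>Rem S. finite {f \<in> SYT S. f b = card S}" using finite_SYT[OF fin] by auto
    show "\<forall>b\<in>Rem S. \<forall>b'\<in>Rem S. b \<noteq> b' \<longrightarrow> {f \<in> SYT S. f b = card S} \<inter> {f \<in> SYT S. f b' = card S} = {}"
    proof (intro ballI impI)
      fix b b' assume bb: "b \<in> Rem S" "b' \<in> Rem S" "b \<noteq> b'"
      then have "b \<in> S" "b' \<in> S" using Rem_subset by auto
      then show "{f \<in> SYT S. f b = card S} \<inter> {f \<in> SYT S. f b' = card S} = {}"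
        using bb(3) by (auto simp: SYT_def bij_betw_def inj_on_def)
    qed
  qed
  ultimately show ?thesis unfolding sdim_def[of S] using card_SYT_top[OF d] by simp
qed

lemma Rem_nonempty: assumes d: "diagram S" and ne: "S \<noteq> {}" shows "Rem S \<noteq> {}"
proof -
  have fin: "finite S" using d diagram_finite by auto
  \<comment> \<open>A box with the largest sum of coordinates has no neighbour to the right or
    below, hence is a corner.\<close>
  obtain b where b: "b \<in> S" "\<forall>x\<in>S. fst x + snd x \<le> fst b + snd b"
  proof -
    let ?I = "(\<lambda>x. fst x + snd x) ` S"
    have "Max ?I \<in> ?I" using fin ne by (intro Max_in) auto
    then obtain b where "b \<in> S" "fst b + snd b = Max ?I" by auto
    moreover have "\<forall>x\<in>S. fst x + snd x \<le> Max ?I" using fin by auto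
    ultimately show thesis using that[of b] by auto
  qed
  obtain i j where ij: "b = (i, j)" by (cases b)
  have "(Suc i, j) \<notin> S" "(i, Suc j) \<notin> S" using b(2) ij by fastforce+
  then show ?thesis using b(1) ij by (auto simp: Rem_def)
qed

lemma sdim_pos: "diagram S \<Longrightarrow> sdim S > 0"
proof (induction "card S" arbitrary: S rule: less_induct)
  case less
  show ?case
  proof (cases "S = {}")
    case True then show ?thesis by (simp add: sdim_empty)
  next
    case False
    then obtain b where b: "b \<in> Rem S" using Rem_nonempty less.prems by blast
    have fin: "finite S" using less.prems diagram_finite by auto
    have "card (S - {b}) < card S" using b Rem_subset[of S] fin by (meson card_Diff1_less subsetD)
    then have "sdim (S - {b}) > 0" using less Rem_diagram b by blast
    moreover have "sdim (S - {b}) \<le> sdim S"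
      unfolding sdim_rec[OF less.prems False] using b finite_Rem[OF less.prems] by (intro member_le_sum) auto
    ultimately show ?thesis by simp
  qed
qed

section \<open>The up and down operators\<close>


text \<open>Expectation of G after removing a random box with the co-transition law
  \<open>p_down\<close>. The operator acts on functions of all levels at once: on level n it reads G
  on level n - 1.\<close>

definition DS :: "((nat \<times> nat) set \<Rightarrow> real) \<Rightarrow> (nat \<times> nat) set \<Rightarrow> real" where
  "DS G S = (\<Sum>b\<in>Rem S. real (sdim (S - {b})) / real (sdim S) * G (S - {b}))"

text \<open>\<open>wt kap s c\<close> is \<open>(z + c) (z' + c)\<close> for \<open>kap = z z'\<close> and \<open>s = z + z'\<close>, both real in either series.\<close>

definition wt :: "real \<Rightarrow> real \<Rightarrow> int \<Rightarrow> real" where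
  "wt kap s c = kap + s * of_int c + (of_int c)\<^sup>2"

definition US :: "real \<Rightarrow> real \<Rightarrow> ((nat \<times> nat) set \<Rightarrow> real) \<Rightarrow> (nat \<times> nat) set \<Rightarrow> real" where
  "US kap s G S = (\<Sum>b\<in>Add S. wt kap s (boxcont b) / (kap + real (card S)) * real (sdim (insert b S))
      / (real (card S + 1) * real (sdim S)) * G (insert b S))"

definition TS :: "real \<Rightarrow> real \<Rightarrow> ((nat \<times> nat) set \<Rightarrow> real) \<Rightarrow> (nat \<times> nat) set \<Rightarrow> real" where
  "TS kap s G = US kap s (DS G)"

text \<open>The operator T - 1 with the denominators of the up probabilities cleared. This
  level-dependent factor is chosen to make it commute with \<open>DS\<close>.\<close>

definition GS :: "real \<Rightarrow> real \<Rightarrow> ((nat \<times> nat) set \<Rightarrow> real) \<Rightarrow> (nat \<times> nat) set \<Rightarrow> real" where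
  "GS kap s G S = (kap + real (card S)) * (real (card S) + 1) * (TS kap s G S - G S)"

lemma finite_Add: assumes "diagram S" shows "finite (Add S)"
proof -
  \<comment> \<open>An addable box b is recovered from the larger diagram \<open>insert b S\<close>
    as the only element outside S, and there are finitely many such diagrams.\<close>
  have "Add S \<subseteq> (\<lambda>T. the_elem (T - S)) ` {T. diagram T \<and> card T = Suc (card S)}"
  proof
    fix b assume b: "b \<in> Add S"
    then have "b \<notin> S" "diagram (insert b S)" using Add_iff[OF assms] by auto
    then have "insert b S \<in> {T. diagram T \<and> card T = Suc (card S)}" using diagram_finite[OF assms] by auto
    moreover have "insert b S - S = {b}" using \<open>b \<notin> S\<close> by auto
    ultimately show "b \<in> (\<lambda>T. the_elem (T - S)) ` {T. diagram T \<and> card T = Suc (card S)}"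
      by (metis (no_types, lifting) image_eqI the_elem_eq)
  qed
  then show ?thesis using finite_diagrams finite_surj by blast
qed

lemma up_set: assumes "diagram S" "card S = n"
  shows "{T. diagram T \<and> card T = Suc n \<and> S \<subseteq> T} = (\<lambda>b. insert b S) ` Add S"
proof (intro subset_antisym subsetI)
  fix T assume "T \<in> {T. diagram T \<and> card T = Suc n \<and> S \<subseteq> T}"
  then have T: "diagram T" "card T = Suc n" "S \<subseteq> T" by auto
  have f: "finite T" using T diagram_finite by auto
  then have "card (T - S) = 1" using T assms by (simp add: card_Diff_subset finite_subset)
  then obtain b where b: "T - S = {b}" by (auto simp: card_1_singleton_iff)
  then have "T = insert b S" "b \<notin> S" using T by auto
  then show "T \<in> (\<lambda>b. insert b S) ` Add S" using Add_iff[OF assms(1)] T by auto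
qed (use assms diagram_finite Add_iff in auto)

lemma down_set: assumes "diagram T" "card T = Suc n"
  shows "{S. diagram S \<and> card S = n \<and> S \<subseteq> T} = (\<lambda>b. T - {b}) ` Rem T"
proof (intro subset_antisym subsetI)
  fix S assume "S \<in> {S. diagram S \<and> card S = n \<and> S \<subseteq> T}"
  then have S: "diagram S" "card S = n" "S \<subseteq> T" by auto
  have f: "finite T" using assms diagram_finite by auto
  then have "card (T - S) = 1" using S assms by (simp add: card_Diff_subset finite_subset)
  then obtain b where b: "T - S = {b}" by (auto simp: card_1_singleton_iff)
  then have "S = T - {b}" "b \<in> T" using S by auto
  then show "S \<in> (\<lambda>b. T - {b}) ` Rem T" using Rem_iff[OF assms(1)] S by auto
next
  fix S assume "S \<in> (\<lambda>b. T - {b}) ` Rem T"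
  then obtain b where b: "b \<in> Rem T" "S = T - {b}" by auto
  then have "b \<in> T" using Rem_subset by auto
  then show "S \<in> {S. diagram S \<and> card S = n \<and> S \<subseteq> T}"
    using b assms Rem_diagram[OF assms(1)] diagram_finite[OF assms(1)] by auto
qed

section \<open>Comparison of the chain on partitions with the operators on sets of boxes\<close>

lemma sum_up: assumes "lam \<in> YD n"
  shows "(\<Sum>nu\<in>YD (Suc n). if yedge lam nu then F nu else (0::real)) = (\<Sum>b\<in>Add (boxes lam). F (lst (insert b (boxes lam))))"
proof -
  let ?S = "boxes lam"
  have S: "diagram ?S" "card ?S = n" "sum_list lam = n" using YD_D[OF assms] by auto
  have "(\<Sum>nu\<in>YD (Suc n). if yedge lam nu then F nu else 0)
     = (\<Sum>T\<in>{T. diagram T \<and> card T = Suc n}. if ?S \<subseteq> T then F (lst T) else 0)"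
    unfolding sum_YD
  proof (rule sum.cong[OF refl])
    fix T assume "T \<in> {T. diagram T \<and> card T = Suc n}"
    then have "boxes (lst T) = T" "sum_list (lst T) = Suc n" using lst_props[of T] card_boxes[of "lst T"] by auto
    then show "(if yedge lam (lst T) then F (lst T) else 0) = (if ?S \<subseteq> T then F (lst T) else 0)"
      using S by (simp add: yedge_def)
  qed
  also have "\<dots> = (\<Sum>T\<in>{T. diagram T \<and> card T = Suc n \<and> ?S \<subseteq> T}. F (lst T))"
    by (rule sum.mono_neutral_cong_right) (auto simp: finite_diagrams)
  also have "\<dots> = (\<Sum>b\<in>Add ?S. F (lst (insert b ?S)))"
    unfolding up_set[OF S(1,2)]
  proof (subst sum.reindex)
    show "inj_on (\<lambda>b. insert b ?S) (Add ?S)" using Add_iff[OF S(1)] by (auto simp: inj_on_def)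
  qed simp
  finally show ?thesis .
qed

lemma sum_down: assumes "nu \<in> YD (Suc n)"
  shows "(\<Sum>lam\<in>YD n. if yedge lam nu then F lam else (0::real)) = (\<Sum>b\<in>Rem (boxes nu). F (lst (boxes nu - {b})))"
proof -
  let ?T = "boxes nu"
  have S: "diagram ?T" "card ?T = Suc n" "sum_list nu = Suc n" using YD_D[OF assms] by auto
  have "(\<Sum>lam\<in>YD n. if yedge lam nu then F lam else 0)
     = (\<Sum>S\<in>{S. diagram S \<and> card S = n}. if S \<subseteq> ?T then F (lst S) else 0)"
    unfolding sum_YD
  proof (rule sum.cong[OF refl])
    fix T assume "T \<in> {T. diagram T \<and> card T = n}"
    then have "boxes (lst T) = T" "sum_list (lst T) = n" using lst_props[of T] card_boxes[of "lst T"] by auto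
    then show "(if yedge (lst T) nu then F (lst T) else 0) = (if T \<subseteq> ?T then F (lst T) else 0)"
      using S by (simp add: yedge_def)
  qed
  also have "\<dots> = (\<Sum>S\<in>{S. diagram S \<and> card S = n \<and> S \<subseteq> ?T}. F (lst S))"
    by (rule sum.mono_neutral_cong_right) (auto simp: finite_diagrams)
  also have "\<dots> = (\<Sum>b\<in>Rem ?T. F (lst (?T - {b})))"
    unfolding down_set[OF S(1,2)]
  proof (subst sum.reindex)
    show "inj_on (\<lambda>b. ?T - {b}) (Rem ?T)" using Rem_subset[of ?T] by (auto simp: inj_on_def)
  qed simp
  finally show ?thesis .
qed

lemma Tn_TS:
  assumes im: "Im (z * z') = 0" and lam: "lam \<in> YD n"
  shows "Tn z z' n g lam = TS (Re (z * z')) (Re (z + z')) (\<lambda>S. g (lst S)) (boxes lam)"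
proof -
  let ?S = "boxes lam" and ?kap = "Re (z * z')" and ?s = "Re (z + z')"
  have S: "diagram ?S" "card ?S = n" "sum_list lam = n" using YD_D[OF lam] by auto
  have inner: "(\<Sum>lt\<in>YD n. p_down nu lt * g lt) = DS (\<lambda>S. g (lst S)) (boxes nu)" if "nu \<in> YD (Suc n)" for nu
  proof -
    have d: "diagram (boxes nu)" using YD_D[OF that] by auto
    have "(\<Sum>lt\<in>YD n. p_down nu lt * g lt) = (\<Sum>lt\<in>YD n. if yedge lt nu then real (ydim lt) / real (ydim nu) * g lt else 0)"
      by (rule sum.cong) (auto simp: p_down_def)
    also have "\<dots> = DS (\<lambda>S. g (lst S)) (boxes nu)"
      unfolding sum_down[OF that] DS_def
      by (rule sum.cong) (auto simp: ydim_sdim lst_props(2)[OF Rem_diagram[OF d]])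
    finally show ?thesis .
  qed
  have "z * z' + of_nat n = complex_of_real (?kap + real n)"
    using im by (simp add: complex_eq_iff)
  then have zz: "Re (x / (z * z' + of_nat n)) = Re x / (?kap + real n)" for x
    by (simp only: Re_divide_of_real)
  have w: "Re ((z + of_int c) * (z' + of_int c)) = wt ?kap ?s c" for c
    by (simp add: wt_def algebra_simps power2_eq_square)
  have "Tn z z' n g lam = (\<Sum>nu\<in>YD (Suc n). p_up z z' lam nu * DS (\<lambda>S. g (lst S)) (boxes nu))"
    unfolding Tn_def by (rule sum.cong) (auto simp: inner)
  also have "\<dots> = (\<Sum>nu\<in>YD (Suc n). if yedge lam nu then
      Re (zpoch z nu lam * zpoch z' nu lam / (z * z' + of_nat (sum_list lam)))
      * real (ydim nu) / (real (sum_list lam + 1) * real (ydim lam)) * DS (\<lambda>S. g (lst S)) (boxes nu) else 0)"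
    by (rule sum.cong) (auto simp: p_up_def)
  also have "\<dots> = US ?kap ?s (DS (\<lambda>S. g (lst S))) ?S"
    unfolding sum_up[OF lam] US_def
  proof (rule sum.cong[OF refl])
    fix b assume b: "b \<in> Add ?S"
    then have bx: "boxes (lst (insert b ?S)) = insert b ?S" using Add_diagram[OF S(1)] lst_props(2) by blast
    have "insert b ?S - ?S = {b}" using b Add_iff[OF S(1)] by auto
    then have zp: "zpoch z (lst (insert b ?S)) lam = z + of_int (boxcont b)" for z
      unfolding zpoch_def bx by (simp add: boxcont_def split_beta)
    show "Re (zpoch z (lst (insert b ?S)) lam * zpoch z' (lst (insert b ?S)) lam / (z * z' + of_nat (sum_list lam)))
      * real (ydim (lst (insert b ?S))) / (real (sum_list lam + 1) * real (ydim lam)) * DS (\<lambda>S. g (lst S)) (boxes (lst (insert b ?S)))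
      = wt ?kap ?s (boxcont b) / (?kap + real (card ?S)) * real (sdim (insert b ?S))
      / (real (card ?S + 1) * real (sdim ?S)) * DS (\<lambda>S. g (lst S)) (insert b ?S)"
      unfolding zp bx ydim_sdim S zz w by simp
  qed
  finally show ?thesis by (simp add: TS_def)
qed

text \<open>For b different from c, adding b and then removing c reaches the same diagram as
  removing c and then adding b, with the same weight. What is left are the pairs that return to S:
  one for each addable box on the left, one for each removable box on the right.\<close>

lemma add_rem_swap:
  fixes w :: "nat \<times> nat \<Rightarrow> real"
  assumes d: "diagram S"
  shows "(\<Sum>b\<in>Add S. \<Sum>c\<in>Rem (insert b S). w b * H (insert b S - {c}))
    = (\<Sum>c\<in>Rem S. \<Sum>b\<in>Add (S - {c}). w b * H (insert b (S - {c})))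
      + ((\<Sum>b\<in>Add S. w b) - (\<Sum>b\<in>Rem S. w b)) * H S"
proof -
  let ?P = "Sigma (Add S) (\<lambda>b. Rem (insert b S) - {b})"
  let ?Q = "Sigma (Rem S) (\<lambda>c. Add (S - {c}) - {c})"
  have L: "(\<Sum>c\<in>Rem (insert b S). w b * H (insert b S - {c})) = w b * H S + (\<Sum>c\<in>Rem (insert b S) - {b}. w b * H (insert b S - {c}))"
    if b: "b \<in> Add S" for b
  proof -
    have bb: "b \<notin> S" "diagram (insert b S)" using b Add_iff[OF d] by auto
    have "b \<in> Rem (insert b S)" using Rem_iff[OF bb(2)] bb d by simp
    moreover have "insert b S - {b} = S" using bb by auto
    ultimately show ?thesis using sum.remove[OF finite_Rem[OF bb(2)], of b "\<lambda>c. w b * H (insert b S - {c})"] by simp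
  qed
  have R: "(\<Sum>b\<in>Add (S - {c}). w b * H (insert b (S - {c}))) = w c * H S + (\<Sum>b\<in>Add (S - {c}) - {c}. w b * H (insert b (S - {c})))"
    if c: "c \<in> Rem S" for c
  proof -
    have cc: "c \<in> S" "diagram (S - {c})" using c Rem_iff[OF d] by auto
    have "insert c (S - {c}) = S" using cc by auto
    then have "c \<in> Add (S - {c})" using Add_iff[OF cc(2)] d by simp
    then show ?thesis using sum.remove[OF finite_Add[OF cc(2)], of c "\<lambda>b. w b * H (insert b (S - {c}))"] \<open>insert c (S - {c}) = S\<close> by simp
  qed
  \<comment> \<open>One order of the two moves is legal iff the other is: \<open>S - {c}\<close> is
    an intersection and \<open>insert b S\<close> a union of diagrams already at hand.\<close>
  have PQ: "(b, c) \<in> ?P \<longleftrightarrow> (c, b) \<in> ?Q" for b c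
  proof
    assume "(b, c) \<in> ?P"
    then have b: "b \<in> Add S" and c: "c \<in> Rem (insert b S)" "c \<noteq> b" by auto
    have bb: "b \<notin> S" "diagram (insert b S)" using b Add_iff[OF d] by auto
    have c': "c \<in> S" "diagram (insert b S - {c})" using Rem_iff[OF bb(2)] c by auto
    have "S \<inter> (insert b S - {c}) = S - {c}" using bb by auto
    then have dc: "diagram (S - {c})" using diagram_Int[OF d c'(2)] by simp
    have "insert b (S - {c}) = insert b S - {c}" using c by auto
    then have "b \<in> Add (S - {c})" using Add_iff[OF dc] c' bb by simp
    moreover have "c \<in> Rem S" using Rem_iff[OF d] c' dc by simp
    ultimately show "(c, b) \<in> ?Q" using c by auto
  next
    assume "(c, b) \<in> ?Q"
    then have c: "c \<in> Rem S" and b: "b \<in> Add (S - {c})" "b \<noteq> c" by auto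
    have cc: "c \<in> S" "diagram (S - {c})" using c Rem_iff[OF d] by auto
    have bb: "b \<notin> S" "diagram (insert b (S - {c}))" using Add_iff[OF cc(2)] b by auto
    have "S \<union> insert b (S - {c}) = insert b S" by auto
    then have di: "diagram (insert b S)" using diagram_Un[OF d bb(2)] by simp
    have "insert b (S - {c}) = insert b S - {c}" using b by auto
    then have "c \<in> Rem (insert b S)" using Rem_iff[OF di] cc bb by simp
    moreover have "b \<in> Add S" using Add_iff[OF d] bb di by simp
    ultimately show "(b, c) \<in> ?P" using b by auto
  qed
  have fA: "finite (Add S)" "finite (Rem S)" using d finite_Add finite_Rem by auto
  have fP: "\<forall>b\<in>Add S. finite (Rem (insert b S) - {b})" using finite_Rem Add_diagram[OF d] by blast
  have fQ: "\<forall>c\<in>Rem S. finite (Add (S - {c}) - {c})" using finite_Add Rem_diagram[OF d] by blast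
  have "(\<Sum>b\<in>Add S. \<Sum>c\<in>Rem (insert b S) - {b}. w b * H (insert b S - {c})) = (\<Sum>(b,c)\<in>?P. w b * H (insert b S - {c}))"
    by (rule sum.Sigma[OF fA(1) fP])
  also have "\<dots> = (\<Sum>(c,b)\<in>?Q. w b * H (insert b (S - {c})))"
  proof (rule sum.reindex_bij_witness[of _ "\<lambda>(c,b). (b,c)" "\<lambda>(b,c). (c,b)"])
    fix x assume x: "x \<in> ?P"
    obtain b c where bc: "x = (b, c)" by (cases x)
    have "insert b (S - {c}) = insert b S - {c}" using x bc by auto
    then show "(case case x of (b, c) \<Rightarrow> (c, b) of (c, b) \<Rightarrow> w b * H (insert b (S - {c}))) = (case x of (b, c) \<Rightarrow> w b * H (insert b S - {c}))"
      using bc by simp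
  qed (use PQ in auto)
  also have "\<dots> = (\<Sum>c\<in>Rem S. \<Sum>b\<in>Add (S - {c}) - {c}. w b * H (insert b (S - {c})))"
    by (rule sum.Sigma[OF fA(2) fQ, symmetric])
  finally show ?thesis
    by (simp add: L R sum.distrib sum_distrib_right left_diff_distrib cong: sum.cong)
qed

text \<open>\<open>kap\<close> and \<open>s\<close> stand for z z' and z + z'. Positivity of (z + c)
  (z' + c) at every integer c is what the principal and the complementary series have in common;
  \<open>kap > 0\<close> keeps the denominators \<open>kap + n\<close> positive.\<close>

locale zpar =
  fixes kap s :: real
  assumes kap: "kap > 0" and wt_pos: "\<And>c::int. wt kap s c > 0"
begin

text \<open>\<open>wt\<close> is a monic quadratic in the content, so its second difference is the
  constant 2 and every box contributes 2; the remaining term is \<open>wt\<close> at content 0, that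
  is \<open>kap\<close>.\<close>

lemma wt_diff: assumes "diagram S"
  shows "(\<Sum>b\<in>Add S. wt kap s (boxcont b)) - (\<Sum>b\<in>Rem S. wt kap s (boxcont b)) = kap + 2 * real (card S)"
proof -
  have "wt kap s (c + 1) + wt kap s (c - 1) - 2 * wt kap s c = 2" for c
    by (simp add: wt_def algebra_simps power2_eq_square)
  then show ?thesis unfolding add_minus_rem_boxes[OF assms] by (simp add: wt_def)
qed

text \<open>Weighting G by the dimension, as in \<open>H\<close>, removes all dimension ratios and
  leaves the bare sums of \<open>add_rem_swap\<close>; the diagonal contribution is computed by
  \<open>wt_diff\<close>. At the empty diagram the factor \<open>card S\<close> removes the term
  with \<open>DS\<close>.\<close>

lemma commutation:
  assumes d: "diagram S"
  shows "(kap + real (card S)) * (real (card S) + 1) * US kap s (DS G) S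
    = (kap + real (card S) - 1) * real (card S) * DS (US kap s G) S + (kap + 2 * real (card S)) * G S"
proof -
  let ?n = "real (card S)" and ?d = "\<lambda>S. real (sdim S)" and ?w = "\<lambda>b. wt kap s (boxcont b)"
  have dS: "?d S > 0" using sdim_pos[OF d] by simp
  have k: "kap + ?n > 0" using kap by (simp add: add_pos_nonneg)
  define H where "H K = ?d K * G K" for K
  have 1: "(kap + ?n) * (?n + 1) * ?d S * US kap s (DS G) S = (\<Sum>b\<in>Add S. \<Sum>c\<in>Rem (insert b S). ?w b * H (insert b S - {c}))"
    unfolding US_def sum_distrib_left
  proof (rule sum.cong[OF refl])
    fix b assume b: "b \<in> Add S"
    have db: "?d (insert b S) > 0" using sdim_pos[OF Add_diagram[OF d b]] by simp
    have "(\<Sum>c\<in>Rem (insert b S). ?w b * H (insert b S - {c})) = ?w b * (?d (insert b S) * DS G (insert b S))"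
      unfolding DS_def sum_distrib_left using db by (simp add: H_def)
    moreover have "(kap + ?n) * (?n + 1) * ?d S * (?w b / (kap + ?n) * ?d (insert b S) / (real (card S + 1) * ?d S) * DS G (insert b S))
       = ?w b * (?d (insert b S) * DS G (insert b S))"
    proof -
      have "A * B * D * (w / A * e / (B * D) * g) = w * (e * g)" if "A \<noteq> 0" "B \<noteq> 0" "D \<noteq> 0" for A B D w e g :: real
        using that by simp
      from this[of "kap + ?n" "?n + 1" "?d S"] show ?thesis using k dS by (simp add: add.commute)
    qed
    ultimately show "(kap + ?n) * (?n + 1) * ?d S * (?w b / (kap + ?n) * ?d (insert b S) / (real (card S + 1) * ?d S) * DS G (insert b S))
      = (\<Sum>c\<in>Rem (insert b S). ?w b * H (insert b S - {c}))" by simp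
  qed
  have 2: "(kap + ?n - 1) * ?n * ?d S * DS (US kap s G) S = (\<Sum>c\<in>Rem S. \<Sum>b\<in>Add (S - {c}). ?w b * H (insert b (S - {c})))"
    unfolding DS_def sum_distrib_left
  proof (rule sum.cong[OF refl])
    fix c assume c: "c \<in> Rem S"
    have dc: "?d (S - {c}) > 0" using sdim_pos[OF Rem_diagram[OF d c]] by simp
    have cS: "c \<in> S" "finite S" using c Rem_subset d diagram_finite by auto
    have n1: "card S \<ge> 1" using cS by (metis One_nat_def Suc_leI card_gt_0_iff empty_iff)
    have cc: "real (card (S - {c})) = ?n - 1" using cS n1 by (simp add: of_nat_diff)
    have k1: "kap + (?n - 1) > 0" using kap n1 by (simp add: add_pos_nonneg)
    have "?d (S - {c}) * ((kap + ?n - 1) * ?n) * US kap s G (S - {c}) = (\<Sum>b\<in>Add (S - {c}). ?w b * H (insert b (S - {c})))"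
      unfolding US_def sum_distrib_left
    proof (rule sum.cong[OF refl])
      fix b
      have c2: "real (card (S - {c}) + 1) = ?n" using cc by simp
      have "?d (S - {c}) * ((kap + ?n - 1) * ?n) * (?w b / (kap + (?n - 1)) * ?d (insert b (S - {c})) / (?n * ?d (S - {c})) * G (insert b (S - {c}))) = ?w b * H (insert b (S - {c}))"
      proof -
        have "D * (A * B) * (w / A * e / (B * D) * g) = w * (e * g)" if "A \<noteq> 0" "B \<noteq> 0" "D \<noteq> 0" for A B D w e g :: real
          using that by simp
        moreover have "kap + ?n - 1 \<noteq> 0" using k1 by linarith
        ultimately show ?thesis using dc n1 by (simp add: H_def add_diff_eq)
      qed
      then show "?d (S - {c}) * ((kap + ?n - 1) * ?n) * (?w b / (kap + real (card (S - {c}))) * ?d (insert b (S - {c})) / (real (card (S - {c}) + 1) * ?d (S - {c})) * G (insert b (S - {c}))) = ?w b * H (insert b (S - {c}))"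
        unfolding cc c2 .
    qed
    then show "(kap + ?n - 1) * ?n * ?d S * (?d (S - {c}) / ?d S * US kap s G (S - {c})) = (\<Sum>b\<in>Add (S - {c}). ?w b * H (insert b (S - {c})))"
    proof -
      assume *: "?d (S - {c}) * ((kap + ?n - 1) * ?n) * US kap s G (S - {c}) = (\<Sum>b\<in>Add (S - {c}). ?w b * H (insert b (S - {c})))"
      have gen: "A * B * d * (e / d * u) = e * (A * B) * u" if "d \<noteq> 0" for A B d e u :: real using that by simp
      have d0: "?d S \<noteq> 0" using dS by simp
      show ?thesis unfolding gen[OF d0] * ..
    qed
  qed
  have "?d S * ((kap + ?n) * (?n + 1) * US kap s (DS G) S) = ?d S * ((kap + ?n - 1) * ?n * DS (US kap s G) S + (kap + 2 * ?n) * G S)"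
    using add_rem_swap[OF d, of ?w H] 1 2 wt_diff[OF d] by (simp add: H_def algebra_simps)
  then show ?thesis using dS by simp
qed

text \<open>Commutation is applied to \<open>DS G\<close>. The identity (kap + n) (n + 1) = (kap + n
  - 1) n + (kap + 2 n) then absorbs the diagonal term into the subtracted identity operator.\<close>

lemma GS_DS:
  assumes d: "diagram S" and ne: "S \<noteq> {}"
  shows "GS kap s (DS G) S = DS (GS kap s G) S"
proof -
  let ?n = "real (card S)"
  have n1: "card S \<ge> 1" using ne diagram_finite[OF d] by (simp add: Suc_leI card_gt_0_iff)
  have alg: "q * ((kap + (n - 1)) * ((n - 1) + 1) * (t - g)) = (kap + n - 1) * n * (q * t - q * g)" for q n t g :: real
    by (simp add: algebra_simps)
  have "DS (GS kap s G) S = (kap + ?n - 1) * ?n * (DS (TS kap s G) S - DS G S)"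
    unfolding DS_def sum_distrib_left sum_subtractf[symmetric]
  proof (rule sum.cong[OF refl])
    fix c assume c: "c \<in> Rem S"
    have cS: "c \<in> S" "finite S" using c Rem_subset d diagram_finite by auto
    have cc: "real (card (S - {c})) = ?n - 1" using cS n1 by (simp add: of_nat_diff)
    show "real (sdim (S - {c})) / real (sdim S) * GS kap s G (S - {c}) = (kap + ?n - 1) * ?n *
       (real (sdim (S - {c})) / real (sdim S) * TS kap s G (S - {c}) - real (sdim (S - {c})) / real (sdim S) * G (S - {c}))"
      unfolding GS_def cc alg ..
  qed
  moreover have "GS kap s (DS G) S = (kap + ?n - 1) * ?n * DS (TS kap s G) S + (kap + 2 * ?n) * DS G S - (kap + ?n) * (?n + 1) * DS G S"
    unfolding GS_def using commutation[OF d, of "DS G"] by (simp add: TS_def algebra_simps)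
  ultimately show ?thesis by (simp add: algebra_simps)
qed

lemma DS_cong: assumes "diagram S" "\<And>R. diagram R \<Longrightarrow> Suc (card R) = card S \<Longrightarrow> G R = H R"
  shows "DS G S = DS H S"
  unfolding DS_def
proof (rule sum.cong[OF refl])
  fix c assume c: "c \<in> Rem S"
  have cS: "c \<in> S" "finite S" using c Rem_subset assms(1) diagram_finite by auto
  then have "Suc (card (S - {c})) = card S" using card.remove[OF cS(2,1)] by simp
  then show "real (sdim (S - {c})) / real (sdim S) * G (S - {c}) = real (sdim (S - {c})) / real (sdim S) * H (S - {c})"
    using assms(2) Rem_diagram[OF assms(1) c] by simp
qed

lemma GS_DS_iter:
  "diagram S \<Longrightarrow> k \<le> card S \<Longrightarrow> GS kap s ((DS ^^ k) G) S = (DS ^^ k) (GS kap s G) S"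
proof (induction k arbitrary: S)
  case (Suc k)
  then have ne: "S \<noteq> {}" by auto
  have "GS kap s ((DS ^^ Suc k) G) S = DS (GS kap s ((DS ^^ k) G)) S"
    using GS_DS[OF Suc.prems(1) ne] by simp
  also have "\<dots> = DS ((DS ^^ k) (GS kap s G)) S"
    by (rule DS_cong[OF Suc.prems(1)]) (use Suc in auto)
  finally show ?case by simp
qed simp

lemma DS_one: assumes "diagram S" "S \<noteq> {}" shows "DS (\<lambda>_. c) S = c"
proof -
  have "DS (\<lambda>_. c) S = (\<Sum>b\<in>Rem S. real (sdim (S - {b}))) / real (sdim S) * c"
    unfolding DS_def by (simp add: sum_divide_distrib sum_distrib_right)
  also have "(\<Sum>b\<in>Rem S. real (sdim (S - {b}))) = real (sdim S)"
    using sdim_rec[OF assms] by simp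
  finally show ?thesis using sdim_pos[OF assms(1)] by simp
qed

lemma US_cong: assumes "diagram S" "\<And>R. diagram R \<Longrightarrow> card R = Suc (card S) \<Longrightarrow> G R = H R"
  shows "US kap s G S = US kap s H S"
  unfolding US_def
proof (rule sum.cong[OF refl])
  fix b assume "b \<in> Add S"
  then have "diagram (insert b S)" "card (insert b S) = Suc (card S)" using Add_iff[OF assms(1)] diagram_finite[OF assms(1)] by auto
  then show "wt kap s (boxcont b) / (kap + real (card S)) * real (sdim (insert b S)) / (real (card S + 1) * real (sdim S)) * G (insert b S)
    = wt kap s (boxcont b) / (kap + real (card S)) * real (sdim (insert b S)) / (real (card S + 1) * real (sdim S)) * H (insert b S)"
    using assms(2) by simp
qed

text \<open>Induction on the level: constants are fixed by \<open>DS\<close>, so commutation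
  determines \<open>US\<close> on constants at level n from level n - 1, and the scalars match. Thus
  the up probabilities sum to 1.\<close>

lemma US_one: "diagram S \<Longrightarrow> US kap s (\<lambda>_. c) S = c"
proof (induction "card S" arbitrary: S rule: less_induct)
  case less
  let ?n = "real (card S)"
  have k: "kap + ?n > 0" using kap by (simp add: add_pos_nonneg)
  have "US kap s (\<lambda>_. c) S = US kap s (DS (\<lambda>_. c)) S"
    by (rule US_cong[OF less.prems]) (metis DS_one card.empty nat.distinct(1))
  then have *: "(kap + ?n) * (?n + 1) * US kap s (\<lambda>_. c) S = (kap + ?n - 1) * ?n * DS (US kap s (\<lambda>_. c)) S + (kap + 2 * ?n) * c"
    using commutation[OF less.prems, of "\<lambda>_. c"] by simp
  have "(kap + ?n - 1) * ?n * DS (US kap s (\<lambda>_. c)) S = (kap + ?n - 1) * ?n * c"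
  proof (cases "S = {}")
    case False
    have "DS (US kap s (\<lambda>_. c)) S = DS (\<lambda>_. c) S"
      by (rule DS_cong[OF less.prems]) (use less in auto)
    then show ?thesis using DS_one[OF less.prems False] by simp
  qed simp
  with * have "(kap + ?n) * (?n + 1) * US kap s (\<lambda>_. c) S = (kap + ?n) * (?n + 1) * c" by (simp add: algebra_simps)
  moreover have "(kap + ?n) * (?n + 1) \<noteq> 0" using k by simp
  ultimately show ?case by simp
qed

lemma DS_mono: assumes "diagram S" "\<And>R. diagram R \<Longrightarrow> Suc (card R) = card S \<Longrightarrow> G R \<le> H R"
  shows "DS G S \<le> DS H S"
  unfolding DS_def
proof (rule sum_mono)
  fix c assume c: "c \<in> Rem S"
  have cS: "c \<in> S" "finite S" using c Rem_subset assms(1) diagram_finite by auto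
  then have "Suc (card (S - {c})) = card S" using card.remove[OF cS(2,1)] by simp
  then show "real (sdim (S - {c})) / real (sdim S) * G (S - {c}) \<le> real (sdim (S - {c})) / real (sdim S) * H (S - {c})"
    using assms(2) Rem_diagram[OF assms(1) c] by (intro mult_left_mono) auto
qed

lemma US_mono: assumes "diagram S" "\<And>R. diagram R \<Longrightarrow> card R = Suc (card S) \<Longrightarrow> G R \<le> H R"
  shows "US kap s G S \<le> US kap s H S"
  unfolding US_def
proof (rule sum_mono)
  fix b assume "b \<in> Add S"
  then have *: "diagram (insert b S)" "card (insert b S) = Suc (card S)" using Add_iff[OF assms(1)] diagram_finite[OF assms(1)] by auto
  have k: "kap + real (card S) > 0" using kap by (simp add: add_pos_nonneg)
  show "wt kap s (boxcont b) / (kap + real (card S)) * real (sdim (insert b S)) / (real (card S + 1) * real (sdim S)) * G (insert b S)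
    \<le> wt kap s (boxcont b) / (kap + real (card S)) * real (sdim (insert b S)) / (real (card S + 1) * real (sdim S)) * H (insert b S)"
    using assms(2)[OF *] k wt_pos[of "boxcont b"] by (intro mult_left_mono) auto
qed

lemma TS_mono: assumes "diagram S" "\<And>R. diagram R \<Longrightarrow> card R = card S \<Longrightarrow> G R \<le> H R"
  shows "TS kap s G S \<le> TS kap s H S"
  unfolding TS_def by (intro US_mono DS_mono assms) auto

lemma TS_const: assumes "diagram S" shows "TS kap s (\<lambda>_. c) S = c"
proof -
  have "TS kap s (\<lambda>_. c) S = US kap s (\<lambda>_. c) S"
    unfolding TS_def by (rule US_cong[OF assms]) (metis DS_one card.empty nat.distinct(1))
  then show ?thesis using US_one[OF assms] by simp
qed

lemma DS_lin: "DS (\<lambda>S. a * G S + b * H S) S = a * DS G S + b * DS H S"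
  unfolding DS_def sum_distrib_left sum.distrib[symmetric] by (rule sum.cong) (auto simp: algebra_simps)

lemma US_lin: "US kap s (\<lambda>S. a * G S + b * H S) S = a * US kap s G S + b * US kap s H S"
proof -
  have "x * (a * g + b * h) = a * (x * g) + b * (x * h)" for x g h :: real by (simp add: algebra_simps)
  then show ?thesis unfolding US_def sum_distrib_left sum.distrib[symmetric] by (intro sum.cong) auto
qed

lemma TS_lin: "TS kap s (\<lambda>S. a * G S + b * H S) S = a * TS kap s G S + b * TS kap s H S"
  unfolding TS_def DS_lin US_lin ..

end

section \<open>Co-transition probabilities\<close>


text \<open>The geometric series 1 / (1 - c X), inverse to the linear factor \<open>flin c\<close>.
  Products of such factors carry power sums in their logarithmic derivatives.\<close>

definition fgeom :: "real \<Rightarrow> real fps" where "fgeom c = Abs_fps (\<lambda>k. c ^ k)"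

definition flin :: "real \<Rightarrow> real fps" where "flin c = 1 - fps_const c * fps_X"

lemma flin_fgeom: "flin c * fgeom c = 1"
proof (rule fps_ext)
  fix n
  have "flin c * fgeom c = fgeom c - fps_const c * (fps_X * fgeom c)" by (simp add: flin_def algebra_simps)
  then show "(flin c * fgeom c) $ n = 1 $ n" by (cases n) (simp_all add: fgeom_def)
qed

lemma flin_nz: "flin c \<noteq> 0" using flin_fgeom[of c] by auto

lemma flin_deriv: "fps_X * fps_deriv (flin c) = flin c * (1 - fgeom c)"
proof -
  have "flin c * (1 - fgeom c) = flin c - 1" using flin_fgeom[of c] by (simp add: right_diff_distrib)
  then show ?thesis by (simp add: flin_def algebra_simps)
qed

text \<open>Additivity of logarithmic derivatives, written without division.\<close>

lemma prod_log_deriv: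
  fixes f g :: "'i \<Rightarrow> real fps"
  assumes "finite I" "\<And>i. i \<in> I \<Longrightarrow> fps_X * fps_deriv (f i) = f i * g i"
  shows "fps_X * fps_deriv (prod f I) = prod f I * sum g I"
  using assms
proof (induction I rule: finite_induct)
  case (insert x F)
  have "fps_X * fps_deriv (f x * prod f F) = (fps_X * fps_deriv (f x)) * prod f F + f x * (fps_X * fps_deriv (prod f F))"
    by (simp add: algebra_simps)
  then show ?case using insert by (simp add: algebra_simps)
qed simp

text \<open>Up to sign the residue at u = y i of the product over r of (u - 1 - y r) / (u - y r).
  Equivalently, the factor by which the Vandermonde product of the y r changes when y i drops by
  1.\<close>

definition omg :: "'i set \<Rightarrow> ('i \<Rightarrow> real) \<Rightarrow> 'i \<Rightarrow> real" where
  "omg I y i = (\<Prod>r\<in>I - {i}. (y i - 1 - y r) / (y i - y r))"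

section \<open>Partial fractions and Newton identities\<close>

lemma degree_prod_linear: "finite I \<Longrightarrow> degree (\<Prod>r\<in>I. [:- (y r :: real), 1:]) = card I \<and> lead_coeff (\<Prod>r\<in>I. [:- (y r), 1:]) = 1"
proof (induction I rule: finite_induct)
  case (insert x F)
  have "(\<Prod>r\<in>F. [:- (y r), 1:]) \<noteq> 0" using insert by (auto simp: prod_zero_iff)
  then have "degree ([:- y x, 1:] * (\<Prod>r\<in>F. [:- (y r), 1:])) = Suc (card F)"
    using insert by (subst degree_mult_eq) auto
  moreover have "lead_coeff ([:- y x, 1:] * (\<Prod>r\<in>F. [:- (y r), 1:])) = 1"
  proof -
    have "lead_coeff (\<Prod>r\<in>F. [:- (y r), 1:]) = 1" using insert by blast
    then show ?thesis unfolding lead_coeff_mult by (metis lead_coeff_pCons(1) mult_1 one_neq_zero one_pCons lead_coeff_1)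
  qed
  ultimately show ?case using insert by (simp del: mult_pCons_left)
qed simp

text \<open>Partial fraction expansion of the quotient of the shifted by the unshifted product,
  cleared of denominators. Both sides have degree at most N, the same coefficient at N, and the same
  values at the N distinct points y i.\<close>

lemma shift_interpolation:
  fixes y :: "'i \<Rightarrow> real"
  assumes fin: "finite I" and inj: "inj_on y I"
  shows "(\<Prod>r\<in>I. [:- (y r), 1:]) = (\<Prod>r\<in>I. [:- (y r + 1), 1:]) + (\<Sum>i\<in>I. smult (omg I y i) (\<Prod>r\<in>I - {i}. [:- (y r), 1:]))"
  (is "?P = ?P1 + ?L")
proof (cases "I = {}")
  case False
  let ?N = "card I"
  have N: "?N > 0" using False fin by (simp add: card_gt_0_iff)
  have degP: "degree ?P = ?N" "poly.coeff ?P ?N = 1" using degree_prod_linear[OF fin, of y] by auto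
  have degP1: "degree ?P1 = ?N" "poly.coeff ?P1 ?N = 1" using degree_prod_linear[OF fin, of "\<lambda>r. y r + 1"] by auto
  have dL: "degree ?L < ?N"
  proof (rule degree_sum_less[OF _ N])
    fix i assume i: "i \<in> I"
    have "degree (\<Prod>r\<in>I - {i}. [:- (y r), 1:]) = ?N - 1"
      using degree_prod_linear[of "I - {i}" y] fin i by simp
    then show "degree (smult (omg I y i) (\<Prod>r\<in>I - {i}. [:- (y r), 1:])) < ?N"
      using N degree_smult_le[of "omg I y i" "\<Prod>r\<in>I - {i}. [:- (y r), 1:]"] by linarith
  qed
  show ?thesis
  proof (rule poly_eqI_degree_lead_coeff[where A = "y ` I" and n = ?N])
    show "degree ?P \<le> ?N" using degP by simp
    show "degree (?P1 + ?L) \<le> ?N" by (rule degree_add_le) (use degP1 dL in auto)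
    show "poly.coeff ?P ?N = poly.coeff (?P1 + ?L) ?N" using degP degP1 dL by (simp add: coeff_eq_0 del: coeff_sum)
    show "card (y ` I) \<ge> ?N" using inj by (simp add: card_image)
    fix z assume "z \<in> y ` I"
    then obtain k where k: "k \<in> I" "z = y k" by auto
    have p0: "poly ?P z = 0" using k fin by (auto simp: poly_prod prod_zero_iff)
    have p1: "poly ?P1 z = - (\<Prod>r\<in>I - {k}. y k - 1 - y r)"
      unfolding poly_prod using k by (simp add: prod.remove[OF fin k(1)] algebra_simps)
    have "poly ?L z = (\<Sum>i\<in>I. omg I y i * (\<Prod>r\<in>I - {i}. z - y r))"
      by (simp add: poly_sum poly_prod algebra_simps)
    also have "\<dots> = omg I y k * (\<Prod>r\<in>I - {k}. z - y r) + (\<Sum>i\<in>I - {k}. omg I y i * (\<Prod>r\<in>I - {i}. z - y r))"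
      by (rule sum.remove[OF fin k(1)])
    also have "(\<Sum>i\<in>I - {k}. omg I y i * (\<Prod>r\<in>I - {i}. z - y r)) = 0"
    proof (rule sum.neutral, rule ballI)
      fix i assume "i \<in> I - {k}"
      then have "k \<in> I - {i}" using k by auto
      then have "(\<Prod>r\<in>I - {i}. z - y r) = 0" using k fin by (auto simp: prod_zero_iff)
      then show "omg I y i * (\<Prod>r\<in>I - {i}. z - y r) = 0" by simp
    qed
    also have "omg I y k * (\<Prod>r\<in>I - {k}. z - y r) = (\<Prod>r\<in>I - {k}. y k - 1 - y r)"
      unfolding omg_def prod.distrib[symmetric]
    proof (rule prod.cong[OF refl])
      fix r assume "r \<in> I - {k}"
      then have "y k - y r \<noteq> 0" using inj k by (auto simp: inj_on_def)
      then show "(y k - 1 - y r) / (y k - y r) * (z - y r) = y k - 1 - y r" using k by simp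
    qed
    finally show "poly ?P z = poly (?P1 + ?L) z" using p0 p1 by simp
  qed
qed simp

lemma fps_of_poly_lin: "fps_of_poly [:1, - c:] = flin c"
  by (simp add: flin_def fps_of_poly_pCons fps_of_poly_const algebra_simps)

text \<open>The polynomial identity at u = 1/w, multiplied by w^N: the reversed polynomials agree at
  every nonzero w and at 0, hence as polynomials, and may be read as power series.\<close>

lemma shift_interpolation_fps:
  fixes y :: "'i \<Rightarrow> real"
  assumes fin: "finite I" and inj: "inj_on y I"
  shows "(\<Prod>r\<in>I. flin (y r + 1)) = (\<Prod>r\<in>I. flin (y r)) * (1 - fps_X * (\<Sum>i\<in>I. fps_const (omg I y i) * fgeom (y i)))"
proof -
  let ?A = "\<Prod>r\<in>I. [:1, - y r:]" and ?C = "\<Prod>r\<in>I. [:1, - (y r + 1):]"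
  let ?L = "\<Sum>i\<in>I. smult (omg I y i) (\<Prod>r\<in>I - {i}. [:1, - y r:])"
  have key: "poly ?A w = poly (?C + pCons 0 ?L) w" for w
  proof (cases "w = 0")
    case True then show ?thesis by (simp add: poly_prod)
  next
    case False
    have sc: "(\<Prod>r\<in>J. inverse w - c r) * w ^ card J = (\<Prod>r\<in>J. 1 - w * c r)" for J :: "'i set" and c
    proof -
      have "(\<Prod>r\<in>J. inverse w - c r) * w ^ card J = (\<Prod>r\<in>J. (inverse w - c r) * w)"
        by (simp add: prod.distrib)
      also have "\<dots> = (\<Prod>r\<in>J. 1 - w * c r)" using False by (intro prod.cong) (auto simp: algebra_simps)
      finally show ?thesis .
    qed
    have "(\<Prod>r\<in>I. inverse w - y r) = (\<Prod>r\<in>I. inverse w - (y r + 1)) + (\<Sum>i\<in>I. omg I y i * (\<Prod>r\<in>I - {i}. inverse w - y r))"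
      using arg_cong[OF shift_interpolation[OF assms], of "\<lambda>p. poly p (inverse w)"]
      by (simp add: poly_prod poly_sum algebra_simps)
    then have "(\<Prod>r\<in>I. inverse w - y r) * w ^ card I = (\<Prod>r\<in>I. inverse w - (y r + 1)) * w ^ card I
       + (\<Sum>i\<in>I. omg I y i * (\<Prod>r\<in>I - {i}. inverse w - y r)) * w ^ card I" by (simp add: distrib_right)
    also have "(\<Sum>i\<in>I. omg I y i * (\<Prod>r\<in>I - {i}. inverse w - y r)) * w ^ card I
       = (\<Sum>i\<in>I. omg I y i * ((\<Prod>r\<in>I - {i}. inverse w - y r) * w ^ card (I - {i})) * w)"
      unfolding sum_distrib_right
    proof (rule sum.cong[OF refl])
      fix i assume "i \<in> I"
      then have "w ^ card I = w ^ card (I - {i}) * w" using fin by (metis card.remove power_Suc2)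
      then show "omg I y i * (\<Prod>r\<in>I - {i}. inverse w - y r) * w ^ card I = omg I y i * ((\<Prod>r\<in>I - {i}. inverse w - y r) * w ^ card (I - {i})) * w"
        by simp
    qed
    finally show ?thesis unfolding sc
      by (simp add: poly_prod poly_sum sum_distrib_left algebra_simps)
  qed
  then have "?A = ?C + pCons 0 ?L" by (simp add: poly_eq_poly_eq_iff[symmetric] fun_eq_iff)
  then have "fps_of_poly ?A = fps_of_poly ?C + fps_X * fps_of_poly ?L"
    by (simp add: fps_of_poly_add fps_of_poly_pCons mult.commute)
  moreover have "fps_of_poly ?L = (\<Prod>r\<in>I. flin (y r)) * (\<Sum>i\<in>I. fps_const (omg I y i) * fgeom (y i))"
    unfolding fps_of_poly_sum sum_distrib_left
  proof (rule sum.cong[OF refl])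
    fix i assume i: "i \<in> I"
    have "(\<Prod>r\<in>I. flin (y r)) * fgeom (y i) = (\<Prod>r\<in>I - {i}. flin (y r)) * (flin (y i) * fgeom (y i))"
      by (simp add: prod.remove[OF fin i] mult_ac)
    then have "(\<Prod>r\<in>I. flin (y r)) * fgeom (y i) = (\<Prod>r\<in>I - {i}. flin (y r))" by (simp add: flin_fgeom)
    moreover have "fps_of_poly (smult (omg I y i) (\<Prod>r\<in>I - {i}. [:1, - y r:])) = fps_const (omg I y i) * (\<Prod>r\<in>I - {i}. flin (y r))"
      by (simp only: fps_of_poly_smult fps_of_poly_prod fps_of_poly_lin)
    ultimately show "fps_of_poly (smult (omg I y i) (\<Prod>r\<in>I - {i}. [:1, - y r:])) = (\<Prod>r\<in>I. flin (y r)) * (fps_const (omg I y i) * fgeom (y i))"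
      by (simp add: mult_ac)
  qed
  ultimately show ?thesis
    by (simp only: fps_of_poly_prod fps_of_poly_lin) (simp add: algebra_simps)
qed

text \<open>When y i is the length of row i minus i and there are N rows, y i + N is the shifted row
  length in the product formula of Frobenius for the dimension, and \<open>ctw\<close> is
  \<open>card S\<close> times the co-transition probability of row i.\<close>

definition ctw :: "'i set \<Rightarrow> ('i \<Rightarrow> real) \<Rightarrow> 'i \<Rightarrow> real" where
  "ctw I y i = (y i + real (card I)) * omg I y i"

text \<open>For the row coordinates of a diagram this is the sum of c^k over the contents of addable
  boxes minus the same sum over removable boxes: the k-th power sum of Kerov's interlacing
  coordinates.\<close>

definition Qsum :: "'i set \<Rightarrow> ('i \<Rightarrow> real) \<Rightarrow> nat \<Rightarrow> real" where
  "Qsum I y k = (- real (card I)) ^ k + (\<Sum>r\<in>I. (y r + 1) ^ k - y r ^ k)"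

text \<open>The series \<open>th\<close>, namely 1 + N X times the product of (1 - (y r + 1) X) / (1
  - y r X), is known in two ways: its logarithmic derivative has the coefficients
  \<open>- Qsum\<close>, and by partial fractions its own coefficients from X^2 on are minus the
  moments of \<open>ctw\<close>. Newton's recursion relates the two.\<close>

lemma ctw_newton:
  fixes y :: "'i \<Rightarrow> real"
  assumes fin: "finite I" and inj: "inj_on y I"
  shows "real (j + 2) * (\<Sum>i\<in>I. ctw I y i * y i ^ j)
    = Qsum I y (j + 2) - (\<Sum>i=1..j. Qsum I y i * (\<Sum>r\<in>I. ctw I y r * y r ^ (j - i)))"
proof -
  let ?N = "real (card I)"
  define del where "del j = (\<Sum>i\<in>I. omg I y i * y i ^ j)" for j
  define M where "M = (\<Sum>i\<in>I. fps_const (omg I y i) * fgeom (y i))"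
  have Mn: "M $ j = del j" for j by (simp add: M_def fps_sum_nth fgeom_def del_def)
  define th1 where "th1 = 1 - fps_X * M"
  define fA where "fA = (\<Prod>r\<in>I. flin (y r))"
  define fC where "fC = (\<Prod>r\<in>I. flin (y r + 1))"
  define gA where "gA = (\<Sum>r\<in>I. 1 - fgeom (y r))"
  define gC where "gC = (\<Sum>r\<in>I. 1 - fgeom (y r + 1))"
  have fC: "fC = fA * th1" using shift_interpolation_fps[OF assms] by (simp add: fA_def fC_def th1_def M_def)
  have lA: "fps_X * fps_deriv fA = fA * gA" unfolding fA_def gA_def by (rule prod_log_deriv[OF fin]) (rule flin_deriv)
  have lC: "fps_X * fps_deriv fC = fC * gC" unfolding fC_def gC_def by (rule prod_log_deriv[OF fin]) (rule flin_deriv)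
  have fA0: "fA \<noteq> 0" using fin flin_nz by (simp add: fA_def prod_zero_iff)
  have "fA * (fps_X * fps_deriv th1) = fA * (th1 * (gC - gA))"
  proof -
    have "fps_X * fps_deriv fC = (fps_X * fps_deriv fA) * th1 + fA * (fps_X * fps_deriv th1)"
      unfolding fC by (simp add: algebra_simps)
    then have "fA * th1 * gC = fA * gA * th1 + fA * (fps_X * fps_deriv th1)" unfolding lC lA fC[symmetric] .
    then show ?thesis by (simp add: algebra_simps)
  qed
  then have l1: "fps_X * fps_deriv th1 = th1 * (gC - gA)" using fA0 by simp
  \<comment> \<open>The factor 1 + N X turns the moments of \<open>omg\<close> into those of (y i +
    N) \<open>omg\<close>, that is of \<open>ctw\<close>.\<close>
  define th where "th = flin (- ?N) * th1"
  define g where "g = gC - gA + (1 - fgeom (- ?N))"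
  have lt: "fps_X * fps_deriv th = th * g"
  proof -
    have "fps_X * fps_deriv th = (fps_X * fps_deriv (flin (- ?N))) * th1 + flin (- ?N) * (fps_X * fps_deriv th1)"
      unfolding th_def by (simp add: algebra_simps)
    then show ?thesis unfolding l1 flin_deriv th_def g_def by (simp add: algebra_simps)
  qed
  have gn: "g $ k = (if k = 0 then 0 else - Qsum I y k)" for k
    by (simp add: g_def gC_def gA_def fps_sum_nth fgeom_def Qsum_def sum_subtractf sum_negf)
  have newton: "real k * th $ k = - (\<Sum>i=1..k. Qsum I y i * th $ (k - i))" if "k > 0" for k
  proof -
    have "real k * th $ k = (fps_X * fps_deriv th) $ k" using that by simp
    also have "\<dots> = (\<Sum>i=0..k. g $ i * th $ (k - i))" unfolding lt mult.commute[of th] fps_mult_nth ..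
    also have "\<dots> = (\<Sum>i=1..k. g $ i * th $ (k - i))"
      by (simp add: sum.atLeast_Suc_atMost gn)
    also have "\<dots> = - (\<Sum>i=1..k. Qsum I y i * th $ (k - i))"
      unfolding sum_negf[symmetric] by (rule sum.cong) (auto simp: gn)
    finally show ?thesis .
  qed
  have th_exp: "th = th1 + fps_const ?N * (fps_X * th1)" unfolding th_def flin_def
    by (simp add: algebra_simps fps_const_neg[symmetric] del: fps_const_neg)
  have t1: "th1 $ 0 = 1" "th1 $ Suc j = - del j" for j by (simp_all add: th1_def Mn)
  have th0: "th $ 0 = 1" by (simp add: th_exp t1)
  \<comment> \<open>\<open>Qsum\<close> at 1 is -N + N = 0, so the coefficient of X vanishes; this
    is why the sum in the recursion stops at i = j.\<close>
  have th1': "th $ Suc 0 = 0" using newton[of 1] th0 by (simp add: Qsum_def)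
  have thn: "th $ Suc (Suc j) = - (\<Sum>i\<in>I. ctw I y i * y i ^ j)" for j
  proof -
    have "(\<Sum>i\<in>I. ctw I y i * y i ^ j) = del (Suc j) + ?N * del j"
      by (simp add: del_def ctw_def sum.distrib[symmetric] sum_distrib_left algebra_simps)
    then show ?thesis by (simp add: th_exp t1)
  qed
  have "{1..j + 2} = insert (j + 2) (insert (j + 1) {1..j})" by auto
  then have "real (j + 2) * th $ (j + 2) = - (Qsum I y (j + 2) * th $ 0 + (Qsum I y (j + 1) * th $ Suc 0 + (\<Sum>i=1..j. Qsum I y i * th $ (j + 2 - i))))"
    using newton[of "j + 2"] by simp
  moreover have "(\<Sum>i=1..j. Qsum I y i * th $ (j + 2 - i)) = - (\<Sum>i=1..j. Qsum I y i * (\<Sum>r\<in>I. ctw I y r * y r ^ (j - i)))"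
    unfolding sum_negf[symmetric]
  proof (rule sum.cong[OF refl])
    fix i assume "i \<in> {1..j}"
    then have "j + 2 - i = Suc (Suc (j - i))" by auto
    then show "Qsum I y i * th $ (j + 2 - i) = - (Qsum I y i * (\<Sum>r\<in>I. ctw I y r * y r ^ (j - i)))" by (simp add: thn)
  qed
  ultimately show ?thesis by (simp add: th0 th1' thn)
qed

text \<open>The mutual factors of i and k cancel between the two steps and the rest is symmetric in
  i and k: lowering y i first and then y k weighs as much as the other order.\<close>

lemma ctw_cocycle:
  fixes y :: "'i \<Rightarrow> real"
  assumes fin: "finite I" and i: "i \<in> I" and k: "k \<in> I" and ik: "i \<noteq> k" and ne: "y i \<noteq> y k" "y i - 1 \<noteq> y k"
  shows "ctw I y i * ctw I (y(i := y i - 1)) k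
    = (y i + card I) * (y k + card I) * (\<Prod>r\<in>I - {i, k}. (y i - 1 - y r) / (y i - y r)) * (\<Prod>r\<in>I - {i, k}. (y k - 1 - y r) / (y k - y r))"
proof -
  have 1: "omg I y i = (y i - 1 - y k) / (y i - y k) * (\<Prod>r\<in>I - {i, k}. (y i - 1 - y r) / (y i - y r))"
    unfolding omg_def using prod.remove[of "I - {i}" k "\<lambda>r. (y i - 1 - y r) / (y i - y r)"] fin k ik
    by (simp add: insert_commute Diff_insert2[symmetric] set_diff_eq)
  have 2: "omg I (y(i := y i - 1)) k = (y k - y i) / (y k - y i + 1) * (\<Prod>r\<in>I - {i, k}. (y k - 1 - y r) / (y k - y r))"
  proof -
    have s: "I - {k} = insert i (I - {i, k})" using i ik by auto
    have "(\<Prod>r\<in>I - {i, k}. (y k - 1 - (y(i := y i - 1)) r) / (y k - (y(i := y i - 1)) r)) = (\<Prod>r\<in>I - {i, k}. (y k - 1 - y r) / (y k - y r))"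
      by (rule prod.cong) auto
    then show ?thesis unfolding omg_def s using fin ik by (simp add: algebra_simps)
  qed
  have c: "(y i - 1 - y k) / (y i - y k) * ((y k - y i) / (y k - y i + 1)) = 1"
  proof -
    define u where "u = y i - y k"
    have u: "u \<noteq> 0" "u - 1 \<noteq> 0" using ne by (auto simp: u_def)
    have e: "y i - 1 - y k = u - 1" "y k - y i = - u" "y k - y i + 1 = - (u - 1)" by (auto simp: u_def)
    have "(- u) / (- (u - 1)) = u / (u - 1)" by (metis minus_divide_left minus_divide_right minus_minus)
    then show ?thesis unfolding e u_def[symmetric] using u by simp
  qed
  have "ctw I y i * ctw I (y(i := y i - 1)) k = (y i + card I) * (y k + card I) * (\<Prod>r\<in>I - {i, k}. (y i - 1 - y r) / (y i - y r)) * (\<Prod>r\<in>I - {i, k}. (y k - 1 - y r) / (y k - y r))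
     * ((y i - 1 - y k) / (y i - y k) * ((y k - y i) / (y k - y i + 1)))"
    unfolding ctw_def 1 2 using ik by (simp add: mult_ac)
  then show ?thesis unfolding c by simp
qed

section \<open>Row coordinates of a diagram and co-transition weights\<close>

definition yc :: "(nat \<times> nat) set \<Rightarrow> nat \<Rightarrow> real" where
  "yc S i = real (rowlen S i) - real i"

lemma yc_strict: assumes "diagram S" "1 \<le> i" "i < k" shows "yc S k \<le> yc S i - 1"
  using row_anti'[OF assms(1,2), of k] assms(3) by (auto simp: yc_def)

lemma yc_inj: assumes "diagram S" shows "inj_on (yc S) {1..N}"
proof (rule linorder_inj_onI')
  fix i j assume "i \<in> {1..N}" "j \<in> {1..N}" "i < j"
  then show "yc S i \<noteq> yc S j" using yc_strict[OF assms, of i j] by auto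
qed

lemma rowlen_remove:
  assumes d: "diagram S" and i: "1 \<le> i" "rowlen S i > 0"
  shows "rowlen (S - {(i, rowlen S i)}) k = (if k = i then rowlen S i - 1 else rowlen S k)"
proof (cases "k = i")
  case True
  have "{j. (i, j) \<in> S - {(i, rowlen S i)}} = {1..rowlen S i - 1}"
    using i by (auto simp: diagram_row[OF d])
  then show ?thesis using True by (simp add: rowlen_def)
next
  case False then show ?thesis by (simp add: rowlen_def)
qed

lemma yc_remove:
  assumes d: "diagram S" and i: "1 \<le> i" "rowlen S i > 0"
  shows "yc (S - {(i, rowlen S i)}) = (yc S)(i := yc S i - 1)"
  using rowlen_remove[OF assms] i by (auto simp: fun_eq_iff yc_def of_nat_diff)

definition rrows :: "(nat \<times> nat) set \<Rightarrow> nat set" where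
  "rrows S = {i. 1 \<le> i \<and> rowlen S (Suc i) < rowlen S i}"

lemma rrows_le: "height_le S N \<Longrightarrow> i \<in> rrows S \<Longrightarrow> i \<in> {1..N}"
  unfolding rrows_def height_le_def by (auto, metis less_nat_zero_code not_le)

text \<open>A row without a removable box is either the empty row N, where y i + N = 0, or as long
  as the next row, which makes a factor of \<open>omg\<close> zero. Sums over corners may therefore
  run over all rows.\<close>

lemma ctw_nonrem:
  assumes d: "diagram S" "height_le S N" "i \<in> {1..N}" "i \<notin> rrows S"
  shows "ctw {1..N} (yc S) i = 0"
proof -
  have eq: "rowlen S (Suc i) = rowlen S i" using assms row_anti[OF d(1), of i] by (auto simp: rrows_def)
  show ?thesis
  proof (cases "i = N")
    case True
    then have "rowlen S i = 0" using eq d(2) by (auto simp: height_le_def)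
    then show ?thesis using True by (simp add: ctw_def yc_def)
  next
    case False
    then have "Suc i \<in> {1..N} - {i}" using assms by auto
    moreover have "yc S i - 1 - yc S (Suc i) = 0" using eq by (simp add: yc_def)
    ultimately have "omg {1..N} (yc S) i = 0" unfolding omg_def by (auto simp: prod_zero_iff)
    then show ?thesis by (simp add: ctw_def)
  qed
qed

lemma yc_rrows_ne: assumes d: "diagram S" and i: "i \<in> rrows S" and k: "1 \<le> k" "k \<noteq> i" shows "yc S i - 1 \<noteq> yc S k"
proof (cases "k < i")
  case True then show ?thesis using yc_strict[OF d k(1) True] by auto
next
  case False
  then have "Suc i \<le> k" using k by auto
  moreover have "rowlen S (Suc i) < rowlen S i" using i by (auto simp: rrows_def)
  ultimately show ?thesis using row_anti'[OF d, of "Suc i" k] by (auto simp: yc_def)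
qed

lemma ctw_rem_ne: assumes d: "diagram S" "height_le S N" and i: "i \<in> rrows S"
  shows "ctw {1..N} (yc S) i \<noteq> 0"
proof -
  have iN: "i \<in> {1..N}" using rrows_le[OF d(2) i] .
  have "rowlen S i > 0" using i by (auto simp: rrows_def)
  then have "yc S i + real N > 0" using iN by (auto simp: yc_def)
  moreover have "omg {1..N} (yc S) i \<noteq> 0" unfolding omg_def
  proof (subst prod_zero_iff, simp, rule notI, elim bexE)
    fix r assume r: "r \<in> {1..N} - {i}" "(yc S i - 1 - yc S r) / (yc S i - yc S r) = 0"
    have "yc S i - yc S r \<noteq> 0" using inj_onD[OF yc_inj[OF d(1), of N], of i r] r iN by auto
    then have "yc S i - 1 = yc S r" using r by auto
    then show False using yc_rrows_ne[OF d(1) i, of r] r by auto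
  qed
  ultimately show ?thesis by (simp add: ctw_def)
qed

lemma Qsum2: assumes "diagram S" "height_le S N" shows "Qsum {1..N} (yc S) 2 = 2 * real (card S)"
proof -
  have "card S = (\<Sum>i=1..N. rowlen S i)" using sum_diagram[OF assms, of "\<lambda>_. 1::nat"] by simp
  then have c: "real (card S) = (\<Sum>i=1..N. real (rowlen S i))" by simp
  have tel: "(\<Sum>i=1..N. 1 - 2 * real i) = - (real N)\<^sup>2" for N :: nat
    by (induction N) (auto simp: power2_eq_square algebra_simps)
  have "(yc S r + 1)\<^sup>2 - (yc S r)\<^sup>2 = 2 * real (rowlen S r) + (1 - 2 * real r)" for r
    by (simp add: yc_def power2_eq_square algebra_simps)
  then have "Qsum {1..N} (yc S) 2 = (real N)\<^sup>2 + (\<Sum>r=1..N. 2 * real (rowlen S r) + (1 - 2 * real r))"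
    unfolding Qsum_def by simp
  also have "\<dots> = 2 * real (card S)"
    unfolding c sum.distrib sum_distrib_left[symmetric] tel by simp
  finally show ?thesis .
qed

lemma ctw_sum: assumes "diagram S" "height_le S N"
  shows "(\<Sum>i=1..N. ctw {1..N} (yc S) i) = real (card S)"
proof -
  have "2 * (\<Sum>i=1..N. ctw {1..N} (yc S) i) = Qsum {1..N} (yc S) (0 + 2)"
    using ctw_newton[OF _ yc_inj[OF assms(1)], of N 0] by simp
  then show ?thesis unfolding add_0 Qsum2[OF assms] by simp
qed

lemma rrows_remove:
  assumes d: "diagram S" and i: "i \<in> rrows S" and k: "k \<in> rrows S" "k \<noteq> i"
  shows "k \<in> rrows (S - {(i, rowlen S i)})"
  using rowlen_remove[OF d, of i] i k by (auto simp: rrows_def)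

lemma Rem_rrows: assumes "diagram S" shows "Rem S = (\<lambda>i. (i, rowlen S i)) ` rrows S"
  using Rem_rows[OF assms] by (simp add: rrows_def)

text \<open>The co-transition probabilities in product form; this replaces the hook formula. Ratios for
  two different corners agree with those of the product by induction, through the diagram with both
  corners removed, and the normalisation is the Newton identity of order zero.\<close>

lemma cotransition:
  assumes "diagram S" "height_le S N" "i \<in> rrows S"
  shows "real (card S) * real (sdim (S - {(i, rowlen S i)})) = ctw {1..N} (yc S) i * real (sdim S)"
  using assms
proof (induction "card S" arbitrary: S i rule: less_induct)
  case less
  note d = less.prems(1) and N = less.prems(2) and i = less.prems(3)
  let ?b = "\<lambda>i. (i, rowlen S i)" and ?W = "ctw {1..N} (yc S)"
  have fin: "finite S" using d diagram_finite by auto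
  have bS: "?b i \<in> Rem S" if "i \<in> rrows S" for i using Rem_rrows[OF d] that by auto
  have pos: "1 \<le> i" "rowlen S i > 0" if "i \<in> rrows S" for i using that by (auto simp: rrows_def)
  have finR: "finite (rrows S)" using rrows_le[OF N] finite_subset[of "rrows S" "{1..N}"] by blast
  \<comment> \<open>The bound N survives the removal, so the smaller diagrams are described by the
    same index set \<open>{1..N}\<close>.\<close>
  have hN: "height_le (S - {?b i}) N" if "i \<in> rrows S" for i
    using N rowlen_remove[OF d pos[OF that]] rrows_le[OF N that] by (auto simp: height_le_def)
  have step: "(real (card S) - 1) * real (sdim (S - {?b i, ?b k})) = ctw {1..N} ((yc S)(i := yc S i - 1)) k * real (sdim (S - {?b i}))"
    if ik: "i \<in> rrows S" "k \<in> rrows S" "k \<noteq> i" for i k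
  proof -
    have bi: "?b i \<in> S" using bS[OF ik(1)] Rem_subset by auto
    have c: "Suc (card (S - {?b i})) = card S" using card.remove[OF fin bi] by simp
    have "real (card (S - {?b i})) * real (sdim (S - {?b i} - {(k, rowlen (S - {?b i}) k)})) = ctw {1..N} (yc (S - {?b i})) k * real (sdim (S - {?b i}))"
    proof (rule less.hyps)
      show "card (S - {?b i}) < card S" using c by simp
      show "diagram (S - {?b i})" using Rem_diagram[OF d bS[OF ik(1)]] .
      show "height_le (S - {?b i}) N" using hN ik by auto
      show "k \<in> rrows (S - {?b i})" using rrows_remove[OF d] ik by auto
    qed
    moreover have "rowlen (S - {?b i}) k = rowlen S k" using rowlen_remove[OF d pos[OF ik(1)]] ik by auto
    moreover have "S - {?b i} - {?b k} = S - {?b i, ?b k}" by auto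
    moreover have "real (card (S - {?b i})) = real (card S) - 1" using c by linarith
    ultimately show ?thesis using yc_remove[OF d pos[OF ik(1)]] by simp
  qed
  have swap: "real (sdim (S - {?b i})) * ?W k = real (sdim (S - {?b k})) * ?W i" if k: "k \<in> rrows S" for k
  proof (cases "k = i")
    case False
    let ?Wk = "ctw {1..N} ((yc S)(i := yc S i - 1)) k" and ?Wi = "ctw {1..N} ((yc S)(k := yc S k - 1)) i"
    \<comment> \<open>Both sides are \<open>card S - 1\<close> times the dimension of the diagram
      without both corners, by induction applied after either removal.\<close>
    have st: "?Wk * real (sdim (S - {?b i})) = ?Wi * real (sdim (S - {?b k}))"
      using step[OF i k False] step[OF k i] False by (simp add: insert_commute)
    have iN: "i \<in> {1..N}" "k \<in> {1..N}" using rrows_le[OF N] i k by auto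
    have yne: "yc S i \<noteq> yc S k" using inj_onD[OF yc_inj[OF d, of N], of i k] iN False by auto
    have coc: "?W i * ?Wk = ?W k * ?Wi"
      using ctw_cocycle[of "{1..N}" i k "yc S"] ctw_cocycle[of "{1..N}" k i "yc S"] iN False yne
        yc_rrows_ne[OF d i, of k] yc_rrows_ne[OF d k, of i]
      by (simp add: insert_commute mult_ac)
    have Wk0: "?Wk \<noteq> 0"
      using ctw_rem_ne[OF Rem_diagram[OF d bS[OF i]] hN[OF i] rrows_remove[OF d i k False]]
        yc_remove[OF d pos[OF i]] by simp
    have Wi0: "?W i \<noteq> 0" using ctw_rem_ne[OF d N i] .
    have "(real (sdim (S - {?b i})) * ?W k) * (?W i * ?Wk) = (real (sdim (S - {?b k})) * ?W i) * (?W k * ?Wi)"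
      using st by (simp add: mult_ac)
    then show ?thesis unfolding coc[symmetric] using Wk0 Wi0 by (metis mult_cancel_right mult_eq_0_iff)
  qed simp
  have sumW: "(\<Sum>k\<in>rrows S. ?W k) = real (card S)"
  proof -
    have "(\<Sum>k\<in>rrows S. ?W k) = (\<Sum>k\<in>{1..N}. ?W k)"
      by (rule sum.mono_neutral_left) (use rrows_le[OF N] ctw_nonrem[OF d N] in auto)
    then show ?thesis using ctw_sum[OF d N] by simp
  qed
  have sumd: "(\<Sum>k\<in>rrows S. real (sdim (S - {?b k}))) = real (sdim S)"
  proof -
    have "S \<noteq> {}" using bS[OF i] Rem_subset by auto
    then have "sdim S = (\<Sum>b\<in>Rem S. sdim (S - {b}))" using sdim_rec[OF d] by simp
    also have "\<dots> = (\<Sum>k\<in>rrows S. sdim (S - {?b k}))" unfolding Rem_rrows[OF d]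
      by (subst sum.reindex) (auto simp: inj_on_def)
    finally show ?thesis by simp
  qed
  \<comment> \<open>The dimensions are proportional to the weights; summing over all corners k fixes
    the factor.\<close>
  have "real (sdim (S - {?b i})) * (\<Sum>k\<in>rrows S. ?W k) = (\<Sum>k\<in>rrows S. real (sdim (S - {?b k}))) * ?W i"
    unfolding sum_distrib_left sum_distrib_right by (rule sum.cong[OF refl]) (rule swap)
  then show ?case unfolding sumW sumd by (simp add: mult_ac)
qed

section \<open>Polynomial functions on diagrams\<close>


abbreviation rc :: "nat \<times> nat \<Rightarrow> real" where "rc b \<equiv> real_of_int (boxcont b)"

text \<open>Telescoping along the diagonal hooks identifies this with the k-th super power sum of
  the modified Frobenius coordinates. As a sum over boxes it changes by a single term when a box is
  removed.\<close>

definition pk :: "nat \<Rightarrow> (nat \<times> nat) set \<Rightarrow> real" where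
  "pk k S = (\<Sum>b\<in>S. (rc b + 1/2) ^ k - (rc b - 1/2) ^ k)"

definition cs :: "nat \<Rightarrow> (nat \<times> nat) set \<Rightarrow> real" where
  "cs j S = (\<Sum>b\<in>S. rc b ^ j)"

text \<open>The box form of \<open>Qsum\<close>, obtained from \<open>add_minus_rem_boxes\<close>;
  the boundary term f 0 is zero for k \<ge> 1.\<close>

definition Qb :: "nat \<Rightarrow> (nat \<times> nat) set \<Rightarrow> real" where
  "Qb k S = (\<Sum>b\<in>S. (rc b + 1) ^ k + (rc b - 1) ^ k - 2 * rc b ^ k)"

text \<open>\<open>pol m f\<close>: on diagrams, \<open>f\<close> is a polynomial in the \<open>pk k\<close> of weighted degree strictly below \<open>m\<close>
  (\<open>pk k\<close> has degree \<open>k\<close>). The shift by one makes \<open>pol 0\<close> the zero function, so that lower-order terms need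
  no case distinction.\<close>

inductive pol :: "nat \<Rightarrow> ((nat \<times> nat) set \<Rightarrow> real) \<Rightarrow> bool" where
  pol_zero: "pol 0 (\<lambda>_. 0)"
| pol_const: "pol (Suc m) (\<lambda>_. c)"
| pol_mult: "pol m f \<Longrightarrow> 1 \<le> k \<Longrightarrow> pol (m + k) (\<lambda>S. pk k S * f S)"
| pol_add: "pol m f \<Longrightarrow> pol m g \<Longrightarrow> pol m (\<lambda>S. f S + g S)"
| pol_mono: "pol m f \<Longrightarrow> m \<le> m' \<Longrightarrow> pol m' f"
| pol_cong: "pol m f \<Longrightarrow> (\<And>S. diagram S \<Longrightarrow> f S = g S) \<Longrightarrow> pol m g"

lemma pol_zero': "pol m (\<lambda>_. 0)"
  by (rule pol_mono[OF pol_zero]) simp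

lemma pol_scale: "pol m f \<Longrightarrow> pol m (\<lambda>S. c * f S)"
proof (induction rule: pol.induct)
  case (pol_mult m f k)
  then show ?case using pol.pol_mult[OF pol_mult.IH, of k] by (simp add: mult_ac)
next
  case (pol_add m f g)
  then show ?case using pol.pol_add[OF pol_add.IH] by (simp add: distrib_left)
next
  case (pol_cong m f g)
  then show ?case by (intro pol.pol_cong[OF pol_cong.IH]) auto
qed (auto intro: pol.intros simp: pol_zero')

lemma pol_diff: "pol m f \<Longrightarrow> pol m g \<Longrightarrow> pol m (\<lambda>S. f S - g S)"
  using pol_add[of m f "\<lambda>S. (- 1) * g S"] pol_scale[of m g "- 1"] by simp

lemma pol_sum: "(\<And>i. i \<in> I \<Longrightarrow> pol m (f i)) \<Longrightarrow> pol m (\<lambda>S. \<Sum>i\<in>I. f i S)"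
proof (induction I rule: infinite_finite_induct)
  case (insert x F)
  then show ?case using pol_add[of m "f x" "\<lambda>S. \<Sum>i\<in>F. f i S"] by simp
qed (auto simp: pol_zero')

lemma pol_0: "pol m f \<Longrightarrow> m = 0 \<Longrightarrow> diagram S \<Longrightarrow> f S = 0"
  by (induction rule: pol.induct) auto

text \<open>One factor carries a strict and the other a non-strict degree bound, so the bounds
  simply add, and the zero function fits in.\<close>

lemma pol_times_aux: "pol m f \<Longrightarrow> pol (Suc b) g \<Longrightarrow> pol (m + b) (\<lambda>S. f S * g S)"
proof (induction rule: pol.induct)
  case (pol_const m c)
  then show ?case by (intro pol_mono[OF pol_scale[OF pol_const]]) auto
next
  case (pol_mult m f k)
  then show ?case using pol.pol_mult[of "m + b" "\<lambda>S. f S * g S" k] by (simp add: mult_ac add_ac)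
next
  case (pol_add m f h)
  then show ?case using pol.pol_add[of "m + b" "\<lambda>S. f S * g S" "\<lambda>S. h S * g S"] by (simp add: distrib_right)
next
  case (pol_mono m f m')
  then show ?case by (intro pol.pol_mono[OF pol_mono.IH]) auto
next
  case (pol_cong m f h)
  then show ?case by (intro pol.pol_cong[OF pol_cong.IH]) auto
qed (simp add: pol_zero')

lemma pol_times: "pol (Suc a) f \<Longrightarrow> pol (Suc b) g \<Longrightarrow> pol (Suc (a + b)) (\<lambda>S. f S * g S)"
  using pol_times_aux[of "Suc a" f b g] by simp

lemma pol_pk: "1 \<le> k \<Longrightarrow> pol (Suc k) (pk k)"
  using pol_mult[OF pol_const[of 0 1], of k] by simp

section \<open>Content power sums and their weights\<close>

definition acf :: "nat \<Rightarrow> nat \<Rightarrow> real" where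
  "acf k i = real (k choose i) * ((1/2) ^ (k - i) - (- 1/2) ^ (k - i))"

lemma pk_summand: "((c::real) + 1/2) ^ k - (c - 1/2) ^ k = (\<Sum>i<k. acf k i * c ^ i)"
proof -
  have "(c + 1/2) ^ k - (c + (- 1/2)) ^ k = (\<Sum>i\<le>k. acf k i * c ^ i)"
    unfolding binomial_ring sum_subtractf[symmetric]
    by (rule sum.cong) (auto simp: acf_def algebra_simps)
  also have "\<dots> = (\<Sum>i<k. acf k i * c ^ i)"
    by (simp add: lessThan_Suc_atMost[symmetric] acf_def)
  finally show ?thesis by simp
qed

lemma acf_top: "acf (Suc j) j = real (Suc j)"
  by (simp add: acf_def)

lemma pk_cs_exp: "pk k S = (\<Sum>i<k. acf k i * cs i S)"
  unfolding pk_def pk_summand cs_def sum_distrib_left by (rule sum.swap)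

text \<open>\<open>pk (Suc j)\<close> is (j + 1) \<open>cs j\<close> plus lower content sums, so the
  relation inverts triangularly. The weight of \<open>cs j\<close> is j + 1, one more than the power
  of the content, because of the summation over boxes.\<close>

lemma cs_pol: "pol (j + 2) (cs j)"
proof (induction j rule: less_induct)
  case (less j)
  have "pol (j + 2) (\<lambda>S. (1 / real (Suc j)) * (pk (Suc j) S - (\<Sum>i<j. acf (Suc j) i * cs i S)))"
  proof (intro pol_scale pol_diff pol_sum)
    show "pol (j + 2) (pk (Suc j))" using pol_pk[of "Suc j"] by simp
    fix i assume "i \<in> {..<j}"
    then show "pol (j + 2) (cs i)" using less by (auto intro: pol_mono[of "i + 2"])
  qed
  moreover have "(1 / real (Suc j)) * (pk (Suc j) S - (\<Sum>i<j. acf (Suc j) i * cs i S)) = cs j S" for S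
    unfolding pk_cs_exp[of "Suc j"] by (simp add: acf_top)
  ultimately show ?case by simp
qed

lemma pk_cs: "pol (j + 1) (\<lambda>S. pk (Suc j) S - real (Suc j) * cs j S)"
proof -
  have "pk (Suc j) S - real (Suc j) * cs j S = (\<Sum>i<j. acf (Suc j) i * cs i S)" for S
    unfolding pk_cs_exp[of "Suc j"] by (simp add: acf_top)
  moreover have "pol (j + 1) (\<lambda>S. \<Sum>i<j. acf (Suc j) i * cs i S)"
    by (intro pol_sum pol_scale pol_mono[OF cs_pol]) auto
  ultimately show ?thesis by simp
qed

definition qcf :: "nat \<Rightarrow> nat \<Rightarrow> real" where
  "qcf k i = real (k choose i) * (1 + (- 1) ^ (k - i))"

lemma Qb_exp: "Qb (j + 2) S = real ((j + 2) * (j + 1)) * cs j S + (\<Sum>i<j. qcf (j + 2) i * cs i S)"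
proof -
  have e: "(c + 1) ^ (j + 2) + (c - 1) ^ (j + 2) - 2 * c ^ (j + 2) = real ((j + 2) * (j + 1)) * c ^ j + (\<Sum>i<j. qcf (j + 2) i * c ^ i)" for c :: real
  proof -
    have "(c + 1) ^ (j + 2) + (c + (- 1)) ^ (j + 2) = (\<Sum>i\<le>j + 2. qcf (j + 2) i * c ^ i)"
      unfolding binomial_ring sum.distrib[symmetric]
      by (rule sum.cong) (auto simp: qcf_def algebra_simps)
    also have "\<dots> = qcf (j + 2) (j + 2) * c ^ (j + 2) + qcf (j + 2) (j + 1) * c ^ (j + 1) + qcf (j + 2) j * c ^ j + (\<Sum>i<j. qcf (j + 2) i * c ^ i)"
      by (simp add: lessThan_Suc_atMost[symmetric])
    also have "qcf (j + 2) (j + 2) = 2" by (simp add: qcf_def)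
    also have "qcf (j + 2) (j + 1) = 0" by (simp add: qcf_def)
    also have "qcf (j + 2) j = real ((j + 2) * (j + 1))"
    proof -
      have "2 * ((j + 2) choose j) = (j + 2) * (j + 1)"
        using binomial_symmetric[of j "j + 2"] choose_two[of "j + 2"] by (simp add: algebra_simps)
      then have "2 * real ((j + 2) choose j) = real ((j + 2) * (j + 1))" by (metis of_nat_mult of_nat_numeral)
      then show ?thesis by (simp add: qcf_def)
    qed
    finally show ?thesis by simp
  qed
  show ?thesis unfolding Qb_def e cs_def sum.distrib sum_distrib_left
    by (simp add: sum.swap[of _ S])
qed

lemma Qb_1: "Qb 1 S = 0" by (simp add: Qb_def)

text \<open>Two degrees in the content are lost by the second difference and one is regained by
  summing over boxes: the weight is k - 1.\<close>

lemma Qb_pol: "1 \<le> k \<Longrightarrow> pol k (Qb k)"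
proof (cases "k = 1")
  case True then show ?thesis using Qb_1 by (intro pol_cong[OF pol_zero']) auto
next
  assume "1 \<le> k" "k \<noteq> 1"
  case False
  then obtain j where j: "k = j + 2" using \<open>1 \<le> k\<close> by (metis add.commute le_Suc_ex less_one nat_neq_iff nat_less_le Suc_leI numeral_2_eq_2 One_nat_def)
  have "pol (j + 2) (\<lambda>S. real ((j + 2) * (j + 1)) * cs j S + (\<Sum>i<j. qcf (j + 2) i * cs i S))"
    by (intro pol_add pol_scale cs_pol pol_sum) (auto intro: pol_mono[OF cs_pol])
  then show ?thesis unfolding j by (rule pol_cong) (simp only: Qb_exp)
qed

lemma Qb_cs: "pol (j + 1) (\<lambda>S. Qb (j + 2) S - real ((j + 2) * (j + 1)) * cs j S)"
proof -
  have "pol (j + 1) (\<lambda>S. \<Sum>i<j. qcf (j + 2) i * cs i S)"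
    by (intro pol_sum pol_scale pol_mono[OF cs_pol]) auto
  then show ?thesis by (rule pol_cong) (metis Qb_exp add_diff_cancel_left')
qed

lemma Qsum_Qb: assumes "diagram S" "height_le S N" "1 \<le> k" shows "Qsum {1..N} (yc S) k = Qb k S"
proof -
  let ?f = "\<lambda>c::int. real_of_int c ^ k"
  have "?f (- int N) + (\<Sum>i=1..N. ?f (int (rowlen S i) - int i + 1) - ?f (int (rowlen S i) - int i))
    = ?f 0 + (\<Sum>b\<in>S. ?f (boxcont b + 1) + ?f (boxcont b - 1) - 2 * ?f (boxcont b))"
    using add_minus_rem[OF assms(1,2), of ?f] add_minus_rem_boxes[OF assms(1), of ?f] by simp
  then show ?thesis using assms(3) by (simp add: Qsum_def Qb_def yc_def power_0_left)
qed

text \<open>A down step weighted with the j-th power of the content of the removed box, times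
  \<open>card S\<close>. These moments have to be carried along since \<open>pk k\<close> at
  \<open>S - {b}\<close> expands in powers of the content of b.\<close>

definition Dj :: "nat \<Rightarrow> ((nat \<times> nat) set \<Rightarrow> real) \<Rightarrow> (nat \<times> nat) set \<Rightarrow> real" where
  "Dj j f S = (\<Sum>b\<in>Rem S. real (card S) * real (sdim (S - {b})) / real (sdim S) * rc b ^ j * f (S - {b}))"

lemma Dj_one_ctw: assumes d: "diagram S" and N: "height_le S N"
  shows "Dj j (\<lambda>_. 1) S = (\<Sum>i\<in>{1..N}. ctw {1..N} (yc S) i * yc S i ^ j)"
proof -
  have "Dj j (\<lambda>_. 1) S = (\<Sum>i\<in>rrows S. ctw {1..N} (yc S) i * yc S i ^ j)"
    unfolding Dj_def Rem_rrows[OF d]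
  proof (subst sum.reindex)
    show "inj_on (\<lambda>i. (i, rowlen S i)) (rrows S)" by (auto simp: inj_on_def)
    show "sum ((\<lambda>b. real (card S) * real (sdim (S - {b})) / real (sdim S) * rc b ^ j * 1) \<circ> (\<lambda>i. (i, rowlen S i))) (rrows S)
       = (\<Sum>i\<in>rrows S. ctw {1..N} (yc S) i * yc S i ^ j)"
    proof (rule sum.cong[OF refl])
      fix i assume i: "i \<in> rrows S"
      have "real (card S) * real (sdim (S - {(i, rowlen S i)})) / real (sdim S) = ctw {1..N} (yc S) i"
        using cotransition[OF d N i] sdim_pos[OF d] by simp
      then show "((\<lambda>b. real (card S) * real (sdim (S - {b})) / real (sdim S) * rc b ^ j * 1) \<circ> (\<lambda>i. (i, rowlen S i))) i
        = ctw {1..N} (yc S) i * yc S i ^ j"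
        unfolding comp_def by (simp only: mult_1_right) (simp add: boxcont_def yc_def)
    qed
  qed
  also have "\<dots> = (\<Sum>i\<in>{1..N}. ctw {1..N} (yc S) i * yc S i ^ j)"
    by (rule sum.mono_neutral_left) (use rrows_le[OF N] ctw_nonrem[OF d N] in auto)
  finally show ?thesis .
qed

lemma Dj_newton: assumes d: "diagram S"
  shows "real (j + 2) * Dj j (\<lambda>_. 1) S = Qb (j + 2) S - (\<Sum>i=1..j. Qb i S * Dj (j - i) (\<lambda>_. 1) S)"
proof -
  obtain N where N: "height_le S N" using height_le_ex[OF d] by blast
  have "(\<Sum>i=1..j. Qsum {1..N} (yc S) i * Dj (j - i) (\<lambda>_. 1) S) = (\<Sum>i=1..j. Qb i S * Dj (j - i) (\<lambda>_. 1) S)"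
    by (rule sum.cong[OF refl]) (subst Qsum_Qb[OF d N], auto)
  moreover have "Qsum {1..N} (yc S) (j + 2) = Qb (j + 2) S" by (rule Qsum_Qb[OF d N]) simp
  ultimately show ?thesis
    using ctw_newton[OF _ yc_inj[OF d], of N j] unfolding Dj_one_ctw[OF d N, symmetric] by simp
qed

text \<open>In the Newton identity \<open>Qb (j + 2)\<close> has weight j + 1 with leading part (j +
  2) (j + 1) \<open>cs j\<close>, while each product has weight (i - 1) + (j - i + 1) = j. Division
  by j + 2 leaves (j + 1) \<open>cs j\<close>, the leading part of
  \<open>pk (Suc j)\<close>.\<close>

lemma Dj_one: "pol (j + 1) (\<lambda>S. Dj j (\<lambda>_. 1) S - pk (Suc j) S)"
proof (induction j rule: less_induct)
  case (less j)
  have IH: "pol (Suc (i + 1)) (Dj i (\<lambda>_. 1))" if "i < j" for i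
  proof -
    have "pol (Suc (i + 1)) (\<lambda>S. (Dj i (\<lambda>_. 1) S - pk (Suc i) S) + pk (Suc i) S)"
      by (intro pol_add pol_mono[OF less[OF that]]) (use pol_pk[of "Suc i"] in auto)
    then show ?thesis by simp
  qed
  have s: "pol (j + 1) (\<lambda>S. \<Sum>i=1..j. Qb i S * Dj (j - i) (\<lambda>_. 1) S)"
  proof (rule pol_sum)
    fix i assume i: "i \<in> {1..j}"
    then have "pol (Suc (i - 1)) (Qb i)" using Qb_pol[of i] by simp
    moreover have "pol (Suc (j - i + 1)) (Dj (j - i) (\<lambda>_. 1))" using IH[of "j - i"] i by auto
    ultimately have "pol (Suc (i - 1 + (j - i + 1))) (\<lambda>S. Qb i S * Dj (j - i) (\<lambda>_. 1) S)" by (rule pol_times)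
    moreover have "Suc (i - 1 + (j - i + 1)) = j + 1" using i by auto
    ultimately show "pol (j + 1) (\<lambda>S. Qb i S * Dj (j - i) (\<lambda>_. 1) S)" by simp
  qed
  have "pol (j + 1) (\<lambda>S. (1 / real (j + 2)) * ((Qb (j + 2) S - real ((j + 2) * (j + 1)) * cs j S) - (\<Sum>i=1..j. Qb i S * Dj (j - i) (\<lambda>_. 1) S))
      - (pk (Suc j) S - real (Suc j) * cs j S))"
    by (intro pol_diff pol_scale Qb_cs s pk_cs)
  then show ?case
  proof (rule pol_cong)
    fix S assume d: "diagram S"
    have alg: "(1 / x) * ((Q - x * y * c) - r) - (p - y * c) = D - p" if "x * D = Q - r" "x \<noteq> 0" for x y c p Q r D :: real
    proof -
      have Q: "Q = x * D + r" using that by simp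
      have "(1 / x) * ((Q - x * y * c) - r) = (1 / x) * (x * (D - y * c))" unfolding Q by (simp add: right_diff_distrib)
      also have "\<dots> = D - y * c" using that by simp
      finally show ?thesis by simp
    qed
    show "(1 / real (j + 2)) * ((Qb (j + 2) S - real ((j + 2) * (j + 1)) * cs j S) - (\<Sum>i=1..j. Qb i S * Dj (j - i) (\<lambda>_. 1) S))
      - (pk (Suc j) S - real (Suc j) * cs j S) = Dj j (\<lambda>_. 1) S - pk (Suc j) S"
    proof -
      have r: "real ((j + 2) * (j + 1)) = real (j + 2) * real (Suc j)" by (simp only: of_nat_mult Suc_eq_plus1)
      show ?thesis unfolding r by (rule alg[OF Dj_newton[OF d]]) simp
    qed
  qed
qed

lemma pk_remove: assumes "diagram S" "b \<in> Rem S"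
  shows "pk k (S - {b}) = pk k S - (\<Sum>i<k. acf k i * rc b ^ i)"
proof -
  have "b \<in> S" "finite S" using assms Rem_subset diagram_finite by auto
  then show ?thesis unfolding pk_def using pk_summand[of "rc b" k] by (simp add: sum_diff1)
qed

lemma Dj_lin: "Dj j (\<lambda>S. a * f S + b * g S) S = a * Dj j f S + b * Dj j g S"
proof -
  have "x * (a * u + b * v) = a * (x * u) + b * (x * v)" for x u v :: real by (simp add: algebra_simps)
  then show ?thesis unfolding Dj_def sum_distrib_left sum.distrib[symmetric] by (intro sum.cong) auto
qed

lemma Dj_cong: assumes "diagram S" "\<And>R. diagram R \<Longrightarrow> f R = g R" shows "Dj j f S = Dj j g S"
  unfolding Dj_def by (rule sum.cong) (use assms Rem_diagram in auto)

lemma Dj_pk: assumes d: "diagram S"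
  shows "Dj j (\<lambda>S. pk k S * f S) S = pk k S * Dj j f S - (\<Sum>i<k. acf k i * Dj (j + i) f S)"
proof -
  have "Dj j (\<lambda>S. pk k S * f S) S = (\<Sum>b\<in>Rem S. pk k S * (real (card S) * real (sdim (S - {b})) / real (sdim S) * rc b ^ j * f (S - {b}))
      - (\<Sum>i<k. acf k i * (real (card S) * real (sdim (S - {b})) / real (sdim S) * rc b ^ (j + i) * f (S - {b}))))"
    unfolding Dj_def
  proof (rule sum.cong[OF refl])
    fix b assume b: "b \<in> Rem S"
    have alg: "x * c ^ j * ((p - (\<Sum>i<k. acf k i * c ^ i)) * y) = p * (x * c ^ j * y) - (\<Sum>i<k. acf k i * (x * c ^ (j + i) * y))" for x c p y :: real
    proof -
      have "x * c ^ j * ((p - (\<Sum>i<k. acf k i * c ^ i)) * y) = p * (x * c ^ j * y) - (\<Sum>i<k. acf k i * c ^ i) * (x * c ^ j * y)" by (simp add: algebra_simps)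
      also have "(\<Sum>i<k. acf k i * c ^ i) * (x * c ^ j * y) = (\<Sum>i<k. acf k i * (x * c ^ (j + i) * y))"
        unfolding sum_distrib_right by (rule sum.cong) (auto simp: power_add mult_ac)
      finally show ?thesis .
    qed
    show "real (card S) * real (sdim (S - {b})) / real (sdim S) * rc b ^ j * (pk k (S - {b}) * f (S - {b})) =
      pk k S * (real (card S) * real (sdim (S - {b})) / real (sdim S) * rc b ^ j * f (S - {b}))
      - (\<Sum>i<k. acf k i * (real (card S) * real (sdim (S - {b})) / real (sdim S) * rc b ^ (j + i) * f (S - {b})))"
      unfolding pk_remove[OF d b] by (rule alg)
  qed
  also have "\<dots> = pk k S * Dj j f S - (\<Sum>i<k. acf k i * Dj (j + i) f S)"
    unfolding sum_subtractf Dj_def sum_distrib_left by (subst sum.swap) simp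
  finally show ?thesis .
qed

text \<open>To top order removing a box does not change f, so only the moment of the content,
  \<open>pk (Suc j)\<close>, remains. In the product case the corrections
  \<open>acf k i * Dj (j + i) f\<close> have i < k and stay within the bound.\<close>

lemma Dj_pol: "pol m f \<Longrightarrow> pol (m + j) (\<lambda>S. Dj j f S - pk (Suc j) S * f S)"
proof (induction arbitrary: j rule: pol.induct)
  case pol_zero then show ?case by (intro pol_cong[OF pol_zero']) (simp add: Dj_def)
next
  case (pol_const m c)
  have "Dj j (\<lambda>_. c) S = c * Dj j (\<lambda>_. 1) S" for S
    using Dj_lin[of j c "\<lambda>_. 1" 0 "\<lambda>_. 0" S] by simp
  then have e: "c * (Dj j (\<lambda>_. 1) S - pk (Suc j) S) = Dj j (\<lambda>_. c) S - pk (Suc j) S * c" for S by (simp add: algebra_simps)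
  have "pol (Suc m + j) (\<lambda>S. c * (Dj j (\<lambda>_. 1) S - pk (Suc j) S))"
    by (intro pol_scale pol_mono[OF Dj_one]) auto
  then show ?case by (simp add: e)
next
  case (pol_mult m f k)
  have D: "pol (m + i + 1) (Dj i f)" for i
  proof -
    have "pol (m + i + 1) (\<lambda>S. (Dj i f S - pk (Suc i) S * f S) + pk (Suc i) S * f S)"
      by (intro pol_add pol_mono[OF pol_mult.IH]) (use pol.pol_mult[OF pol_mult.hyps(1), of "Suc i"] in auto)
    then show ?thesis by simp
  qed
  have 1: "pol (m + k + j) (\<lambda>S. pk k S * (Dj j f S - pk (Suc j) S * f S))"
    using pol.pol_mult[OF pol_mult.IH[of j] pol_mult.hyps(2)] by (simp add: add_ac)
  have 2: "pol (m + k + j) (\<lambda>S. \<Sum>i<k. acf k i * Dj (j + i) f S)"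
    by (intro pol_sum pol_scale pol_mono[OF D]) auto
  show ?case
  proof (rule pol_cong[OF pol_diff[OF 1 2]])
    fix S assume d: "diagram S"
    show "pk k S * (Dj j f S - pk (Suc j) S * f S) - (\<Sum>i<k. acf k i * Dj (j + i) f S) = Dj j (\<lambda>S. pk k S * f S) S - pk (Suc j) S * (pk k S * f S)"
      unfolding Dj_pk[OF d] by (simp add: algebra_simps)
  qed
next
  case (pol_add m f g)
  have "pol (m + j) (\<lambda>S. (Dj j f S - pk (Suc j) S * f S) + (Dj j g S - pk (Suc j) S * g S))"
    by (intro pol.pol_add pol_add.IH)
  then show ?case
    using Dj_lin[of j 1 f 1 g] by (simp add: algebra_simps)
next
  case (pol_mono m f m')
  then show ?case by (intro pol.pol_mono[OF pol_mono.IH]) auto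
next
  case (pol_cong m f g)
  show ?case
    by (rule pol.pol_cong[OF pol_cong.IH[of j]]) (use pol_cong.hyps Dj_cong[of _ f g] in auto)
qed

text \<open>Written as \<open>Dj 0\<close> minus multiplication by \<open>pk 1\<close>, the number
  of boxes, so that the expansion for \<open>Dj\<close> applies; the name refers to the Euler
  operator of the weighted grading.\<close>

definition Eul :: "((nat \<times> nat) set \<Rightarrow> real) \<Rightarrow> (nat \<times> nat) set \<Rightarrow> real" where
  "Eul f S = Dj 0 f S - pk 1 S * f S"

lemma pk_1: "pk 1 S = real (card S)" by (simp add: pk_def)

lemma Eul_DS: "Eul f S = real (card S) * (DS f S - f S)"
  unfolding Eul_def Dj_def DS_def pk_1 by (simp add: sum_distrib_left right_diff_distrib mult_ac)

lemma Eul_lin: "Eul (\<lambda>S. a * f S + b * g S) S = a * Eul f S + b * Eul g S"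
  unfolding Eul_def Dj_lin by (simp add: algebra_simps)

lemma Eul_cong: assumes "diagram S" "\<And>R. diagram R \<Longrightarrow> f R = g R" shows "Eul f S = Eul g S"
  unfolding Eul_def using Dj_cong[OF assms] assms by simp

lemma Eul_const: assumes "diagram S" shows "Eul (\<lambda>_. c) S = 0"
proof (cases "S = {}")
  case False
  have "DS (\<lambda>_. c) S = (\<Sum>b\<in>Rem S. real (sdim (S - {b}))) / real (sdim S) * c"
    unfolding DS_def by (simp add: sum_divide_distrib sum_distrib_right)
  also have "(\<Sum>b\<in>Rem S. real (sdim (S - {b}))) = real (sdim S)"
    using sdim_rec[OF assms False] by simp
  finally show ?thesis using sdim_pos[OF assms] by (simp add: Eul_DS)
qed (simp add: Eul_DS)

text \<open>Multiplying by \<open>pk k\<close> shifts the eigenvalue by -k: among the corrections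
  only i = k - 1 has full weight, with coefficient \<open>acf k (k - 1) = k\<close> and leading part
  \<open>pk k * f\<close>. The factor is \<open>real m - 1\<close> because \<open>pol m\<close>
  means degree at most m - 1.\<close>

lemma Eul_pol: "pol m f \<Longrightarrow> pol (m - 1) (\<lambda>S. Eul f S + (real m - 1) * f S)"
proof (induction rule: pol.induct)
  case pol_zero then show ?case by (intro pol_cong[OF pol_zero']) (simp add: Eul_const)
next
  case (pol_const m c)
  show ?case
  proof (cases m)
    case 0 then show ?thesis by (intro pol_cong[OF pol_zero']) (simp add: Eul_const)
  next
    case (Suc k)
    show ?thesis by (rule pol_cong[of _ "\<lambda>_. real m * c"]) (simp_all add: Eul_const Suc pol.pol_const)
  qed
next
  case (pol_mult m f k)
  obtain k' where k: "k = Suc k'" using pol_mult.hyps(2) by (cases k) auto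
  have D: "pol (m + i + 1) (Dj i f)" for i
  proof -
    have "pol (m + i + 1) (\<lambda>S. (Dj i f S - pk (Suc i) S * f S) + pk (Suc i) S * f S)"
      by (intro pol_add pol_mono[OF Dj_pol[OF pol_mult.hyps(1)]]) (use pol.pol_mult[OF pol_mult.hyps(1), of "Suc i"] in auto)
    then show ?thesis by simp
  qed
  have 1: "pol (m + k') (\<lambda>S. pk k S * (Eul f S + (real m - 1) * f S))"
  proof (cases "m = 0")
    case True
    then have "f S = 0" if "diagram S" for S using pol_0[OF pol_mult.hyps(1)] that by simp
    then have "Eul f S + (real m - 1) * f S = 0" if "diagram S" for S
      using that Eul_cong[OF that, of f "\<lambda>_. 0"] Eul_const[OF that, of 0] by simp
    then show ?thesis by (intro pol_cong[OF pol_zero']) auto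
  next
    case False
    have "pol (m - 1 + k) (\<lambda>S. pk k S * (Eul f S + (real m - 1) * f S))"
      by (rule pol.pol_mult[OF pol_mult.IH pol_mult.hyps(2)])
    then show ?thesis using False k by simp
  qed
  have 2: "pol (m + k') (\<lambda>S. real k * (Dj k' f S - pk k S * f S))"
    unfolding k by (intro pol_scale Dj_pol pol_mult.hyps(1))
  have 3: "pol (m + k') (\<lambda>S. \<Sum>i<k'. acf k i * Dj i f S)"
    by (intro pol_sum pol_scale pol_mono[OF D]) auto
  have "pol (m + k - 1) (\<lambda>S. pk k S * (Eul f S + (real m - 1) * f S) - real k * (Dj k' f S - pk k S * f S) - (\<Sum>i<k'. acf k i * Dj i f S))"
    using pol_diff[OF pol_diff[OF 1 2] 3] k by simp
  then show ?case
  proof (rule pol_cong)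
    fix S assume d: "diagram S"
    have "(\<Sum>i<k. acf k i * Dj (0 + i) f S) = real k * Dj k' f S + (\<Sum>i<k'. acf k i * Dj i f S)"
      unfolding k by (simp add: acf_top)
    then have "Eul (\<lambda>S. pk k S * f S) S = pk k S * Eul f S - (real k * Dj k' f S + (\<Sum>i<k'. acf k i * Dj i f S))"
      unfolding Eul_def Dj_pk[OF d] by (simp add: algebra_simps)
    then show "pk k S * (Eul f S + (real m - 1) * f S) - real k * (Dj k' f S - pk k S * f S) - (\<Sum>i<k'. acf k i * Dj i f S)
      = Eul (\<lambda>S. pk k S * f S) S + (real (m + k) - 1) * (pk k S * f S)"
      by (simp add: algebra_simps)
  qed
next
  case (pol_add m f g)
  have "pol (m - 1) (\<lambda>S. (Eul f S + (real m - 1) * f S) + (Eul g S + (real m - 1) * g S))"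
    by (intro pol.pol_add pol_add.IH)
  then show ?case using Eul_lin[of 1 f 1 g] by (simp add: algebra_simps)
next
  case (pol_mono m f m')
  show ?case
  proof (cases "m = m'")
    case True then show ?thesis using pol_mono by simp
  next
    case False
    have "pol (m' - 1) (\<lambda>S. (Eul f S + (real m - 1) * f S) + (real m' - real m) * f S)"
      by (intro pol.pol_add pol_scale pol.pol_mono[OF pol_mono.IH] pol.pol_mono[OF pol_mono.hyps(1)])
         (use False pol_mono.hyps(2) in auto)
    then show ?thesis by (simp add: algebra_simps)
  qed
next
  case (pol_cong m f g)
  show ?case
    by (rule pol.pol_cong[OF pol_cong.IH]) (use pol_cong.hyps Eul_cong[of _ f g] in auto)
qed

lemma Eul_sum: "finite I \<Longrightarrow> Eul (\<lambda>S. \<Sum>i\<in>I. a i * f i S) S = (\<Sum>i\<in>I. a i * Eul (f i) S)"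
proof (induction I rule: finite_induct)
  case empty
  then show ?case using Eul_lin[of 0 "\<lambda>_. 0" 0 "\<lambda>_. 0" S] by simp
next
  case (insert x F)
  then show ?case using Eul_lin[of "a x" "f x" 1 "\<lambda>S. \<Sum>i\<in>F. a i * f i S" S] by simp
qed

text \<open>The remainder r = (Eul + m + 1) f has lower degree and is decomposed by induction. The
  equation (Eul + m + 1) h = r is solved componentwise with the coefficients 1 / (m + 1 - k), and f
  - h is the missing eigenfunction.\<close>

lemma eigen_decomposition:
  "pol (Suc m) f \<Longrightarrow> \<exists>F. (\<forall>k\<le>m. pol (Suc k) (F k) \<and> (\<forall>S. diagram S \<longrightarrow> Eul (F k) S = - real k * F k S))
     \<and> (\<forall>S. diagram S \<longrightarrow> f S = (\<Sum>k\<le>m. F k S))"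
proof (induction m arbitrary: f)
  case 0
  have "pol 0 (\<lambda>S. Eul f S + (real 1 - 1) * f S)" using Eul_pol[OF 0] by simp
  then have "Eul f S = 0" if "diagram S" for S using pol_0[of 0 "\<lambda>S. Eul f S + (real 1 - 1) * f S" S] that by simp
  then show ?case using 0 by (intro exI[of _ "\<lambda>_. f"]) auto
next
  case (Suc m)
  define r where "r S = Eul f S + real (Suc m) * f S" for S
  have "pol (Suc m) r" using Eul_pol[OF Suc.prems] by (simp add: r_def[abs_def] algebra_simps)
  from Suc.IH[OF this] obtain R where R: "\<And>k. k \<le> m \<Longrightarrow> pol (Suc k) (R k)"
    "\<And>k S. k \<le> m \<Longrightarrow> diagram S \<Longrightarrow> Eul (R k) S = - real k * R k S"
    "\<And>S. diagram S \<Longrightarrow> r S = (\<Sum>k\<le>m. R k S)" by blast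
  define a where "a k = 1 / (real (Suc m) - real k)" for k
  define h where "h S = (\<Sum>k\<le>m. a k * R k S)" for S
  define F where "F k = (if k \<le> m then (\<lambda>S. a k * R k S) else (\<lambda>S. f S - h S))" for k
  have hp: "pol (Suc m) h" unfolding h_def[abs_def]
    by (intro pol_sum pol_scale pol_mono[OF R(1)]) auto
  have a: "a k * real k = real (Suc m) * a k - 1" if "k \<le> m" for k
    using that by (simp add: a_def field_simps)
  have Eh: "Eul h S = real (Suc m) * (- h S) + r S" if d: "diagram S" for S
  proof -
    have "Eul h S = (\<Sum>k\<le>m. a k * Eul (R k) S)" unfolding h_def[abs_def] by (rule Eul_sum) simp
    also have "\<dots> = (\<Sum>k\<le>m. R k S - real (Suc m) * (a k * R k S))"
    proof (rule sum.cong[OF refl])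
      fix k assume k: "k \<in> {..m}"
      have "a k * Eul (R k) S = - (a k * real k) * R k S" using R(2)[of k S] k d by simp
      also have "\<dots> = - (real (Suc m) * a k - 1) * R k S" using a[of k] k by simp
      also have "\<dots> = R k S - real (Suc m) * (a k * R k S)" by (simp add: algebra_simps)
      finally show "a k * Eul (R k) S = R k S - real (Suc m) * (a k * R k S)" .
    qed
    also have "\<dots> = real (Suc m) * (- h S) + r S"
      unfolding R(3)[OF d] h_def sum_subtractf sum_distrib_left[symmetric] by simp
    finally show ?thesis .
  qed
  show ?case
  proof (intro exI[of _ F] conjI allI impI)
    fix k assume k: "k \<le> Suc m"
    show "pol (Suc k) (F k)"
    proof (cases "k \<le> m")
      case True then show ?thesis using R(1) by (simp add: F_def pol_scale)
    next
      case False
      then have "k = Suc m" using k by simp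
      then show ?thesis using Suc.prems hp by (auto simp: F_def intro!: pol_diff intro: pol_mono)
    qed
    fix S assume d: "diagram S"
    show "Eul (F k) S = - real k * F k S"
    proof (cases "k \<le> m")
      case True
      then show ?thesis using R(2)[OF True d] Eul_lin[of "a k" "R k" 0 "R k" S] by (simp add: F_def)
    next
      case False
      then have "k = Suc m" using k by simp
      moreover have "Eul (\<lambda>S. f S - h S) S = Eul f S - Eul h S" using Eul_lin[of 1 f "- 1" h S] by simp
      ultimately show ?thesis using Eh[OF d] r_def[of S] by (simp add: F_def algebra_simps)
    qed
  next
    fix S assume d: "diagram S"
    have "(\<Sum>k\<le>Suc m. F k S) = (\<Sum>k\<le>m. a k * R k S) + (f S - h S)" by (simp add: F_def)
    then show "f S = (\<Sum>k\<le>Suc m. F k S)" by (simp add: h_def)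
  qed
qed

section \<open>Eigenfunctions of the down operator\<close>


text \<open>Falling factorial n (n - 1) ... (n - j + 1), taken over the reals so that it vanishes
  for n < j.\<close>

definition fl :: "nat \<Rightarrow> nat \<Rightarrow> real" where "fl n j = (\<Prod>i<j. real n - real i)"

lemma fl_Suc: "fl n j * (real n - real j) = real n * fl (n - 1) j" if "n \<ge> 1"
proof -
  have "fl n (Suc j) = real n * fl (n - 1) j"
    unfolding fl_def prod.lessThan_Suc_shift using that by (simp add: of_nat_diff algebra_simps)
  moreover have "fl n (Suc j) = fl n j * (real n - real j)" by (simp add: fl_def)
  ultimately show ?thesis by simp
qed

lemma fl_pos: "j \<le> n \<Longrightarrow> fl n j > 0"
  unfolding fl_def by (intro prod_pos) auto

lemma fl_0: "n < j \<Longrightarrow> fl n j = 0"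
  unfolding fl_def by (auto simp: prod_zero_iff)

lemma DS_iter_cong':
  "diagram S \<Longrightarrow> l \<le> card S \<Longrightarrow> (\<And>R. diagram R \<Longrightarrow> card R = card S - l \<Longrightarrow> G R = H R)
    \<Longrightarrow> (DS ^^ l) G S = (DS ^^ l) H S"
proof (induction l arbitrary: S)
  case (Suc l)
  have "DS ((DS ^^ l) G) S = DS ((DS ^^ l) H) S"
    unfolding DS_def[of "(DS ^^ l) G"] DS_def[of "(DS ^^ l) H"]
  proof (rule sum.cong[OF refl])
    fix b assume b: "b \<in> Rem S"
    then have bS: "b \<in> S" "finite S" using Rem_subset Suc.prems diagram_finite by auto
    have c: "Suc (card (S - {b})) = card S" using card.remove[OF bS(2,1)] by simp
    have "(DS ^^ l) G (S - {b}) = (DS ^^ l) H (S - {b})"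
      by (rule Suc.IH) (use Suc.prems c Rem_diagram[OF Suc.prems(1) b] in auto)
    then show "real (sdim (S - {b})) / real (sdim S) * (DS ^^ l) G (S - {b}) = real (sdim (S - {b})) / real (sdim S) * (DS ^^ l) H (S - {b})"
      by simp
  qed
  then show ?case by simp
qed simp

lemma DS_sum: "finite I \<Longrightarrow> DS (\<lambda>S. \<Sum>i\<in>I. a i * f i S) = (\<lambda>S. \<Sum>i\<in>I. a i * DS (f i) S)"
proof
  fix S assume "finite I"
  show "DS (\<lambda>S. \<Sum>i\<in>I. a i * f i S) S = (\<Sum>i\<in>I. a i * DS (f i) S)"
    unfolding DS_def sum_distrib_left by (subst sum.swap) (simp add: mult_ac)
qed

lemma DS_iter_sum: "finite I \<Longrightarrow> (DS ^^ l) (\<lambda>S. \<Sum>i\<in>I. a i * f i S) = (\<lambda>S. \<Sum>i\<in>I. a i * (DS ^^ l) (f i) S)"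
  by (induction l) (simp_all add: DS_sum)

lemma DS_iter_scale: "(DS ^^ l) (\<lambda>S. a * f S) = (\<lambda>S. a * (DS ^^ l) f S)"
  using DS_iter_sum[of "{()}" l "\<lambda>_. a" "\<lambda>_. f"] by simp

text \<open>On level n the eigenvalue equation says that \<open>DS\<close> multiplies F by (n - j) /
  n; over l levels the factors telescope to a quotient of falling factorials. The cross-multiplied
  form also covers n < j.\<close>

lemma DS_iter_eigen:
  assumes F: "\<And>S. diagram S \<Longrightarrow> Eul F S = - real j * F S"
  shows "diagram S \<Longrightarrow> l \<le> card S \<Longrightarrow> fl (card S) j * (DS ^^ l) F S = fl (card S - l) j * F S"
proof (induction l)
  case (Suc l)
  let ?n = "card S" let ?m = "?n - l"
  have m: "?m \<ge> 1" using Suc.prems by auto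
  have DSF: "DS F R = ((real ?m - real j) / real ?m) * F R" if "diagram R" "card R = ?m" for R
  proof -
    have "real ?m * (DS F R - F R) = - real j * F R" using F[OF that(1)] that(2) by (simp add: Eul_DS)
    then have "real ?m * DS F R = (real ?m - real j) * F R" by (simp add: algebra_simps)
    moreover have "real ?m \<noteq> 0" using m by auto
    ultimately show ?thesis by (simp add: field_simps)
  qed
  have "(DS ^^ Suc l) F S = (DS ^^ l) (DS F) S" by (simp add: funpow_swap1)
  also have "\<dots> = (DS ^^ l) (\<lambda>R. ((real ?m - real j) / real ?m) * F R) S"
    by (rule DS_iter_cong') (use Suc.prems DSF in auto)
  also have "\<dots> = ((real ?m - real j) / real ?m) * (DS ^^ l) F S" by (simp only: DS_iter_scale)
  finally have "fl ?n j * (DS ^^ Suc l) F S = ((real ?m - real j) / real ?m) * (fl ?n j * (DS ^^ l) F S)" by simp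
  also have "\<dots> = ((real ?m - real j) / real ?m) * (fl ?m j * F S)" using Suc by simp
  also have "\<dots> = (fl ?m j * (real ?m - real j)) / real ?m * F S" by simp
  also have "\<dots> = fl (?m - 1) j * F S" unfolding fl_Suc[OF m] using m by simp
  finally show ?case by simp
qed simp

section \<open>Separation and interpolation on a level\<close>

definition polx :: "((nat \<times> nat) set \<Rightarrow> real) \<Rightarrow> bool" where "polx f \<longleftrightarrow> (\<exists>K. pol K f)"

lemma polx_const: "polx (\<lambda>_. c)" using pol_const polx_def by blast

lemma polx_Suc: "polx f \<Longrightarrow> \<exists>K\<ge>k. pol (Suc K) f"
proof -
  assume "polx f"
  then obtain K where "pol K f" by (auto simp: polx_def)
  then have "pol (Suc (max K k)) f" by (rule pol_mono) simp
  then show ?thesis by (intro exI[of _ "max K k"]) auto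
qed

lemma polx_add: assumes "polx f" "polx g" shows "polx (\<lambda>S. f S + g S)"
proof -
  obtain K L where "pol K f" "pol L g" using assms by (auto simp: polx_def)
  then have "pol (max K L) (\<lambda>S. f S + g S)" by (intro pol_add) (auto elim: pol_mono)
  then show ?thesis by (auto simp: polx_def)
qed

lemma polx_times: assumes "polx f" "polx g" shows "polx (\<lambda>S. f S * g S)"
proof -
  obtain K L where "pol (Suc K) f" "pol (Suc L) g" using polx_Suc[OF assms(1), of 0] polx_Suc[OF assms(2), of 0] by blast
  from pol_times[OF this] show ?thesis by (auto simp: polx_def)
qed

lemma polx_sum: "(\<And>i. i \<in> I \<Longrightarrow> polx (f i)) \<Longrightarrow> polx (\<lambda>S. \<Sum>i\<in>I. f i S)"
  by (induction I rule: infinite_finite_induct) (simp_all add: polx_const polx_add)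

lemma polx_prod: "(\<And>i. i \<in> I \<Longrightarrow> polx (f i)) \<Longrightarrow> polx (\<lambda>S. \<Prod>i\<in>I. f i S)"
  by (induction I rule: infinite_finite_induct) (simp_all add: polx_const polx_times)

lemma polx_contents: "polx (\<lambda>S. \<Sum>b\<in>S. poly q (rc b))"
proof -
  have "(\<Sum>b\<in>S. poly q (rc b)) = (\<Sum>i\<le>degree q. poly.coeff q i * cs i S)" for S
    unfolding poly_altdef cs_def sum_distrib_left by (rule sum.swap)
  moreover have "polx (\<lambda>S. \<Sum>i\<le>degree q. poly.coeff q i * cs i S)"
    by (intro polx_sum polx_times polx_const) (use cs_pol polx_def in blast)
  ultimately show ?thesis by simp
qed

definition diaglen :: "(nat \<times> nat) set \<Rightarrow> int \<Rightarrow> nat" where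
  "diaglen S x = card {b \<in> S. boxcont b = x}"

text \<open>A diagonal of fixed content, read through min i j, is an initial segment because a
  diagram is closed under moving up along it; its length therefore determines it.\<close>

lemma diagram_diaglen: assumes d: "diagram S"
  shows "(i, j) \<in> S \<longleftrightarrow> 1 \<le> i \<and> 1 \<le> j \<and> min i j \<le> diaglen S (int j - int i)"
proof -
  let ?x = "int j - int i"
  let ?B = "{b \<in> S. boxcont b = ?x}" let ?m = "\<lambda>b. min (fst b) (snd b)"
  have fin: "finite ?B" using diagram_finite[OF d] by simp
  have inj: "inj_on ?m ?B" by (auto simp: inj_on_def boxcont_def min_def split: if_splits)
  have "?m ` ?B = {1..card (?m ` ?B)}"
  proof (rule initial_segment_eq)
    show "finite (?m ` ?B)" using fin by simp
    fix t assume "t \<in> ?m ` ?B" then show "1 \<le> t" using diagram_pos[OF d] by auto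
  next
    fix t assume t: "Suc t \<in> ?m ` ?B" "1 \<le> t"
    then obtain a b where ab: "(a, b) \<in> S" "boxcont (a, b) = ?x" "min a b = Suc t" by auto
    have "(a - 1, b - 1) \<in> S" by (rule diagram_down[OF d ab(1)]) (use ab t in auto)
    moreover have "boxcont (a - 1, b - 1) = ?x" "min (a - 1) (b - 1) = t" using ab t by (auto simp: boxcont_def)
    ultimately show "t \<in> ?m ` ?B" by force
  qed
  moreover have "card (?m ` ?B) = diaglen S ?x" using card_image[OF inj] by (simp add: diaglen_def)
  ultimately have im: "?m ` ?B = {1..diaglen S ?x}" by simp
  show ?thesis
  proof
    assume "(i, j) \<in> S"
    then have "min i j \<in> ?m ` ?B" by (force simp: boxcont_def)
    then show "1 \<le> i \<and> 1 \<le> j \<and> min i j \<le> diaglen S ?x" using im diagram_pos[OF d] by auto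
  next
    assume *: "1 \<le> i \<and> 1 \<le> j \<and> min i j \<le> diaglen S ?x"
    then have "min i j \<in> ?m ` ?B" using im by auto
    then obtain a b where ab: "(a, b) \<in> S" "boxcont (a, b) = ?x" "min a b = min i j" by auto
    then have "a = i" "b = j" by (auto simp: boxcont_def min_def split: if_splits)
    then show "(i, j) \<in> S" using ab by simp
  qed
qed

lemma diagram_separation:
  assumes d: "diagram S" "diagram T" and ne: "S \<noteq> T"
  shows "\<exists>f. polx f \<and> f S \<noteq> f T"
proof -
  have "\<exists>x. diaglen S x \<noteq> diaglen T x"
  proof (rule ccontr)
    assume "\<not> ?thesis"
    then have "(i, j) \<in> S \<longleftrightarrow> (i, j) \<in> T" for i j using diagram_diaglen[OF d(1)] diagram_diaglen[OF d(2)] by simp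
    then show False using ne by auto
  qed
  then obtain x where x: "diaglen S x \<noteq> diaglen T x" by blast
  \<comment> \<open>The polynomial q vanishes at every content occurring in S or T except x, so its
    sum over contents counts only the boxes of content x.\<close>
  define X where "X = boxcont ` (S \<union> T) - {x}"
  have finX: "finite X" using d diagram_finite by (auto simp: X_def)
  define q where "q = (\<Prod>y\<in>X. [:- real_of_int y, 1:])"
  have pq: "poly q c = (\<Prod>y\<in>X. c - real_of_int y)" for c by (simp add: q_def poly_prod)
  have q0: "poly q (real_of_int x) \<noteq> 0" unfolding pq using finX by (auto simp: prod_zero_iff X_def)
  have ev: "(\<Sum>b\<in>R. poly q (rc b)) = real (diaglen R x) * poly q (real_of_int x)" if R: "R \<subseteq> S \<union> T" "finite R" for R
  proof -
    have "(\<Sum>b\<in>R. poly q (rc b)) = (\<Sum>b\<in>{b\<in>R. boxcont b = x}. poly q (real_of_int x))"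
    proof (rule sum.mono_neutral_cong_right)
      show "\<forall>b\<in>R - {b \<in> R. boxcont b = x}. poly q (rc b) = 0"
      proof
        fix b assume "b \<in> R - {b \<in> R. boxcont b = x}"
        then have "boxcont b \<in> X" using R by (auto simp: X_def)
        then show "poly q (rc b) = 0" unfolding pq using finX by (auto simp: prod_zero_iff)
      qed
    qed (use R in auto)
    then show ?thesis by (simp add: diaglen_def)
  qed
  have "(\<Sum>b\<in>S. poly q (rc b)) \<noteq> (\<Sum>b\<in>T. poly q (rc b))"
    using ev[of S] ev[of T] d diagram_finite x q0 by auto
  then show ?thesis using polx_contents[of q] by blast
qed

text \<open>Lagrange interpolation with products of separating functions. The degree is not
  controlled; the lift in \<open>GS_eigen\<close> removes the surplus.\<close>

lemma level_interpolation: "\<exists>f. polx f \<and> (\<forall>S. diagram S \<longrightarrow> card S = m \<longrightarrow> f S = G S)"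
proof -
  let ?L = "{S. diagram S \<and> card S = m}"
  have "\<exists>f. polx f \<and> f S \<noteq> f T" if "diagram S" "diagram T" "S \<noteq> T" for S T
    using diagram_separation that by blast
  then obtain sep where sep: "\<And>S T. diagram S \<Longrightarrow> diagram T \<Longrightarrow> S \<noteq> T \<Longrightarrow> polx (sep S T) \<and> sep S T S \<noteq> sep S T T"
    by metis
  define e where "e S R = (\<Prod>T\<in>?L - {S}. (sep S T R + (- sep S T T)) * (1 / (sep S T S - sep S T T)))" for S R
  have e1: "polx (e S)" if "S \<in> ?L" for S
    unfolding e_def[abs_def] by (intro polx_prod polx_times polx_add polx_const) (use sep that in auto)
  have e2: "e S R = (if R = S then 1 else 0)" if "S \<in> ?L" "R \<in> ?L" for S R
  proof (cases "R = S")
    case True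
    have "e S R = (\<Prod>T\<in>?L - {S}. 1)" unfolding e_def
      by (rule prod.cong) (use True sep that in auto)
    then show ?thesis using True by simp
  next
    case False
    then have "e S R = 0" unfolding e_def using finite_diagrams that by (subst prod_zero_iff) auto
    then show ?thesis using False by simp
  qed
  define f where "f R = (\<Sum>S\<in>?L. G S * e S R)" for R
  have "polx f" unfolding f_def[abs_def] by (intro polx_sum polx_times polx_const e1)
  moreover have "f S = G S" if "S \<in> ?L" for S
  proof -
    have "f S = (\<Sum>R\<in>?L. if R = S then G S else 0)" unfolding f_def
      by (rule sum.cong) (use e2 that in auto)
    then show ?thesis using that finite_diagrams by simp
  qed
  ultimately show ?thesis by blast
qed

context zpar begin

text \<open>An up-down step returns to the level it started from, so only proportionality on that
  level matters.\<close>

lemma GS_level: assumes d: "diagram S" and e: "\<And>R. diagram R \<Longrightarrow> card R = card S \<Longrightarrow> f R = c * g R"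
  shows "GS kap s f S = c * GS kap s g S"
proof -
  have "TS kap s f S = TS kap s (\<lambda>R. c * g R + 0 * g R) S"
    by (rule antisym; rule TS_mono[OF d]) (use e in auto)
  then have "TS kap s f S = c * TS kap s g S" using TS_lin[of c g 0 g S] by simp
  then show ?thesis unfolding GS_def using e[OF d] by (simp add: algebra_simps)
qed

text \<open>On level n, f is \<open>fl n k / fl k k\<close> times its own lift from level k, and
  \<open>GS\<close> commutes with the lift. On level k the values of \<open>GS f\<close> are
  interpolated by \<open>H0\<close>; lifting its component of degree j multiplies it by
  \<open>fl k j / fl n j\<close>, which is 0 for j > k.\<close>

lemma GS_eigen:
  assumes f: "\<And>S. diagram S \<Longrightarrow> Eul f S = - real k * f S"
  shows "\<exists>K h. (\<forall>j\<le>k. pol (Suc j) (h j)) \<and>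
    (\<forall>S. diagram S \<longrightarrow> card S \<ge> K \<longrightarrow> GS kap s f S = fl (card S) k / fl k k * (\<Sum>j\<le>k. fl k j / fl (card S) j * h j S))"
proof -
  obtain H0 where H0: "polx H0" "\<And>S. diagram S \<Longrightarrow> card S = k \<Longrightarrow> H0 S = GS kap s f S"
    using level_interpolation[of k "GS kap s f"] by blast
  \<comment> \<open>K bounds the degree of the interpolant; on levels n \<ge> K all
    \<open>fl n j\<close> with j \<le> K are positive and may be divided by.\<close>
  obtain K where K: "K \<ge> k" "pol (Suc K) H0" using polx_Suc[OF H0(1)] by blast
  obtain H where H: "\<And>j. j \<le> K \<Longrightarrow> pol (Suc j) (H j)" "\<And>j S. j \<le> K \<Longrightarrow> diagram S \<Longrightarrow> Eul (H j) S = - real j * H j S"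
    "\<And>S. diagram S \<Longrightarrow> H0 S = (\<Sum>j\<le>K. H j S)"
    using eigen_decomposition[OF K(2)] by blast
  have main: "GS kap s f S = fl (card S) k / fl k k * (\<Sum>j\<le>k. fl k j / fl (card S) j * H j S)"
    if d: "diagram S" and n: "card S \<ge> K" for S
  proof -
    let ?n = "card S" let ?l = "?n - k"
    have nk: "?n \<ge> k" using K n by simp
    have lev: "f R = (fl ?n k / fl k k) * (DS ^^ ?l) f R" if "diagram R" "card R = ?n" for R
    proof -
      have "fl ?n k * (DS ^^ ?l) f R = fl k k * f R"
        using DS_iter_eigen[OF f that(1), of ?l] that nk by simp
      then show ?thesis using fl_pos[of k k] by (simp add: field_simps)
    qed
    have "GS kap s f S = (fl ?n k / fl k k) * GS kap s ((DS ^^ ?l) f) S"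
      by (rule GS_level[OF d]) (use lev in auto)
    also have "GS kap s ((DS ^^ ?l) f) S = (DS ^^ ?l) (GS kap s f) S" by (rule GS_DS_iter[OF d]) simp
    also have "\<dots> = (DS ^^ ?l) (\<lambda>S. \<Sum>j\<le>K. 1 * H j S) S"
      by (rule DS_iter_cong'[OF d]) (use H0(2) H(3) nk in auto)
    also have "\<dots> = (\<Sum>j\<le>K. 1 * (DS ^^ ?l) (H j) S)" by (subst DS_iter_sum) auto
    also have "\<dots> = (\<Sum>j\<le>K. fl k j / fl ?n j * H j S)"
    proof (rule sum.cong[OF refl])
      fix j assume j: "j \<in> {..K}"
      have "fl ?n j * (DS ^^ ?l) (H j) S = fl k j * H j S"
        using DS_iter_eigen[OF H(2) d, of j ?l] j nk by simp
      moreover have "fl ?n j > 0" using fl_pos j n by simp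
      ultimately show "1 * (DS ^^ ?l) (H j) S = fl k j / fl ?n j * H j S" by (simp add: field_simps)
    qed
    also have "\<dots> = (\<Sum>j\<le>k. fl k j / fl ?n j * H j S)"
      by (rule sum.mono_neutral_right) (use K fl_0 in auto)
    finally show ?thesis .
  qed
  show ?thesis by (intro exI[of _ K] exI[of _ H]) (use main H(1) K in auto)
qed

end

section \<open>Frobenius coordinates\<close>


lemma tpt_tendsto:
  fixes X :: "nat \<Rightarrow> tpt"
  assumes "\<And>i. (\<lambda>n. fst (X n) i) \<longlonglongrightarrow> fst x i" "\<And>i. (\<lambda>n. snd (X n) i) \<longlonglongrightarrow> snd x i"
  shows "X \<longlonglongrightarrow> x"
proof -
  have fun_lim: "F \<longlonglongrightarrow> f" if "\<And>i. (\<lambda>n. F n i) \<longlonglongrightarrow> f i" for F :: "nat \<Rightarrow> nat \<Rightarrow> real" and f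
  proof -
    have "limitin (product_topology (\<lambda>i. euclidean) UNIV) F f sequentially"
      unfolding limitin_componentwise using that by auto
    then show ?thesis by (simp add: euclidean_product_topology)
  qed
  have "(\<lambda>n. (fst (X n), snd (X n))) \<longlonglongrightarrow> (fst x, snd x)"
    by (intro tendsto_Pair fun_lim assms)
  then show ?thesis by simp
qed

definition collen :: "(nat \<times> nat) set \<Rightarrow> nat \<Rightarrow> nat" where "collen S j = card {i. (i, j) \<in> S}"

lemma diagram_collen: "diagram S \<Longrightarrow> (i, j) \<in> S \<longleftrightarrow> 1 \<le> i \<and> 1 \<le> j \<and> i \<le> collen S j"
  unfolding collen_def by (rule diagram_col)

definition diagonal :: "(nat \<times> nat) set \<Rightarrow> nat" where "diagonal S = card {i. (i, i) \<in> S}"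

lemma diagram_diagonal: assumes d: "diagram S" shows "(i, i) \<in> S \<longleftrightarrow> 1 \<le> i \<and> i \<le> diagonal S"
proof -
  have "{i. (i, i) \<in> S} = {1..diagonal S}" unfolding diagonal_def
  proof (rule initial_segment_eq)
    show "finite {i. (i, i) \<in> S}" by (rule finite_subset[of _ "fst ` S"]) (use d diagram_finite in force)+
    show "1 \<le> j" if "j \<in> {i. (i, i) \<in> S}" for j using that diagram_pos[OF d] by auto
    show "j \<in> {i. (i, i) \<in> S}" if "Suc j \<in> {i. (i, i) \<in> S}" "1 \<le> j" for j
      using that diagram_down[OF d, of "Suc j" "Suc j" j j] by auto
  qed
  then show ?thesis by (metis (lifting) atLeastAtMost_iff mem_Collect_eq)
qed

text \<open>Group the boxes by the smaller coordinate i: the contents in the i-th diagonal hook fill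
  an interval, so the half-shifted differences telescope to the two ends of the hook.\<close>

lemma hook_sum:
  fixes phi :: "real \<Rightarrow> real"
  assumes d: "diagram S"
  shows "(\<Sum>b\<in>S. phi (rc b + 1/2) - phi (rc b - 1/2))
    = (\<Sum>i=1..diagonal S. phi (real (rowlen S i) - real i + 1/2) - phi (- (real (collen S i) - real i + 1/2)))"
proof -
  let ?h = "\<lambda>b. phi (rc b + 1/2) - phi (rc b - 1/2)"
  let ?m = "\<lambda>b::nat \<times> nat. min (fst b) (snd b)"
  have fin: "finite S" using d diagram_finite by auto
  have inS: "?m b \<in> {1..diagonal S}" if "b \<in> S" for b
  proof -
    obtain i j where b: "b = (i, j)" by (cases b)
    have "(min i j, min i j) \<in> S" by (rule diagram_down[OF d, of i j]) (use that b diagram_pos[OF d, of i j] in auto)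
    then show ?thesis using diagram_diagonal[OF d] b by auto
  qed
  have "(\<Sum>b\<in>S. ?h b) = (\<Sum>i=1..diagonal S. \<Sum>b\<in>{b\<in>S. ?m b = i}. ?h b)"
    by (rule sum.group[symmetric]) (use fin inS in auto)
  also have "\<dots> = (\<Sum>i=1..diagonal S. phi (real (rowlen S i) - real i + 1/2) - phi (- (real (collen S i) - real i + 1/2)))"
  proof (rule sum.cong[OF refl])
    fix i assume i: "i \<in> {1..diagonal S}"
    then have ii: "(i, i) \<in> S" using diagram_diagonal[OF d] by auto
    have r: "i \<le> rowlen S i" "i \<le> collen S i" using ii diagram_row[OF d] diagram_collen[OF d] by auto
    have split: "{b\<in>S. ?m b = i} = (\<lambda>j. (i, j)) ` {i..rowlen S i} \<union> (\<lambda>j. (j, i)) ` {Suc i..collen S i}"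
    proof (intro subset_antisym subsetI)
      fix b assume b: "b \<in> {b\<in>S. ?m b = i}"
      obtain k l where kl: "b = (k, l)" by (cases b)
      have "k \<le> l \<or> Suc l \<le> k" by linarith
      then show "b \<in> (\<lambda>j. (i, j)) ` {i..rowlen S i} \<union> (\<lambda>j. (j, i)) ` {Suc i..collen S i}"
        using b kl diagram_row[OF d, of k l] diagram_collen[OF d, of k l] by (auto simp: min_def split: if_splits)
    next
      fix b assume "b \<in> (\<lambda>j. (i, j)) ` {i..rowlen S i} \<union> (\<lambda>j. (j, i)) ` {Suc i..collen S i}"
      then show "b \<in> {b\<in>S. ?m b = i}"
      proof
        assume "b \<in> (\<lambda>j. (i, j)) ` {i..rowlen S i}"
        then show ?thesis using i diagram_row[OF d] by auto
      next
        assume "b \<in> (\<lambda>j. (j, i)) ` {Suc i..collen S i}"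
        then show ?thesis using i diagram_collen[OF d] by auto
      qed
    qed
    have arm: "(\<Sum>j=i..r. ?h (i, j)) = phi (real r - real i + 1/2) - phi (- 1/2)" if "i \<le> r" for r
      using that
    proof (induction r rule: dec_induct)
      case (step r)
      have "{i..Suc r} = insert (Suc r) {i..r}" using step by auto
      then have "(\<Sum>j=i..Suc r. ?h (i, j)) = ?h (i, Suc r) + (\<Sum>j=i..r. ?h (i, j))" by simp
      then show ?case using step by (simp add: boxcont_def algebra_simps)
    qed (simp add: boxcont_def)
    have leg: "(\<Sum>j=Suc i..c. ?h (j, i)) = phi (- 1/2) - phi (- (real c - real i + 1/2))" if "i \<le> c" for c
      using that
    proof (induction c rule: dec_induct)
      case (step r)
      have "{Suc i..Suc r} = insert (Suc r) {Suc i..r}" using step by auto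
      then have "(\<Sum>j=Suc i..Suc r. ?h (j, i)) = ?h (Suc r, i) + (\<Sum>j=Suc i..r. ?h (j, i))" by simp
      then show ?case using step by (simp add: boxcont_def algebra_simps)
    qed simp
    have "(\<Sum>b\<in>{b\<in>S. ?m b = i}. ?h b) = (\<Sum>b\<in>(\<lambda>j. (i, j)) ` {i..rowlen S i}. ?h b) + (\<Sum>b\<in>(\<lambda>j. (j, i)) ` {Suc i..collen S i}. ?h b)"
      unfolding split by (rule sum.union_disjoint) auto
    also have "(\<Sum>b\<in>(\<lambda>j. (i, j)) ` {i..rowlen S i}. ?h b) = (\<Sum>j=i..rowlen S i. ?h (i, j))"
      by (subst sum.reindex) (auto simp: inj_on_def)
    also have "(\<Sum>b\<in>(\<lambda>j. (j, i)) ` {Suc i..collen S i}. ?h b) = (\<Sum>j=Suc i..collen S i. ?h (j, i))"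
      by (subst sum.reindex) (auto simp: inj_on_def)
    finally show "(\<Sum>b\<in>{b\<in>S. ?m b = i}. ?h b) = phi (real (rowlen S i) - real i + 1/2) - phi (- (real (collen S i) - real i + 1/2))"
      using arm[OF r(1)] leg[OF r(2)] by simp
  qed
  finally show ?thesis .
qed

lemma ycol_collen: "ycol lam j = collen (boxes lam) j"
  by (simp add: ycol_def collen_def)

lemma frob_d_diagonal: "frob_d lam = diagonal (boxes lam)"
proof -
  have "{i. 1 \<le> i \<and> i \<le> yrow lam i} = {i. (i, i) \<in> boxes lam}" by (auto simp: boxes_def)
  then show ?thesis by (simp add: frob_d_def diagonal_def)
qed

lemma frob_hook_sum:
  fixes phi :: "real \<Rightarrow> real"
  assumes "is_partition lam"
  shows "(\<Sum>b\<in>boxes lam. phi (rc b + 1/2) - phi (rc b - 1/2))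
    = (\<Sum>i<frob_d lam. phi (frob_a lam (Suc i)) - phi (- frob_b lam (Suc i)))"
proof -
  have "(\<Sum>b\<in>boxes lam. phi (rc b + 1/2) - phi (rc b - 1/2)) = (\<Sum>i=1..frob_d lam. phi (frob_a lam i) - phi (- frob_b lam i))"
    unfolding hook_sum[OF diagram_boxes[OF assms]] frob_d_diagonal
    by (rule sum.cong) (auto simp: rowlen_boxes frob_a_def frob_b_def ycol_collen)
  also have "\<dots> = (\<Sum>i<frob_d lam. phi (frob_a lam (Suc i)) - phi (- frob_b lam (Suc i)))"
    by (rule sum.reindex_bij_witness[of _ Suc "\<lambda>i. i - 1"]) auto
  finally show ?thesis .
qed

lemma frob_le:
  assumes p: "is_partition lam" and i: "1 \<le> i" "i \<le> frob_d lam"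
  shows "1/2 \<le> frob_a lam i" "1/2 \<le> frob_b lam i"
proof -
  have d: "diagram (boxes lam)" using diagram_boxes[OF p] .
  have "(i, i) \<in> boxes lam" using diagram_diagonal[OF d] i frob_d_diagonal by simp
  then show "1/2 \<le> frob_a lam i" "1/2 \<le> frob_b lam i"
    using diagram_row[OF d, of i i] diagram_collen[OF d, of i i] i by (auto simp: frob_a_def frob_b_def rowlen_boxes ycol_collen)
qed

lemma frob_anti:
  assumes p: "is_partition lam" and i: "1 \<le> i"
  shows "frob_a lam (Suc i) \<le> frob_a lam i" "frob_b lam (Suc i) \<le> frob_b lam i"
proof -
  have d: "diagram (boxes lam)" using diagram_boxes[OF p] .
  have "collen (boxes lam) (Suc i) \<le> collen (boxes lam) i"
    unfolding collen_def by (rule card_mono) (use diagram_fibre_finite'[OF d] diagram_down2[OF d] i in auto)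
  then show "frob_a lam (Suc i) \<le> frob_a lam i" "frob_b lam (Suc i) \<le> frob_b lam i"
    using yrow_anti[OF p i] by (auto simp: frob_a_def frob_b_def ycol_collen)
qed

text \<open>The hook sum for the identity function shows that the total mass is exactly 1: the half
  shifts of the coordinates account for the diagonal boxes.\<close>

lemma iota_Thoma: assumes "lam \<in> YD n" "n \<ge> 1" shows "iota n lam \<in> Thoma"
proof -
  have p: "is_partition lam" and c: "card (boxes lam) = n" using YD_D[OF assms(1)] by auto
  define al be where "al = fst (iota n lam)" and "be = snd (iota n lam)"
  have n: "real n > 0" using assms by simp
  have pos: "0 \<le> al i" "0 \<le> be i" for i
    unfolding al_def be_def iota_def using frob_le[OF p, of "Suc i"] n by auto
  have anti: "al (Suc i) \<le> al i \<and> be (Suc i) \<le> be i" for i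
  proof (cases "Suc (Suc i) \<le> frob_d lam")
    case True
    then show ?thesis unfolding al_def be_def iota_def using frob_anti[OF p, of "Suc i"] n by (auto intro: divide_right_mono)
  next
    case False
    then have "al (Suc i) = 0" "be (Suc i) = 0" by (auto simp: al_def be_def iota_def)
    then show ?thesis using pos[of i] by simp
  qed
  have tot: "(\<Sum>i<frob_d lam. al i + be i) = 1"
  proof -
    have "real n = (\<Sum>b\<in>boxes lam. (rc b + 1/2) - (rc b - 1/2))" using c by simp
    also have "\<dots> = (\<Sum>i<frob_d lam. frob_a lam (Suc i) - (- frob_b lam (Suc i)))"
      using frob_hook_sum[OF p, of "\<lambda>x. x"] .
    finally have t: "real n = (\<Sum>i<frob_d lam. frob_a lam (Suc i) + frob_b lam (Suc i))" by simp
    have "(\<Sum>i<frob_d lam. al i + be i) = (\<Sum>i<frob_d lam. (frob_a lam (Suc i) + frob_b lam (Suc i)) / real n)"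
      by (rule sum.cong) (auto simp: al_def be_def iota_def add_divide_distrib)
    also have "\<dots> = 1" unfolding sum_divide_distrib[symmetric] t[symmetric] using n by simp
    finally show ?thesis .
  qed
  have "(\<Sum>i<N. al i + be i) \<le> 1" for N
  proof -
    have "(\<Sum>i<N. al i + be i) \<le> (\<Sum>i<max N (frob_d lam). al i + be i)"
      by (rule sum_mono2) (use pos in \<open>auto intro: add_nonneg_nonneg\<close>)
    also have "\<dots> = (\<Sum>i<frob_d lam. al i + be i)"
      by (rule sum.mono_neutral_right) (auto simp: al_def be_def iota_def)
    finally show ?thesis using tot by simp
  qed
  then have "(al, be) \<in> Thoma" unfolding Thoma_def using pos anti by auto
  then show ?thesis by (simp add: al_def be_def)
qed

text \<open>The hook sum for x^k; the sign (-1)^(k - 1) is that of - (-b)^k. For k = 1 both sides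
  are n, in accordance with p_1 = 1.\<close>

lemma pk_pcirc: assumes "lam \<in> YD n" "n \<ge> 1" "k \<ge> 1"
  shows "pk k (boxes lam) = real n ^ k * pcirc k (iota n lam)"
proof -
  have p: "is_partition lam" and c: "card (boxes lam) = n" using YD_D[OF assms(1)] by auto
  have n: "real n > 0" using assms by simp
  show ?thesis
  proof (cases "k = 1")
    case True then show ?thesis using pk_1 c by (simp add: pcirc_def)
  next
    case False
    let ?d = "frob_d lam"
    have k0: "k > 0" using assms by simp
    have A: "(\<Sum>i. fst (iota n lam) i ^ k) = (\<Sum>i<?d. (frob_a lam (Suc i) / real n) ^ k)"
      by (subst suminf_finite[of "{..<?d}"]) (use k0 in \<open>auto simp: iota_def\<close>)
    have B: "(\<Sum>i. snd (iota n lam) i ^ k) = (\<Sum>i<?d. (frob_b lam (Suc i) / real n) ^ k)"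
      by (subst suminf_finite[of "{..<?d}"]) (use k0 in \<open>auto simp: iota_def\<close>)
    have sgn: "- ((- x) ^ k) = (-1) ^ (k - 1) * x ^ k" for x :: real
      using k0 by (cases k) (auto simp: power_minus[of x] mult_ac)
    have "pk k (boxes lam) = (\<Sum>i<?d. frob_a lam (Suc i) ^ k - (- frob_b lam (Suc i)) ^ k)"
      unfolding pk_def by (rule frob_hook_sum[OF p])
    also have "\<dots> = (\<Sum>i<?d. frob_a lam (Suc i) ^ k + (-1) ^ (k - 1) * frob_b lam (Suc i) ^ k)"
      unfolding sgn[symmetric] by simp
    also have "\<dots> = (\<Sum>i<?d. real n ^ k * (frob_a lam (Suc i) / real n) ^ k + (-1) ^ (k - 1) * (real n ^ k * (frob_b lam (Suc i) / real n) ^ k))"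
      using n by (simp add: power_divide)
    also have "\<dots> = real n ^ k * pcirc k (iota n lam)"
      unfolding pcirc_def A B using False by (simp add: sum.distrib sum_distrib_left distrib_left mult_ac)
    finally show ?thesis .
  qed
qed

section \<open>Diagrams with prescribed arms and legs\<close>

definition hookd :: "nat \<Rightarrow> (nat \<Rightarrow> nat) \<Rightarrow> (nat \<Rightarrow> nat) \<Rightarrow> (nat \<times> nat) set" where
  "hookd K arm leg = {(i, j). 1 \<le> i \<and> 1 \<le> j \<and> min i j \<le> K \<and> (i \<le> j \<longrightarrow> j - i \<le> arm i) \<and> (j \<le> i \<longrightarrow> i - j \<le> leg j)}"

lemma strict_dec_gap:
  fixes g :: "nat \<Rightarrow> nat"
  assumes "\<And>i. 1 \<le> i \<Longrightarrow> Suc i \<le> K \<Longrightarrow> g (Suc i) < g i" "1 \<le> j" "j \<le> i" "i \<le> K"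
  shows "g i + (i - j) \<le> g j"
  using assms(3,4)
proof (induction i rule: dec_induct)
  case (step i)
  then show ?case using assms(1)[of i] assms(2) by auto
qed simp

lemma hookd_props:
  assumes arm: "\<And>i. 1 \<le> i \<Longrightarrow> Suc i \<le> K \<Longrightarrow> arm (Suc i) < arm i"
      and leg: "\<And>i. 1 \<le> i \<Longrightarrow> Suc i \<le> K \<Longrightarrow> leg (Suc i) < leg i"
  defines "S \<equiv> hookd K arm leg"
  shows "diagram S" "diagonal S = K" "\<And>i. 1 \<le> i \<Longrightarrow> i \<le> K \<Longrightarrow> rowlen S i = i + arm i"
    "\<And>i. 1 \<le> i \<Longrightarrow> i \<le> K \<Longrightarrow> collen S i = i + leg i"
proof -
  have fin: "finite S"
  proof -
    have "S \<subseteq> {0..K + arm 1 + leg 1} \<times> {0..K + arm 1 + leg 1}"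
    proof
      fix b assume b: "b \<in> S"
      obtain i j where ij: "b = (i, j)" by (cases b)
      note bb = b[unfolded S_def hookd_def ij]
      show "b \<in> {0..K + arm 1 + leg 1} \<times> {0..K + arm 1 + leg 1}"
      proof (cases "i \<le> j")
        case True
        then have "i \<le> K" "j - i \<le> arm i" "1 \<le> i" using bb by auto
        moreover have "arm i \<le> arm 1" using strict_dec_gap[of K arm 1 i] arm calculation by auto
        ultimately show ?thesis using ij True by auto
      next
        case False
        then have "j \<le> K" "i - j \<le> leg j" "1 \<le> j" using bb by auto
        moreover have "leg j \<le> leg 1" using strict_dec_gap[of K leg 1 j] leg calculation by auto
        ultimately show ?thesis using ij False by auto
      qed
    qed
    then show ?thesis by (rule finite_subset) auto
  qed
  have d1: "(i, j) \<in> S" if s: "(Suc i, j) \<in> S" "1 \<le> i" for i j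
  proof (cases "Suc i \<le> j")
    case True
    then have "Suc i \<le> K" "j - Suc i \<le> arm (Suc i)" using s by (auto simp: S_def hookd_def)
    then show ?thesis using arm[of i] s True by (auto simp: S_def hookd_def)
  next
    case False
    then show ?thesis using s by (auto simp: S_def hookd_def)
  qed
  have d2: "(i, j) \<in> S" if s: "(i, Suc j) \<in> S" "1 \<le> j" for i j
  proof (cases "Suc j \<le> i")
    case True
    then have "Suc j \<le> K" "i - Suc j \<le> leg (Suc j)" using s by (auto simp: S_def hookd_def)
    then show ?thesis using leg[of j] s True by (auto simp: S_def hookd_def)
  next
    case False
    then show ?thesis using s by (auto simp: S_def hookd_def)
  qed
  have "1 \<le> i \<and> 1 \<le> j" if "(i, j) \<in> S" for i j using that by (auto simp: S_def hookd_def)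
  then show "diagram S" unfolding diagram_def using fin d1 d2 by blast
  have "{i. (i, i) \<in> S} = {1..K}" by (auto simp: S_def hookd_def)
  then show "diagonal S = K" by (simp add: diagonal_def)
  show "rowlen S i = i + arm i" if i: "1 \<le> i" "i \<le> K" for i
  proof -
    have "(i, j) \<in> S \<longleftrightarrow> j \<in> {1..i + arm i}" for j
    proof (cases "i \<le> j")
      case True then show ?thesis using i by (auto simp: S_def hookd_def)
    next
      case False
      show ?thesis
      proof (cases "j = 0")
        case False
        \<comment> \<open>Strictly decreasing legs ensure that row i is full to the left of the
          diagonal.\<close>
        then have "leg i + (i - j) \<le> leg j" using strict_dec_gap[of K leg j i] leg i \<open>\<not> i \<le> j\<close> by auto
        then show ?thesis using i False \<open>\<not> i \<le> j\<close> by (auto simp: S_def hookd_def)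
      qed (simp add: S_def hookd_def)
    qed
    then have "{j. (i, j) \<in> S} = {1..i + arm i}" by blast
    then show ?thesis by (simp add: rowlen_def)
  qed
  show "collen S i = i + leg i" if i: "1 \<le> i" "i \<le> K" for i
  proof -
    have "(j, i) \<in> S \<longleftrightarrow> j \<in> {1..i + leg i}" for j
    proof (cases "i \<le> j")
      case True then show ?thesis using i by (auto simp: S_def hookd_def)
    next
      case False
      show ?thesis
      proof (cases "j = 0")
        case False
        then have "arm i + (i - j) \<le> arm j" using strict_dec_gap[of K arm j i] arm i \<open>\<not> i \<le> j\<close> by auto
        then show ?thesis using i False \<open>\<not> i \<le> j\<close> by (auto simp: S_def hookd_def)
      qed (simp add: S_def hookd_def)
    qed
    then have "{j. (j, i) \<in> S} = {1..i + leg i}" by blast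
    then show ?thesis by (simp add: collen_def)
  qed
qed

lemma hookd_list:
  assumes arm: "\<And>i. 1 \<le> i \<Longrightarrow> Suc i \<le> K \<Longrightarrow> arm (Suc i) < arm i"
      and leg: "\<And>i. 1 \<le> i \<Longrightarrow> Suc i \<le> K \<Longrightarrow> leg (Suc i) < leg i"
      and tot: "(\<Sum>i=1..K. arm i + leg i + 1) = n"
  shows "\<exists>lam\<in>YD n. frob_d lam = K \<and> (\<forall>i. 1 \<le> i \<longrightarrow> i \<le> K \<longrightarrow> frob_a lam i = real (arm i) + 1/2 \<and> frob_b lam i = real (leg i) + 1/2)"
proof -
  let ?S = "hookd K arm leg"
  note hp = hookd_props[of K arm leg, OF arm leg, simplified]
  have d: "diagram ?S" by (rule hp(1))
  have "real (card ?S) = (\<Sum>b\<in>?S. (rc b + 1/2) - (rc b - 1/2))" by simp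
  also have "\<dots> = (\<Sum>i=1..K. (real (rowlen ?S i) - real i + 1/2) - (- (real (collen ?S i) - real i + 1/2)))"
    using hook_sum[OF d, of "\<lambda>x. x"] unfolding hp(2) .
  also have "\<dots> = (\<Sum>i=1..K. real (arm i + leg i + 1))"
    by (rule sum.cong) (use hp(3,4) in auto)
  also have "\<dots> = real n" using tot by (simp only: of_nat_sum[symmetric])
  finally have c: "card ?S = n" by simp
  have b: "boxes (lst ?S) = ?S" using lst_props[OF d] by simp
  show ?thesis
  proof (intro bexI[of _ "lst ?S"] conjI allI impI)
    show "frob_d (lst ?S) = K" unfolding frob_d_diagonal b by (rule hp(2))
    fix i :: nat assume i: "1 \<le> i" "i \<le> K"
    show "frob_a (lst ?S) i = real (arm i) + 1/2"
      using hp(3)[of i] i rowlen_boxes[of i "lst ?S"] by (simp add: frob_a_def b)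
    show "frob_b (lst ?S) i = real (leg i) + 1/2"
      using hp(4)[of i] i by (simp add: frob_b_def ycol_collen b)
  next
    show "lst ?S \<in> YD n" using lst_YD[OF d c] .
  qed
qed

section \<open>Approximation of points of the Thoma simplex\<close>


lemma Thoma_nonneg: "x \<in> Thoma \<Longrightarrow> 0 \<le> fst x i \<and> 0 \<le> snd x i"
  by (auto simp: Thoma_def)

lemma Thoma_sum: "x \<in> Thoma \<Longrightarrow> (\<Sum>i<N. fst x i + snd x i) \<le> 1"
  by (auto simp: Thoma_def)

lemma Thoma_anti: "x \<in> Thoma \<Longrightarrow> fst x (Suc i) \<le> fst x i \<and> snd x (Suc i) \<le> snd x i"
  by (auto simp: Thoma_def)

lemma Thoma_le1: assumes "x \<in> Thoma" shows "fst x i \<le> 1" "snd x i \<le> 1"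
proof -
  have "fst x i + snd x i \<le> (\<Sum>i<Suc i. fst x i + snd x i)"
    using Thoma_nonneg[OF assms] by (simp add: sum_nonneg add_nonneg_nonneg)
  also have "\<dots> \<le> 1" by (rule Thoma_sum[OF assms])
  finally show "fst x i \<le> 1" "snd x i \<le> 1" using Thoma_nonneg[OF assms, of i] by auto
qed

lemma sum_odd_rev: "(\<Sum>i=1..K. 2 * (K - i) + 1) = (K::nat)\<^sup>2"
proof -
  have "(\<Sum>i=1..K. 2 * (K - i) + 1) = (\<Sum>i<K. 2 * i + 1)"
    by (rule sum.reindex_bij_witness[of _ "\<lambda>i. K - i" "\<lambda>i. K - i"]) auto
  also have "\<dots> = K\<^sup>2" by (induction K) (auto simp: power2_eq_square)
  finally show ?thesis .
qed

text \<open>K hooks are built from the integer parts of M times the coordinates, where M = n - K^2.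
  The extra K - i in arm and leg forces strict decrease and, with the diagonal box, uses 2 (K - i) +
  1 boxes per hook, K^2 in total. The boxes still left come from rounding and from mass missing in
  the first K coordinates; spread evenly over the arms they add at most n / K + 1 to each.\<close>

lemma Thoma_approx_step:
  assumes x: "x \<in> Thoma" and K: "1 \<le> K" "K\<^sup>2 \<le> n"
  defines "err \<equiv> (3 + real K + (real K)\<^sup>2) / real n + 1 / real K"
  shows "\<exists>lam\<in>YD n. \<forall>i<K. \<bar>fst (iota n lam) i - fst x i\<bar> \<le> err \<and> \<bar>snd (iota n lam) i - snd x i\<bar> \<le> err"
proof -
  define M where "M = n - K\<^sup>2"
  have M: "real M = real n - (real K)\<^sup>2" using K by (simp add: M_def of_nat_diff)
  have n: "n \<ge> 1" using K by (metis le_trans one_le_power)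
  define A where "A i = nat \<lfloor>fst x (i - 1) * real M\<rfloor>" for i
  define B where "B i = nat \<lfloor>snd x (i - 1) * real M\<rfloor>" for i
  have pos: "0 \<le> fst x i" "0 \<le> snd x i" for i using Thoma_nonneg[OF x] by auto
  have A1: "real (A i) \<le> fst x (i - 1) * real M" "fst x (i - 1) * real M - 1 \<le> real (A i)" for i
  proof -
    have "real (A i) = of_int \<lfloor>fst x (i - 1) * real M\<rfloor>" using pos[of "i - 1"] by (simp add: A_def)
    then show "real (A i) \<le> fst x (i - 1) * real M" "fst x (i - 1) * real M - 1 \<le> real (A i)" by linarith+
  qed
  have B1: "real (B i) \<le> snd x (i - 1) * real M" "snd x (i - 1) * real M - 1 \<le> real (B i)" for i
  proof -
    have "real (B i) = of_int \<lfloor>snd x (i - 1) * real M\<rfloor>" using pos[of "i - 1"] by (simp add: B_def)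
    then show "real (B i) \<le> snd x (i - 1) * real M" "snd x (i - 1) * real M - 1 \<le> real (B i)" by linarith+
  qed
  have Aan: "A (Suc i) \<le> A i" if "1 \<le> i" for i
  proof -
    have "fst x i * real M \<le> fst x (i - 1) * real M" using Thoma_anti[OF x, of "i - 1"] that by (intro mult_right_mono) auto
    then show ?thesis unfolding A_def by (intro nat_mono floor_mono) simp
  qed
  have Ban: "B (Suc i) \<le> B i" if "1 \<le> i" for i
  proof -
    have "snd x i * real M \<le> snd x (i - 1) * real M" using Thoma_anti[OF x, of "i - 1"] that by (intro mult_right_mono) auto
    then show ?thesis unfolding B_def by (intro nat_mono floor_mono) simp
  qed
  have AB: "(\<Sum>i=1..K. A i + B i) \<le> M"
  proof -
    have "real (\<Sum>i=1..K. A i + B i) \<le> (\<Sum>i=1..K. (fst x (i - 1) + snd x (i - 1)) * real M)"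
      unfolding of_nat_sum by (rule sum_mono) (use A1 B1 in \<open>auto simp: distrib_right intro!: add_mono\<close>)
    also have "\<dots> = (\<Sum>i=1..K. fst x (i - 1) + snd x (i - 1)) * real M" by (simp add: sum_distrib_right)
    also have "(\<Sum>i=1..K. fst x (i - 1) + snd x (i - 1)) = (\<Sum>i<K. fst x i + snd x i)"
      by (rule sum.reindex_bij_witness[of _ Suc "\<lambda>i. i - 1"]) auto
    also have "\<dots> * real M \<le> 1 * real M" by (intro mult_right_mono Thoma_sum[OF x]) auto
    finally show ?thesis by (simp only: mult_1 of_nat_le_iff)
  qed
  define ra where "ra = M - (\<Sum>i=1..K. A i + B i)"
  define q where "q = ra div K"
  define rm where "rm = ra mod K"
  \<comment> \<open>Each arm receives q of the remaining boxes and the first \<open>rm\<close> arms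
    one more, which keeps the arms strictly decreasing.\<close>
  define arm where "arm i = A i + (K - i) + q + (if i \<le> rm then 1 else 0)" for i
  define leg where "leg i = B i + (K - i)" for i
  have rmK: "rm < K" using K by (simp add: rm_def)
  have armd: "arm (Suc i) < arm i" if "1 \<le> i" "Suc i \<le> K" for i
    using Aan[OF that(1)] that by (auto simp: arm_def)
  have legd: "leg (Suc i) < leg i" if "1 \<le> i" "Suc i \<le> K" for i
    using Ban[OF that(1)] that by (auto simp: leg_def)
  have tot: "(\<Sum>i=1..K. arm i + leg i + 1) = n"
  proof -
    have "(\<Sum>i=1..K. (if i \<le> rm then 1 else 0)) = card {i\<in>{1..K}. i \<le> rm}" by (simp add: sum.If_cases Int_def)
    also have "{i\<in>{1..K}. i \<le> rm} = {1..rm}" using rmK by auto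
    finally have ind: "(\<Sum>i=1..K. (if i \<le> rm then 1 else 0)) = rm" by simp
    have "(\<Sum>i=1..K. arm i + leg i + 1) = (\<Sum>i=1..K. (A i + B i) + (2 * (K - i) + 1) + q + (if i \<le> rm then 1 else 0))"
      by (rule sum.cong) (auto simp: arm_def leg_def)
    also have "\<dots> = (\<Sum>i=1..K. A i + B i) + (\<Sum>i=1..K. 2 * (K - i) + 1) + (\<Sum>i=1..K. q) + (\<Sum>i=1..K. (if i \<le> rm then 1 else 0))"
      by (simp only: sum.distrib)
    also have "\<dots> = (\<Sum>i=1..K. A i + B i) + K\<^sup>2 + K * q + rm"
      unfolding ind sum_odd_rev by simp
    also have "K * q + rm = ra" by (simp add: q_def rm_def)
    then have "(\<Sum>i=1..K. A i + B i) + K\<^sup>2 + K * q + rm = (\<Sum>i=1..K. A i + B i) + K\<^sup>2 + ra" by simp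
    also have "\<dots> = n" using AB K by (simp add: ra_def M_def)
    finally show ?thesis .
  qed
  obtain lam where lam: "lam \<in> YD n" "frob_d lam = K"
    "\<And>i. 1 \<le> i \<Longrightarrow> i \<le> K \<Longrightarrow> frob_a lam i = real (arm i) + 1/2 \<and> frob_b lam i = real (leg i) + 1/2"
    using hookd_list[of K arm leg n, OF armd legd tot] by blast
  have qn: "real q \<le> real n / real K"
  proof -
    have "q * K \<le> ra" by (simp add: q_def)
    then have "real q * real K \<le> real ra" by (simp only: of_nat_mult[symmetric] of_nat_le_iff)
    then have "real q \<le> real ra / real K" using K by (subst pos_le_divide_eq) auto
    also have "\<dots> \<le> real n / real K" by (intro divide_right_mono) (auto simp: ra_def M_def)
    finally show ?thesis .
  qed
  have nK: "0 \<le> real n / real K" by simp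
  have gen: "\<bar>y / real n - c\<bar> \<le> err" if "\<bar>y - c * real n\<bar> \<le> 3 + real K + (real K)\<^sup>2 + real n / real K" for y c
  proof -
    have np: "real n > 0" using n by simp
    have "\<bar>y / real n - c\<bar> = \<bar>y - c * real n\<bar> / real n" using np by (simp add: abs_divide diff_divide_distrib[symmetric] field_simps)
    also have "\<dots> \<le> (3 + real K + (real K)\<^sup>2 + real n / real K) / real n" using that np by (intro divide_right_mono) auto
    also have "\<dots> = err" unfolding err_def add_divide_distrib using np by simp
    finally show ?thesis .
  qed
  have cM: "c * real n - (real K)\<^sup>2 \<le> c * real M" "c * real M \<le> c * real n" if "0 \<le> c" "c \<le> 1" for c
  proof -
    have "c * (real K)\<^sup>2 \<le> 1 * (real K)\<^sup>2" by (intro mult_right_mono that) auto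
    moreover have "0 \<le> c * (real K)\<^sup>2" using that by auto
    ultimately show "c * real n - (real K)\<^sup>2 \<le> c * real M" "c * real M \<le> c * real n" by (auto simp: M algebra_simps)
  qed
  show ?thesis
  proof (intro bexI[OF _ lam(1)] allI impI conjI)
    fix i assume i: "i < K"
    have fa: "fst (iota n lam) i = (real (arm (Suc i)) + 1/2) / real n" "snd (iota n lam) i = (real (leg (Suc i)) + 1/2) / real n"
      using lam(2) lam(3)[of "Suc i"] i by (auto simp: iota_def)
    have K2: "0 \<le> (real K)\<^sup>2" by simp
    have kk: "real (K - Suc i) \<le> real K" by simp
    show "\<bar>fst (iota n lam) i - fst x i\<bar> \<le> err" unfolding fa
    proof (rule gen)
      have "real (arm (Suc i)) \<le> fst x i * real n + real K + real n / real K + 1"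
      proof -
        have "real (A (Suc i)) \<le> fst x i * real M" using A1(1)[of "Suc i"] by simp
        moreover have "real (arm (Suc i)) \<le> real (A (Suc i)) + real (K - Suc i) + real q + 1" by (simp add: arm_def)
        ultimately show ?thesis using cM(2)[OF pos(1) Thoma_le1(1)[OF x], of i] qn kk by linarith
      qed
      moreover have "fst x i * real n - (real K)\<^sup>2 - 1 \<le> real (arm (Suc i))"
        using A1(2)[of "Suc i"] cM(1)[OF pos(1) Thoma_le1(1)[OF x], of i] by (simp add: arm_def)
      ultimately show "\<bar>real (arm (Suc i)) + 1/2 - fst x i * real n\<bar> \<le> 3 + real K + (real K)\<^sup>2 + real n / real K"
        using nK K2 by linarith
    qed
    show "\<bar>snd (iota n lam) i - snd x i\<bar> \<le> err" unfolding fa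
    proof (rule gen)
      have "real (leg (Suc i)) \<le> snd x i * real n + real K"
        using B1(1)[of "Suc i"] cM(2)[OF pos(2) Thoma_le1(2)[OF x], of i] kk by (simp add: leg_def)
      moreover have "snd x i * real n - (real K)\<^sup>2 - 1 \<le> real (leg (Suc i))"
        using B1(2)[of "Suc i"] cM(1)[OF pos(2) Thoma_le1(2)[OF x], of i] by (simp add: leg_def)
      ultimately show "\<bar>real (leg (Suc i)) + 1/2 - snd x i * real n\<bar> \<le> 3 + real K + (real K)\<^sup>2 + real n / real K"
        using nK K2 by linarith
    qed
  qed
qed

text \<open>With s = n^(1/4) and K its integer part, both K^2 / n and 1 / K tend to 0; for s \<ge> 2
  the error is at most 5 / s + 2 / s.\<close>

lemma Thoma_approx:
  assumes x: "x \<in> Thoma"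
  shows "\<exists>L. (\<forall>n. L n \<in> YD n) \<and> (\<lambda>n. iota n (L n)) \<longlonglongrightarrow> x"
proof -
  define s where "s n = sqrt (sqrt (real n))" for n
  define K where "K n = nat \<lfloor>s n\<rfloor>" for n
  define err where "err n = (3 + real (K n) + (real (K n))\<^sup>2) / real n + 1 / real (K n)" for n
  have s_inf: "filterlim s at_top sequentially" unfolding s_def
    by (intro filterlim_compose[OF sqrt_at_top] filterlim_real_sequentially)
  have s0: "0 \<le> s n" for n by (simp add: s_def)
  have s4: "s n ^ 4 = real n" for n
  proof -
    have "s n ^ 4 = ((s n)\<^sup>2)\<^sup>2" by simp
    then show ?thesis by (simp add: s_def)
  qed
  have Ks: "real (K n) \<le> s n" "s n - 1 \<le> real (K n)" for n
  proof -
    have "real (K n) = of_int \<lfloor>s n\<rfloor>" using s0[of n] by (simp add: K_def)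
    then show "real (K n) \<le> s n" "s n - 1 \<le> real (K n)" by linarith+
  qed
  have Kcond: "1 \<le> K n \<and> (K n)\<^sup>2 \<le> n" if "s n \<ge> 2" for n
  proof -
    have "real (K n) \<ge> 1" using Ks(2)[of n] that by linarith
    then have 1: "1 \<le> K n" by simp
    have "(real (K n))\<^sup>2 \<le> (s n)\<^sup>2" using Ks(1)[of n] by (intro power_mono) auto
    also have "\<dots> \<le> s n ^ 4" by (rule power_increasing) (use that in auto)
    finally have "real ((K n)\<^sup>2) \<le> real n" by (simp add: s4)
    then show ?thesis using 1 by (simp only: of_nat_le_iff)
  qed
  have errb: "err n \<le> 7 / s n" if s2: "s n \<ge> 2" for n
  proof -
    have sp: "s n > 0" using s2 by simp
    have a: "3 + real (K n) + (real (K n))\<^sup>2 \<le> 5 * s n ^ 3"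
    proof -
      have p3: "1 \<le> s n ^ 3" using s2 by (simp add: one_le_power)
      have "real (K n) \<le> s n ^ 3" using Ks(1)[of n] power_increasing[of 1 3 "s n"] s2 by auto
      moreover have "(real (K n))\<^sup>2 \<le> s n ^ 3"
        by (rule order_trans[OF power_mono[OF Ks(1)[of n]] power_increasing[of 2 3 "s n"]]) (use s2 in auto)
      ultimately show ?thesis using p3 by linarith
    qed
    have "(3 + real (K n) + (real (K n))\<^sup>2) / real n \<le> 5 * s n ^ 3 / s n ^ 4"
      unfolding s4[of n, symmetric] by (intro divide_right_mono a) (use s0 in simp)
    also have "\<dots> = 5 / s n" using sp by (simp add: power_eq_if)
    finally have b: "(3 + real (K n) + (real (K n))\<^sup>2) / real n \<le> 5 / s n" .
    have "1 / real (K n) \<le> 1 / (s n / 2)"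
      by (rule divide_left_mono) (use Ks(2)[of n] s2 Kcond[OF s2] in auto)
    then have "1 / real (K n) \<le> 2 / s n" by simp
    then show ?thesis using b unfolding err_def by (simp add: add_divide_distrib[symmetric] add_mono order_trans[OF add_mono[OF b \<open>1 / real (K n) \<le> 2 / s n\<close>]])
  qed
  have ev2: "\<forall>\<^sub>F n in sequentially. s n \<ge> c" for c
    using s_inf by (simp add: filterlim_at_top)
  have "\<exists>lam. lam \<in> YD n \<and> (s n \<ge> 2 \<longrightarrow> (\<forall>i<K n. \<bar>fst (iota n lam) i - fst x i\<bar> \<le> err n \<and> \<bar>snd (iota n lam) i - snd x i\<bar> \<le> err n))" for n
  proof (cases "s n \<ge> 2")
    case True
    then show ?thesis using Thoma_approx_step[OF x, of "K n" n] Kcond[OF True] unfolding err_def by auto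
  next
    case False then show ?thesis using YD_nonempty by auto
  qed
  then obtain L where L: "\<And>n. L n \<in> YD n" "\<And>n i. s n \<ge> 2 \<Longrightarrow> i < K n \<Longrightarrow> \<bar>fst (iota n (L n)) i - fst x i\<bar> \<le> err n \<and> \<bar>snd (iota n (L n)) i - snd x i\<bar> \<le> err n"
    by metis
  have lim7: "(\<lambda>n. 7 / s n) \<longlonglongrightarrow> 0"
    using tendsto_divide_0[OF tendsto_const filterlim_at_top_imp_at_infinity[OF s_inf]] .
  have ev: "\<forall>\<^sub>F n in sequentially. \<bar>fst (iota n (L n)) i - fst x i\<bar> \<le> 7 / s n \<and> \<bar>snd (iota n (L n)) i - snd x i\<bar> \<le> 7 / s n" for i
    using ev2[of "real i + 2"]
  proof eventually_elim
    case (elim n)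
    then have "s n \<ge> 2" by simp
    moreover have "i < K n" using Ks(2)[of n] elim by linarith
    ultimately show ?case using L(2)[of n i] errb[of n] by fastforce
  qed
  have conv: "g \<longlonglongrightarrow> c" if "\<forall>\<^sub>F n in sequentially. \<bar>g n - c\<bar> \<le> 7 / s n" for g :: "nat \<Rightarrow> real" and c
  proof -
    have "(\<lambda>n. g n - c) \<longlonglongrightarrow> 0"
      by (rule Lim_null_comparison[OF _ lim7]) (use that in simp)
    then show ?thesis by (simp add: LIM_zero_iff)
  qed
  have "(\<lambda>n. iota n (L n)) \<longlonglongrightarrow> x"
  proof (rule tpt_tendsto)
    fix i
    show "(\<lambda>n. fst (iota n (L n)) i) \<longlonglongrightarrow> fst x i"
      by (rule conv) (use ev[of i] in \<open>rule eventually_mono, blast\<close>)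
    show "(\<lambda>n. snd (iota n (L n)) i) \<longlonglongrightarrow> snd x i"
      by (rule conv) (use ev[of i] in \<open>rule eventually_mono, blast\<close>)
  qed
  then show ?thesis using L(1) by blast
qed

section \<open>Topology of the Thoma simplex\<close>


lemma continuous_on_coord: "continuous_on A (\<lambda>x::tpt. fst x i)" "continuous_on A (\<lambda>x::tpt. snd x i)"
  by (rule continuous_on_product_then_coordinatewise, intro continuous_intros)+

lemma compact_Thoma: "compact Thoma"
proof -
  let ?C = "PiE UNIV (\<lambda>_::nat. {0..1::real})"
  have "compactin (product_topology (\<lambda>_::nat. euclidean :: real topology) UNIV) ?C"
    unfolding compactin_PiE by auto
  then have "compact ?C" by (simp add: euclidean_product_topology)
  then have C: "compact (?C \<times> ?C)" by (intro compact_Times)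
  have cl: "closed {x::tpt. 0 \<le> fst x i}" "closed {x::tpt. 0 \<le> snd x i}" "closed {x::tpt. fst x (Suc i) \<le> fst x i}"
    "closed {x::tpt. snd x (Suc i) \<le> snd x i}" "closed {x::tpt. (\<Sum>i<i. fst x i + snd x i) \<le> 1}" for i
    by (intro closed_Collect_le continuous_intros continuous_on_coord)+
  have "Thoma = (\<Inter>i. {x. 0 \<le> fst x i}) \<inter> (\<Inter>i. {x. 0 \<le> snd x i}) \<inter> (\<Inter>i. {x. fst x (Suc i) \<le> fst x i})
      \<inter> (\<Inter>i. {x. snd x (Suc i) \<le> snd x i}) \<inter> (\<Inter>i. {x. (\<Sum>i<i. fst x i + snd x i) \<le> 1})"
    unfolding Thoma_def by auto
  moreover have "closed \<dots>" by (intro closed_Int closed_INT ballI cl)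
  ultimately have "closed Thoma" by simp
  moreover have "Thoma \<subseteq> ?C \<times> ?C"
  proof
    fix x assume "x \<in> Thoma"
    then show "x \<in> ?C \<times> ?C" using Thoma_nonneg[of x] Thoma_le1[of x] by (cases x) auto
  qed
  ultimately show ?thesis using C by (metis compact_Int_closed inf.absorb_iff2)
qed

lemma Thoma_zero: "((\<lambda>_. 0), (\<lambda>_. 0)) \<in> Thoma" by (simp add: Thoma_def)

text \<open>A nonincreasing sequence of mass at most 1. The powers from the second on are then
  dominated by a summable sequence uniformly on the simplex, which serves the M-tests for k \<ge>
  2.\<close>

lemma Thoma_decay: assumes x: "x \<in> Thoma" shows "fst x i \<le> 1 / real (Suc i)" "snd x i \<le> 1 / real (Suc i)"
proof -
  have anti: "fst x i \<le> fst x j \<and> snd x i \<le> snd x j" if "j \<le> i" for i j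
    using that by (induction i rule: dec_induct) (use Thoma_anti[OF x] order_trans in blast)+
  have "real (Suc i) * fst x i = (\<Sum>j<Suc i. fst x i)" by simp
  also have "\<dots> \<le> (\<Sum>j<Suc i. fst x j + snd x j)"
    by (rule sum_mono) (use anti Thoma_nonneg[OF x] in \<open>auto intro: add_increasing2\<close>)
  also have "\<dots> \<le> 1" by (rule Thoma_sum[OF x])
  finally show "fst x i \<le> 1 / real (Suc i)" by (simp add: field_simps)
  have "real (Suc i) * snd x i = (\<Sum>j<Suc i. snd x i)" by simp
  also have "\<dots> \<le> (\<Sum>j<Suc i. fst x j + snd x j)"
    by (rule sum_mono) (use anti Thoma_nonneg[OF x] in \<open>auto intro: add_increasing\<close>)
  also have "\<dots> \<le> 1" by (rule Thoma_sum[OF x])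
  finally show "snd x i \<le> 1 / real (Suc i)" by (simp add: field_simps)
qed

lemma Thoma_power_bound: assumes "x \<in> Thoma" "k \<ge> 2"
  shows "norm (fst x i ^ k) \<le> inverse (real (Suc i) ^ 2)" "norm (snd x i ^ k) \<le> inverse (real (Suc i) ^ 2)"
proof -
  have gen: "norm (c ^ k) \<le> inverse (real (Suc i) ^ 2)" if "0 \<le> c" "c \<le> 1" "c \<le> 1 / real (Suc i)" for c :: real
  proof -
    have "c ^ k \<le> c ^ 2" using that assms(2) by (intro power_decreasing) auto
    also have "\<dots> \<le> (1 / real (Suc i)) ^ 2" using that by (intro power_mono) auto
    finally show ?thesis using that by (simp add: power_divide inverse_eq_divide)
  qed
  show "norm (fst x i ^ k) \<le> inverse (real (Suc i) ^ 2)" "norm (snd x i ^ k) \<le> inverse (real (Suc i) ^ 2)"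
    using gen Thoma_nonneg[OF assms(1)] Thoma_le1[OF assms(1)] Thoma_decay[OF assms(1)] by auto
qed

lemma summable_inv_sq: "summable (\<lambda>i. inverse (real (Suc i) ^ 2))"
  using inverse_power_summable[of 2, where 'a = real] by (subst summable_Suc_iff) simp

lemma Thoma_summable: assumes "x \<in> Thoma" "k \<ge> 2"
  shows "summable (\<lambda>i. fst x i ^ k)" "summable (\<lambda>i. snd x i ^ k)"
  by (rule summable_comparison_test'[OF summable_inv_sq]; use Thoma_power_bound[OF assms] in simp)+

text \<open>Weierstrass M-test for k \<ge> 2. For k = 1 the sum of all coordinates would not be
  continuous, as mass can escape in small pieces; the convention p_1 = 1 avoids this.\<close>

lemma continuous_on_pcirc: assumes "k \<ge> 1" shows "continuous_on Thoma (pcirc k)"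
proof (cases "k = 1")
  case True
  then have "pcirc k = (\<lambda>_. 1)" by (auto simp: pcirc_def fun_eq_iff)
  then show ?thesis by simp
next
  case False
  then have k: "k \<ge> 2" using assms by simp
  have 1: "continuous_on Thoma (\<lambda>x. \<Sum>i. fst x i ^ k)"
  proof (rule uniform_limit_theorem[where F = sequentially])
    show "uniform_limit Thoma (\<lambda>n x. \<Sum>i<n. fst x i ^ k) (\<lambda>x. \<Sum>i. fst x i ^ k) sequentially"
      by (rule Weierstrass_m_test[OF _ summable_inv_sq]) (use Thoma_power_bound k in auto)
    show "\<forall>\<^sub>F n in sequentially. continuous_on Thoma (\<lambda>x. \<Sum>i<n. fst x i ^ k)"
      by (intro always_eventually allI continuous_intros continuous_on_coord)
  qed simp
  have 2: "continuous_on Thoma (\<lambda>x. \<Sum>i. snd x i ^ k)"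
  proof (rule uniform_limit_theorem[where F = sequentially])
    show "uniform_limit Thoma (\<lambda>n x. \<Sum>i<n. snd x i ^ k) (\<lambda>x. \<Sum>i. snd x i ^ k) sequentially"
      by (rule Weierstrass_m_test[OF _ summable_inv_sq]) (use Thoma_power_bound k in auto)
    show "\<forall>\<^sub>F n in sequentially. continuous_on Thoma (\<lambda>x. \<Sum>i<n. snd x i ^ k)"
      by (intro always_eventually allI continuous_intros continuous_on_coord)
  qed simp
  have "pcirc k = (\<lambda>x. (\<Sum>i. fst x i ^ k) + (-1) ^ (k - 1) * (\<Sum>i. snd x i ^ k))"
    using False by (auto simp: pcirc_def fun_eq_iff)
  then show ?thesis using 1 2 by (auto intro!: continuous_intros)
qed

text \<open>Integral of g against the signed measure with masses al_i^2 at al_i and -be_i^2 at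
  -be_i, where al and be are the two sequences of x. Its k-th moment is
  \<open>pcirc (k + 2)\<close>.\<close>

definition mom :: "(real \<Rightarrow> real) \<Rightarrow> tpt \<Rightarrow> real" where
  "mom g x = (\<Sum>i. fst x i ^ 2 * g (fst x i)) - (\<Sum>i. snd x i ^ 2 * g (- snd x i))"

lemma mom_summable:
  assumes x: "x \<in> Thoma" and g: "\<And>t. t \<in> {-1..1} \<Longrightarrow> \<bar>g t\<bar> \<le> c"
  shows "summable (\<lambda>i. fst x i ^ 2 * g (fst x i))" "summable (\<lambda>i. snd x i ^ 2 * g (- snd x i))"
    "\<bar>mom g x\<bar> \<le> c * (2 * (\<Sum>i. inverse (real (Suc i) ^ 2)))"
proof -
  let ?b = "\<lambda>i. c * inverse (real (Suc i) ^ 2)"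
  have sb: "summable ?b" by (intro summable_mult summable_inv_sq)
  have b1: "norm (fst x i ^ 2 * g (fst x i)) \<le> ?b i" for i
    using Thoma_power_bound(1)[OF x, of 2 i] g[of "fst x i"] Thoma_nonneg[OF x, of i] Thoma_le1[OF x, of i]
    by (simp add: abs_mult mult.commute[of c] mult_mono)
  have b2: "norm (snd x i ^ 2 * g (- snd x i)) \<le> ?b i" for i
    using Thoma_power_bound(2)[OF x, of 2 i] g[of "- snd x i"] Thoma_nonneg[OF x, of i] Thoma_le1[OF x, of i]
    by (simp add: abs_mult mult.commute[of c] mult_mono)
  show s1: "summable (\<lambda>i. fst x i ^ 2 * g (fst x i))" by (rule summable_comparison_test'[OF sb]) (use b1 in auto)
  show s2: "summable (\<lambda>i. snd x i ^ 2 * g (- snd x i))" by (rule summable_comparison_test'[OF sb]) (use b2 in auto)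
  have "norm (\<Sum>i. fst x i ^ 2 * g (fst x i)) \<le> suminf ?b" by (rule norm_suminf_le[OF b1 sb])
  moreover have "norm (\<Sum>i. snd x i ^ 2 * g (- snd x i)) \<le> suminf ?b" by (rule norm_suminf_le[OF b2 sb])
  moreover have "suminf ?b = c * (\<Sum>i. inverse (real (Suc i) ^ 2))" by (rule suminf_mult[OF summable_inv_sq])
  ultimately show "\<bar>mom g x\<bar> \<le> c * (2 * (\<Sum>i. inverse (real (Suc i) ^ 2)))" unfolding mom_def by simp
qed

lemma mom_power: assumes "x \<in> Thoma" shows "mom (\<lambda>t. t ^ k) x = pcirc (k + 2) x"
proof -
  have a: "fst x i ^ 2 * fst x i ^ k = fst x i ^ (k + 2)" for i by (simp add: power_add power2_eq_square)
  have b: "snd x i ^ 2 * (- snd x i) ^ k = (- 1) ^ k * snd x i ^ (k + 2)" for i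
    by (simp add: power_minus[of "snd x i"] power_add power2_eq_square mult_ac)
  have c: "(\<Sum>i. (- 1) ^ k * snd x i ^ (k + 2)) = (- 1) ^ k * (\<Sum>i. snd x i ^ (k + 2))"
    by (rule suminf_mult[OF Thoma_summable(2)[OF assms]]) simp
  show ?thesis unfolding mom_def pcirc_def a b c by simp
qed

lemma mom_lin:
  assumes x: "x \<in> Thoma" and g: "continuous_on {-1..1} g" and h: "continuous_on {-1..1} h"
  shows "mom (\<lambda>t. a * g t + b * h t) x = a * mom g x + b * mom h x"
proof -
  have bd: "\<exists>c. \<forall>t\<in>{-1..1::real}. \<bar>g t\<bar> \<le> c" if "continuous_on {-1..1} g" for g :: "real \<Rightarrow> real"
    using compact_imp_bounded[OF compact_continuous_image[OF that compact_Icc]] by (auto simp: bounded_iff)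
  obtain c where c: "\<And>t. t \<in> {-1..1} \<Longrightarrow> \<bar>g t\<bar> \<le> c" using bd[OF g] by blast
  obtain e where e: "\<And>t. t \<in> {-1..1} \<Longrightarrow> \<bar>h t\<bar> \<le> e" using bd[OF h] by blast
  note s1 = mom_summable(1,2)[OF x, of g, OF c] and s2 = mom_summable(1,2)[OF x, of h, OF e]
  have alg: "q * (a * u + b * v) = a * (q * u) + b * (q * v)" for q u v :: real by (simp add: algebra_simps)
  have 1: "(\<Sum>i. fst x i ^ 2 * (a * g (fst x i) + b * h (fst x i))) = a * (\<Sum>i. fst x i ^ 2 * g (fst x i)) + b * (\<Sum>i. fst x i ^ 2 * h (fst x i))"
    unfolding alg by (rule sums_unique[symmetric], intro sums_add sums_mult summable_sums s1 s2)
  have 2: "(\<Sum>i. snd x i ^ 2 * (a * g (- snd x i) + b * h (- snd x i))) = a * (\<Sum>i. snd x i ^ 2 * g (- snd x i)) + b * (\<Sum>i. snd x i ^ 2 * h (- snd x i))"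
    unfolding alg by (rule sums_unique[symmetric], intro sums_add sums_mult summable_sums s1 s2)
  show ?thesis unfolding mom_def 1 2 by (simp add: algebra_simps)
qed

lemma mom_polynomial:
  assumes x: "x \<in> Thoma"
  shows "mom (\<lambda>t. \<Sum>i<n. a i * t ^ i) x = (\<Sum>i<n. a i * pcirc (i + 2) x)"
proof (induction n)
  case 0 then show ?case by (simp add: mom_def)
next
  case (Suc n)
  have "mom (\<lambda>t. 1 * (\<Sum>i<n. a i * t ^ i) + a n * t ^ n) x = 1 * mom (\<lambda>t. \<Sum>i<n. a i * t ^ i) x + a n * mom (\<lambda>t. t ^ n) x"
    by (rule mom_lin[OF x]) (intro continuous_intros)+
  then show ?case using Suc mom_power[OF x] by simp
qed

text \<open>Equal moments give equal integrals of polynomials, and by Weierstrass approximation on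
  [-1, 1] of every continuous g, since the total variation is at most Z.\<close>

lemma mom_eq:
  assumes x: "x \<in> Thoma" and y: "y \<in> Thoma" and eq: "\<And>k. k \<ge> 2 \<Longrightarrow> pcirc k x = pcirc k y"
    and g: "continuous_on {-1..1} g"
  shows "mom g x = mom g y"
proof -
  define Z where "Z = 2 * (\<Sum>i. inverse (real (Suc i) ^ 2))"
  have Z: "Z \<ge> 0" unfolding Z_def by (intro mult_nonneg_nonneg suminf_nonneg summable_inv_sq) auto
  have "\<bar>mom g x - mom g y\<bar> \<le> e * (2 * Z)" if e: "e > 0" for e
  proof -
    obtain p where p: "real_polynomial_function p" "\<And>t. t \<in> {-1..1} \<Longrightarrow> \<bar>g t - p t\<bar> < e"
      using Stone_Weierstrass_real_polynomial_function[OF compact_Icc g e] by blast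
    obtain a n where "p = (\<lambda>t. \<Sum>i\<le>n. a i * t ^ i)" using p(1) real_polynomial_function_iff_sum by auto
    then have pa: "p = (\<lambda>t. \<Sum>i<Suc n. a i * t ^ i)" by (simp add: lessThan_Suc_atMost)
    have cp: "continuous_on {-1..1} p" unfolding pa by (intro continuous_intros)
    have mp: "mom p x = mom p y" unfolding pa mom_polynomial[OF x] mom_polynomial[OF y]
      by (rule sum.cong) (auto simp: eq)
    have d: "\<bar>mom g w - mom p w\<bar> \<le> e * Z" if w: "w \<in> Thoma" for w
    proof -
      have "mom (\<lambda>t. 1 * g t + (- 1) * p t) w = 1 * mom g w + (- 1) * mom p w" by (rule mom_lin[OF w g cp])
      moreover have "\<bar>mom (\<lambda>t. 1 * g t + (- 1) * p t) w\<bar> \<le> e * Z"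
        unfolding Z_def by (rule mom_summable(3)[OF w]) (use p(2) less_imp_le in auto)
      ultimately show ?thesis by simp
    qed
    show ?thesis using d[OF x] d[OF y] mp by (simp add: algebra_simps)
  qed
  then have "\<bar>mom g x - mom g y\<bar> \<le> 0"
  proof -
    assume *: "\<And>e. e > 0 \<Longrightarrow> \<bar>mom g x - mom g y\<bar> \<le> e * (2 * Z)"
    show ?thesis
    proof (rule field_le_epsilon)
      fix e :: real assume e: "e > 0"
      have "\<bar>mom g x - mom g y\<bar> \<le> e / (2 * Z + 1) * (2 * Z)" using *[of "e / (2 * Z + 1)"] e Z by auto
      also have "\<dots> \<le> e" using e Z by (simp add: field_simps)
      finally show "\<bar>mom g x - mom g y\<bar> \<le> 0 + e" by simp
    qed
  qed
  then show ?thesis by simp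
qed

lemma separation_fst:
  assumes x: "x \<in> Thoma" and y: "y \<in> Thoma" and eq: "\<And>k. k \<ge> 2 \<Longrightarrow> pcirc k x = pcirc k y"
    and i0: "\<And>i. i < i0 \<Longrightarrow> fst x i = fst y i" "fst y i0 < fst x i0"
  shows False
proof -
  define c c' where "c = fst x i0" and "c' = fst y i0"
  have cc: "c' < c" "0 \<le> c'" using i0(2) Thoma_nonneg[OF y] by (auto simp: c_def c'_def)
  \<comment> \<open>The ramp g is 0 up to c' and 1 from c on. It ignores the atoms at nonpositive
    points, sees only the first i0 coordinates of y, and sees one more coordinate of x, which adds
    c^2.\<close>
  define g where "g t = max 0 (min 1 ((t - c') / (c - c')))" for t
  have g: "continuous_on {-1..1} g" unfolding g_def using cc by (intro continuous_intros) auto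
  have g0: "g t = 0" if "t \<le> c'" for t 
  proof -
    have "(t - c') / (c - c') \<le> 0" using that cc by (intro divide_nonpos_pos) auto
    then show ?thesis by (simp add: g_def)
  qed
  have g1: "g t = 1" if "t \<ge> c" for t using that cc by (auto simp: g_def max_def min_def le_divide_eq)
  have gp: "0 \<le> g t" "g t \<le> 1" for t by (auto simp: g_def)
  have antix: "fst x i \<le> fst x j" if "j \<le> i" for i j
    using that by (induction i rule: dec_induct) (use Thoma_anti[OF x] order_trans in blast)+
  have antiy: "fst y i \<le> fst y j" if "j \<le> i" for i j
    using that by (induction i rule: dec_induct) (use Thoma_anti[OF y] order_trans in blast)+
  have beta: "(\<Sum>i. snd w i ^ 2 * g (- snd w i)) = 0" if "w \<in> Thoma" for w
  proof -
    have "g (- snd w i) = 0" for i by (rule g0) (use Thoma_nonneg[OF that, of i] cc in auto)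
    then show ?thesis by simp
  qed
  have sx: "summable (\<lambda>i. fst x i ^ 2 * g (fst x i))" by (rule mom_summable(1)[OF x, of g 1]) (use gp in auto)
  have gxi: "g (fst x i) = 1" if "i \<le> i0" for i by (rule g1) (use antix[OF that] c_def in simp)
  have "(\<Sum>i<i0. fst x i ^ 2) + c ^ 2 = (\<Sum>i<Suc i0. fst x i ^ 2 * g (fst x i))"
    using gxi by (simp add: c_def)
  also have "\<dots> \<le> (\<Sum>i. fst x i ^ 2 * g (fst x i))" by (rule sum_le_suminf[OF sx]) (use gp in auto)
  finally have X: "(\<Sum>i<i0. fst x i ^ 2) + c ^ 2 \<le> mom g x" unfolding mom_def beta[OF x] by simp
  have "(\<Sum>i. fst y i ^ 2 * g (fst y i)) = (\<Sum>i<i0. fst y i ^ 2 * g (fst y i))"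
  proof (rule suminf_finite)
    fix i assume "i \<notin> {..<i0}"
    then have "fst y i \<le> c'" using antiy[of i0 i] by (simp add: c'_def)
    then show "fst y i ^ 2 * g (fst y i) = 0" using g0 by simp
  qed simp
  also have "\<dots> = (\<Sum>i<i0. fst x i ^ 2)"
  proof (rule sum.cong[OF refl])
    fix i assume "i \<in> {..<i0}"
    then show "fst y i ^ 2 * g (fst y i) = fst x i ^ 2" using i0(1)[of i] gxi[of i] by simp
  qed
  finally have Y: "mom g y = (\<Sum>i<i0. fst x i ^ 2)" unfolding mom_def beta[OF y] by simp
  have "c ^ 2 > 0" using cc by simp
  then show False using X Y mom_eq[OF x y eq g] by simp
qed

lemma separation_fst_eq:
  assumes x: "x \<in> Thoma" and y: "y \<in> Thoma" and eq: "\<And>k. k \<ge> 2 \<Longrightarrow> pcirc k x = pcirc k y"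
  shows "fst x = fst y"
proof (rule ccontr)
  assume "fst x \<noteq> fst y"
  then have "\<exists>i. fst x i \<noteq> fst y i" by auto
  define i0 where "i0 = (LEAST i. fst x i \<noteq> fst y i)"
  have ne: "fst x i0 \<noteq> fst y i0" unfolding i0_def using \<open>\<exists>i. fst x i \<noteq> fst y i\<close> by (rule LeastI_ex)
  have lt: "fst x i = fst y i" if "i < i0" for i using not_less_Least[of i "\<lambda>i. fst x i \<noteq> fst y i"] that by (simp add: i0_def)
  show False
  proof (cases "fst y i0 < fst x i0")
    case True then show False using separation_fst[OF x y eq lt] by blast
  next
    case False
    then have "fst x i0 < fst y i0" using ne by simp
    then show False using separation_fst[OF y x, of i0] eq lt by metis
  qed
qed

text \<open>The alpha coordinates are recovered directly; exchanging the two sequences changes the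
  power sums only by signs and so yields the beta coordinates.\<close>

lemma Thoma_separation:
  assumes x: "x \<in> Thoma" and y: "y \<in> Thoma" and ne: "x \<noteq> y"
  shows "\<exists>k\<ge>2. pcirc k x \<noteq> pcirc k y"
proof (rule ccontr)
  assume "\<not> ?thesis"
  then have eq: "\<And>k. k \<ge> 2 \<Longrightarrow> pcirc k x = pcirc k y" by blast
  have sw: "prod.swap w \<in> Thoma" if "w \<in> Thoma" for w
    using that by (cases w) (auto simp: Thoma_def add.commute)
  have psw: "pcirc k (prod.swap w) = (- 1) ^ (k - 1) * pcirc k w" if "k \<ge> 2" for k w
    using that by (cases w) (auto simp: pcirc_def distrib_left power_mult_distrib[symmetric] mult.assoc[symmetric])
  have "fst x = fst y" by (rule separation_fst_eq[OF x y eq])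
  moreover have "fst (prod.swap x) = fst (prod.swap y)"
    by (rule separation_fst_eq[OF sw[OF x] sw[OF y]]) (simp add: psw eq)
  ultimately show False using ne by (simp add: prod_eq_iff)
qed

section \<open>The generator on symmetric functions\<close>


definition Pm :: "nat \<Rightarrow> nat list set" where "Pm m = {mu. is_partition mu \<and> sum_list mu \<le> m}"

definition mon :: "nat list \<Rightarrow> tpt \<Rightarrow> real" where "mon mu x = (\<Prod>k\<leftarrow>mu. pcirc k x)"

lemma finite_Pm: "finite (Pm m)"
proof -
  have "Pm m = (\<Union>n\<le>m. YD n)" by (auto simp: Pm_def YD_def)
  then show ?thesis using finite_YD by simp
qed

lemma LamC_eq: "LamC m = {restrO (\<lambda>x. \<Sum>mu\<in>Pm m. c mu * mon mu x) | c. True}"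
  by (simp add: LamC_def Pm_def mon_def)

lemma LamC_I: "f = restrO (\<lambda>x. \<Sum>mu\<in>Pm m. c mu * mon mu x) \<Longrightarrow> f \<in> LamC m"
  unfolding LamC_eq by auto

lemma LamC_lin: assumes "f \<in> LamC m" "g \<in> LamC m" shows "(\<lambda>x. a * f x + b * g x) \<in> LamC m"
proof -
  obtain c where c: "f = restrO (\<lambda>x. \<Sum>mu\<in>Pm m. c mu * mon mu x)" using assms(1) by (auto simp: LamC_eq)
  obtain d where d: "g = restrO (\<lambda>x. \<Sum>mu\<in>Pm m. d mu * mon mu x)" using assms(2) by (auto simp: LamC_eq)
  have "(\<lambda>x. a * f x + b * g x) = restrO (\<lambda>x. \<Sum>mu\<in>Pm m. (a * c mu + b * d mu) * mon mu x)"
    unfolding c d restrO_def by (auto simp: fun_eq_iff sum_distrib_left sum.distrib algebra_simps)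
  then show ?thesis by (rule LamC_I)
qed

lemma LamC_zero: "(\<lambda>_. 0) \<in> LamC m"
proof -
  have "(\<lambda>_. 0) = restrO (\<lambda>x. \<Sum>mu\<in>Pm m. (\<lambda>_. 0) mu * mon mu x)" by (auto simp: restrO_def)
  then show ?thesis by (rule LamC_I)
qed

lemma LamC_add: "f \<in> LamC m \<Longrightarrow> g \<in> LamC m \<Longrightarrow> (\<lambda>x. f x + g x) \<in> LamC m"
  using LamC_lin[of f m g 1 1] by simp

lemma LamC_scale: "f \<in> LamC m \<Longrightarrow> (\<lambda>x. a * f x) \<in> LamC m"
  using LamC_lin[of f m f a 0] by simp

lemma LamC_diff: "f \<in> LamC m \<Longrightarrow> g \<in> LamC m \<Longrightarrow> (\<lambda>x. f x - g x) \<in> LamC m"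
  using LamC_lin[of f m g 1 "- 1"] by simp

lemma LamC_sum: "(\<And>i. i \<in> I \<Longrightarrow> f i \<in> LamC m) \<Longrightarrow> (\<lambda>x. \<Sum>i\<in>I. f i x) \<in> LamC m"
  by (induction I rule: infinite_finite_induct) (auto intro: LamC_zero LamC_add)

lemma LamC_mon: assumes "\<forall>k\<in>set mu. 1 \<le> k" "sum_list mu \<le> m" shows "restrO (mon mu) \<in> LamC m"
proof -
  define nu where "nu = rev (sort mu)"
  have "sorted_wrt (\<ge>) nu" by (simp add: nu_def sorted_wrt_rev)
  moreover have ms: "mset nu = mset mu" by (simp add: nu_def)
  moreover have "sum_list nu = sum_list mu" using ms by (metis sum_mset_sum_list)
  moreover have "set nu = set mu" using ms by (metis set_mset_mset)
  ultimately have nu: "nu \<in> Pm m" using assms by (auto simp: Pm_def is_partition_def Suc_le_eq)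
  have "mon nu x = mon mu x" for x
    unfolding mon_def prod_mset_prod_list[symmetric] mset_map ms ..
  then have "(\<Sum>mu'\<in>Pm m. (if mu' = nu then 1 else 0) * mon mu' x) = mon mu x" for x
    using nu finite_Pm[of m] by (simp add: if_distrib[of "\<lambda>c. c * _"] sum.delta cong: if_cong)
  then have "restrO (mon mu) = restrO (\<lambda>x. \<Sum>mu'\<in>Pm m. (\<lambda>mu'. if mu' = nu then 1 else 0) mu' * mon mu' x)" by simp
  then show ?thesis by (rule LamC_I)
qed

lemma Pm_parts: "mu \<in> Pm m \<Longrightarrow> (\<forall>k\<in>set mu. 1 \<le> k) \<and> sum_list mu \<le> m"
  by (auto simp: Pm_def is_partition_def Suc_le_eq)

lemma LamC_expand: assumes "f \<in> LamC m"
  shows "\<exists>c. f = (\<lambda>x. \<Sum>mu\<in>Pm m. c mu * restrO (mon mu) x)"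
proof -
  obtain c where c: "f = restrO (\<lambda>x. \<Sum>mu\<in>Pm m. c mu * mon mu x)" using assms by (auto simp: LamC_eq)
  have "f = (\<lambda>x. \<Sum>mu\<in>Pm m. c mu * restrO (mon mu) x)" unfolding c by (auto simp: restrO_def fun_eq_iff)
  then show ?thesis by blast
qed

lemma LamC_mult: assumes "f \<in> LamC a" "g \<in> LamC b" shows "(\<lambda>x. f x * g x) \<in> LamC (a + b)"
proof -
  obtain c where c: "f = (\<lambda>x. \<Sum>mu\<in>Pm a. c mu * restrO (mon mu) x)" using LamC_expand[OF assms(1)] by blast
  obtain d where d: "g = (\<lambda>x. \<Sum>mu\<in>Pm b. d mu * restrO (mon mu) x)" using LamC_expand[OF assms(2)] by blast
  have mm: "restrO (mon mu) x * restrO (mon nu) x = restrO (mon (mu @ nu)) x" for mu nu x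
    by (simp add: restrO_def mon_def)
  have "(\<lambda>x. f x * g x) = (\<lambda>x. \<Sum>mu\<in>Pm a. \<Sum>nu\<in>Pm b. (c mu * d nu) * restrO (mon (mu @ nu)) x)"
    unfolding c d mm[symmetric] sum_product by (intro ext sum.cong) auto
  moreover have "\<dots> \<in> LamC (a + b)"
  proof (intro LamC_sum LamC_scale LamC_mon)
    fix mu nu assume "mu \<in> Pm a" "nu \<in> Pm b"
    then have "(\<forall>k\<in>set mu. 1 \<le> k) \<and> sum_list mu \<le> a" "(\<forall>k\<in>set nu. 1 \<le> k) \<and> sum_list nu \<le> b" using Pm_parts by auto
    then show "\<forall>k\<in>set (mu @ nu). 1 \<le> k" "sum_list (mu @ nu) \<le> a + b" by auto
  qed
  ultimately show ?thesis by simp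
qed

lemma LamC_mono: assumes "f \<in> LamC a" "a \<le> b" shows "f \<in> LamC b"
proof -
  obtain c where c: "f = (\<lambda>x. \<Sum>mu\<in>Pm a. c mu * restrO (mon mu) x)" using LamC_expand[OF assms(1)] by blast
  have "(\<lambda>x. \<Sum>mu\<in>Pm a. c mu * restrO (mon mu) x) \<in> LamC b"
  proof (intro LamC_sum LamC_scale LamC_mon)
    fix mu assume "mu \<in> Pm a"
    then show "\<forall>k\<in>set mu. 1 \<le> k" "sum_list mu \<le> b" using Pm_parts[of mu a] assms(2) by auto
  qed
  then show ?thesis unfolding c .
qed

lemma LamC_const: "restrO (\<lambda>_. c) \<in> LamC m"
proof -
  have "restrO (\<lambda>_. c) = (\<lambda>x. c * restrO (mon []) x)" by (auto simp: restrO_def mon_def fun_eq_iff)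
  then show ?thesis using LamC_scale[OF LamC_mon[of "[]" m]] by simp
qed

lemma LamC_pcirc: "1 \<le> k \<Longrightarrow> restrO (pcirc k) \<in> LamC k"
proof -
  assume "1 \<le> k"
  moreover have "mon [k] = pcirc k" by (auto simp: mon_def fun_eq_iff)
  ultimately show ?thesis using LamC_mon[of "[k]" k] by simp
qed

lemma continuous_on_mon: "\<forall>k\<in>set mu. 1 \<le> k \<Longrightarrow> continuous_on Thoma (mon mu)"
proof (induction mu)
  case Nil
  have "mon [] = (\<lambda>_. 1)" by (auto simp: mon_def fun_eq_iff)
  then show ?case by simp
next
  case (Cons k mu)
  have "mon (k # mu) = (\<lambda>x. pcirc k x * mon mu x)" by (auto simp: mon_def fun_eq_iff)
  then show ?case using Cons continuous_on_pcirc by (auto intro: continuous_on_mult)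
qed

lemma LamC_CO: assumes "f \<in> LamC m" shows "f \<in> CO"
proof -
  obtain c where c: "f = (\<lambda>x. \<Sum>mu\<in>Pm m. c mu * restrO (mon mu) x)" using LamC_expand[OF assms] by blast
  have "continuous_on Thoma (\<lambda>x. \<Sum>mu\<in>Pm m. c mu * mon mu x)"
    by (intro continuous_intros continuous_on_mon) (use Pm_parts in blast)
  then have "continuous_on Thoma f" unfolding c by (rule continuous_on_eq) (auto simp: restrO_def)
  then show ?thesis unfolding CO_def c by (auto simp: restrO_def)
qed

lemma LamCall_dense: assumes "f \<in> CO" "e > 0" shows "\<exists>h\<in>LamCall. \<forall>x\<in>Thoma. \<bar>f x - h x\<bar> < e"
proof -
  \<comment> \<open>The ring for Stone-Weierstrass must contain the constants as functions on the
    whole type, whereas members of \<open>LamCall\<close> vanish outside the simplex; R therefore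
    compares functions on the simplex only.\<close>
  define R where "R = {g :: tpt \<Rightarrow> real. \<exists>h\<in>LamCall. \<forall>x\<in>Thoma. g x = h x}"
  interpret function_ring_on R Thoma
  proof
    show "compact Thoma" by (rule compact_Thoma)
    fix f assume "f \<in> R"
    then obtain h m where "h \<in> LamC m" "\<forall>x\<in>Thoma. f x = h x" by (auto simp: R_def LamCall_def)
    moreover have "continuous_on Thoma h" using LamC_CO[OF \<open>h \<in> LamC m\<close>] by (simp add: CO_def)
    ultimately show "continuous_on Thoma f" by (metis continuous_on_cong)
  next
    fix f g assume "f \<in> R" "g \<in> R"
    then obtain h k m l where *: "h \<in> LamC m" "\<forall>x\<in>Thoma. f x = h x" "k \<in> LamC l" "\<forall>x\<in>Thoma. g x = k x" by (auto simp: R_def LamCall_def)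
    then have "(\<lambda>x. h x + k x) \<in> LamC (max m l)" by (intro LamC_add) (auto elim: LamC_mono)
    then show "(\<lambda>x. f x + g x) \<in> R" unfolding R_def LamCall_def using * by (auto intro!: bexI[of _ "\<lambda>x. h x + k x"])
    have "(\<lambda>x. h x * k x) \<in> LamC (m + l)" using * by (intro LamC_mult)
    then show "(\<lambda>x. f x * g x) \<in> R" unfolding R_def LamCall_def using * by (auto intro!: bexI[of _ "\<lambda>x. h x * k x"])
  next
    fix c :: real
    show "(\<lambda>_. c) \<in> R" unfolding R_def LamCall_def using LamC_const[of c 0]
      by (auto intro!: bexI[of _ "restrO (\<lambda>_. c)"] simp: restrO_def)
  next
    fix x y assume *: "x \<in> Thoma" "y \<in> Thoma" "x \<noteq> y"
    then obtain k where k: "k \<ge> 2" "pcirc k x \<noteq> pcirc k y" using Thoma_separation by blast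
    have "restrO (pcirc k) \<in> R" unfolding R_def LamCall_def using LamC_pcirc[of k] k by auto
    then show "\<exists>f\<in>R. f x \<noteq> f y" using k * by (intro bexI[of _ "restrO (pcirc k)"]) (auto simp: restrO_def)
  qed
  have "continuous_on Thoma f" using assms(1) by (simp add: CO_def)
  from Stone_Weierstrass_basic[OF this assms(2)] obtain g where "g \<in> R" "\<forall>x\<in>Thoma. \<bar>f x - g x\<bar> < e" by blast
  then show ?thesis unfolding R_def by fastforce
qed

section \<open>Uniform limits and rescaled polynomial functions\<close>

lemma CO_bounded_image: "f \<in> CO \<Longrightarrow> bounded (f ` Thoma)"
  using compact_imp_bounded[OF compact_continuous_image[OF _ compact_Thoma]] unfolding CO_def by blast

lemma CO_outside: "f \<in> CO \<Longrightarrow> x \<notin> Thoma \<Longrightarrow> f x = 0"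
  unfolding CO_def by blast

lemma CO_bounded: assumes "f \<in> CO" shows "\<exists>c. \<forall>x. \<bar>f x\<bar> \<le> c"
proof -
  obtain c where c: "\<And>x. x \<in> Thoma \<Longrightarrow> \<bar>f x\<bar> \<le> c" using CO_bounded_image[OF assms] by (auto simp: bounded_iff)
  have "\<bar>f x\<bar> \<le> max c 0" for x using c[of x] CO_outside[OF assms, of x] by (cases "x \<in> Thoma") auto
  then show ?thesis by blast
qed

lemma uniform_limit_scaled:
  fixes H :: "nat \<Rightarrow> tpt \<Rightarrow> real"
  assumes H: "uniform_limit Thoma H h sequentially" and c: "c \<longlonglongrightarrow> c0" and h: "h \<in> CO"
  shows "uniform_limit Thoma (\<lambda>n x. c n * H n x) (\<lambda>x. c0 * h x) sequentially"
proof (rule uniform_lim_mult[OF _ H])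
  show "uniform_limit Thoma (\<lambda>n x. c n) (\<lambda>x. c0) sequentially"
    unfolding uniform_limit_iff using c by (auto simp: tendsto_iff elim: eventually_mono)
  show "bounded ((\<lambda>x. c0) ` Thoma)" by (auto intro: boundedI)
  show "bounded (h ` Thoma)" by (rule CO_bounded_image[OF h])
qed

lemma uniform_limit_finite_sum:
  fixes H :: "'i \<Rightarrow> nat \<Rightarrow> tpt \<Rightarrow> real"
  assumes "\<And>i. i \<in> I \<Longrightarrow> uniform_limit Thoma (H i) (h i) sequentially"
  shows "uniform_limit Thoma (\<lambda>n x. \<Sum>i\<in>I. H i n x) (\<lambda>x. \<Sum>i\<in>I. h i x) sequentially"
  using assms by (induction I rule: infinite_finite_induct) (auto intro: uniform_limit_const uniform_limit_add)

text \<open>On level n the function f divided by n^m is the pull-back of \<open>F n\<close>, and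
  \<open>F n\<close> converges to \<open>F0\<close>, the part of f of top degree m. Terms of lower
  degree carry negative powers of n and disappear in the limit.\<close>

definition lifts :: "nat \<Rightarrow> ((nat \<times> nat) set \<Rightarrow> real) \<Rightarrow> (nat \<Rightarrow> tpt \<Rightarrow> real) \<Rightarrow> (tpt \<Rightarrow> real) \<Rightarrow> bool" where
  "lifts m f F F0 \<longleftrightarrow> (\<forall>n. F n \<in> LamC m) \<and> F0 \<in> LamC m \<and> uniform_limit Thoma F F0 sequentially \<and>
     (\<forall>n\<ge>1. \<forall>lam\<in>YD n. f (boxes lam) = real n ^ m * F n (iota n lam))"

lemma lifts_zero: "(\<And>S. diagram S \<Longrightarrow> f S = 0) \<Longrightarrow> lifts m f (\<lambda>_ _. 0) (\<lambda>_. 0)"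
  unfolding lifts_def using LamC_zero YD_D by (auto intro: uniform_limit_const)

lemma lifts_mono: assumes "lifts m f F F0" "m \<le> m'" shows "\<exists>G G0. lifts m' f G G0"
proof -
  define c where "c n = (1 / real n) ^ (m' - m)" for n
  define c0 :: real where "c0 = 0 ^ (m' - m)"
  have cl: "c \<longlonglongrightarrow> c0" unfolding c_def c0_def by (intro tendsto_power lim_1_over_n)
  have F0: "F0 \<in> CO" using assms LamC_CO by (auto simp: lifts_def)
  have "lifts m' f (\<lambda>n x. c n * F n x) (\<lambda>x. c0 * F0 x)" unfolding lifts_def
  proof (intro conjI allI impI ballI)
    show "(\<lambda>x. c n * F n x) \<in> LamC m'" for n using assms LamC_mono LamC_scale unfolding lifts_def by blast
    show "(\<lambda>x. c0 * F0 x) \<in> LamC m'" using assms LamC_mono LamC_scale unfolding lifts_def by blast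
    show "uniform_limit Thoma (\<lambda>n x. c n * F n x) (\<lambda>x. c0 * F0 x) sequentially"
      using uniform_limit_scaled[OF _ cl F0] assms by (auto simp: lifts_def)
    fix n lam assume n: "1 \<le> n" "lam \<in> YD n"
    have "real n ^ m = real n ^ m' * c n" using n assms(2) by (simp add: c_def power_divide power_diff)
    then show "f (boxes lam) = real n ^ m' * (c n * F n (iota n lam))" using assms n by (auto simp: lifts_def)
  qed
  then show ?thesis by blast
qed

lemma pol_lifts: "pol M f \<Longrightarrow> \<exists>F F0. lifts (M - 1) f F F0"
proof (induction rule: pol.induct)
  case pol_zero then show ?case using lifts_zero[of "\<lambda>_. 0"] by blast
next
  case (pol_const m c)
  have "lifts 0 (\<lambda>_. c) (\<lambda>_. restrO (\<lambda>_. c)) (restrO (\<lambda>_. c))"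
    unfolding lifts_def using LamC_const iota_Thoma by (auto intro: uniform_limit_const simp: restrO_def)
  from lifts_mono[OF this, of m] show ?case by simp
next
  case (pol_mult m f k)
  show ?case
  proof (cases "m = 0")
    case True
    then have "pk k S * f S = 0" if "diagram S" for S using pol_0[OF pol_mult.hyps(1)] that by simp
    then show ?thesis using lifts_zero[of "\<lambda>S. pk k S * f S"] by blast
  next
    case False
    obtain F F0 where F: "lifts (m - 1) f F F0" using pol_mult.IH by blast
    have F0: "F0 \<in> CO" using F LamC_CO by (auto simp: lifts_def)
    have P: "restrO (pcirc k) \<in> LamC k" using LamC_pcirc[OF pol_mult.hyps(2)] .
    have deg: "m + k - 1 = k + (m - 1)" using False by simp
    have "lifts (m + k - 1) (\<lambda>S. pk k S * f S) (\<lambda>n x. restrO (pcirc k) x * F n x) (\<lambda>x. restrO (pcirc k) x * F0 x)"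
      unfolding lifts_def
    proof (intro conjI allI impI ballI)
      show "(\<lambda>x. restrO (pcirc k) x * F n x) \<in> LamC (m + k - 1)" for n
        unfolding deg using F P by (auto simp: lifts_def intro: LamC_mult)
      show "(\<lambda>x. restrO (pcirc k) x * F0 x) \<in> LamC (m + k - 1)"
        unfolding deg using F P by (auto simp: lifts_def intro: LamC_mult)
      show "uniform_limit Thoma (\<lambda>n x. restrO (pcirc k) x * F n x) (\<lambda>x. restrO (pcirc k) x * F0 x) sequentially"
      proof (rule uniform_lim_mult[OF uniform_limit_const])
        show "uniform_limit Thoma F F0 sequentially" using F by (simp add: lifts_def)
        show "bounded (F0 ` Thoma)" by (rule CO_bounded_image[OF F0])
        show "bounded (restrO (pcirc k) ` Thoma)" by (rule CO_bounded_image[OF LamC_CO[OF P]])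
      qed
      fix n lam assume n: "1 \<le> n" "lam \<in> YD n"
      have "f (boxes lam) = real n ^ (m - 1) * F n (iota n lam)" using F n by (auto simp: lifts_def)
      moreover have "restrO (pcirc k) (iota n lam) = pcirc k (iota n lam)" using iota_Thoma[OF n(2,1)] by (simp add: restrO_def)
      ultimately show "pk k (boxes lam) * f (boxes lam) = real n ^ (m + k - 1) * (restrO (pcirc k) (iota n lam) * F n (iota n lam))"
        unfolding deg using pk_pcirc[OF n(2,1) pol_mult.hyps(2)] by (simp add: power_add)
    qed
    then show ?thesis by blast
  qed
next
  case (pol_add m f g)
  obtain F F0 where F: "lifts (m - 1) f F F0" using pol_add.IH by blast
  obtain G G0 where G: "lifts (m - 1) g G G0" using pol_add.IH by blast
  have "lifts (m - 1) (\<lambda>S. f S + g S) (\<lambda>n x. F n x + G n x) (\<lambda>x. F0 x + G0 x)"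
    using F G unfolding lifts_def by (auto intro: LamC_add uniform_limit_add simp: distrib_left)
  then show ?case by blast
next
  case (pol_mono m f m')
  then show ?case using lifts_mono[of "m - 1" f _ _ "m' - 1"] by (meson diff_le_mono)
next
  case (pol_cong m f g)
  then obtain F F0 where F: "lifts (m - 1) f F F0" by blast
  then have "lifts (m - 1) g F F0" unfolding lifts_def using pol_cong.hyps(2) YD_D by metis
  then show ?case by blast
qed

lemma LamC_pol: assumes "f \<in> LamC m"
  shows "\<exists>fh. pol (Suc m) fh \<and> (\<forall>n\<ge>1. \<forall>lam\<in>YD n. fh (boxes lam) = real n ^ m * f (iota n lam))"
proof -
  have lp: "pol (Suc (sum_list mu)) (\<lambda>S. \<Prod>k\<leftarrow>mu. pk k S)" if "\<forall>k\<in>set mu. 1 \<le> k" for mu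
    using that
  proof (induction mu)
    case (Cons k mu)
    then show ?case using pol_mult[of "Suc (sum_list mu)" "\<lambda>S. \<Prod>k\<leftarrow>mu. pk k S" k] by (simp add: add_ac)
  qed (simp add: pol_const)
  have ev: "(\<Prod>k\<leftarrow>mu. pk k (boxes lam)) = real n ^ sum_list mu * mon mu (iota n lam)"
    if "\<forall>k\<in>set mu. 1 \<le> k" "1 \<le> n" "lam \<in> YD n" for mu n lam
    using that
  proof (induction mu)
    case (Cons k mu)
    then show ?case using pk_pcirc[of lam n k] by (simp add: mon_def power_add mult_ac)
  qed (simp add: mon_def)
  \<comment> \<open>Padding with parts 1 makes every monomial homogeneous of weight m:
    \<open>pk 1\<close> is the number of boxes while \<open>pcirc 1\<close> is 1, so the factor n^m
    becomes exact.\<close>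
  define pad where "pad mu = replicate (m - sum_list mu) 1 @ mu" for mu :: "nat list"
  have mp: "mon (pad mu) x = mon mu x" for mu x
    by (simp add: mon_def pad_def pcirc_def prod_list_replicate)
  have sp: "sum_list (pad mu) = m" "\<forall>k\<in>set (pad mu). 1 \<le> k" if "mu \<in> Pm m" for mu
    using Pm_parts[OF that] by (auto simp: pad_def sum_list_replicate)
  obtain c where c: "f = (\<lambda>x. \<Sum>mu\<in>Pm m. c mu * restrO (mon mu) x)" using LamC_expand[OF assms] by blast
  define fh where "fh S = (\<Sum>mu\<in>Pm m. c mu * (\<Prod>k\<leftarrow>pad mu. pk k S))" for S
  have "pol (Suc m) fh" unfolding fh_def[abs_def]
    by (intro pol_sum pol_scale) (use lp[of "pad _"] sp in metis)
  moreover have "fh (boxes lam) = real n ^ m * f (iota n lam)" if n: "1 \<le> n" "lam \<in> YD n" for n lam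
  proof -
    have "fh (boxes lam) = (\<Sum>mu\<in>Pm m. c mu * (real n ^ m * mon mu (iota n lam)))"
      unfolding fh_def
    proof (rule sum.cong[OF refl])
      fix mu assume mu: "mu \<in> Pm m"
      show "c mu * (\<Prod>k\<leftarrow>pad mu. pk k (boxes lam)) = c mu * (real n ^ m * mon mu (iota n lam))"
        using ev[OF sp(2)[OF mu] n] sp(1)[OF mu] mp by simp
    qed
    also have "\<dots> = real n ^ m * f (iota n lam)"
      unfolding c using iota_Thoma[OF n(2,1)] by (simp add: restrO_def sum_distrib_left mult_ac)
    finally show ?thesis .
  qed
  ultimately show ?thesis by blast
qed

lemma fl_asymp: "(\<lambda>n. fl n j / real n ^ j) \<longlonglongrightarrow> 1"
proof (induction j)
  case 0 then show ?case by (simp add: fl_def)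
next
  case (Suc j)
  have e: "fl n (Suc j) / real n ^ Suc j = (fl n j / real n ^ j) * ((real n - real j) / real n)" for n
    by (simp add: fl_def)
  have "(\<lambda>n. 1 - real j * (1 / real n)) \<longlonglongrightarrow> 1 - real j * 0"
    by (intro tendsto_intros lim_1_over_n)
  moreover have "\<forall>\<^sub>F n in sequentially. 1 - real j * (1 / real n) = (real n - real j) / real n"
    using eventually_gt_at_top[of 0] by eventually_elim (simp add: field_simps)
  ultimately have "(\<lambda>n. (real n - real j) / real n) \<longlonglongrightarrow> 1" by (simp add: tendsto_cong)
  from tendsto_mult[OF Suc this] show ?case unfolding e by simp
qed

context zpar begin

lemma GS_sum: assumes d: "diagram S" and e: "\<And>R. diagram R \<Longrightarrow> card R = card S \<Longrightarrow> f R = (\<Sum>k\<in>I. F k R)" and I: "finite I"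
  shows "GS kap s f S = (\<Sum>k\<in>I. GS kap s (F k) S)"
proof -
  have "TS kap s (\<lambda>R. \<Sum>k\<in>I. F k R) S = (\<Sum>k\<in>I. TS kap s (F k) S)" using I
  proof (induction I rule: finite_induct)
    case empty
    show ?case using TS_const[OF d, of 0] by simp
  next
    case (insert k I)
    then show ?case using TS_lin[of 1 "F k" 1 "\<lambda>R. \<Sum>k\<in>I. F k R" S] by simp
  qed
  moreover have "TS kap s f S = TS kap s (\<lambda>R. \<Sum>k\<in>I. F k R) S"
    by (rule antisym; rule TS_mono[OF d]) (use e in auto)
  ultimately show ?thesis unfolding GS_def using e[OF d] by (simp add: sum_distrib_left sum_subtractf right_diff_distrib)
qed

text \<open>On level n, f is n^(-m) times a polynomial function; this is split into eigenfunctions,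
  and \<open>GS_eigen\<close> applies to each. All dependence on n then sits in the scalars
  \<open>cf\<close> and in the sequences from \<open>lifts\<close>, both convergent.\<close>

lemma generator_limit:
  assumes im: "Im (z * z') = 0" and ks: "kap = Re (z * z')" "s = Re (z + z')" and f: "f \<in> LamC m"
  shows "\<exists>g Af. Af \<in> LamC m \<and> (\<forall>n. g n \<in> LamC m) \<and> uniform_limit Thoma g Af sequentially \<and>
    (\<forall>\<^sub>F n in sequentially. \<forall>lam\<in>YD n. pi_n n (g n) lam = (real n)\<^sup>2 * (Tn z z' n (pi_n n f) lam - pi_n n f lam))"
proof -
  obtain fh where fh: "pol (Suc m) fh" "\<And>n lam. 1 \<le> n \<Longrightarrow> lam \<in> YD n \<Longrightarrow> fh (boxes lam) = real n ^ m * f (iota n lam)"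
    using LamC_pol[OF f] by blast
  obtain F where F: "\<And>k S. k \<le> m \<Longrightarrow> diagram S \<Longrightarrow> Eul (F k) S = - real k * F k S"
    "\<And>S. diagram S \<Longrightarrow> fh S = (\<Sum>k\<le>m. F k S)"
    using eigen_decomposition[OF fh(1)] by blast
  define Q where "Q k K h \<longleftrightarrow> (\<forall>j\<le>k. pol (Suc j) (h j)) \<and>
    (\<forall>S. diagram S \<longrightarrow> card S \<ge> K \<longrightarrow> GS kap s (F k) S = fl (card S) k / fl k k * (\<Sum>j\<le>k. fl k j / fl (card S) j * h j S))" for k K h
  have "\<exists>K h. Q k K h" if "k \<le> m" for k unfolding Q_def by (rule GS_eigen[OF F(1)[OF that]])
  then obtain K where "\<And>k. k \<le> m \<Longrightarrow> \<exists>h. Q k (K k) h" by metis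
  then obtain h where hQ: "\<And>k. k \<le> m \<Longrightarrow> Q k (K k) (h k)" by metis
  have h: "\<And>k j. k \<le> m \<Longrightarrow> j \<le> k \<Longrightarrow> pol (Suc j) (h k j)"
    "\<And>k S. k \<le> m \<Longrightarrow> diagram S \<Longrightarrow> card S \<ge> K k \<Longrightarrow> GS kap s (F k) S = fl (card S) k / fl k k * (\<Sum>j\<le>k. fl k j / fl (card S) j * h k j S)"
    using hQ unfolding Q_def by blast+
  have "\<exists>G. lifts j (h k j) (fst G) (snd G)" if "k \<le> m" "j \<le> k" for k j
    using pol_lifts[OF h(1)[OF that]] by (metis diff_Suc_1 fst_conv snd_conv)
  then obtain G where G: "\<And>k j. k \<le> m \<Longrightarrow> j \<le> k \<Longrightarrow> lifts j (h k j) (fst (G k j)) (snd (G k j))" by metis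
  \<comment> \<open>The four factors are: n^2 against the factor of \<open>GS\<close>, the lift of
    degree k against n^m, the constant from level k, and the rescaling of the component of degree j.
    The second tends to 0 unless k = m.\<close>
  define cf where "cf k j n = (real n)\<^sup>2 / ((kap + real n) * (real n + 1)) * (fl n k / real n ^ m) * (fl k j / fl k k) * (real n ^ j / fl n j)" for k j n
  define cl where "cl k j = (if k = m then fl k j / fl k k else 0)" for k j
  have lim1: "(\<lambda>n. (real n)\<^sup>2 / ((kap + real n) * (real n + 1))) \<longlonglongrightarrow> 1"
  proof -
    have "(\<lambda>n. 1 / ((kap * (1 / real n) + 1) * (1 + 1 / real n))) \<longlonglongrightarrow> 1 / ((kap * 0 + 1) * (1 + 0))"
      by (intro tendsto_intros lim_1_over_n) auto
    moreover have "\<forall>\<^sub>F n in sequentially. 1 / ((kap * (1 / real n) + 1) * (1 + 1 / real n)) = (real n)\<^sup>2 / ((kap + real n) * (real n + 1))"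
      using eventually_gt_at_top[of 0]
    proof eventually_elim
      case (elim n)
      have "(kap * (1 / real n) + 1) * (1 + 1 / real n) = (kap + real n) * (real n + 1) / (real n)\<^sup>2"
        using elim by (simp add: field_simps power2_eq_square)
      then show ?case by simp
    qed
    ultimately show ?thesis by (simp add: tendsto_cong)
  qed
  have lim2: "(\<lambda>n. fl n k / real n ^ m) \<longlonglongrightarrow> (if k = m then 1 else 0)" if k: "k \<le> m" for k
  proof -
    have "(\<lambda>n. fl n k / real n ^ k * (1 / real n) ^ (m - k)) \<longlonglongrightarrow> 1 * 0 ^ (m - k)"
      by (intro tendsto_mult fl_asymp tendsto_power lim_1_over_n)
    moreover have "fl n k / real n ^ k * (1 / real n) ^ (m - k) = fl n k / real n ^ m" for n
      using k by (simp add: power_divide power_add[symmetric])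
    moreover have "1 * 0 ^ (m - k) = (if k = m then 1 else (0::real))" using k by auto
    ultimately show ?thesis by simp
  qed
  have lim3: "(\<lambda>n. real n ^ j / fl n j) \<longlonglongrightarrow> 1" for j
    using tendsto_inverse[OF fl_asymp[of j]] by (simp add: inverse_eq_divide)
  have cfl: "cf k j \<longlonglongrightarrow> cl k j" if "k \<le> m" for k j
  proof -
    have "cf k j \<longlonglongrightarrow> 1 * (if k = m then 1 else 0) * (fl k j / fl k k) * 1"
      unfolding cf_def by (intro tendsto_mult lim1 lim2[OF that] lim3 tendsto_const)
    then show ?thesis by (cases "k = m") (simp_all add: cl_def)
  qed
  define g where "g n x = (\<Sum>k\<le>m. \<Sum>j\<le>k. cf k j n * fst (G k j) n x)" for n x
  define Af where "Af x = (\<Sum>k\<le>m. \<Sum>j\<le>k. cl k j * snd (G k j) x)" for x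
  have inL: "fst (G k j) n \<in> LamC m" "snd (G k j) \<in> LamC m" if "k \<le> m" "j \<le> k" for k j n
    using G[OF that] that LamC_mono[of _ j m] by (auto simp: lifts_def)
  have gL: "g n \<in> LamC m" for n unfolding g_def[abs_def] by (intro LamC_sum LamC_scale inL) auto
  have AL: "Af \<in> LamC m" unfolding Af_def[abs_def] by (intro LamC_sum LamC_scale inL) auto
  have ul: "uniform_limit Thoma g Af sequentially" unfolding g_def[abs_def] Af_def[abs_def]
  proof (intro uniform_limit_finite_sum uniform_limit_scaled)
    fix k j assume "k \<in> {..m}" "j \<in> {..k}"
    then have kj: "k \<le> m" "j \<le> k" by auto
    show "uniform_limit Thoma (fst (G k j)) (snd (G k j)) sequentially" using G[OF kj] by (simp add: lifts_def)
    show "cf k j \<longlonglongrightarrow> cl k j" by (rule cfl[OF kj(1)])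
    show "snd (G k j) \<in> CO" using LamC_CO inL[OF kj] by blast
  qed
  have "\<forall>\<^sub>F n in sequentially. \<forall>lam\<in>YD n. pi_n n (g n) lam = (real n)\<^sup>2 * (Tn z z' n (pi_n n f) lam - pi_n n f lam)"
    using eventually_ge_at_top[of "max 1 (Max (K ` {..m}))"]
  proof eventually_elim
    case (elim n)
    then have n1: "1 \<le> n" and nK: "K k \<le> n" if "k \<le> m" for k
      using that Max_ge[of "K ` {..m}" "K k"] by auto
    have n1: "1 \<le> n" using elim by simp
    show ?case
    proof
      fix lam assume lam: "lam \<in> YD n"
      let ?S = "boxes lam"
      have S: "diagram ?S" "card ?S = n" using YD_D[OF lam] by auto
      have lev: "pi_n n f (lst R) = (1 / real n ^ m) * fh R" if "diagram R" "card R = card ?S" for R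
      proof -
        have "fh (boxes (lst R)) = real n ^ m * f (iota n (lst R))" using fh(2)[OF n1 lst_YD] that S by simp
        then show ?thesis using lst_props(2)[OF that(1)] n1 by (simp add: pi_n_def)
      qed
      have "GS kap s (\<lambda>R. pi_n n f (lst R)) ?S = (1 / real n ^ m) * GS kap s fh ?S"
        by (rule GS_level[OF S(1)]) (use lev in auto)
      also have "GS kap s fh ?S = (\<Sum>k\<le>m. GS kap s (F k) ?S)"
        by (rule GS_sum[OF S(1)]) (use F(2) in auto)
      also have "\<dots> = (\<Sum>k\<le>m. fl n k / fl k k * (\<Sum>j\<le>k. fl k j / fl n j * (real n ^ j * fst (G k j) n (iota n lam))))"
      proof (rule sum.cong[OF refl])
        fix k assume "k \<in> {..m}"
        then have k: "k \<le> m" by simp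
        have "h k j ?S = real n ^ j * fst (G k j) n (iota n lam)" if "j \<le> k" for j
          using G[OF k that] n1 lam by (auto simp: lifts_def)
        then show "GS kap s (F k) ?S = fl n k / fl k k * (\<Sum>j\<le>k. fl k j / fl n j * (real n ^ j * fst (G k j) n (iota n lam)))"
          using h(2)[OF k S(1)] nK[OF k] S(2) by simp
      qed
      finally have GSe: "GS kap s (\<lambda>R. pi_n n f (lst R)) ?S = (1 / real n ^ m) * (\<Sum>k\<le>m. fl n k / fl k k * (\<Sum>j\<le>k. fl k j / fl n j * (real n ^ j * fst (G k j) n (iota n lam))))" .
      have kn: "(kap + real n) * (real n + 1) > 0" using kap by (simp add: add_pos_nonneg)
      have "Tn z z' n (pi_n n f) lam - pi_n n f lam = TS kap s (\<lambda>R. pi_n n f (lst R)) ?S - pi_n n f (lst ?S)"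
        using Tn_TS[OF im lam] ks lst_boxes YD_D[OF lam] by simp
      also have "\<dots> = GS kap s (\<lambda>R. pi_n n f (lst R)) ?S / ((kap + real n) * (real n + 1))"
        unfolding GS_def S(2) by (rule nonzero_mult_div_cancel_left[symmetric]) (use kn in linarith)
      finally have "(real n)\<^sup>2 * (Tn z z' n (pi_n n f) lam - pi_n n f lam)
         = (real n)\<^sup>2 / ((kap + real n) * (real n + 1)) * ((1 / real n ^ m) * (\<Sum>k\<le>m. fl n k / fl k k * (\<Sum>j\<le>k. fl k j / fl n j * (real n ^ j * fst (G k j) n (iota n lam)))))"
        unfolding GSe by simp
      also have "\<dots> = pi_n n (g n) lam"
        unfolding pi_n_def g_def cf_def comp_def sum_distrib_left by (intro sum.cong refl) (simp add: mult_ac)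
      finally show "pi_n n (g n) lam = (real n)\<^sup>2 * (Tn z z' n (pi_n n f) lam - pi_n n f lam)" by simp
    qed
  qed
  then show ?thesis using gL AL ul by blast
qed

end

section \<open>Finite-dimensional invariant spaces\<close>


lemma Thoma_ne: "Thoma \<noteq> {}" using Thoma_zero by auto

lemma supO_le: "(\<And>x. x \<in> Thoma \<Longrightarrow> \<bar>f x\<bar> \<le> c) \<Longrightarrow> supO f \<le> c"
  unfolding supO_def using Thoma_ne by (rule cSUP_least)

lemma supO_ge: assumes "f \<in> CO" shows "\<bar>f x\<bar> \<le> supO f"
proof -
  obtain c where c: "\<forall>x. \<bar>f x\<bar> \<le> c" using CO_bounded[OF assms] by blast
  then have bdd: "bdd_above ((\<lambda>x. \<bar>f x\<bar>) ` Thoma)" by (intro bdd_aboveI[of _ c]) blast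
  have up: "\<bar>f x\<bar> \<le> supO f" if "x \<in> Thoma" for x
    unfolding supO_def using that bdd by (rule cSUP_upper)
  show ?thesis
  proof (cases "x \<in> Thoma")
    case False
    have "0 \<le> supO f" using up[OF Thoma_zero] by linarith
    then show ?thesis using CO_outside[OF assms False] by simp
  qed (rule up)
qed

lemma supO_nonneg: "f \<in> CO \<Longrightarrow> 0 \<le> supO f"
  using supO_ge[of f "((\<lambda>_. 0), (\<lambda>_. 0))"] by linarith

lemma CO_lin: assumes "f \<in> CO" "g \<in> CO" shows "(\<lambda>x. a * f x + b * g x) \<in> CO"
  using assms unfolding CO_def by (auto intro!: continuous_intros)

lemma CO_diff: assumes "f \<in> CO" "g \<in> CO" shows "(\<lambda>x. f x - g x) \<in> CO"
  using CO_lin[OF assms, of 1 "- 1"] by simp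

lemma CO_ext: "f \<in> CO \<Longrightarrow> g \<in> CO \<Longrightarrow> (\<And>x. x \<in> Thoma \<Longrightarrow> f x = g x) \<Longrightarrow> f = g"
  using CO_outside by (metis ext)

lemma uniform_limit_supO:
  assumes "uniform_limit Thoma g h sequentially" "\<And>n. g n \<in> CO" "h \<in> CO"
  shows "(\<lambda>n. supO (\<lambda>x. g n x - h x)) \<longlonglongrightarrow> 0"
proof (rule tendstoI)
  fix e :: real assume e: "e > 0"
  have "\<forall>\<^sub>F n in sequentially. \<forall>x\<in>Thoma. dist (g n x) (h x) < e / 2"
    using assms(1) e unfolding uniform_limit_iff by (meson half_gt_zero)
  then show "\<forall>\<^sub>F n in sequentially. dist (supO (\<lambda>x. g n x - h x)) 0 < e"
  proof eventually_elim
    case (elim n)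
    have "supO (\<lambda>x. g n x - h x) \<le> e / 2" by (rule supO_le) (use elim in \<open>force simp: dist_real_def\<close>)
    moreover have "0 \<le> supO (\<lambda>x. g n x - h x)" by (intro supO_nonneg CO_diff assms)
    ultimately show ?case using e by simp
  qed
qed

text \<open>A fixed choice, for every point of the simplex, of diagrams converging to it; limits
  along this sequence define \<open>A\<close> and \<open>T\<close> pointwise. For other points the
  choice is arbitrary.\<close>

definition ap :: "tpt \<Rightarrow> nat \<Rightarrow> nat list" where
  "ap x = (SOME L. (\<forall>n. L n \<in> YD n) \<and> (x \<in> Thoma \<longrightarrow> (\<lambda>n. iota n (L n)) \<longlonglongrightarrow> x))"

lemma ap: "ap x n \<in> YD n" "x \<in> Thoma \<Longrightarrow> (\<lambda>n. iota n (ap x n)) \<longlonglongrightarrow> x"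
proof -
  have "\<exists>L. (\<forall>n. L n \<in> YD n) \<and> (x \<in> Thoma \<longrightarrow> (\<lambda>n. iota n (L n)) \<longlonglongrightarrow> x)"
  proof (cases "x \<in> Thoma")
    case True then show ?thesis using Thoma_approx by blast
  next
    case False
    have "\<exists>L. \<forall>n. L n \<in> YD n" using YD_nonempty by (meson ex_in_conv)
    then show ?thesis using False by blast
  qed
  from someI_ex[OF this] show "ap x n \<in> YD n" "x \<in> Thoma \<Longrightarrow> (\<lambda>n. iota n (ap x n)) \<longlonglongrightarrow> x"
    unfolding ap_def by blast+
qed

lemma CO_ap: assumes "f \<in> CO" "x \<in> Thoma" shows "(\<lambda>n. f (iota n (ap x n))) \<longlonglongrightarrow> f x"
proof (rule continuous_on_tendsto_compose[where s = Thoma])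
  show "continuous_on Thoma f" using assms by (simp add: CO_def)
  show "(\<lambda>n. iota n (ap x n)) \<longlonglongrightarrow> x" "x \<in> Thoma" using ap assms by auto
  show "\<forall>\<^sub>F n in sequentially. iota n (ap x n) \<in> Thoma"
    using eventually_ge_at_top[of 1] by eventually_elim (use ap iota_Thoma in auto)
qed

text \<open>Evaluation at suitable points gives coordinates on a finite-dimensional function space.\<close>

lemma lagrange_points:
  assumes "finite I" "\<And>i. i \<in> I \<Longrightarrow> fs i \<in> LamC m"
  shows "\<exists>(d::nat) xs es. (\<forall>i<d. xs i \<in> Thoma \<and> es i \<in> LamC m) \<and> (\<forall>i<d. \<forall>j<d. es i (xs j) = (if i = j then 1 else 0)) \<and>
    (\<forall>i\<in>I. \<forall>x. fs i x = (\<Sum>j<d. fs i (xs j) * es j x))"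
  using assms
proof (induction I rule: finite_induct)
  case empty
  show ?case by (intro exI[of _ 0]) auto
next
  case (insert i I)
  have "\<And>i. i \<in> I \<Longrightarrow> fs i \<in> LamC m" using insert.prems by blast
  from insert.IH[OF this] obtain d xs es where d: "\<And>i. i < (d::nat) \<Longrightarrow> xs i \<in> Thoma \<and> es i \<in> LamC m"
    "\<And>i j. i < d \<Longrightarrow> j < d \<Longrightarrow> es i (xs j) = (if i = j then 1 else 0)"
    "\<And>k x. k \<in> I \<Longrightarrow> fs k x = (\<Sum>j<d. fs k (xs j) * es j x)" by blast
  have fi: "fs i \<in> LamC m" using insert by auto
  \<comment> \<open>r is the part of the new function not captured by the present points. If it is
    nonzero at x0, then x0 becomes a new point, r rescaled its dual function, and the old dual
    functions are corrected to vanish at x0.\<close>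
  define r where "r x = fs i x - (\<Sum>j<d. fs i (xs j) * es j x)" for x
  have rL: "r \<in> LamC m" unfolding r_def[abs_def] by (intro LamC_diff fi LamC_sum LamC_scale) (use d in auto)
  show ?case
  proof (cases "\<forall>x. r x = 0")
    case True
    have "fs i x = (\<Sum>j<d. fs i (xs j) * es j x)" for x using spec[OF True, of x] unfolding r_def by linarith
    then show ?thesis using d by (intro exI[of _ d] exI[of _ xs] exI[of _ es]) blast
  next
    case False
    then obtain x0 where x0: "r x0 \<noteq> 0" by blast
    have x0T: "x0 \<in> Thoma" using x0 CO_outside[OF LamC_CO[OF rL]] by blast
    have r0: "r (xs k) = 0" if "k < d" for k
    proof -
      have "(\<Sum>j<d. fs i (xs j) * es j (xs k)) = (\<Sum>j<d. if j = k then fs i (xs k) else 0)"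
        by (rule sum.cong) (use d(2) that in auto)
      then show ?thesis using that by (simp add: r_def)
    qed
    define e' where "e' x = (1 / r x0) * r x" for x
    have e'L: "e' \<in> LamC m" unfolding e'_def[abs_def] by (intro LamC_scale rL)
    define es' where "es' j = (if j < d then (\<lambda>x. es j x - es j x0 * e' x) else e')" for j
    define xs' where "xs' = xs(d := x0)"
    have span: "f x = (\<Sum>j<Suc d. f (xs' j) * es' j x)" if f: "\<And>x. f x = (\<Sum>j<d. f (xs j) * es j x) + c * r x" for f c x
    proof -
      have "(\<Sum>j<Suc d. f (xs' j) * es' j x) = (\<Sum>j<d. f (xs j) * (es j x - es j x0 * e' x)) + f x0 * e' x"
        by (simp add: xs'_def es'_def)
      also have "(\<Sum>j<d. f (xs j) * (es j x - es j x0 * e' x)) = (\<Sum>j<d. f (xs j) * es j x) - (\<Sum>j<d. f (xs j) * es j x0) * e' x"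
        by (simp only: right_diff_distrib sum_subtractf sum_distrib_right mult.assoc)
      also have "(\<Sum>j<d. f (xs j) * es j x0) = f x0 - c * r x0" using f[of x0] by simp
      finally have "(\<Sum>j<Suc d. f (xs' j) * es' j x) = (\<Sum>j<d. f (xs j) * es j x) + c * r x0 * e' x" by (simp add: algebra_simps)
      also have "c * r x0 * e' x = c * r x" using x0 by (simp add: e'_def)
      finally show ?thesis using f[of x] by simp
    qed
    show ?thesis
    proof (intro exI[of _ "Suc d"] exI[of _ xs'] exI[of _ es'] conjI allI impI ballI)
      fix j assume "j < Suc d"
      then show "xs' j \<in> Thoma" "es' j \<in> LamC m"
        using d(1) x0T e'L by (auto simp: xs'_def es'_def intro!: LamC_diff LamC_scale)
    next
      fix j k assume jk: "j < Suc d" "k < Suc d"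
      show "es' j (xs' k) = (if j = k then 1 else 0)"
        using jk d(2) r0 x0 by (cases "k = d") (auto simp: es'_def xs'_def e'_def)
    next
      fix k x assume "k \<in> insert i I"
      then show "fs k x = (\<Sum>j<Suc d. fs k (xs' j) * es' j x)"
      proof
        assume "k = i"
        show ?thesis unfolding \<open>k = i\<close> by (rule span[where c = 1]) (simp add: r_def)
      next
        assume "k \<in> I"
        then show ?thesis by (intro span[where c = 0]) (simp add: d(3)[symmetric])
      qed
    qed
  qed
qed

lemma LamC_coordinates:
  "\<exists>(d::nat) xs es. (\<forall>i<d. xs i \<in> Thoma \<and> es i \<in> LamC m) \<and> (\<forall>f\<in>LamC m. \<forall>x. f x = (\<Sum>j<d. f (xs j) * es j x))"
proof -
  obtain d xs es where d: "\<forall>i<(d::nat). xs i \<in> Thoma \<and> es i \<in> LamC m"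
    "\<And>mu x. mu \<in> Pm m \<Longrightarrow> restrO (mon mu) x = (\<Sum>j<d. restrO (mon mu) (xs j) * es j x)"
    using lagrange_points[OF finite_Pm[of m], of "\<lambda>mu. restrO (mon mu)" m] LamC_mon Pm_parts by blast
  have "f x = (\<Sum>j<d. f (xs j) * es j x)" if f: "f \<in> LamC m" for f x
  proof -
    obtain c where c: "f = (\<lambda>x. \<Sum>mu\<in>Pm m. c mu * restrO (mon mu) x)" using LamC_expand[OF f] by blast
    have "f x = (\<Sum>mu\<in>Pm m. c mu * (\<Sum>j<d. restrO (mon mu) (xs j) * es j x))"
      unfolding c by (rule sum.cong) (simp_all add: d(2)[symmetric])
    also have "\<dots> = (\<Sum>j<d. \<Sum>mu\<in>Pm m. c mu * (restrO (mon mu) (xs j) * es j x))"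
      unfolding sum_distrib_left by (rule sum.swap)
    also have "\<dots> = (\<Sum>j<d. f (xs j) * es j x)" unfolding c sum_distrib_right by (simp add: mult.assoc)
    finally show ?thesis .
  qed
  then show ?thesis using d(1) by blast
qed

text \<open>Finitely many points determine f, and each is approximated by embedded diagrams. If f
  vanishes on the diagrams, the sum T of the absolute values of f at the points satisfies T \<le> T
  * err, with err < 1 for large n independently of f.\<close>

lemma pi_n_injective:
  "\<forall>\<^sub>F n in sequentially. \<forall>f\<in>LamC m. (\<forall>lam\<in>YD n. pi_n n f lam = 0) \<longrightarrow> f = (\<lambda>_. 0)"
proof -
  obtain d xs es where d: "\<And>i. i < (d::nat) \<Longrightarrow> xs i \<in> Thoma \<and> es i \<in> LamC m" "\<And>f x. f \<in> LamC m \<Longrightarrow> f x = (\<Sum>j<d. f (xs j) * es j x)"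
    using LamC_coordinates[of m] by blast
  define err where "err n = (\<Sum>j<d. \<Sum>i<d. \<bar>es i (xs j) - es i (iota n (ap (xs j) n))\<bar>)" for n
  have "err \<longlonglongrightarrow> (\<Sum>j<d. \<Sum>i<d. \<bar>es i (xs j) - es i (xs j)\<bar>)" unfolding err_def
    by (intro tendsto_sum tendsto_rabs tendsto_diff tendsto_const CO_ap) (use d(1) LamC_CO in blast)+
  then have "err \<longlonglongrightarrow> 0" by simp
  then have "\<forall>\<^sub>F n in sequentially. err n < 1" by (rule order_tendstoD) simp
  then show ?thesis
  proof eventually_elim
    case (elim n)
    show ?case
    proof (intro ballI impI)
      fix f assume f: "f \<in> LamC m" and z: "\<forall>lam\<in>YD n. pi_n n f lam = 0"
      define T where "T = (\<Sum>j<d. \<bar>f (xs j)\<bar>)"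
      have T0: "T \<ge> 0" by (simp add: T_def sum_nonneg)
      have "\<bar>f (xs j)\<bar> \<le> (\<Sum>i<d. T * \<bar>es i (xs j) - es i (iota n (ap (xs j) n))\<bar>)" if "j < d" for j
      proof -
        let ?y = "iota n (ap (xs j) n)"
        have "f ?y = 0" using z ap(1)[of "xs j" n] by (auto simp: pi_n_def)
        then have "f (xs j) = f (xs j) - f ?y" by simp
        also have "\<dots> = (\<Sum>i<d. f (xs i) * (es i (xs j) - es i ?y))"
          by (subst (1 2) d(2)[OF f]) (simp add: right_diff_distrib sum_subtractf)
        finally have "\<bar>f (xs j)\<bar> \<le> (\<Sum>i<d. \<bar>f (xs i) * (es i (xs j) - es i ?y)\<bar>)" by (metis sum_abs)
        also have "\<dots> \<le> (\<Sum>i<d. T * \<bar>es i (xs j) - es i ?y\<bar>)"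
          unfolding abs_mult
        proof (rule sum_mono, rule mult_right_mono)
          fix i assume "i \<in> {..<d}"
          then show "\<bar>f (xs i)\<bar> \<le> T" unfolding T_def by (intro member_le_sum) auto
        qed simp
        finally show ?thesis .
      qed
      then have "T \<le> (\<Sum>j<d. \<Sum>i<d. T * \<bar>es i (xs j) - es i (iota n (ap (xs j) n))\<bar>)"
        unfolding T_def by (intro sum_mono) (simp add: T_def)
      also have "\<dots> = T * err n" by (simp add: err_def sum_distrib_left)
      finally have "T * (1 - err n) \<le> 0" by (simp add: algebra_simps)
      then have "T = 0" using elim T0 by (simp add: mult_le_0_iff)
      then have "\<forall>j\<in>{..<d}. \<bar>f (xs j)\<bar> = 0" unfolding T_def by (subst (asm) sum_nonneg_eq_0_iff) auto
      then have z: "f (xs j) * es j x = 0" if "j \<in> {..<d}" for j x using that by simp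
      show "f = (\<lambda>_. 0)"
      proof
        fix x
        have "f x = (\<Sum>j<d. f (xs j) * es j x)" by (rule d(2)[OF f])
        also have "\<dots> = 0" by (rule sum.neutral) (use z in blast)
        finally show "f x = 0" .
      qed
    qed
  qed
qed

text \<open>All that the passage to the limit uses of the chains: Markov operators on the levels
  whose rescaled generators converge on each \<open>LamC m\<close>.\<close>

locale scheme =
  fixes P :: "nat \<Rightarrow> (nat list \<Rightarrow> real) \<Rightarrow> nat list \<Rightarrow> real"
  assumes P_lin: "\<And>n lam a b g h. lam \<in> YD n \<Longrightarrow> P n (\<lambda>l. a * g l + b * h l) lam = a * P n g lam + b * P n h lam"
    and P_mono: "\<And>n lam g h. lam \<in> YD n \<Longrightarrow> (\<And>l. l \<in> YD n \<Longrightarrow> g l \<le> h l) \<Longrightarrow> P n g lam \<le> P n h lam"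
    and P_const: "\<And>n lam c. lam \<in> YD n \<Longrightarrow> P n (\<lambda>_. c) lam = c"
    and P_gen: "\<And>m f. f \<in> LamC m \<Longrightarrow> \<exists>g Af. Af \<in> LamC m \<and> (\<forall>n. g n \<in> LamC m) \<and> uniform_limit Thoma g Af sequentially \<and>
    (\<forall>\<^sub>F n in sequentially. \<forall>lam\<in>YD n. pi_n n (g n) lam = (real n)\<^sup>2 * (P n (pi_n n f) lam - pi_n n f lam))"
begin

lemma P_cong: "lam \<in> YD n \<Longrightarrow> (\<And>l. l \<in> YD n \<Longrightarrow> g l = h l) \<Longrightarrow> P n g lam = P n h lam"
  by (rule antisym; rule P_mono) auto

lemma P_bound: assumes "lam \<in> YD n" "\<And>l. l \<in> YD n \<Longrightarrow> \<bar>g l\<bar> \<le> c" shows "\<bar>P n g lam\<bar> \<le> c"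
proof -
  have "P n g lam \<le> P n (\<lambda>_. c) lam" by (rule P_mono[OF assms(1)]) (use assms(2) in force)
  moreover have "P n (\<lambda>_. - c) lam \<le> P n g lam" by (rule P_mono[OF assms(1)]) (use assms(2) in force)
  ultimately show ?thesis using P_const[OF assms(1)] by auto
qed

lemma P_diff_bound: assumes "lam \<in> YD n" "\<And>l. l \<in> YD n \<Longrightarrow> \<bar>g l - h l\<bar> \<le> c" shows "\<bar>P n g lam - P n h lam\<bar> \<le> c"
  using P_bound[OF assms(1), of "\<lambda>l. 1 * g l + (- 1) * h l" c] P_lin[OF assms(1), of 1 g "- 1" h] assms(2) by simp

lemma P_sum: "lam \<in> YD n \<Longrightarrow> P n (\<lambda>l. \<Sum>i<(d::nat). a i * g i l) lam = (\<Sum>i<d. a i * P n (g i) lam)"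
proof (induction d)
  case 0 then show ?case using P_const[of lam n 0] by simp
next
  case (Suc d)
  then show ?case using P_lin[OF Suc.prems, of 1 "\<lambda>l. \<Sum>i<d. a i * g i l" "a d" "g d"] by simp
qed

lemma iter_lin: "lam \<in> YD n \<Longrightarrow> (P n ^^ k) (\<lambda>l. a * g l + b * h l) lam = a * (P n ^^ k) g lam + b * (P n ^^ k) h lam"
proof (induction k arbitrary: lam)
  case (Suc k)
  have "P n ((P n ^^ k) (\<lambda>l. a * g l + b * h l)) lam = P n (\<lambda>l. a * (P n ^^ k) g l + b * (P n ^^ k) h l) lam"
    by (rule P_cong[OF Suc.prems]) (rule Suc.IH)
  then show ?case using P_lin[OF Suc.prems] by simp
qed simp

lemma iter_bound: "lam \<in> YD n \<Longrightarrow> (\<And>l. l \<in> YD n \<Longrightarrow> \<bar>g l\<bar> \<le> c) \<Longrightarrow> \<bar>(P n ^^ k) g lam\<bar> \<le> c"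
  by (induction k arbitrary: lam) (auto intro: P_bound)

lemma iter_diff_bound: assumes "lam \<in> YD n" "\<And>l. l \<in> YD n \<Longrightarrow> \<bar>g l - h l\<bar> \<le> c" shows "\<bar>(P n ^^ k) g lam - (P n ^^ k) h lam\<bar> \<le> c"
  using iter_bound[OF assms(1), of "\<lambda>l. 1 * g l + (- 1) * h l" c k] iter_lin[OF assms(1), of k 1 g "- 1" h] assms(2) by simp

lemma iter_nonneg: "lam \<in> YD n \<Longrightarrow> (\<And>l. l \<in> YD n \<Longrightarrow> 0 \<le> g l) \<Longrightarrow> 0 \<le> (P n ^^ k) g lam"
proof (induction k arbitrary: lam)
  case (Suc k)
  have "P n (\<lambda>_. 0) lam \<le> P n ((P n ^^ k) g) lam" by (rule P_mono) (use Suc in auto)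
  then show ?case using P_const[OF Suc.prems(1)] by simp
qed auto

lemma iter_const: "lam \<in> YD n \<Longrightarrow> (\<And>l. l \<in> YD n \<Longrightarrow> g l = c) \<Longrightarrow> (P n ^^ k) g lam = c"
proof (induction k arbitrary: lam)
  case (Suc k)
  have "P n ((P n ^^ k) g) lam = P n (\<lambda>_. c) lam" by (rule P_cong) (use Suc in auto)
  then show ?case using P_const[OF Suc.prems(1)] by simp
qed auto

text \<open>The definition does not mention the degree m, so one operator serves all the spaces
  \<open>LamC m\<close>; \<open>A_gen\<close> identifies it with the limit on each of them.\<close>

definition A :: "(tpt \<Rightarrow> real) \<Rightarrow> tpt \<Rightarrow> real" where
  "A f x = (if x \<in> Thoma then lim (\<lambda>n. (real n)\<^sup>2 * (P n (pi_n n f) (ap x n) - pi_n n f (ap x n))) else 0)"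

lemma A_gen: assumes f: "f \<in> LamC m"
  shows "A f \<in> LamC m"
    "x \<in> Thoma \<Longrightarrow> (\<lambda>n. (real n)\<^sup>2 * (P n (pi_n n f) (ap x n) - pi_n n f (ap x n))) \<longlonglongrightarrow> A f x"
    "\<exists>g. (\<forall>n. g n \<in> LamC m) \<and> uniform_limit Thoma g (A f) sequentially \<and>
    (\<forall>\<^sub>F n in sequentially. \<forall>lam\<in>YD n. pi_n n (g n) lam = (real n)\<^sup>2 * (P n (pi_n n f) lam - pi_n n f lam))"
proof -
  obtain g Af where g: "Af \<in> LamC m" "\<forall>n. g n \<in> LamC m" "uniform_limit Thoma g Af sequentially"
    "\<forall>\<^sub>F n in sequentially. \<forall>lam\<in>YD n. pi_n n (g n) lam = (real n)\<^sup>2 * (P n (pi_n n f) lam - pi_n n f lam)"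
    using P_gen[OF f] by blast
  have lim: "(\<lambda>n. (real n)\<^sup>2 * (P n (pi_n n f) (ap x n) - pi_n n f (ap x n))) \<longlonglongrightarrow> Af x" if x: "x \<in> Thoma" for x
  proof -
    have 1: "(\<lambda>n. Af (iota n (ap x n))) \<longlonglongrightarrow> Af x" by (rule CO_ap[OF LamC_CO[OF g(1)] x])
    have 2: "(\<lambda>n. g n (iota n (ap x n)) - Af (iota n (ap x n))) \<longlonglongrightarrow> 0"
    proof (rule tendstoI)
      fix e :: real assume "e > 0"
      then have "\<forall>\<^sub>F n in sequentially. \<forall>x\<in>Thoma. dist (g n x) (Af x) < e" using g(3) by (simp add: uniform_limit_iff)
      then show "\<forall>\<^sub>F n in sequentially. dist (g n (iota n (ap x n)) - Af (iota n (ap x n))) 0 < e"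
        using eventually_ge_at_top[of 1]
        by eventually_elim (use ap iota_Thoma in \<open>auto simp: dist_real_def\<close>)
    qed
    have "(\<lambda>n. g n (iota n (ap x n))) \<longlonglongrightarrow> Af x" using tendsto_add[OF 2 1] by simp
    moreover have "\<forall>\<^sub>F n in sequentially. g n (iota n (ap x n)) = (real n)\<^sup>2 * (P n (pi_n n f) (ap x n) - pi_n n f (ap x n))"
      using g(4)
    proof eventually_elim
      case (elim n)
      then have "pi_n n (g n) (ap x n) = (real n)\<^sup>2 * (P n (pi_n n f) (ap x n) - pi_n n f (ap x n))" using ap(1) by blast
      then show ?case by (simp add: pi_n_def)
    qed
    ultimately show ?thesis by (rule Lim_transform_eventually)
  qed
  have AAf: "A f = Af"
  proof
    fix x show "A f x = Af x"
      using limI[OF lim[of x]] CO_outside[OF LamC_CO[OF g(1)], of x] by (cases "x \<in> Thoma") (simp_all add: A_def)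
  qed
  show "A f \<in> LamC m" using AAf g by simp
  show "x \<in> Thoma \<Longrightarrow> (\<lambda>n. (real n)\<^sup>2 * (P n (pi_n n f) (ap x n) - pi_n n f (ap x n))) \<longlonglongrightarrow> A f x"
    using AAf lim by simp
  show "\<exists>g. (\<forall>n. g n \<in> LamC m) \<and> uniform_limit Thoma g (A f) sequentially \<and>
    (\<forall>\<^sub>F n in sequentially. \<forall>lam\<in>YD n. pi_n n (g n) lam = (real n)\<^sup>2 * (P n (pi_n n f) lam - pi_n n f lam))"
    using AAf g by blast
qed

lemma A_lin: assumes f: "f \<in> LamC m" and g: "g \<in> LamC m"
  shows "A (\<lambda>x. a * f x + b * g x) = (\<lambda>x. a * A f x + b * A g x)"
proof
  fix x
  let ?h = "\<lambda>x. a * f x + b * g x"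
  have hL: "?h \<in> LamC m" by (rule LamC_lin[OF f g])
  show "A ?h x = a * A f x + b * A g x"
  proof (cases "x \<in> Thoma")
    case True
    have "(\<lambda>n. a * ((real n)\<^sup>2 * (P n (pi_n n f) (ap x n) - pi_n n f (ap x n))) + b * ((real n)\<^sup>2 * (P n (pi_n n g) (ap x n) - pi_n n g (ap x n))))
      \<longlonglongrightarrow> a * A f x + b * A g x"
      by (intro tendsto_intros A_gen(2)[OF f True] A_gen(2)[OF g True])
    moreover have "a * ((real n)\<^sup>2 * (P n (pi_n n f) (ap x n) - pi_n n f (ap x n))) + b * ((real n)\<^sup>2 * (P n (pi_n n g) (ap x n) - pi_n n g (ap x n)))
      = (real n)\<^sup>2 * (P n (pi_n n ?h) (ap x n) - pi_n n ?h (ap x n))" for n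
    proof -
      have "P n (pi_n n ?h) (ap x n) = a * P n (pi_n n f) (ap x n) + b * P n (pi_n n g) (ap x n)"
        using P_lin[OF ap(1), of n a "pi_n n f" b "pi_n n g" x] by (simp add: pi_n_def comp_def)
      then show ?thesis by (simp add: pi_n_def algebra_simps)
    qed
    ultimately have "(\<lambda>n. (real n)\<^sup>2 * (P n (pi_n n ?h) (ap x n) - pi_n n ?h (ap x n))) \<longlonglongrightarrow> a * A f x + b * A g x" by simp
    then show ?thesis using A_gen(2)[OF hL True] LIMSEQ_unique by blast
  qed (simp add: A_def)
qed

lemma A_sum: "(\<And>i. i < d \<Longrightarrow> f i \<in> LamC m) \<Longrightarrow> A (\<lambda>x. \<Sum>i<(d::nat). c i * f i x) = (\<lambda>x. \<Sum>i<d. c i * A (f i) x)"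
proof (induction d)
  case 0
  have "A (\<lambda>x. 0 * (\<lambda>_. 0) x + 0 * (\<lambda>_. 0) x) = (\<lambda>x. 0 * A (\<lambda>_. 0) x + 0 * A (\<lambda>_. 0) x)" by (rule A_lin[of _ 0]) (rule LamC_zero)+
  then show ?case by simp
next
  case (Suc d)
  have "A (\<lambda>x. 1 * (\<Sum>i<d. c i * f i x) + c d * f d x) = (\<lambda>x. 1 * A (\<lambda>x. \<Sum>i<d. c i * f i x) x + c d * A (f d) x)"
    by (rule A_lin[of _ m]) (use Suc in \<open>auto intro!: LamC_sum LamC_scale\<close>)
  then show ?case using Suc by simp
qed

lemma A_coordinates:
  assumes "\<And>x. f x = (\<Sum>j<(d::nat). f (xs j) * es j x)" "\<And>j. j < d \<Longrightarrow> es j \<in> LamC m"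
  shows "A f x = (\<Sum>j<d. f (xs j) * A (es j) x)"
proof -
  have "f = (\<lambda>x. \<Sum>j<d. f (xs j) * es j x)" using assms(1) by (rule ext)
  then have "A f = A (\<lambda>x. \<Sum>j<d. f (xs j) * es j x)" by (rule arg_cong)
  also have "\<dots> = (\<lambda>x. \<Sum>j<d. f (xs j) * A (es j) x)" by (rule A_sum) (rule assms(2))
  finally show ?thesis by (rule fun_cong)
qed

lemma A_iter_LamC: "f \<in> LamC m \<Longrightarrow> (A ^^ k) f \<in> LamC m"
  by (induction k) (auto intro: A_gen(1))

lemma A_bound: "\<exists>C\<ge>0. \<forall>f\<in>LamC m. supO (A f) \<le> C * supO f"
proof -
  obtain d xs es where d: "\<And>i. i < (d::nat) \<Longrightarrow> xs i \<in> Thoma \<and> es i \<in> LamC m" "\<And>f x. f \<in> LamC m \<Longrightarrow> f x = (\<Sum>j<d. f (xs j) * es j x)"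
    using LamC_coordinates[of m] by blast
  define C where "C = (\<Sum>i<d. supO (A (es i)))"
  have co: "A (es i) \<in> CO" if "i < d" for i using d that A_gen(1) LamC_CO by blast
  have "supO (A f) \<le> C * supO f" if f: "f \<in> LamC m" for f
  proof (rule supO_le)
    fix x
    have fCO: "f \<in> CO" using f LamC_CO by blast
    have "A f x = (\<Sum>j<d. f (xs j) * A (es j) x)" using d f by (intro A_coordinates[of _ _ _ _ m]) auto
    then have "\<bar>A f x\<bar> \<le> (\<Sum>j<d. \<bar>f (xs j) * A (es j) x\<bar>)" by (simp add: sum_abs)
    also have "\<dots> \<le> (\<Sum>j<d. supO f * supO (A (es j)))"
      unfolding abs_mult by (intro sum_mono mult_mono supO_ge fCO co supO_nonneg) auto
    finally show "\<bar>A f x\<bar> \<le> C * supO f" by (simp add: C_def sum_distrib_left sum_distrib_right mult.commute)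
  qed
  moreover have "C \<ge> 0" unfolding C_def by (intro sum_nonneg supO_nonneg co) auto
  ultimately show ?thesis by blast
qed

text \<open>By linearity only the finitely many functions \<open>es i\<close> matter; the
  coefficients f (xs i) are at most \<open>supO f\<close> in absolute value, which makes the error
  uniform over \<open>LamC m\<close>.\<close>

lemma one_step:
  "\<exists>eps. eps \<longlonglongrightarrow> 0 \<and> (\<forall>n. 0 \<le> eps n) \<and> (\<forall>\<^sub>F n in sequentially. \<forall>f\<in>LamC m. \<forall>lam\<in>YD n.
     \<bar>P n (pi_n n f) lam - pi_n n f lam - A f (iota n lam) / (real n)\<^sup>2\<bar> \<le> eps n / (real n)\<^sup>2 * supO f)"
proof -
  obtain d xs es where d: "\<And>i. i < (d::nat) \<Longrightarrow> xs i \<in> Thoma \<and> es i \<in> LamC m" "\<And>f x. f \<in> LamC m \<Longrightarrow> f x = (\<Sum>j<d. f (xs j) * es j x)"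
    using LamC_coordinates[of m] by blast
  define Q where "Q i g \<longleftrightarrow> (\<forall>n. g n \<in> LamC m) \<and> uniform_limit Thoma g (A (es i)) sequentially \<and>
    (\<forall>\<^sub>F n in sequentially. \<forall>lam\<in>YD n. pi_n n (g n) lam = (real n)\<^sup>2 * (P n (pi_n n (es i)) lam - pi_n n (es i) lam))" for i g
  have "\<exists>g. Q i g" if "i < d" for i
    unfolding Q_def by (rule A_gen(3)) (use d(1) that in blast)
  then obtain g where gQ: "\<And>i. i < d \<Longrightarrow> Q i (g i)" by metis
  have g: "\<And>i n. i < d \<Longrightarrow> g i n \<in> LamC m" "\<And>i. i < d \<Longrightarrow> uniform_limit Thoma (g i) (A (es i)) sequentially"
    "\<And>i. i < d \<Longrightarrow> \<forall>\<^sub>F n in sequentially. \<forall>lam\<in>YD n. pi_n n (g i n) lam = (real n)\<^sup>2 * (P n (pi_n n (es i)) lam - pi_n n (es i) lam)"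
    using gQ unfolding Q_def by blast+
  have co: "g i n \<in> CO" "A (es i) \<in> CO" if "i < d" for i n using d that A_gen(1) g(1) LamC_CO by blast+
  define eps where "eps n = (\<Sum>i<d. supO (\<lambda>x. g i n x - A (es i) x))" for n
  have "eps \<longlonglongrightarrow> (\<Sum>i<d. 0)" unfolding eps_def
    by (intro tendsto_sum uniform_limit_supO g co) auto
  then have l: "eps \<longlonglongrightarrow> 0" by simp
  have nn: "0 \<le> eps n" for n unfolding eps_def by (intro sum_nonneg supO_nonneg CO_diff co) auto
  have "\<forall>\<^sub>F n in sequentially. \<forall>i\<in>{..<d}. \<forall>lam\<in>YD n. pi_n n (g i n) lam = (real n)\<^sup>2 * (P n (pi_n n (es i)) lam - pi_n n (es i) lam)"
    by (rule eventually_ball_finite) (use g(3) in auto)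
  then have "\<forall>\<^sub>F n in sequentially. \<forall>f\<in>LamC m. \<forall>lam\<in>YD n.
     \<bar>P n (pi_n n f) lam - pi_n n f lam - A f (iota n lam) / (real n)\<^sup>2\<bar> \<le> eps n / (real n)\<^sup>2 * supO f"
    using eventually_ge_at_top[of 1]
  proof eventually_elim
    case (elim n)
    show ?case
    proof (intro ballI)
      fix f lam assume f: "f \<in> LamC m" and lam: "lam \<in> YD n"
      let ?y = "iota n lam"
      have fCO: "f \<in> CO" using f LamC_CO by blast
      have n2: "(real n)\<^sup>2 > 0" using elim by simp
      have fe: "f = (\<lambda>x. \<Sum>j<d. f (xs j) * es j x)" using d(2)[OF f] by blast
      have Af: "A f ?y = (\<Sum>j<d. f (xs j) * A (es j) ?y)" using d f by (intro A_coordinates[of _ _ _ _ m]) auto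
      have pf: "pi_n n f = (\<lambda>l. \<Sum>j<d. f (xs j) * pi_n n (es j) l)"
        by (subst fe) (simp add: pi_n_def comp_def)
      have Pf: "P n (pi_n n f) lam = (\<Sum>j<d. f (xs j) * P n (pi_n n (es j)) lam)"
        unfolding pf by (rule P_sum[OF lam])
      have "(real n)\<^sup>2 * (P n (pi_n n f) lam - pi_n n f lam) - A f ?y
        = (\<Sum>j<d. f (xs j) * ((real n)\<^sup>2 * (P n (pi_n n (es j)) lam - pi_n n (es j) lam) - A (es j) ?y))"
        unfolding Pf Af by (subst pf) (simp add: sum_distrib_left sum_subtractf[symmetric] algebra_simps)
      also have "\<dots> = (\<Sum>j<d. f (xs j) * (g j n ?y - A (es j) ?y))"
        by (rule sum.cong) (use elim lam in \<open>auto simp: pi_n_def\<close>)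
      finally have "\<bar>(real n)\<^sup>2 * (P n (pi_n n f) lam - pi_n n f lam) - A f ?y\<bar> \<le> (\<Sum>j<d. \<bar>f (xs j) * (g j n ?y - A (es j) ?y)\<bar>)"
        by (simp add: sum_abs)
      also have "\<dots> \<le> (\<Sum>j<d. supO f * supO (\<lambda>x. g j n x - A (es j) x))"
        unfolding abs_mult
      proof (rule sum_mono)
        fix j assume "j \<in> {..<d}"
        then have j: "(\<lambda>x. g j n x - A (es j) x) \<in> CO" by (intro CO_diff co) auto
        show "\<bar>f (xs j)\<bar> * \<bar>g j n ?y - A (es j) ?y\<bar> \<le> supO f * supO (\<lambda>x. g j n x - A (es j) x)"
          by (rule mult_mono[OF supO_ge[OF fCO] supO_ge[OF j] supO_nonneg[OF fCO]]) simp
      qed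
      also have "\<dots> = eps n * supO f" by (simp add: eps_def sum_distrib_left sum_distrib_right mult.commute)
      finally have b: "\<bar>(real n)\<^sup>2 * (P n (pi_n n f) lam - pi_n n f lam) - A f ?y\<bar> \<le> eps n * supO f" .
      have "P n (pi_n n f) lam - pi_n n f lam - A f ?y / (real n)\<^sup>2 = ((real n)\<^sup>2 * (P n (pi_n n f) lam - pi_n n f lam) - A f ?y) / (real n)\<^sup>2"
        using n2 by (simp add: diff_divide_distrib)
      then have "\<bar>P n (pi_n n f) lam - pi_n n f lam - A f ?y / (real n)\<^sup>2\<bar> = \<bar>(real n)\<^sup>2 * (P n (pi_n n f) lam - pi_n n f lam) - A f ?y\<bar> / (real n)\<^sup>2"
        by (simp add: abs_divide)
      also have "\<dots> \<le> eps n * supO f / (real n)\<^sup>2" by (intro divide_right_mono b) simp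
      finally show "\<bar>P n (pi_n n f) lam - pi_n n f lam - A f ?y / (real n)\<^sup>2\<bar> \<le> eps n / (real n)\<^sup>2 * supO f" by simp
    qed
  qed
  then show ?thesis using l nn by blast
qed

end

section \<open>The limit semigroup\<close>


lemma pi_n_apply: "pi_n n f lam = f (iota n lam)"
  by (simp add: pi_n_def)

context scheme begin

text \<open>The exponential series of t A, meaningful on each \<open>LamC m\<close> because A is
  bounded there.\<close>

definition E :: "real \<Rightarrow> (tpt \<Rightarrow> real) \<Rightarrow> tpt \<Rightarrow> real" where
  "E t f x = (\<Sum>k. (A ^^ k) f x / fact k * t ^ k)"

abbreviation Pt :: "nat \<Rightarrow> real \<Rightarrow> (nat list \<Rightarrow> real) \<Rightarrow> nat list \<Rightarrow> real" where
  "Pt n t \<equiv> P n ^^ nat \<lfloor>(real n)\<^sup>2 * t\<rfloor>"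

definition bnd :: "nat \<Rightarrow> real" where
  "bnd m = (SOME C. C \<ge> 0 \<and> (\<forall>f\<in>LamC m. supO (A f) \<le> C * supO f))"

lemma bnd: "bnd m \<ge> 0" "f \<in> LamC m \<Longrightarrow> supO (A f) \<le> bnd m * supO f"
proof -
  have "\<exists>C. C \<ge> 0 \<and> (\<forall>f\<in>LamC m. supO (A f) \<le> C * supO f)" using A_bound by blast
  from someI_ex[OF this] show "bnd m \<ge> 0" "f \<in> LamC m \<Longrightarrow> supO (A f) \<le> bnd m * supO f" unfolding bnd_def by blast+
qed

lemma A_iter_bound: assumes f: "f \<in> LamC m" shows "\<bar>(A ^^ k) f x\<bar> \<le> bnd m ^ k * supO f"
proof -
  have "supO ((A ^^ k) f) \<le> bnd m ^ k * supO f"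
  proof (induction k)
    case (Suc k)
    have "supO (A ((A ^^ k) f)) \<le> bnd m * supO ((A ^^ k) f)" by (rule bnd(2)[OF A_iter_LamC[OF f]])
    also have "\<dots> \<le> bnd m * (bnd m ^ k * supO f)" by (rule mult_left_mono[OF Suc bnd(1)])
    finally show ?case by (simp add: mult.assoc)
  qed simp
  moreover have "\<bar>(A ^^ k) f x\<bar> \<le> supO ((A ^^ k) f)" by (rule supO_ge[OF LamC_CO[OF A_iter_LamC[OF f]]])
  ultimately show ?thesis by linarith
qed

lemma E_term_bound: assumes f: "f \<in> LamC m"
  shows "norm ((A ^^ k) f x / fact k * t ^ k) \<le> supO f * ((bnd m * \<bar>t\<bar>) ^ k / fact k)"
proof -
  have "norm ((A ^^ k) f x / fact k * t ^ k) = \<bar>(A ^^ k) f x\<bar> * (\<bar>t\<bar> ^ k / fact k)" by (simp add: abs_mult power_abs)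
  also have "\<dots> \<le> (bnd m ^ k * supO f) * (\<bar>t\<bar> ^ k / fact k)" by (intro mult_right_mono A_iter_bound[OF f]) simp
  finally show ?thesis by (simp add: power_mult_distrib mult_ac)
qed

lemma exp_sums: "(\<lambda>k. c * (y ^ k / fact k)) sums (c * exp (y::real))"
  using exp_converges[of y] by (intro sums_mult) (simp add: scaleR_conv_of_real divide_inverse mult.commute)

lemma E_summable: assumes f: "f \<in> LamC m" shows "summable (\<lambda>k. (A ^^ k) f x / fact k * t ^ k)"
  by (rule summable_comparison_test'[OF sums_summable[OF exp_sums]]) (rule E_term_bound[OF f])

lemma E_bound: assumes f: "f \<in> LamC m" shows "\<bar>E t f x\<bar> \<le> supO f * exp (bnd m * \<bar>t\<bar>)"
proof -
  have "norm (\<Sum>k. (A ^^ k) f x / fact k * t ^ k) \<le> (\<Sum>k. supO f * ((bnd m * \<bar>t\<bar>) ^ k / fact k))"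
    by (rule norm_suminf_le[OF E_term_bound[OF f] sums_summable[OF exp_sums]])
  also have "\<dots> = supO f * exp (bnd m * \<bar>t\<bar>)" by (rule sums_unique[OF exp_sums, symmetric])
  finally show ?thesis by (simp add: E_def)
qed

lemma E_0: "E 0 f x = f x"
  unfolding E_def powser_zero by simp

lemma E_combination: assumes f: "f \<in> LamC m"
  shows "(\<Sum>i<(d::nat). E t f (xs i) * c i) = (\<Sum>k. (\<Sum>i<d. (A ^^ k) f (xs i) * c i) / fact k * t ^ k)"
proof -
  have s: "(\<lambda>k. \<Sum>i<d. (A ^^ k) f (xs i) / fact k * t ^ k * c i) sums (\<Sum>i<d. E t f (xs i) * c i)"
    unfolding E_def by (intro sums_sum sums_mult2 summable_sums E_summable[OF f])
  have "(\<Sum>i<d. (A ^^ k) f (xs i) / fact k * t ^ k * c i) = (\<Sum>i<d. (A ^^ k) f (xs i) * c i) / fact k * t ^ k" for k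
    unfolding sum_divide_distrib sum_distrib_right by (rule sum.cong) auto
  then show ?thesis using sums_unique[OF s] by simp
qed

text \<open>The coordinate formula is a linear relation with finitely many terms, satisfied by all
  iterates of A on f, so it passes to the series. The same device gives \<open>A_E\<close>.\<close>

lemma E_LamC: assumes f: "f \<in> LamC m" shows "E t f \<in> LamC m"
proof -
  obtain d xs es where d: "\<And>i. i < (d::nat) \<Longrightarrow> xs i \<in> Thoma \<and> es i \<in> LamC m" "\<And>f x. f \<in> LamC m \<Longrightarrow> f x = (\<Sum>j<d. f (xs j) * es j x)"
    using LamC_coordinates[of m] by blast
  have "E t f x = (\<Sum>j<d. E t f (xs j) * es j x)" for x
  proof -
    have "(\<Sum>j<d. E t f (xs j) * es j x) = (\<Sum>k. (\<Sum>i<d. (A ^^ k) f (xs i) * es i x) / fact k * t ^ k)" by (rule E_combination[OF f])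
    also have "\<dots> = E t f x" by (simp only: d(2)[OF A_iter_LamC[OF f], symmetric] E_def)
    finally show ?thesis by simp
  qed
  then have eq: "E t f = (\<lambda>x. \<Sum>j<d. E t f (xs j) * es j x)" by (rule ext)
  have mem: "(\<lambda>x. \<Sum>j<d. E t f (xs j) * es j x) \<in> LamC m" by (intro LamC_sum LamC_scale) (use d in auto)
  show ?thesis by (rule ssubst[where P = "\<lambda>g. g \<in> LamC m", OF eq mem])
qed

lemma A_E: assumes f: "f \<in> LamC m" shows "A (E t f) = E t (A f)"
proof
  fix x
  obtain d xs es where d: "\<And>i. i < (d::nat) \<Longrightarrow> xs i \<in> Thoma \<and> es i \<in> LamC m" "\<And>f x. f \<in> LamC m \<Longrightarrow> f x = (\<Sum>j<d. f (xs j) * es j x)"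
    using LamC_coordinates[of m] by blast
  have "A (E t f) x = (\<Sum>j<d. E t f (xs j) * A (es j) x)"
    by (rule A_coordinates[of _ _ _ _ m]) (use d(2)[OF E_LamC[OF f]] d(1) in blast)+
  also have "\<dots> = (\<Sum>k. (\<Sum>i<d. (A ^^ k) f (xs i) * A (es i) x) / fact k * t ^ k)" by (rule E_combination[OF f])
  also have "\<dots> = (\<Sum>k. (A ^^ k) (A f) x / fact k * t ^ k)"
  proof -
    have "(\<Sum>i<d. (A ^^ k) f (xs i) * A (es i) x) = (A ^^ k) (A f) x" for k
    proof -
      have "A ((A ^^ k) f) x = (\<Sum>i<d. (A ^^ k) f (xs i) * A (es i) x)"
        by (rule A_coordinates[of _ _ _ _ m]) (use d(2)[OF A_iter_LamC[OF f]] d(1) in blast)+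
      then show ?thesis by (metis funpow_swap1)
    qed
    then show ?thesis by simp
  qed
  finally show "A (E t f) x = E t (A f) x" by (simp add: E_def)
qed

lemma E_deriv: assumes f: "f \<in> LamC m"
  shows "((\<lambda>t. E t f x) has_real_derivative E t (A f) x) (at t)"
proof -
  let ?c = "\<lambda>k. (A ^^ k) f x / fact k"
  have "((\<lambda>t. \<Sum>k. ?c k * t ^ k) has_field_derivative (\<Sum>k. diffs ?c k * t ^ k)) (at t)"
    by (rule termdiffs_strong_converges_everywhere) (rule E_summable[OF f])
  moreover have "diffs ?c k = (A ^^ k) (A f) x / fact k" for k
    by (simp add: diffs_def funpow_swap1 del: of_nat_Suc)
  ultimately show ?thesis by (simp add: E_def)
qed

lemma E_step: assumes f: "f \<in> LamC m" and t: "0 \<le> t" and h: "0 \<le> h" "t + h \<le> t1"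
  shows "\<bar>E (t + h) f x - E t f x\<bar> \<le> h * (bnd m * supO f * exp (bnd m * t1))"
proof (cases "h = 0")
  case False
  then have "t < t + h" using h by simp
  then obtain z where z: "t < z" "z < t + h" "E (t + h) f x - E t f x = (t + h - t) * E z (A f) x"
    using MVT2[of t "t + h" "\<lambda>t. E t f x" "\<lambda>t. E t (A f) x"] E_deriv[OF f] by blast
  have "\<bar>E z (A f) x\<bar> \<le> supO (A f) * exp (bnd m * \<bar>z\<bar>)" by (rule E_bound[OF A_gen(1)[OF f]])
  also have "\<dots> \<le> (bnd m * supO f) * exp (bnd m * t1)"
    using z t h bnd(1)[of m] supO_nonneg[OF LamC_CO[OF f]] by (intro mult_mono bnd(2)[OF f]) (auto intro: mult_left_mono mult_nonneg_nonneg)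
  finally show ?thesis using z h by (simp add: abs_mult mult_left_mono)
qed simp

text \<open>The mean value theorem is used once for E and, through \<open>E_step\<close> at A f,
  once more for its derivative; hence the square of \<open>bnd m\<close> in the remainder.\<close>

lemma E_taylor: assumes f: "f \<in> LamC m" and t: "0 \<le> t" and h: "0 \<le> h" "t + h \<le> t1"
  shows "\<bar>E (t + h) f x - E t f x - h * A (E t f) x\<bar> \<le> h * (h * ((bnd m)\<^sup>2 * supO f * exp (bnd m * t1)))"
proof (cases "h = 0")
  case False
  then have "t < t + h" using h by simp
  then obtain z where z: "t < z" "z < t + h" "E (t + h) f x - E t f x = (t + h - t) * E z (A f) x"
    using MVT2[of t "t + h" "\<lambda>t. E t f x" "\<lambda>t. E t (A f) x"] E_deriv[OF f] by blast
  have Af: "A f \<in> LamC m" by (rule A_gen(1)[OF f])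
  have s0: "0 \<le> supO f" using supO_nonneg[OF LamC_CO[OF f]] .
  have "\<bar>E (t + (z - t)) (A f) x - E t (A f) x\<bar> \<le> (z - t) * (bnd m * supO (A f) * exp (bnd m * t1))"
    by (rule E_step[OF Af t]) (use z h in auto)
  also have "\<dots> \<le> h * (bnd m * (bnd m * supO f) * exp (bnd m * t1))"
    using z h bnd(1)[of m] supO_nonneg[OF LamC_CO[OF Af]]
    by (intro mult_mono mult_right_mono mult_left_mono bnd(2)[OF f] mult_nonneg_nonneg s0) auto
  finally have "\<bar>E z (A f) x - E t (A f) x\<bar> \<le> h * ((bnd m)\<^sup>2 * supO f * exp (bnd m * t1))" by (simp add: power2_eq_square mult_ac)
  then have "h * \<bar>E z (A f) x - E t (A f) x\<bar> \<le> h * (h * ((bnd m)\<^sup>2 * supO f * exp (bnd m * t1)))" using h by (intro mult_left_mono) auto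
  moreover have "E (t + h) f x - E t f x - h * A (E t f) x = h * (E z (A f) x - E t (A f) x)"
    using z by (simp add: A_E[OF f] right_diff_distrib)
  ultimately show ?thesis using h by (simp add: abs_mult)
qed simp

text \<open>Each step of length 1 / n^2 adds two local errors, the deviation of the chain from 1 + A
  / n^2 and the Taylor remainder; earlier errors are not amplified because the chain is a
  contraction. The margin t0 + 1 in M covers the endpoint t + 1 / n^2 of a step.\<close>

lemma euler_error:
  assumes f: "f \<in> LamC m" and n: "1 \<le> n" and t0: "0 \<le> t0" and eps0: "0 \<le> eps"
    and one: "\<forall>f\<in>LamC m. \<forall>lam\<in>YD n. \<bar>P n (pi_n n f) lam - pi_n n f lam - A f (iota n lam) / (real n)\<^sup>2\<bar> \<le> eps / (real n)\<^sup>2 * supO f"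
  defines "M \<equiv> supO f * exp (bnd m * (t0 + 1))"
  shows "real k \<le> (real n)\<^sup>2 * t0 \<Longrightarrow> lam \<in> YD n \<Longrightarrow>
     \<bar>(P n ^^ k) (pi_n n f) lam - E (real k / (real n)\<^sup>2) f (iota n lam)\<bar> \<le> real k / (real n)\<^sup>2 * ((eps + (bnd m)\<^sup>2 / (real n)\<^sup>2) * M)"
proof (induction k arbitrary: lam)
  case 0
  then show ?case by (simp add: E_0 pi_n_def)
next
  case (Suc k)
  let ?N = "(real n)\<^sup>2"
  have N: "?N \<ge> 1" using n by (simp add: one_le_power)
  define t where "t = real k / ?N"
  have t: "0 \<le> t" "t \<le> t0" "t + 1 / ?N \<le> t0 + 1"
  proof -
    show "0 \<le> t" by (simp add: t_def)
    have np: "?N > 0" using N by linarith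
    show tt: "t \<le> t0" unfolding t_def using Suc.prems(1) by (subst pos_divide_le_eq[OF np]) (simp add: mult.commute)
    have "1 / ?N \<le> 1" using N by (subst pos_divide_le_eq[OF np]) simp
    then show "t + 1 / ?N \<le> t0 + 1" using tt by linarith
  qed
  have tS: "real (Suc k) / ?N = t + 1 / ?N" by (simp add: t_def add_divide_distrib add.commute)
  let ?u = "E t f"
  have uL: "?u \<in> LamC m" by (rule E_LamC[OF f])
  have s0: "0 \<le> supO f" using supO_nonneg[OF LamC_CO[OF f]] .
  have uM: "supO ?u \<le> M"
  proof (rule supO_le)
    fix x
    have "\<bar>E t f x\<bar> \<le> supO f * exp (bnd m * \<bar>t\<bar>)" by (rule E_bound[OF f])
    also have "\<dots> \<le> M" unfolding M_def using t bnd(1)[of m] s0 by (intro mult_left_mono) (auto intro: mult_left_mono)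
    finally show "\<bar>E t f x\<bar> \<le> M" .
  qed
  have a: "\<bar>P n ((P n ^^ k) (pi_n n f)) lam - P n (pi_n n ?u) lam\<bar> \<le> real k / ?N * ((eps + (bnd m)\<^sup>2 / ?N) * M)"
  proof (rule P_diff_bound[OF Suc.prems(2)])
    fix l assume l: "l \<in> YD n"
    have kt: "real k \<le> ?N * t0" using Suc.prems(1) by simp
    show "\<bar>(P n ^^ k) (pi_n n f) l - pi_n n ?u l\<bar> \<le> real k / ?N * ((eps + (bnd m)\<^sup>2 / ?N) * M)"
      unfolding t_def pi_n_apply[of n "E (real k / ?N) f"] by (rule Suc.IH[OF kt l])
  qed
  have b: "\<bar>P n (pi_n n ?u) lam - pi_n n ?u lam - A ?u (iota n lam) / ?N\<bar> \<le> 1 / ?N * (eps * M)"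
  proof -
    have "\<bar>P n (pi_n n ?u) lam - pi_n n ?u lam - A ?u (iota n lam) / ?N\<bar> \<le> eps / ?N * supO ?u"
      using one uL Suc.prems(2) by blast
    also have "\<dots> \<le> eps / ?N * M" by (rule mult_left_mono[OF uM]) (use eps0 in simp)
    finally show ?thesis by simp
  qed
  have c: "\<bar>E (t + 1 / ?N) f (iota n lam) - ?u (iota n lam) - 1 / ?N * A ?u (iota n lam)\<bar> \<le> 1 / ?N * (1 / ?N * ((bnd m)\<^sup>2 * supO f * exp (bnd m * (t0 + 1))))"
    by (rule E_taylor[OF f t(1)]) (use t N in auto)
  have "\<bar>(P n ^^ Suc k) (pi_n n f) lam - E (t + 1 / ?N) f (iota n lam)\<bar> \<le>
     real k / ?N * ((eps + (bnd m)\<^sup>2 / ?N) * M) + 1 / ?N * (eps * M) + 1 / ?N * (1 / ?N * ((bnd m)\<^sup>2 * M))"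
    using a b c by (simp add: pi_n_def M_def mult.assoc)
  also have "\<dots> = real (Suc k) / ?N * ((eps + (bnd m)\<^sup>2 / ?N) * M)"
    by (simp add: add_divide_distrib algebra_simps)
  finally show ?case unfolding tS .
qed

text \<open>After k steps, k being the integer part of n^2 t, the accumulated error is at most t0
  times a null sequence; replacing k / n^2 by t costs at most one further step length.\<close>

lemma convergence_LamC:
  assumes f: "f \<in> LamC m" and t0: "0 \<le> t0" and e: "0 < e"
  shows "\<forall>\<^sub>F n in sequentially. \<forall>t\<in>{0..t0}. \<forall>lam\<in>YD n. \<bar>Pt n t (pi_n n f) lam - E t f (iota n lam)\<bar> \<le> e"
proof -
  obtain eps where eps: "eps \<longlonglongrightarrow> 0" "\<And>n. 0 \<le> eps n" "\<forall>\<^sub>F n in sequentially. \<forall>f\<in>LamC m. \<forall>lam\<in>YD n.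
     \<bar>P n (pi_n n f) lam - pi_n n f lam - A f (iota n lam) / (real n)\<^sup>2\<bar> \<le> eps n / (real n)\<^sup>2 * supO f"
    using one_step[of m] by blast
  define M where "M = supO f * exp (bnd m * (t0 + 1))"
  have M0: "M \<ge> 0" using supO_nonneg[OF LamC_CO[OF f]] by (simp add: M_def)
  define q where "q n = t0 * ((eps n + (bnd m)\<^sup>2 * (1 / real n)\<^sup>2) * M) + (1 / real n)\<^sup>2 * (bnd m * supO f * exp (bnd m * t0))" for n
  have "q \<longlonglongrightarrow> t0 * ((0 + (bnd m)\<^sup>2 * 0\<^sup>2) * M) + 0\<^sup>2 * (bnd m * supO f * exp (bnd m * t0))"
    unfolding q_def by (intro tendsto_intros eps lim_1_over_n)
  then have "q \<longlonglongrightarrow> 0" by simp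
  then have "\<forall>\<^sub>F n in sequentially. q n < e" using e by (rule order_tendstoD(2))
  with eps(3) eventually_ge_at_top[of 1] show ?thesis
  proof eventually_elim
    case (elim n)
    let ?N = "(real n)\<^sup>2"
    have N: "?N \<ge> 1" using elim by (simp add: one_le_power)
    show ?case
    proof (intro ballI)
      fix t lam assume t: "t \<in> {0..t0}" and lam: "lam \<in> YD n"
      define k where "k = nat \<lfloor>?N * t\<rfloor>"
      have kt: "real k \<le> ?N * t" "?N * t - 1 \<le> real k"
      proof -
        have "real k = of_int \<lfloor>?N * t\<rfloor>" using t N by (simp add: k_def)
        then show "real k \<le> ?N * t" "?N * t - 1 \<le> real k" by linarith+
      qed
      have kt0: "real k \<le> ?N * t0" using kt(1) t N by (meson atLeastAtMost_iff mult_left_mono order_trans zero_le_power2)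
      have kN: "real k / ?N \<le> t" "t - real k / ?N \<le> 1 / ?N" "real k / ?N \<le> t0"
      proof -
        have np: "?N > 0" using N by linarith
        show "real k / ?N \<le> t" using kt(1) np by (simp add: divide_le_eq mult.commute)
        show "real k / ?N \<le> t0" using kt0 np by (simp add: divide_le_eq mult.commute)
        have "t - 1 / ?N = (?N * t - 1) / ?N" using np by (simp add: diff_divide_distrib)
        also have "\<dots> \<le> real k / ?N" using kt(2) np by (intro divide_right_mono) auto
        finally show "t - real k / ?N \<le> 1 / ?N" by linarith
      qed
      have 1: "\<bar>(P n ^^ k) (pi_n n f) lam - E (real k / ?N) f (iota n lam)\<bar> \<le> real k / ?N * ((eps n + (bnd m)\<^sup>2 / ?N) * M)"
        unfolding M_def by (rule euler_error[OF f _ t0 eps(2) _ kt0 lam]) (use elim in auto)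
      also have "\<dots> \<le> t0 * ((eps n + (bnd m)\<^sup>2 / ?N) * M)"
        using kN eps(2) M0 by (intro mult_right_mono mult_nonneg_nonneg add_nonneg_nonneg) auto
      finally have 1: "\<bar>(P n ^^ k) (pi_n n f) lam - E (real k / ?N) f (iota n lam)\<bar> \<le> t0 * ((eps n + (bnd m)\<^sup>2 / ?N) * M)" .
      have "\<bar>E (real k / ?N + (t - real k / ?N)) f (iota n lam) - E (real k / ?N) f (iota n lam)\<bar> \<le> (t - real k / ?N) * (bnd m * supO f * exp (bnd m * t0))"
        by (rule E_step[OF f]) (use kN t in auto)
      also have "\<dots> \<le> 1 / ?N * (bnd m * supO f * exp (bnd m * t0))"
        using kN bnd(1)[of m] supO_nonneg[OF LamC_CO[OF f]] by (intro mult_right_mono mult_nonneg_nonneg) auto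
      finally have 2: "\<bar>E t f (iota n lam) - E (real k / ?N) f (iota n lam)\<bar> \<le> 1 / ?N * (bnd m * supO f * exp (bnd m * t0))" by simp
      have "\<bar>(P n ^^ k) (pi_n n f) lam - E t f (iota n lam)\<bar> \<le> q n"
        using 1 2 by (simp add: q_def power_divide)
      then show "\<bar>(P n ^^ nat \<lfloor>?N * t\<rfloor>) (pi_n n f) lam - E t f (iota n lam)\<bar> \<le> e"
        using elim by (simp add: k_def)
    qed
  qed
qed

section \<open>Extension to continuous functions\<close>

definition T :: "real \<Rightarrow> (tpt \<Rightarrow> real) \<Rightarrow> tpt \<Rightarrow> real" where
  "T t f x = (if x \<in> Thoma then lim (\<lambda>n. Pt n t (pi_n n f) (ap x n)) else 0)"

lemma T_LamC_tends: assumes f: "f \<in> LamC m" and t: "0 \<le> t" and x: "x \<in> Thoma"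
  shows "(\<lambda>n. Pt n t (pi_n n f) (ap x n)) \<longlonglongrightarrow> E t f x"
proof -
  have "(\<lambda>n. Pt n t (pi_n n f) (ap x n) - E t f (iota n (ap x n))) \<longlonglongrightarrow> 0"
  proof (rule tendstoI)
    fix e :: real assume e: "e > 0"
    show "\<forall>\<^sub>F n in sequentially. dist (Pt n t (pi_n n f) (ap x n) - E t f (iota n (ap x n))) 0 < e"
      using convergence_LamC[OF f t half_gt_zero[OF e]]
    proof eventually_elim
      case (elim n)
      have "\<bar>Pt n t (pi_n n f) (ap x n) - E t f (iota n (ap x n))\<bar> \<le> e / 2"
        using elim t ap(1)[of x n] by auto
      then show ?case using e by (simp add: dist_real_def)
    qed
  qed
  from tendsto_add[OF this CO_ap[OF LamC_CO[OF E_LamC[OF f, of t]] x]] show ?thesis by simp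
qed

lemma pi_close: assumes "\<And>x. x \<in> Thoma \<Longrightarrow> \<bar>f x - h x\<bar> \<le> c" "n \<ge> 1" "lam \<in> YD n"
  shows "\<bar>(P n ^^ k) (pi_n n f) lam - (P n ^^ k) (pi_n n h) lam\<bar> \<le> c"
  by (rule iter_diff_bound[OF assms(3)]) (use assms(1) iota_Thoma[OF _ assms(2)] in \<open>auto simp: pi_n_def\<close>)

text \<open>Convergence is known on \<open>LamCall\<close>; by density and the contraction property
  of the chains the sequence for general f is Cauchy.\<close>

lemma T_tends: assumes f: "f \<in> CO" and t: "0 \<le> t" and x: "x \<in> Thoma"
  shows "(\<lambda>n. Pt n t (pi_n n f) (ap x n)) \<longlonglongrightarrow> T t f x"
proof -
  let ?s = "\<lambda>f n. Pt n t (pi_n n f) (ap x n)"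
  have "Cauchy (?s f)"
  proof (rule metric_CauchyI)
    fix e :: real assume e: "e > 0"
    obtain h where h: "h \<in> LamCall" "\<And>x. x \<in> Thoma \<Longrightarrow> \<bar>f x - h x\<bar> \<le> e / 4" using LamCall_dense[OF f, of "e / 4"] e less_imp_le by (metis divide_pos_pos zero_less_numeral)
    then obtain m where hm: "h \<in> LamC m" by (auto simp: LamCall_def)
    have "Cauchy (?s h)" using T_LamC_tends[OF hm t x] by (intro convergent_Cauchy) (auto simp: convergent_def)
    then obtain N where N: "\<And>n k. n \<ge> N \<Longrightarrow> k \<ge> N \<Longrightarrow> dist (?s h n) (?s h k) < e / 4" using e unfolding Cauchy_def by (meson divide_pos_pos zero_less_numeral)
    show "\<exists>N. \<forall>n\<ge>N. \<forall>k\<ge>N. dist (?s f n) (?s f k) < e"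
    proof (intro exI allI impI)
      fix n k assume nk: "n \<ge> max N 1" "k \<ge> max N 1"
      have "\<bar>?s f n - ?s h n\<bar> \<le> e / 4" "\<bar>?s f k - ?s h k\<bar> \<le> e / 4" by (rule pi_close; use h nk ap in auto)+
      moreover have "\<bar>?s h n - ?s h k\<bar> < e / 4" using N[of n k] nk by (simp add: dist_real_def)
      ultimately show "dist (?s f n) (?s f k) < e" unfolding dist_real_def by linarith
    qed
  qed
  then have "convergent (?s f)" by (simp add: real_Cauchy_convergent)
  then show ?thesis using x by (simp add: T_def convergent_LIMSEQ_iff)
qed

lemma T_LamC: assumes f: "f \<in> LamC m" and t: "0 \<le> t" shows "T t f = E t f"
proof
  fix x
  show "T t f x = E t f x"
  proof (cases "x \<in> Thoma")
    case True
    show ?thesis by (rule LIMSEQ_unique[OF T_tends[OF LamC_CO[OF f] t True] T_LamC_tends[OF f t True]])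
  next
    case False
    then show ?thesis using CO_outside[OF LamC_CO[OF E_LamC[OF f]]] by (simp add: T_def)
  qed
qed

lemma T_close: assumes f: "f \<in> CO" and h: "h \<in> CO" and t: "0 \<le> t" and x: "x \<in> Thoma" and c: "\<And>x. x \<in> Thoma \<Longrightarrow> \<bar>f x - h x\<bar> \<le> c"
  shows "\<bar>T t f x - T t h x\<bar> \<le> c"
proof -
  have "(\<lambda>n. \<bar>Pt n t (pi_n n f) (ap x n) - Pt n t (pi_n n h) (ap x n)\<bar>) \<longlonglongrightarrow> \<bar>T t f x - T t h x\<bar>"
    by (intro tendsto_intros T_tends assms)
  moreover have "\<forall>\<^sub>F n in sequentially. \<bar>Pt n t (pi_n n f) (ap x n) - Pt n t (pi_n n h) (ap x n)\<bar> \<le> c"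
    using eventually_ge_at_top[of 1] by eventually_elim (rule pi_close[OF c _ ap(1)])
  ultimately show ?thesis by (rule tendsto_upperbound) simp
qed

lemma T_outside: "x \<notin> Thoma \<Longrightarrow> T t f x = 0" by (simp add: T_def)

lemma dense_obtain: assumes "f \<in> CO" "e > 0"
  obtains m h where "h \<in> LamC m" "\<And>x. x \<in> Thoma \<Longrightarrow> \<bar>f x - h x\<bar> \<le> e"
proof -
  obtain h where "h \<in> LamCall" "\<forall>x\<in>Thoma. \<bar>f x - h x\<bar> < e" using LamCall_dense[OF assms] by blast
  then show ?thesis using that by (auto simp: LamCall_def less_imp_le)
qed

text \<open>By \<open>T_close\<close>, uniform approximation of f by h in \<open>LamCall\<close>
  makes \<open>T t f\<close> a uniform limit of the continuous functions
  \<open>E t h\<close>.\<close>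

lemma T_CO: assumes f: "f \<in> CO" and t: "0 \<le> t" shows "T t f \<in> CO"
proof -
  have "\<exists>h. h \<in> CO \<and> (\<forall>x\<in>Thoma. \<bar>T t f x - h x\<bar> \<le> inverse (real (Suc j)))" for j
  proof -
    obtain m h where h: "h \<in> LamC m" "\<And>x. x \<in> Thoma \<Longrightarrow> \<bar>f x - h x\<bar> \<le> inverse (real (Suc j))"
      using dense_obtain[OF f positive_imp_inverse_positive[OF of_nat_0_less_iff[THEN iffD2, OF zero_less_Suc]]] by blast
    have "\<bar>T t f x - E t h x\<bar> \<le> inverse (real (Suc j))" if "x \<in> Thoma" for x
      using T_close[OF f LamC_CO[OF h(1)] t that h(2)] T_LamC[OF h(1) t] by simp
    then show ?thesis using LamC_CO[OF E_LamC[OF h(1)]] by blast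
  qed
  then obtain H where H: "\<And>j. H j \<in> CO" "\<And>j x. x \<in> Thoma \<Longrightarrow> \<bar>T t f x - H j x\<bar> \<le> inverse (real (Suc j))" by metis
  have "uniform_limit Thoma H (T t f) sequentially"
    unfolding uniform_limit_iff
  proof (intro allI impI)
    fix e :: real assume "e > 0"
    then have "\<forall>\<^sub>F j in sequentially. inverse (real (Suc j)) < e"
      using LIMSEQ_inverse_real_of_nat by (intro order_tendstoD(2)) auto
    then show "\<forall>\<^sub>F j in sequentially. \<forall>x\<in>Thoma. dist (H j x) (T t f x) < e"
    proof eventually_elim
      case (elim j)
      then show ?case using H(2)[of _ j] by (fastforce simp: dist_real_def abs_minus_commute)
    qed
  qed
  then have "continuous_on Thoma (T t f)"
    by (rule uniform_limit_theorem[rotated]) (use H(1) in \<open>auto simp: CO_def\<close>)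
  then show ?thesis unfolding CO_def using T_outside by blast
qed

lemma T_lin: assumes f: "f \<in> CO" and g: "g \<in> CO" and t: "0 \<le> t"
  shows "T t (\<lambda>x. a * f x + b * g x) = (\<lambda>x. a * T t f x + b * T t g x)"
proof
  fix x
  let ?h = "\<lambda>x. a * f x + b * g x"
  show "T t ?h x = a * T t f x + b * T t g x"
  proof (cases "x \<in> Thoma")
    case True
    have e: "pi_n n ?h = (\<lambda>l. a * pi_n n f l + b * pi_n n g l)" for n by (simp add: pi_n_def comp_def)
    have "(\<lambda>n. Pt n t (pi_n n ?h) (ap x n)) \<longlonglongrightarrow> a * T t f x + b * T t g x"
      unfolding e iter_lin[OF ap(1)] by (intro tendsto_intros T_tends f g t True)
    then show ?thesis using T_tends[OF CO_lin[OF f g] t True] LIMSEQ_unique by blast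
  qed (simp add: T_outside)
qed

lemma convergence:
  assumes f: "f \<in> CO" and t0: "0 \<le> t0" and e: "0 < e"
  shows "\<forall>\<^sub>F n in sequentially. \<forall>t\<in>{0..t0}. \<forall>lam\<in>YD n. \<bar>Pt n t (pi_n n f) lam - T t f (iota n lam)\<bar> \<le> e"
proof -
  obtain m h where h: "h \<in> LamC m" "\<And>x. x \<in> Thoma \<Longrightarrow> \<bar>f x - h x\<bar> \<le> e / 3"
    using dense_obtain[OF f divide_pos_pos[OF e zero_less_numeral]] by blast
  have "e / 3 > 0" using e by simp
  from convergence_LamC[OF h(1) t0 this] eventually_ge_at_top[of 1] show ?thesis
  proof eventually_elim
    case (elim n)
    show ?case
    proof (intro ballI)
      fix t lam assume t: "t \<in> {0..t0}" and lam: "lam \<in> YD n"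
      let ?k = "nat \<lfloor>(real n)\<^sup>2 * t\<rfloor>"
      have "\<bar>(P n ^^ ?k) (pi_n n f) lam - (P n ^^ ?k) (pi_n n h) lam\<bar> \<le> e / 3" by (rule pi_close) (use h elim lam in auto)
      moreover have "\<bar>(P n ^^ ?k) (pi_n n h) lam - E t h (iota n lam)\<bar> \<le> e / 3" using elim t lam by blast
      moreover have "\<bar>T t f (iota n lam) - E t h (iota n lam)\<bar> \<le> e / 3"
        using T_close[OF f LamC_CO[OF h(1)] _ iota_Thoma[OF lam] h(2), of t] T_LamC[OF h(1), of t] t elim by simp
      ultimately show "\<bar>(P n ^^ ?k) (pi_n n f) lam - T t f (iota n lam)\<bar> \<le> e" by linarith
    qed
  qed
qed

text \<open>Needed for the semigroup law, where the integer parts of n^2 s and n^2 t may add up to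
  one less than the integer part of n^2 (s + t).\<close>

lemma one_step_small: assumes f: "f \<in> CO" and e: "0 < e"
  shows "\<forall>\<^sub>F n in sequentially. \<forall>lam\<in>YD n. \<bar>P n (pi_n n f) lam - pi_n n f lam\<bar> \<le> e"
proof -
  obtain m h where h: "h \<in> LamC m" "\<And>x. x \<in> Thoma \<Longrightarrow> \<bar>f x - h x\<bar> \<le> e / 3"
    using dense_obtain[OF f divide_pos_pos[OF e zero_less_numeral]] by blast
  obtain eps where eps: "eps \<longlonglongrightarrow> 0" "\<And>n. 0 \<le> eps n" "\<forall>\<^sub>F n in sequentially. \<forall>f\<in>LamC m. \<forall>lam\<in>YD n.
     \<bar>P n (pi_n n f) lam - pi_n n f lam - A f (iota n lam) / (real n)\<^sup>2\<bar> \<le> eps n / (real n)\<^sup>2 * supO f"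
    using one_step[of m] by blast
  define q where "q n = (supO (A h) + eps n * supO h) * (1 / real n)\<^sup>2" for n
  have "q \<longlonglongrightarrow> (supO (A h) + 0 * supO h) * 0\<^sup>2" unfolding q_def by (intro tendsto_intros eps lim_1_over_n)
  then have "q \<longlonglongrightarrow> 0" by simp
  then have "\<forall>\<^sub>F n in sequentially. q n < e / 3" using e by (intro order_tendstoD(2)) auto
  with eps(3) eventually_ge_at_top[of 1] show ?thesis
  proof eventually_elim
    case (elim n)
    show ?case
    proof
      fix lam assume lam: "lam \<in> YD n"
      have 1: "\<bar>P n (pi_n n f) lam - P n (pi_n n h) lam\<bar> \<le> e / 3" using pi_close[of f h "e / 3" n lam 1] h elim lam by simp
      have 2: "\<bar>pi_n n f lam - pi_n n h lam\<bar> \<le> e / 3" using h(2) iota_Thoma[OF lam] elim by (simp add: pi_n_def)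
      have 3: "\<bar>P n (pi_n n h) lam - pi_n n h lam - A h (iota n lam) / (real n)\<^sup>2\<bar> \<le> eps n / (real n)\<^sup>2 * supO h"
        using elim h(1) lam by blast
      have "\<bar>A h (iota n lam) / (real n)\<^sup>2\<bar> \<le> supO (A h) / (real n)\<^sup>2"
        unfolding abs_divide using supO_ge[OF LamC_CO[OF A_gen(1)[OF h(1)]]] by (simp add: divide_right_mono)
      then have "\<bar>P n (pi_n n h) lam - pi_n n h lam\<bar> \<le> supO (A h) / (real n)\<^sup>2 + eps n / (real n)\<^sup>2 * supO h"
        using 3 by linarith
      also have "\<dots> = q n" by (simp add: q_def power_divide add_divide_distrib)
      finally show "\<bar>P n (pi_n n f) lam - pi_n n f lam\<bar> \<le> e" using 1 2 elim by linarith
    qed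
  qed
qed

lemma T_semigroup: assumes f: "f \<in> CO" and s: "0 \<le> s" and t: "0 \<le> t"
  shows "T (s + t) f = T s (T t f)"
proof
  fix x
  have TtCO: "T t f \<in> CO" by (rule T_CO[OF f t])
  show "T (s + t) f x = T s (T t f) x"
  proof (cases "x \<in> Thoma")
    case x: True
    let ?a = "\<lambda>n. nat \<lfloor>(real n)\<^sup>2 * s\<rfloor>" and ?b = "\<lambda>n. nat \<lfloor>(real n)\<^sup>2 * t\<rfloor>" and ?c = "\<lambda>n. nat \<lfloor>(real n)\<^sup>2 * (s + t)\<rfloor>"
    have "(\<lambda>n. (P n ^^ ?c n) (pi_n n f) (ap x n) - (P n ^^ ?a n) (pi_n n (T t f)) (ap x n)) \<longlonglongrightarrow> 0"
    proof (rule tendstoI)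
      fix e :: real assume e: "e > 0"
      then have e3: "e / 3 > 0" by simp
      show "\<forall>\<^sub>F n in sequentially. dist ((P n ^^ ?c n) (pi_n n f) (ap x n) - (P n ^^ ?a n) (pi_n n (T t f)) (ap x n)) 0 < e"
        using convergence[OF f t e3] one_step_small[OF f e3]
      proof eventually_elim
        case (elim n)
        have lam: "ap x n \<in> YD n" by (rule ap)
        have cab: "?c n = ?a n + ?b n \<or> ?c n = ?a n + (?b n + 1)"
        proof -
          have "\<lfloor>(real n)\<^sup>2 * (s + t)\<rfloor> = \<lfloor>(real n)\<^sup>2 * s\<rfloor> + \<lfloor>(real n)\<^sup>2 * t\<rfloor> \<or> \<lfloor>(real n)\<^sup>2 * (s + t)\<rfloor> = \<lfloor>(real n)\<^sup>2 * s\<rfloor> + \<lfloor>(real n)\<^sup>2 * t\<rfloor> + 1"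
            unfolding distrib_left by linarith
          moreover have "0 \<le> \<lfloor>(real n)\<^sup>2 * s\<rfloor>" "0 \<le> \<lfloor>(real n)\<^sup>2 * t\<rfloor>" using s t by simp_all
          ultimately show ?thesis by linarith
        qed
        have b: "\<bar>(P n ^^ ?b n) (pi_n n f) l - pi_n n (T t f) l\<bar> \<le> e / 3" if "l \<in> YD n" for l
          using elim(1) t that by (auto simp: pi_n_def)
        have b1: "\<bar>(P n ^^ (?b n + 1)) (pi_n n f) l - (P n ^^ ?b n) (pi_n n f) l\<bar> \<le> e / 3" if "l \<in> YD n" for l
        proof -
          have "(P n ^^ (?b n + 1)) (pi_n n f) = (P n ^^ ?b n) (P n (pi_n n f))" by (simp add: funpow_swap1)
          then show ?thesis using iter_diff_bound[OF that, of "P n (pi_n n f)" "pi_n n f" "e / 3" "?b n"] elim(2) by simp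
        qed
        define k where "k = ?c n - ?a n"
        have ck: "?c n = ?a n + k" "k = ?b n \<or> k = ?b n + 1" using cab by (auto simp: k_def)
        have bk: "\<bar>(P n ^^ k) (pi_n n f) l - pi_n n (T t f) l\<bar> \<le> 2 * (e / 3)" if "l \<in> YD n" for l
        proof (cases "k = ?b n")
          case True
          show ?thesis using b[OF that] e unfolding True by linarith
        next
          case False
          then have k: "k = ?b n + 1" using ck(2) by blast
          show ?thesis using b[OF that] b1[OF that] unfolding k by linarith
        qed
        have "(P n ^^ ?c n) (pi_n n f) = (P n ^^ ?a n) ((P n ^^ k) (pi_n n f))" unfolding ck(1) by (simp add: funpow_add)
        then have "\<bar>(P n ^^ ?c n) (pi_n n f) (ap x n) - (P n ^^ ?a n) (pi_n n (T t f)) (ap x n)\<bar> \<le> 2 * (e / 3)"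
          using iter_diff_bound[OF lam bk] by simp
        then show ?case using e by (simp add: dist_real_def)
      qed
    qed
    moreover have "(\<lambda>n. (P n ^^ ?c n) (pi_n n f) (ap x n) - (P n ^^ ?a n) (pi_n n (T t f)) (ap x n)) \<longlonglongrightarrow> T (s + t) f x - T s (T t f) x"
      by (intro tendsto_diff T_tends f TtCO x) (use s t in auto)
    ultimately have "T (s + t) f x - T s (T t f) x = 0" using LIMSEQ_unique by blast
    then show ?thesis by simp
  qed (simp add: T_outside)
qed

lemma T_contraction: assumes f: "f \<in> CO" and t: "0 \<le> t" shows "\<bar>T t f x\<bar> \<le> supO f"
proof (cases "x \<in> Thoma")
  case True
  have "(\<lambda>n. \<bar>Pt n t (pi_n n f) (ap x n)\<bar>) \<longlonglongrightarrow> \<bar>T t f x\<bar>"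
    by (intro tendsto_intros T_tends f t True)
  then show ?thesis
    by (rule tendsto_upperbound) (auto intro!: always_eventually iter_bound ap simp: pi_n_def supO_ge[OF f])
qed (simp add: T_outside supO_nonneg[OF f])

lemma T_pos: assumes f: "f \<in> CO" and t: "0 \<le> t" and p: "\<forall>x\<in>Thoma. 0 \<le> f x" and x: "x \<in> Thoma" shows "0 \<le> T t f x"
proof (rule tendsto_lowerbound[OF T_tends[OF f t x]])
  show "\<forall>\<^sub>F n in sequentially. 0 \<le> Pt n t (pi_n n f) (ap x n)"
    using eventually_ge_at_top[of 1]
    by eventually_elim (use p iota_Thoma in \<open>auto intro!: iter_nonneg ap simp: pi_n_def\<close>)
qed simp

lemma oneO_CO: "oneO \<in> CO" unfolding oneO_def using LamC_CO[OF LamC_const] .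

lemma T_one: assumes t: "0 \<le> t" shows "T t oneO = oneO"
proof
  fix x
  show "T t oneO x = oneO x"
  proof (cases "x \<in> Thoma")
    case True
    have "(\<lambda>n. Pt n t (pi_n n oneO) (ap x n)) \<longlonglongrightarrow> 1"
    proof (rule tendsto_eventually)
      show "\<forall>\<^sub>F n in sequentially. Pt n t (pi_n n oneO) (ap x n) = 1"
        using eventually_ge_at_top[of 1]
        by eventually_elim (use iota_Thoma in \<open>auto intro!: iter_const ap simp: pi_n_def oneO_def restrO_def\<close>)
    qed
    then have "T t oneO x = 1" using T_tends[OF oneO_CO t True] LIMSEQ_unique by blast
    then show ?thesis using True by (simp add: oneO_def restrO_def)
  qed (simp add: T_outside oneO_def restrO_def)
qed

lemma T_0: assumes f: "f \<in> CO" shows "T 0 f = f"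
proof (rule CO_ext[OF T_CO[OF f] f])
  fix x assume x: "x \<in> Thoma"
  have "(\<lambda>n. (P n ^^ nat \<lfloor>(real n)\<^sup>2 * 0\<rfloor>) (pi_n n f) (ap x n)) \<longlonglongrightarrow> f x"
    using CO_ap[OF f x] by (simp add: pi_n_def)
  then show "T 0 f x = f x" using T_tends[OF f _ x, of 0] LIMSEQ_unique by blast
qed simp

lemma T_strong: assumes f: "f \<in> CO" and e: "0 < e"
  shows "\<exists>d>0. \<forall>t\<in>{0..d}. \<forall>x\<in>Thoma. \<bar>T t f x - f x\<bar> \<le> e"
proof -
  obtain m h where h: "h \<in> LamC m" "\<And>x. x \<in> Thoma \<Longrightarrow> \<bar>f x - h x\<bar> \<le> e / 3"
    using dense_obtain[OF f divide_pos_pos[OF e zero_less_numeral]] by blast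
  define C where "C = bnd m * supO h * exp (bnd m * 1)"
  have C0: "C \<ge> 0" unfolding C_def using bnd(1)[of m] supO_nonneg[OF LamC_CO[OF h(1)]] by simp
  define d where "d = min 1 (e / (3 * (C + 1)))"
  have d: "d > 0" using e C0 by (simp add: d_def)
  have "\<bar>T t f x - f x\<bar> \<le> e" if t: "t \<in> {0..d}" and x: "x \<in> Thoma" for t x
  proof -
    have 1: "\<bar>T t f x - E t h x\<bar> \<le> e / 3" using T_close[OF f LamC_CO[OF h(1)] _ x h(2), of t] T_LamC[OF h(1), of t] t by simp
    have "\<bar>E (0 + t) h x - E 0 h x\<bar> \<le> t * C" unfolding C_def by (rule E_step[OF h(1)]) (use t d_def in auto)
    then have 2: "\<bar>E t h x - h x\<bar> \<le> t * C" by (simp add: E_0)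
    have "t * C \<le> e / (3 * (C + 1)) * C" using t C0 by (intro mult_right_mono) (auto simp: d_def)
    also have "\<dots> \<le> e / 3" using C0 e by (simp add: field_simps)
    finally have 3: "t * C \<le> e / 3" .
    show ?thesis using 1 2 3 h(2)[OF x] by linarith
  qed
  then show ?thesis using d by blast
qed

end

section \<open>The generator of the limit semigroup\<close>


text \<open>Gaussian elimination: a vector p with c p i \<noteq> 0 clears coordinate i from the
  others, and a relation found among those determines the coefficient of p.\<close>

lemma linear_dependence:
  fixes c :: "'k \<Rightarrow> 'i \<Rightarrow> real"
  assumes "finite I" "finite K" "card I < card K"
  shows "\<exists>a. (\<exists>k\<in>K. a k \<noteq> 0) \<and> (\<forall>i\<in>I. (\<Sum>k\<in>K. a k * c k i) = 0)"
  using assms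
proof (induction I arbitrary: K c rule: finite_induct)
  case empty
  then obtain k where "k \<in> K" by fastforce
  then show ?case by (intro exI[of _ "\<lambda>_. 1"]) auto
next
  case (insert i I)
  show ?case
  proof (cases "\<forall>k\<in>K. c k i = 0")
    case True
    have "card I < card K" using insert by simp
    from insert.IH[OF insert.prems(1) this] obtain a where "\<exists>k\<in>K. a k \<noteq> 0" "\<forall>i\<in>I. (\<Sum>k\<in>K. a k * c k i) = 0" by blast
    then show ?thesis using True by (intro exI[of _ a]) auto
  next
    case False
    then obtain p where p: "p \<in> K" "c p i \<noteq> 0" by blast
    define K' where "K' = K - {p}"
    have K': "finite K'" "card I < card K'" using insert p by (auto simp: K'_def)
    define c' where "c' k j = c k j - c k i / c p i * c p j" for k j
    from insert.IH[OF K', of c'] obtain a where a: "\<exists>k\<in>K'. a k \<noteq> 0" "\<And>j. j \<in> I \<Longrightarrow> (\<Sum>k\<in>K'. a k * c' k j) = 0" by blast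
    define b where "b = a(p := - (\<Sum>k\<in>K'. a k * (c k i / c p i)))"
    have bs: "(\<Sum>k\<in>K. b k * c k j) = (\<Sum>k\<in>K'. a k * c' k j)" for j
    proof -
      have "(\<Sum>k\<in>K. b k * c k j) = b p * c p j + (\<Sum>k\<in>K'. b k * c k j)"
        unfolding K'_def by (rule sum.remove[OF insert.prems(1) p(1)])
      also have "(\<Sum>k\<in>K'. b k * c k j) = (\<Sum>k\<in>K'. a k * c k j)" by (rule sum.cong) (auto simp: b_def K'_def)
      also have "b p * c p j = - (\<Sum>k\<in>K'. a k * (c k i / c p i) * c p j)" by (simp add: b_def sum_distrib_right)
      finally have "(\<Sum>k\<in>K. b k * c k j) = (\<Sum>k\<in>K'. a k * c k j) - (\<Sum>k\<in>K'. a k * (c k i / c p i) * c p j)" by simp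
      also have "\<dots> = (\<Sum>k\<in>K'. a k * c' k j)" unfolding sum_subtractf[symmetric] c'_def by (rule sum.cong) (auto simp: right_diff_distrib mult.assoc)
      finally show ?thesis .
    qed
    have "c' k i = 0" for k using p by (simp add: c'_def)
    then have "(\<Sum>k\<in>K. b k * c k j) = 0" if "j \<in> insert i I" for j using that a(2) bs by auto
    moreover have "\<exists>k\<in>K. b k \<noteq> 0" using a(1) by (auto simp: b_def K'_def)
    ultimately show ?thesis by blast
  qed
qed

context scheme begin

lemma conservative: "conservative_markov_semigroup T"
  unfolding conservative_markov_semigroup_def
proof (intro conjI ballI allI impI)
  fix f assume f: "f \<in> CO"
  show "((\<lambda>t. supO (\<lambda>x. T t f x - f x)) \<longlongrightarrow> 0) (at_right 0)"
  proof (rule tendstoI)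
    fix e :: real assume e: "e > 0"
    obtain d where d: "d > 0" "\<And>t x. t \<in> {0..d} \<Longrightarrow> x \<in> Thoma \<Longrightarrow> \<bar>T t f x - f x\<bar> \<le> e / 2"
      using T_strong[OF f half_gt_zero[OF e]] by blast
    have "dist (supO (\<lambda>x. T t f x - f x)) 0 < e" if t: "0 < t" "t < d" for t
    proof -
      have "supO (\<lambda>x. T t f x - f x) \<le> e / 2" by (rule supO_le) (use d t in auto)
      moreover have "0 \<le> supO (\<lambda>x. T t f x - f x)" by (intro supO_nonneg CO_diff T_CO f) (use t in auto)
      ultimately show ?thesis using e by simp
    qed
    then show "\<forall>\<^sub>F t in at_right 0. dist (supO (\<lambda>x. T t f x - f x)) 0 < e"
      unfolding eventually_at_right_field using d(1) by blast
  qed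
qed (use T_CO T_lin T_0 T_semigroup T_pos T_one in \<open>auto intro!: supO_le T_contraction\<close>)

text \<open>For h in \<open>LamCall\<close> the mean value theorem gives T t h - h = t T s (A h) at
  each point, with s < t depending on the point. Contraction and strong continuity at g replace the
  right side by t g up to t e; the approximation errors vanish along the sequence h.\<close>

lemma closure_generator: assumes "(f, g) \<in> graph_closure LamCall A" shows "(f, g) \<in> generator_graph T"
proof -
  obtain h where fg: "f \<in> CO" "g \<in> CO" and h: "\<And>k. h k \<in> LamCall"
    "(\<lambda>k. supO (\<lambda>x. h k x - f x)) \<longlonglongrightarrow> 0" "(\<lambda>k. supO (\<lambda>x. A (h k) x - g x)) \<longlonglongrightarrow> 0"
    using assms by (auto simp: graph_closure_def)
  have key: "\<bar>T t f x - f x - t * g x\<bar> \<le> t * e"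
    if e: "e > 0" and d: "\<And>s x. s \<in> {0..d} \<Longrightarrow> x \<in> Thoma \<Longrightarrow> \<bar>T s g x - g x\<bar> \<le> e" and t: "0 < t" "t < d" and x: "x \<in> Thoma" for e d t x
  proof -
    let ?u = "\<lambda>k. supO (\<lambda>x. h k x - f x)" and ?v = "\<lambda>k. supO (\<lambda>x. A (h k) x - g x)"
    have "\<bar>T t f x - f x - t * g x\<bar> \<le> 2 * ?u k + t * ?v k + t * (e + 2 * ?v k)" for k
    proof -
      obtain m where hm: "h k \<in> LamC m" using h(1) by (auto simp: LamCall_def)
      have hCO: "h k \<in> CO" "A (h k) \<in> CO" using hm A_gen(1)[OF hm] LamC_CO by blast+
      have u: "\<bar>h k y - f y\<bar> \<le> ?u k" for y using supO_ge[OF CO_diff[OF hCO(1) fg(1)]] by simp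
      have v: "\<bar>A (h k) y - g y\<bar> \<le> ?v k" for y using supO_ge[OF CO_diff[OF hCO(2) fg(2)]] by simp
      obtain s where s: "0 < s" "s < t" "E t (h k) x - E 0 (h k) x = (t - 0) * E s (A (h k)) x"
        using MVT2[of 0 t "\<lambda>t. E t (h k) x" "\<lambda>t. E t (A (h k)) x"] E_deriv[OF hm] t by blast
      have Es: "E s (A (h k)) x = T s (A (h k)) x" using T_LamC[OF A_gen(1)[OF hm], of s] s by simp
      have 1: "\<bar>T s (A (h k)) x - T s g x\<bar> \<le> ?v k" by (rule T_close[OF hCO(2) fg(2) _ x v]) (use s in simp)
      have 2: "\<bar>T s g x - g x\<bar> \<le> e" by (rule d) (use s t x in auto)
      have "\<bar>E s (A (h k)) x - A (h k) x\<bar> \<le> e + 2 * ?v k" unfolding Es using 1 2 v[of x] by linarith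
      then have "t * \<bar>E s (A (h k)) x - A (h k) x\<bar> \<le> t * (e + 2 * ?v k)" using t by (intro mult_left_mono) auto
      moreover have "E t (h k) x - h k x - t * A (h k) x = t * (E s (A (h k)) x - A (h k) x)" using s(3) by (simp add: E_0 right_diff_distrib)
      ultimately have 3: "\<bar>E t (h k) x - h k x - t * A (h k) x\<bar> \<le> t * (e + 2 * ?v k)" using t by (simp add: abs_mult)
      have "\<bar>T t (h k) x - T t f x\<bar> \<le> ?u k" by (rule T_close[OF hCO(1) fg(1) _ x u]) (use t in simp)
      then have 4: "\<bar>E t (h k) x - T t f x\<bar> \<le> ?u k" using T_LamC[OF hm, of t] t by simp
      have "t * \<bar>A (h k) x - g x\<bar> \<le> t * ?v k" using v[of x] t by (intro mult_left_mono) auto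
      then have 5: "\<bar>t * A (h k) x - t * g x\<bar> \<le> t * ?v k" using t by (simp add: right_diff_distrib[symmetric] abs_mult)
      show ?thesis using 3 4 5 u[of x] by linarith
    qed
    moreover have "(\<lambda>k. 2 * ?u k + t * ?v k + t * (e + 2 * ?v k)) \<longlonglongrightarrow> 2 * 0 + t * 0 + t * (e + 2 * 0)"
      by (intro tendsto_intros h)
    ultimately have "\<bar>T t f x - f x - t * g x\<bar> \<le> 2 * 0 + t * 0 + t * (e + 2 * 0)"
      by (intro LIMSEQ_le_const) auto
    then show ?thesis by simp
  qed
  have "((\<lambda>t. supO (\<lambda>x. (T t f x - f x) / t - g x)) \<longlongrightarrow> 0) (at_right 0)"
  proof (rule tendstoI)
    fix e :: real assume e: "e > 0"
    obtain d where d: "d > 0" "\<And>t x. t \<in> {0..d} \<Longrightarrow> x \<in> Thoma \<Longrightarrow> \<bar>T t g x - g x\<bar> \<le> e / 2"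
      using T_strong[OF fg(2) half_gt_zero[OF e]] by blast
    have "dist (supO (\<lambda>x. (T t f x - f x) / t - g x)) 0 < e" if t: "0 < t" "t < d" for t
    proof -
      have co: "(\<lambda>x. (T t f x - f x) / t - g x) \<in> CO"
        using CO_lin[OF CO_diff[OF T_CO[OF fg(1)] fg(1)] fg(2), of t "1 / t" "- 1"] t by simp
      have "supO (\<lambda>x. (T t f x - f x) / t - g x) \<le> e / 2"
      proof (rule supO_le)
        fix x assume x: "x \<in> Thoma"
        have "(T t f x - f x) / t - g x = (T t f x - f x - t * g x) / t" using t by (simp add: diff_divide_distrib)
        then have "\<bar>(T t f x - f x) / t - g x\<bar> = \<bar>T t f x - f x - t * g x\<bar> / t" using t by (simp add: abs_divide)
        also have "\<dots> \<le> t * (e / 2) / t" using key[OF half_gt_zero[OF e] d(2) t x] t by (intro divide_right_mono) auto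
        finally show "\<bar>(T t f x - f x) / t - g x\<bar> \<le> e / 2" using t by simp
      qed
      moreover have "0 \<le> supO (\<lambda>x. (T t f x - f x) / t - g x)" by (rule supO_nonneg[OF co])
      ultimately show ?thesis using e by simp
    qed
    then show "\<forall>\<^sub>F t in at_right 0. dist (supO (\<lambda>x. (T t f x - f x) / t - g x)) 0 < e"
      unfolding eventually_at_right_field using d(1) by blast
  qed
  then show ?thesis using fg by (simp add: generator_graph_def)
qed

lemma generator_CO: "(f, g) \<in> generator_graph T \<Longrightarrow> f \<in> CO \<and> g \<in> CO"
  by (auto simp: generator_graph_def)

lemma quotient_CO: "f \<in> CO \<Longrightarrow> g \<in> CO \<Longrightarrow> 0 < t \<Longrightarrow> (\<lambda>x. (T t f x - f x) / t - g x) \<in> CO"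
  using CO_lin[OF CO_diff[OF T_CO[of f t]], of f g "1 / t" "- 1"] by simp

text \<open>In (1 + 1/t) f = (f - g) - ((T t f - f) / t - g) + T t f / t the last term is at most
  \<open>supO f / t\<close> by contraction, which cancels against the left side; then t tends to
  0.\<close>

lemma dissipative: assumes "(f, g) \<in> generator_graph T" shows "supO f \<le> supO (\<lambda>x. f x - g x)"
proof -
  have fg: "f \<in> CO" "g \<in> CO" and l: "((\<lambda>t. supO (\<lambda>x. (T t f x - f x) / t - g x)) \<longlongrightarrow> 0) (at_right 0)"
    using assms by (auto simp: generator_graph_def)
  let ?r = "\<lambda>t. supO (\<lambda>x. (T t f x - f x) / t - g x)" and ?D = "supO (\<lambda>x. f x - g x)"
  have "supO f \<le> ?D + ?r t" if t: "0 < t" for t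
  proof -
    have "supO f \<le> (?D + ?r t + supO f / t) / (1 + 1 / t)"
    proof (rule supO_le)
      fix x
      have a: "\<bar>f x - g x\<bar> \<le> ?D" using supO_ge[OF CO_diff[OF fg]] by simp
      have b: "\<bar>(T t f x - f x) / t - g x\<bar> \<le> ?r t" using supO_ge[OF quotient_CO[OF fg t]] by simp
      have c: "\<bar>T t f x / t\<bar> \<le> supO f / t" using T_contraction[OF fg(1), of t x] t by (simp add: abs_divide divide_right_mono)
      have "f x * (1 + 1 / t) = (f x - g x) - ((T t f x - f x) / t - g x) + T t f x / t" by (simp add: algebra_simps diff_divide_distrib)
      then have "\<bar>f x * (1 + 1 / t)\<bar> \<le> ?D + ?r t + supO f / t" using a b c by linarith
      then have "\<bar>f x\<bar> * (1 + 1 / t) \<le> ?D + ?r t + supO f / t" using t by (simp add: abs_mult)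
      moreover have "1 + 1 / t > 0" using t by (simp add: add_pos_pos)
      ultimately show "\<bar>f x\<bar> \<le> (?D + ?r t + supO f / t) / (1 + 1 / t)" by (simp add: pos_le_divide_eq)
    qed
    moreover have "1 + 1 / t > 0" using t by (simp add: add_pos_pos)
    ultimately have "supO f * (1 + 1 / t) \<le> ?D + ?r t + supO f / t" by (simp add: pos_le_divide_eq)
    then show ?thesis by (simp add: algebra_simps)
  qed
  then have "\<forall>\<^sub>F t in at_right 0. supO f \<le> ?D + ?r t"
    unfolding eventually_at_right_field by (intro exI[of _ 1]) auto
  moreover have "((\<lambda>t. ?D + ?r t) \<longlongrightarrow> ?D + 0) (at_right 0)" by (intro tendsto_intros l)
  ultimately have "supO f \<le> ?D + 0" by (intro tendsto_lowerbound[of _ _ "at_right 0"]) auto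
  then show ?thesis by simp
qed

lemma generator_diff: assumes "(f, g) \<in> generator_graph T" "(f', g') \<in> generator_graph T"
  shows "((\<lambda>x. f x - f' x), (\<lambda>x. g x - g' x)) \<in> generator_graph T"
proof -
  have fg: "f \<in> CO" "g \<in> CO" "f' \<in> CO" "g' \<in> CO" using assms generator_CO by auto
  let ?r = "\<lambda>t. supO (\<lambda>x. (T t f x - f x) / t - g x)" and ?r' = "\<lambda>t. supO (\<lambda>x. (T t f' x - f' x) / t - g' x)"
  let ?d = "\<lambda>t. supO (\<lambda>x. (T t (\<lambda>x. f x - f' x) x - (f x - f' x)) / t - (g x - g' x))"
  have "((\<lambda>t. ?r t + ?r' t) \<longlongrightarrow> 0 + 0) (at_right 0)" using assms by (intro tendsto_intros) (auto simp: generator_graph_def)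
  then have l: "((\<lambda>t. ?r t + ?r' t) \<longlongrightarrow> 0) (at_right 0)" by simp
  have b: "norm (?d t) \<le> ?r t + ?r' t" if t: "0 < t" for t
  proof -
    have Td: "T t (\<lambda>x. f x - f' x) = (\<lambda>x. T t f x - T t f' x)" using T_lin[OF fg(1,3), of t 1 "- 1"] t by simp
    have "?d t \<le> ?r t + ?r' t"
    proof (rule supO_le)
      fix x
      have "(T t (\<lambda>x. f x - f' x) x - (f x - f' x)) / t - (g x - g' x) = ((T t f x - f x) / t - g x) - ((T t f' x - f' x) / t - g' x)"
        unfolding Td by (simp add: diff_divide_distrib)
      moreover have "\<bar>(T t f x - f x) / t - g x\<bar> \<le> ?r t" using supO_ge[OF quotient_CO[OF fg(1,2) t]] by simp
      moreover have "\<bar>(T t f' x - f' x) / t - g' x\<bar> \<le> ?r' t" using supO_ge[OF quotient_CO[OF fg(3,4) t]] by simp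
      ultimately show "\<bar>(T t (\<lambda>x. f x - f' x) x - (f x - f' x)) / t - (g x - g' x)\<bar> \<le> ?r t + ?r' t" by linarith
    qed
    moreover have "0 \<le> ?d t" by (rule supO_nonneg[OF quotient_CO[OF CO_diff[OF fg(1,3)] CO_diff[OF fg(2,4)] t]])
    ultimately show ?thesis by simp
  qed
  have "\<forall>\<^sub>F t in at_right 0. norm (?d t) \<le> ?r t + ?r' t"
    unfolding eventually_at_right_field using b by (intro exI[of _ 1]) auto
  then have "(?d \<longlongrightarrow> 0) (at_right 0)" using l by (rule Lim_null_comparison)
  then show ?thesis unfolding generator_graph_def using CO_diff fg by auto
qed

lemma A_closure: assumes f: "f \<in> LamC m" shows "(f, A f) \<in> graph_closure LamCall A"
proof -
  have z: "supO (\<lambda>x. 0) = 0" using supO_le[of "\<lambda>_. 0" 0] supO_nonneg[OF LamC_CO[OF LamC_zero]] by simp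
  have "f \<in> LamCall" using f by (auto simp: LamCall_def)
  then show ?thesis unfolding graph_closure_def using LamC_CO[OF f] LamC_CO[OF A_gen(1)[OF f]]
    by (auto intro!: exI[of _ "\<lambda>_. f"] simp: z)
qed

section \<open>Bijectivity of 1 - A on the finite-dimensional pieces\<close>

definition B :: "(tpt \<Rightarrow> real) \<Rightarrow> tpt \<Rightarrow> real" where "B v = (\<lambda>x. v x - A v x)"

lemma B_LamC: "v \<in> LamC m \<Longrightarrow> B v \<in> LamC m"
  unfolding B_def by (intro LamC_diff A_gen(1))

lemma B_iter_LamC: "v \<in> LamC m \<Longrightarrow> (B ^^ k) v \<in> LamC m"
  by (induction k) (auto intro: B_LamC)

lemma B_inj: assumes v: "v \<in> LamC m" and z: "B v = (\<lambda>_. 0)" shows "v = (\<lambda>_. 0)"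
proof -
  have "supO v \<le> supO (\<lambda>x. v x - A v x)" by (rule dissipative[OF closure_generator[OF A_closure[OF v]]])
  also have "\<dots> \<le> 0" using z supO_le[of "\<lambda>_. 0" 0] by (simp add: B_def)
  finally have "\<bar>v x\<bar> \<le> 0" for x using supO_ge[OF LamC_CO[OF v], of x] by linarith
  then show ?thesis by (intro ext) simp
qed

lemma B_sum: assumes "\<And>k. k \<le> d \<Longrightarrow> f k \<in> LamC m"
  shows "B (\<lambda>x. \<Sum>k\<le>(d::nat). a k * f k x) = (\<lambda>x. \<Sum>k\<le>d. a k * B (f k) x)"
proof -
  have "A (\<lambda>x. \<Sum>k<Suc d. a k * f k x) = (\<lambda>x. \<Sum>k<Suc d. a k * A (f k) x)" by (rule A_sum[of _ _ m]) (use assms in auto)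
  then show ?thesis unfolding B_def lessThan_Suc_atMost by (simp add: right_diff_distrib sum_subtractf)
qed

text \<open>Induction on the length of the relation, with w the combination of the higher terms
  after lowering each power of B by one. If a 0 is nonzero, u is the image of -1 / a 0 times w; if a
  0 = 0, then B w = 0, and w = 0 is a shorter nontrivial relation.\<close>

lemma B_surj_aux:
  assumes u: "u \<in> LamC m"
  shows "\<exists>k\<le>d. a k \<noteq> 0 \<Longrightarrow> (\<And>x. (\<Sum>k\<le>(d::nat). a k * (B ^^ k) u x) = 0) \<Longrightarrow> \<exists>v\<in>LamC m. B v = u"
proof (induction d arbitrary: a)
  case 0
  then have "u = (\<lambda>_. 0)" by (intro ext) auto
  moreover have "B (\<lambda>x. 0) = (\<lambda>_. 0)" using B_sum[of 0 "\<lambda>_ _. 0" m "\<lambda>_. 0"] LamC_zero by simp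
  ultimately show ?case using LamC_zero by blast
next
  case (Suc d)
  define w where "w x = (\<Sum>k\<le>d. a (Suc k) * (B ^^ k) u x)" for x
  have wL: "w \<in> LamC m" unfolding w_def[abs_def] by (intro LamC_sum LamC_scale B_iter_LamC u)
  have Bw: "B w = (\<lambda>x. \<Sum>k\<le>d. a (Suc k) * (B ^^ Suc k) u x)"
    unfolding w_def[abs_def] by (subst B_sum[of _ _ m]) (auto intro: B_iter_LamC u)
  have eq: "a 0 * u x + B w x = 0" for x
    using Suc.prems(2)[of x] unfolding Bw sum.atMost_Suc_shift by simp
  show ?case
  proof (cases "a 0 = 0")
    case False
    have "B (\<lambda>x. (- 1 / a 0) * w x) x = (- 1 / a 0) * B w x" for x
      using A_lin[OF wL wL, of "- 1 / a 0" 0] by (simp add: B_def diff_divide_distrib)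
    moreover have "(- 1 / a 0) * B w x = u x" for x
    proof -
      have "B w x = - (a 0 * u x)" using eq[of x] by linarith
      then show ?thesis using False by simp
    qed
    ultimately have "B (\<lambda>x. (- 1 / a 0) * w x) = u" by (intro ext) simp
    then show ?thesis using LamC_scale[OF wL] by blast
  next
    case True
    then have "B w = (\<lambda>_. 0)" using eq by (intro ext) simp
    then have w0: "w = (\<lambda>_. 0)" by (rule B_inj[OF wL])
    show ?thesis
    proof (rule Suc.IH[of "\<lambda>k. a (Suc k)"])
      obtain k where k: "k \<le> Suc d" "a k \<noteq> 0" using Suc.prems(1) by blast
      then have "k \<noteq> 0" using True by (intro notI) simp
      then show "\<exists>k\<le>d. a (Suc k) \<noteq> 0" using k by (intro exI[of _ "k - 1"]) auto
      show "(\<Sum>k\<le>d. a (Suc k) * (B ^^ k) u x) = 0" for x using fun_cong[OF w0, of x] by (simp add: w_def)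
    qed
  qed
qed

text \<open>An injective endomorphism of a finite-dimensional space is surjective: among the iterates of
  any vector there is a linear relation, whose lowest term expresses the vector as an image.\<close>

lemma B_surj: assumes u: "u \<in> LamC m" shows "\<exists>v\<in>LamC m. B v = u"
proof -
  obtain d xs es where d: "\<And>i. i < (d::nat) \<Longrightarrow> xs i \<in> Thoma \<and> es i \<in> LamC m" "\<And>f x. f \<in> LamC m \<Longrightarrow> f x = (\<Sum>j<d. f (xs j) * es j x)"
    using LamC_coordinates[of m] by blast
  have "\<exists>a. (\<exists>k\<in>{..d}. a k \<noteq> 0) \<and> (\<forall>i\<in>{..<d}. (\<Sum>k\<in>{..d}. a k * (B ^^ k) u (xs i)) = 0)"
    by (rule linear_dependence) auto
  then obtain a where a: "\<exists>k\<le>d. a k \<noteq> 0" "\<And>i. i < d \<Longrightarrow> (\<Sum>k\<le>d. a k * (B ^^ k) u (xs i)) = 0" by auto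
  define w where "w x = (\<Sum>k\<le>d. a k * (B ^^ k) u x)" for x
  have wL: "w \<in> LamC m" unfolding w_def[abs_def] by (intro LamC_sum LamC_scale B_iter_LamC u)
  have "w x = 0" for x
  proof -
    have "w x = (\<Sum>j<d. w (xs j) * es j x)" by (rule d(2)[OF wL])
    also have "\<dots> = 0" by (rule sum.neutral) (use a(2) in \<open>auto simp: w_def\<close>)
    finally show ?thesis .
  qed
  then show ?thesis by (intro B_surj_aux[OF u a(1)]) (simp add: w_def)
qed

text \<open>Approximate f - g by u in \<open>LamCall\<close> and solve v - A v = u. Dissipativity
  applied to f - v and g - A v shows that v is close to f, and then A v = v - u is close to
  g.\<close>

lemma generator_closure: assumes fgG: "(f, g) \<in> generator_graph T" shows "(f, g) \<in> graph_closure LamCall A"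
proof -
  have fg: "f \<in> CO" "g \<in> CO" using fgG generator_CO by auto
  let ?w = "\<lambda>x. f x - g x"
  define Q where "Q k v \<longleftrightarrow> v \<in> LamCall \<and> supO (\<lambda>x. v x - f x) \<le> inverse (real (Suc k)) \<and> supO (\<lambda>x. A v x - g x) \<le> 2 * inverse (real (Suc k))
      \<and> v \<in> CO \<and> A v \<in> CO" for k v
  have "\<exists>v. Q k v" for k
  proof -
    let ?e = "inverse (real (Suc k))"
    have e: "?e > 0" by simp
    obtain m u where u: "u \<in> LamC m" "\<And>x. x \<in> Thoma \<Longrightarrow> \<bar>?w x - u x\<bar> \<le> ?e" using dense_obtain[OF CO_diff[OF fg] e] by blast
    obtain v where v: "v \<in> LamC m" "B v = u" using B_surj[OF u(1)] by blast
    have vu: "u x = v x - A v x" for x using v(2) by (auto simp: B_def)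
    have vCO: "v \<in> CO" "A v \<in> CO" using v A_gen(1) LamC_CO by blast+
    have "((\<lambda>x. f x - v x), (\<lambda>x. g x - A v x)) \<in> generator_graph T"
      by (rule generator_diff[OF fgG closure_generator[OF A_closure[OF v(1)]]])
    then have "supO (\<lambda>x. f x - v x) \<le> supO (\<lambda>x. (f x - v x) - (g x - A v x))" by (rule dissipative)
    also have "\<dots> \<le> ?e"
    proof (rule supO_le)
      fix x assume x: "x \<in> Thoma"
      have "(f x - v x) - (g x - A v x) = ?w x - u x" by (simp add: vu)
      then show "\<bar>(f x - v x) - (g x - A v x)\<bar> \<le> ?e" using u(2)[OF x] by simp
    qed
    finally have fv: "\<bar>f x - v x\<bar> \<le> ?e" for x using supO_ge[OF CO_diff[OF fg(1) vCO(1)], of x] by linarith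
    have "supO (\<lambda>x. v x - f x) \<le> ?e" by (rule supO_le) (use fv in \<open>simp only: abs_minus_commute\<close>)
    moreover have "supO (\<lambda>x. A v x - g x) \<le> 2 * ?e"
    proof (rule supO_le)
      fix x assume x: "x \<in> Thoma"
      have "A v x - g x = (?w x - u x) - (f x - v x)" by (simp add: vu)
      then show "\<bar>A v x - g x\<bar> \<le> 2 * ?e" using u(2)[OF x] fv[of x] by linarith
    qed
    moreover have "v \<in> LamCall" using v(1) by (auto simp: LamCall_def)
    ultimately show ?thesis unfolding Q_def using vCO by blast
  qed
  then obtain v where vQ: "\<And>k. Q k (v k)" by metis
  have v: "\<And>k. v k \<in> LamCall" "\<And>k. supO (\<lambda>x. v k x - f x) \<le> inverse (real (Suc k))"
    "\<And>k. supO (\<lambda>x. A (v k) x - g x) \<le> 2 * inverse (real (Suc k))" "\<And>k. v k \<in> CO" "\<And>k. A (v k) \<in> CO"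
    using vQ unfolding Q_def by blast+
  have l1: "(\<lambda>k. supO (\<lambda>x. v k x - f x)) \<longlonglongrightarrow> 0"
    by (rule tendsto_sandwich[OF _ _ tendsto_const LIMSEQ_inverse_real_of_nat])
       (use v supO_nonneg[OF CO_diff[OF v(4) fg(1)]] in auto)
  have l2: "(\<lambda>k. 2 * inverse (real (Suc k))) \<longlonglongrightarrow> 0"
    using tendsto_mult[OF tendsto_const LIMSEQ_inverse_real_of_nat, of 2] by simp
  have "(\<lambda>k. supO (\<lambda>x. A (v k) x - g x)) \<longlonglongrightarrow> 0"
    by (rule tendsto_sandwich[OF _ _ tendsto_const l2])
       (use v supO_nonneg[OF CO_diff[OF v(5) fg(2)]] in auto)
  then show ?thesis unfolding graph_closure_def using fg v(1) l1 by blast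
qed

lemma generator_eq_closure: "generator_graph T = graph_closure LamCall A"
  using closure_generator generator_closure by auto

text \<open>The closure lies in the graph of the generator, which is single-valued because the
  difference quotients have at most one limit.\<close>

lemma closable_A: "closable LamCall A"
  unfolding closable_def
proof (intro allI impI)
  fix f g1 g2 assume "(f, g1) \<in> graph_closure LamCall A \<and> (f, g2) \<in> graph_closure LamCall A"
  then have g: "(f, g1) \<in> generator_graph T" "(f, g2) \<in> generator_graph T" using closure_generator by auto
  have co: "f \<in> CO" "g1 \<in> CO" "g2 \<in> CO" using g generator_CO by auto
  show "g1 = g2"
  proof (rule CO_ext[OF co(2,3)])
    fix x
    let ?r = "\<lambda>g t. supO (\<lambda>x. (T t f x - f x) / t - g x)"
    have "((\<lambda>t. ?r g1 t + ?r g2 t) \<longlongrightarrow> 0 + 0) (at_right 0)" using g by (intro tendsto_intros) (auto simp: generator_graph_def)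
    then have l: "((\<lambda>t. ?r g1 t + ?r g2 t) \<longlongrightarrow> 0) (at_right 0)" by simp
    have "\<bar>g1 x - g2 x\<bar> \<le> ?r g1 t + ?r g2 t" if t: "0 < t" for t
    proof -
      have "\<bar>(T t f x - f x) / t - g1 x\<bar> \<le> ?r g1 t" using supO_ge[OF quotient_CO[OF co(1,2) t]] by simp
      moreover have "\<bar>(T t f x - f x) / t - g2 x\<bar> \<le> ?r g2 t" using supO_ge[OF quotient_CO[OF co(1,3) t]] by simp
      ultimately show ?thesis by linarith
    qed
    then have "\<forall>\<^sub>F t in at_right 0. \<bar>g1 x - g2 x\<bar> \<le> ?r g1 t + ?r g2 t"
      unfolding eventually_at_right_field by (intro exI[of _ 1]) auto
    then have "\<bar>g1 x - g2 x\<bar> \<le> 0" using l by (intro tendsto_lowerbound[of _ _ "at_right 0"]) auto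
    then show "g1 x = g2 x" by simp
  qed
qed

text \<open>For each coordinate function \<open>es i\<close> and large n, \<open>P n\<close> adds a
  member of the same space divided by n^2. There are finitely many of them, so by linearity one
  threshold serves all f.\<close>

lemma invariance: "\<forall>\<^sub>F n in sequentially. \<forall>f\<in>LamC m. \<exists>h\<in>LamC m. \<forall>lam\<in>YD n. P n (pi_n n f) lam = pi_n n h lam"
proof -
  obtain d xs es where d: "\<And>i. i < (d::nat) \<Longrightarrow> xs i \<in> Thoma \<and> es i \<in> LamC m" "\<And>f x. f \<in> LamC m \<Longrightarrow> f x = (\<Sum>j<d. f (xs j) * es j x)"
    using LamC_coordinates[of m] by blast
  define Q where "Q i n h \<longleftrightarrow> h \<in> LamC m \<and> (\<forall>lam\<in>YD n. P n (pi_n n (es i)) lam = pi_n n h lam)" for i n h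
  have "\<forall>\<^sub>F n in sequentially. \<exists>h. Q i n h" if i: "i < d" for i
  proof -
    obtain g where g: "\<And>n. g n \<in> LamC m" "\<forall>\<^sub>F n in sequentially. \<forall>lam\<in>YD n. pi_n n (g n) lam = (real n)\<^sup>2 * (P n (pi_n n (es i)) lam - pi_n n (es i) lam)"
      using A_gen(3)[of "es i" m] d(1)[OF i] by blast
    show ?thesis using g(2) eventually_ge_at_top[of 1]
    proof eventually_elim
      case (elim n)
      have n: "(real n)\<^sup>2 \<noteq> 0" using elim by simp
      have "Q i n (\<lambda>x. 1 * es i x + (1 / (real n)\<^sup>2) * g n x)" unfolding Q_def
      proof (intro conjI ballI)
        show "(\<lambda>x. 1 * es i x + (1 / (real n)\<^sup>2) * g n x) \<in> LamC m" by (rule LamC_lin) (use d(1)[OF i] g in auto)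
        fix lam assume "lam \<in> YD n"
        then have "g n (iota n lam) = (real n)\<^sup>2 * (P n (pi_n n (es i)) lam - es i (iota n lam))" using elim by (simp add: pi_n_apply)
        then show "P n (pi_n n (es i)) lam = pi_n n (\<lambda>x. 1 * es i x + (1 / (real n)\<^sup>2) * g n x) lam" using n by (simp add: pi_n_apply)
      qed
      then show ?case by blast
    qed
  qed
  then have "\<forall>\<^sub>F n in sequentially. \<forall>i\<in>{..<d}. \<exists>h. Q i n h" by (intro eventually_ball_finite) auto
  then show ?thesis
  proof eventually_elim
    case (elim n)
    then obtain h where h: "\<And>i. i < d \<Longrightarrow> Q i n (h i)" by (metis lessThan_iff)
    show ?case
    proof
      fix f assume f: "f \<in> LamC m"
      have "f = (\<lambda>x. \<Sum>j<d. f (xs j) * es j x)" using d(2)[OF f] by (rule ext)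
      then have pf: "pi_n n f l = (\<Sum>j<d. f (xs j) * pi_n n (es j) l)" for l unfolding pi_n_apply by (rule fun_cong)
      show "\<exists>h\<in>LamC m. \<forall>lam\<in>YD n. P n (pi_n n f) lam = pi_n n h lam"
      proof (intro bexI ballI)
        show "(\<lambda>x. \<Sum>j<d. f (xs j) * h j x) \<in> LamC m" by (intro LamC_sum LamC_scale) (use h in \<open>auto simp: Q_def\<close>)
        fix lam assume lam: "lam \<in> YD n"
        have "P n (pi_n n f) lam = P n (\<lambda>l. \<Sum>j<d. f (xs j) * pi_n n (es j) l) lam" by (rule P_cong[OF lam]) (rule pf)
        also have "\<dots> = (\<Sum>j<d. f (xs j) * P n (pi_n n (es j)) lam)" by (rule P_sum[OF lam])
        also have "\<dots> = (\<Sum>j<d. f (xs j) * h j (iota n lam))" by (rule sum.cong) (use h lam in \<open>auto simp: Q_def pi_n_apply\<close>)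
        finally show "P n (pi_n n f) lam = pi_n n (\<lambda>x. \<Sum>j<d. f (xs j) * h j x) lam" by (simp add: pi_n_apply)
      qed
    qed
  qed
qed

text \<open>For large n injectivity of \<open>pi_n\<close> identifies any admissible sequence with
  the one already known to converge.\<close>

lemma generator_unique_limit:
  assumes f: "f \<in> LamC m"
    and g: "\<forall>\<^sub>F n in sequentially. g n \<in> LamC m \<and> (\<forall>lam\<in>YD n. pi_n n (g n) lam = (real n)\<^sup>2 * (P n (pi_n n f) lam - pi_n n f lam))"
  shows "(\<lambda>n. supO (\<lambda>x. g n x - A f x)) \<longlonglongrightarrow> 0"
proof -
  obtain k where k: "\<And>n. k n \<in> LamC m" "uniform_limit Thoma k (A f) sequentially"
    "\<forall>\<^sub>F n in sequentially. \<forall>lam\<in>YD n. pi_n n (k n) lam = (real n)\<^sup>2 * (P n (pi_n n f) lam - pi_n n f lam)"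
    using A_gen(3)[OF f] by blast
  have "\<forall>\<^sub>F n in sequentially. supO (\<lambda>x. k n x - A f x) = supO (\<lambda>x. g n x - A f x)"
    using g k(3) pi_n_injective[of m]
  proof eventually_elim
    case (elim n)
    have "(\<lambda>x. k n x - g n x) \<in> LamC m" using k(1) elim by (intro LamC_diff) auto
    moreover have "\<forall>lam\<in>YD n. pi_n n (\<lambda>x. k n x - g n x) lam = 0" using elim by (simp add: pi_n_apply)
    ultimately have "(\<lambda>x. k n x - g n x) = (\<lambda>_. 0)" using elim by blast
    then have "k n x = g n x" for x by (metis eq_iff_diff_eq_0)
    then show ?case by simp
  qed
  moreover have "(\<lambda>n. supO (\<lambda>x. k n x - A f x)) \<longlonglongrightarrow> 0"
    by (rule uniform_limit_supO[OF k(2)]) (use k(1) A_gen(1)[OF f] LamC_CO in blast)+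
  ultimately show ?thesis by (rule Lim_transform_eventually[rotated])
qed

lemma A_lin_all: assumes "f \<in> LamCall" "g \<in> LamCall"
  shows "A (\<lambda>x. a * f x + b * g x) = (\<lambda>x. a * A f x + b * A g x)"
proof -
  obtain m l where "f \<in> LamC m" "g \<in> LamC l" using assms by (auto simp: LamCall_def)
  then have "f \<in> LamC (max m l)" "g \<in> LamC (max m l)" by (auto elim: LamC_mono)
  then show ?thesis by (rule A_lin)
qed

end

section \<open>The two parameter series and the up-down chains\<close>

lemma zpar_series:
  assumes zz: "(z \<notin> \<real> \<and> z' = cnj z) \<or>
    (\<exists>N::int. z \<in> \<real> \<and> z' \<in> \<real> \<and> of_int N < Re z \<and> Re z < of_int N + 1
                           \<and> of_int N < Re z' \<and> Re z' < of_int N + 1)"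
  shows "Im (z * z') = 0" "zpar (Re (z * z')) (Re (z + z'))"
proof -
  have wt: "wt (Re (z * z')) (Re (z + z')) c = Re ((z + of_int c) * (z' + of_int c))" for c
    by (simp add: wt_def algebra_simps power2_eq_square)
  have "Im (z * z') = 0 \<and> (\<forall>c::int. Re ((z + of_int c) * (z' + of_int c)) > 0)"
    using zz
  proof
    assume a: "z \<notin> \<real> \<and> z' = cnj z"
    then have im: "Im z \<noteq> 0" by (simp add: complex_is_Real_iff)
    \<comment> \<open>In the principal series the weight is the squared modulus of z + c, positive
      since z is not real.\<close>
    have "Re ((z + of_int c) * (z' + of_int c)) = (Re z + of_int c)\<^sup>2 + (Im z)\<^sup>2" for c
      using a by (simp add: power2_eq_square)
    moreover have "(Re z + of_int c)\<^sup>2 + (Im z)\<^sup>2 > 0" for c :: int using im by (simp add: add_nonneg_pos)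
    ultimately show ?thesis using a by simp
  next
    assume "\<exists>N::int. z \<in> \<real> \<and> z' \<in> \<real> \<and> of_int N < Re z \<and> Re z < of_int N + 1 \<and> of_int N < Re z' \<and> Re z' < of_int N + 1"
    then obtain N :: int where N: "z \<in> \<real>" "z' \<in> \<real>" "of_int N < Re z" "Re z < of_int N + 1" "of_int N < Re z'" "Re z' < of_int N + 1" by blast
    have im: "Im z = 0" "Im z' = 0" using N by (simp_all add: complex_is_Real_iff)
    \<comment> \<open>No integer lies between z and z': both z + c and z' + c are positive for c
      \<ge> -N and negative for smaller c.\<close>
    have "(Re z + of_int c) * (Re z' + of_int c) > 0" for c :: int
    proof (cases "c \<ge> - N")
      case True
      then have "real_of_int c \<ge> - real_of_int N" by linarith
      then show ?thesis using N by (intro mult_pos_pos) linarith+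
    next
      case False
      then have "real_of_int c \<le> - real_of_int N - 1" by linarith
      then show ?thesis using N by (intro mult_neg_neg) linarith+
    qed
    then show ?thesis using im by simp
  qed
  then have *: "Im (z * z') = 0" "\<And>c::int. wt (Re (z * z')) (Re (z + z')) c > 0" unfolding wt by blast+
  show "Im (z * z') = 0" by (rule *(1))
  show "zpar (Re (z * z')) (Re (z + z'))"
  proof
    show "0 < Re (z * z')" using *(2)[of 0] by (simp add: wt_def)
  qed (rule *(2))
qed

lemma scheme_Tn:
  assumes im: "Im (z * z') = 0" and zp: "zpar (Re (z * z')) (Re (z + z'))"
  shows "scheme (Tn z z')"
proof -
  interpret zpar "Re (z * z')" "Re (z + z')" by (rule zp)
  show ?thesis
  proof
    fix n lam a b g h assume lam: "lam \<in> YD n"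
    show "Tn z z' n (\<lambda>l. a * g l + b * h l) lam = a * Tn z z' n g lam + b * Tn z z' n h lam"
      unfolding Tn_TS[OF im lam] by (rule TS_lin)
  next
    fix n lam g h assume lam: "lam \<in> YD n" and le: "\<And>l. l \<in> YD n \<Longrightarrow> g l \<le> (h l :: real)"
    have S: "diagram (boxes lam)" "card (boxes lam) = n" using YD_D[OF lam] by auto
    show "Tn z z' n g lam \<le> Tn z z' n h lam"
      unfolding Tn_TS[OF im lam] by (rule TS_mono[OF S(1)]) (use le lst_YD S(2) in auto)
  next
    fix n lam c assume lam: "lam \<in> YD n"
    have S: "diagram (boxes lam)" using YD_D[OF lam] by auto
    show "Tn z z' n (\<lambda>_. c) lam = c" unfolding Tn_TS[OF im lam] by (rule TS_const[OF S])
  next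
    fix m f assume "f \<in> LamC m"
    then show "\<exists>g Af. Af \<in> LamC m \<and> (\<forall>n. g n \<in> LamC m) \<and> uniform_limit Thoma g Af sequentially \<and>
      (\<forall>\<^sub>F n in sequentially. \<forall>lam\<in>YD n. pi_n n (g n) lam = (real n)\<^sup>2 * (Tn z z' n (pi_n n f) lam - pi_n n f lam))"
      by (intro generator_limit[OF im]) auto
  qed
qed

theorem theorem5p1:
  fixes z z' :: complex
  assumes zz: "(z \<notin> \<real> \<and> z' = cnj z) \<or>
    (\<exists>N::int. z \<in> \<real> \<and> z' \<in> \<real> \<and> of_int N < Re z \<and> Re z < of_int N + 1
                           \<and> of_int N < Re z' \<and> Re z' < of_int N + 1)"
  shows
    "(\<forall>m. \<forall>\<^sub>F n in sequentially.
        (\<forall>f1\<in>LamC m. \<forall>f2\<in>LamC m. (\<forall>lam\<in>YD n. pi_n n f1 lam = pi_n n f2 lam) \<longrightarrow> f1 = f2) \<and>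
        (\<forall>f\<in>LamC m. \<exists>h\<in>LamC m. \<forall>lam\<in>YD n. Tn z z' n (pi_n n f) lam = pi_n n h lam))
   \<and> (\<exists>A. (\<forall>m. \<forall>f\<in>LamC m. A f \<in> LamC m \<and>
             (\<forall>g. (\<forall>\<^sub>F n in sequentially. g n \<in> LamC m \<and>
                     (\<forall>lam\<in>YD n. pi_n n (g n) lam
                        = (real n)\<^sup>2 * (Tn z z' n (pi_n n f) lam - pi_n n f lam)))
                  \<longrightarrow> (\<lambda>n. supO (\<lambda>x. g n x - A f x)) \<longlonglongrightarrow> 0))
        \<and> (\<forall>f\<in>LamCall. \<forall>g\<in>LamCall. \<forall>a b.
              A (\<lambda>x. a * f x + b * g x) = (\<lambda>x. a * A f x + b * A g x))
        \<and> closable LamCall A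
        \<and> (\<exists>T. conservative_markov_semigroup T
              \<and> generator_graph T = graph_closure LamCall A
              \<and> (\<forall>f\<in>CO. \<forall>t0\<ge>0. \<forall>e>0. \<forall>\<^sub>F n in sequentially. \<forall>t\<in>{0..t0}.
                    normY n (\<lambda>lam. (Tn z z' n ^^ nat \<lfloor>(real n)\<^sup>2 * t\<rfloor>) (pi_n n f) lam
                                    - pi_n n (T t f) lam) < e)))"
proof -
  interpret scheme "Tn z z'" by (rule scheme_Tn[OF zpar_series[OF zz]])
  show ?thesis
  proof (intro conjI allI exI[of _ A] exI[of _ T] ballI impI)
    fix m
    show "\<forall>\<^sub>F n in sequentially.
          (\<forall>f1\<in>LamC m. \<forall>f2\<in>LamC m. (\<forall>lam\<in>YD n. pi_n n f1 lam = pi_n n f2 lam) \<longrightarrow> f1 = f2) \<and>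
          (\<forall>f\<in>LamC m. \<exists>h\<in>LamC m. \<forall>lam\<in>YD n. Tn z z' n (pi_n n f) lam = pi_n n h lam)"
      using pi_n_injective[of m] invariance[of m]
    proof eventually_elim
      case (elim n)
      have "f1 = f2" if f: "f1 \<in> LamC m" "f2 \<in> LamC m" "\<forall>lam\<in>YD n. pi_n n f1 lam = pi_n n f2 lam" for f1 f2
      proof -
        have "\<forall>lam\<in>YD n. pi_n n (\<lambda>x. f1 x - f2 x) lam = 0" using f(3) by (simp add: pi_n_apply)
        then have "(\<lambda>x. f1 x - f2 x) = (\<lambda>_. 0)" using elim(1) LamC_diff[OF f(1,2)] by blast
        then show ?thesis by (metis eq_iff_diff_eq_0 ext)
      qed
      then show ?case using elim(2) by blast
    qed
  next
    fix f t0 e assume f: "f \<in> CO" and t0: "0 \<le> (t0::real)" and e: "0 < (e::real)"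
    show "\<forall>\<^sub>F n in sequentially. \<forall>t\<in>{0..t0}. normY n (\<lambda>lam. (Tn z z' n ^^ nat \<lfloor>(real n)\<^sup>2 * t\<rfloor>) (pi_n n f) lam - pi_n n (T t f) lam) < e"
      using convergence[OF f t0 half_gt_zero[OF e]]
    proof eventually_elim
      case (elim n)
      show ?case
      proof
        fix t assume t: "t \<in> {0..t0}"
        have "normY n (\<lambda>lam. (Tn z z' n ^^ nat \<lfloor>(real n)\<^sup>2 * t\<rfloor>) (pi_n n f) lam - pi_n n (T t f) lam) \<le> e / 2"
          unfolding normY_def
        proof (rule Max.boundedI)
          fix a assume "a \<in> (\<lambda>lam. \<bar>(Tn z z' n ^^ nat \<lfloor>(real n)\<^sup>2 * t\<rfloor>) (pi_n n f) lam - pi_n n (T t f) lam\<bar>) ` YD n"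
          then obtain lam where lam: "lam \<in> YD n" "a = \<bar>(Tn z z' n ^^ nat \<lfloor>(real n)\<^sup>2 * t\<rfloor>) (pi_n n f) lam - pi_n n (T t f) lam\<bar>" by blast
          have "\<bar>(Tn z z' n ^^ nat \<lfloor>(real n)\<^sup>2 * t\<rfloor>) (pi_n n f) lam - T t f (iota n lam)\<bar> \<le> e / 2" using elim t lam(1) by blast
          then show "a \<le> e / 2" unfolding lam(2) pi_n_apply[of n "T t f"] .
        qed (use finite_YD YD_nonempty in auto)
        then show "normY n (\<lambda>lam. (Tn z z' n ^^ nat \<lfloor>(real n)\<^sup>2 * t\<rfloor>) (pi_n n f) lam - pi_n n (T t f) lam) < e" using e by linarith
      qed
    qed
  qed (use A_gen(1) generator_unique_limit A_lin_all closable_A conservative generator_eq_closure in blast)+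
qed

end
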